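(* Let $d\in\{2,3\}$ and $\beta<0$. Let $V\ge0$ be a real-valued potential with $V\in C^\infty(\mathbb R^d)$, $D^{\mathbf k}V\in L^\infty(\mathbb R^d)$ for all multi-indices $\mathbf k\in\mathbb N_0^d$ with $|\mathbf k|\ge2$, and $d\,V(\mathbf x)+\mathbf x\cdot\nabla V(\mathbf x)\ge0$ for all $\mathbf x\in\mathbb R^d$. Let $\psi_0\in X$ have finite variance $\int_{\mathbb R^d}|\mathbf x|^2|\psi_0|^2d\mathbf x<\infty$, and let $\psi\in C([0,T_{\max}),X)$ be the maximal solution of $$i\partial_t\psi=-\tfrac12\nabla^2\psi+V(\mathbf x)\psi+\beta|\psi|^2\psi,\qquad \psi(\mathbf x,0)=\psi_0(\mathbf x),\quad\mathbf x\in\mathbb R^d .$$ Then there is finite time blow-up, i.e. $T_{\max}<\infty$, if one of the following holds: (i) $E(\psi_0)<0$; (ii) $E(\psi_0)=0$ and ${\rm Im}\big(\int_{\mathbb R^d}\overline{\psi_0}\,(\mathbf x\cdot\nabla\psi_0)\,d\mathbf x\big)<0$; (iii) $E(\psi_0)>0$ and ${\rm Im}\big(\int_{\mathbb R^d}\overline{\psi_0}\,(\mathbf x\cdot\nabla\psi_0)\,d\mathbf x\big)<-\sqrt{d\,E(\psi_0)}\,\|\mathbf x\psi_0\|_{L^2}$.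
   Context: $X=H^1(\mathbb R^d)\cap\{\phi\ |\ \int_{\mathbb R^d}V|\phi|^2d\mathbf x<\infty\}$ and $E(\phi)=\int_{\mathbb R^d}[\frac12|\nabla\phi|^2+V|\phi|^2+\frac\beta2|\phi|^4]d\mathbf x$. Under the stated conditions on $V$ the Cauchy problem has, for each $\psi_0\in X$, a unique maximal solution in $C([0,T_{\max}),X)$, $T_{\max}\in(0,\infty]$ (if $T_{\max}<\infty$ then $\|\psi(\cdot,t)\|_X\to\infty$ as $t\to T_{\max}^-$), and $\|\psi(\cdot,t)\|_{L^2}$ and $E(\psi(\cdot,t))$ are conserved on $[0,T_{\max})$. *)

theory Defs
  imports "HOL-Analysis.Analysis"
begin

(* Points of R^d are vectors of type real ^ 'd, with d = CARD('d). *)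

definition partial :: "'d::finite \<Rightarrow> (real ^ 'd \<Rightarrow> 'b::real_normed_vector) \<Rightarrow> real ^ 'd \<Rightarrow> 'b" where
  "partial i f x = frechet_derivative f (at x) (axis i 1)"

definition laplacian :: "(real ^ 'd::finite \<Rightarrow> 'b::real_normed_vector) \<Rightarrow> real ^ 'd \<Rightarrow> 'b" where
  "laplacian f x = (\<Sum>i\<in>UNIV. partial i (partial i f) x)"

primrec C_k :: "nat \<Rightarrow> (real ^ 'd::finite \<Rightarrow> 'b::real_normed_vector) \<Rightarrow> bool" where
  "C_k 0 f \<longleftrightarrow> continuous_on UNIV f"
| "C_k (Suc k) f \<longleftrightarrow> (\<forall>x. f differentiable (at x)) \<and> (\<forall>i. C_k k (partial i f))"

definition smooth :: "(real ^ 'd::finite \<Rightarrow> 'b::real_normed_vector) \<Rightarrow> bool" where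
  "smooth f \<longleftrightarrow> (\<forall>k. C_k k f)"

(* A multi-index k is represented by a list of directions containing each i exactly k_i times,
   so |k| is the length of the list. For smooth functions the order is immaterial. *)
definition D_multi :: "'d::finite list \<Rightarrow> (real ^ 'd \<Rightarrow> 'b::real_normed_vector) \<Rightarrow> real ^ 'd \<Rightarrow> 'b" where
  "D_multi is f = foldr partial is f"

definition test_function :: "(real ^ 'd::finite \<Rightarrow> complex) \<Rightarrow> bool" where
  "test_function \<eta> \<longleftrightarrow> smooth \<eta> \<and> compact (closure {x. \<eta> x \<noteq> 0})"

(* Elements of the function spaces below are Borel representatives, not equivalence classes. *)

definition L2 :: "(real ^ 'd::finite \<Rightarrow> 'b::euclidean_space) set" where
  "L2 = {f. f \<in> borel_measurable lborel \<and> integrable lborel (\<lambda>x. (norm (f x))\<^sup>2)}"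

definition norm_L2 :: "(real ^ 'd::finite \<Rightarrow> 'b::euclidean_space) \<Rightarrow> real" where
  "norm_L2 f = sqrt (LINT x|lborel. (norm (f x))\<^sup>2)"

definition is_weak_gradient :: "(real ^ 'd::finite \<Rightarrow> complex) \<Rightarrow> (real ^ 'd \<Rightarrow> complex ^ 'd) \<Rightarrow> bool" where
  "is_weak_gradient \<phi> g \<longleftrightarrow>
     (\<forall>\<eta> i. test_function \<eta> \<longrightarrow>
        (LINT x|lborel. \<phi> x * partial i \<eta> x) = - (LINT x|lborel. (g x $ i) * \<eta> x))"

definition H1 :: "(real ^ 'd::finite \<Rightarrow> complex) set" where
  "H1 = {\<phi> \<in> L2. \<exists>g \<in> L2. is_weak_gradient \<phi> g}"

(* Determined up to a null set for functions in H1; arbitrary outside H1. *)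
definition weak_grad :: "(real ^ 'd::finite \<Rightarrow> complex) \<Rightarrow> real ^ 'd \<Rightarrow> complex ^ 'd" where
  "weak_grad \<phi> = (SOME g. g \<in> L2 \<and> is_weak_gradient \<phi> g)"

definition space_X :: "(real ^ 'd::finite \<Rightarrow> real) \<Rightarrow> (real ^ 'd \<Rightarrow> complex) set" where
  "space_X V = {\<phi> \<in> H1. integrable lborel (\<lambda>x. V x * (cmod (\<phi> x))\<^sup>2)}"

definition norm_X :: "(real ^ 'd::finite \<Rightarrow> real) \<Rightarrow> (real ^ 'd \<Rightarrow> complex) \<Rightarrow> real" where
  "norm_X V \<phi> = sqrt (LINT x|lborel.
      (cmod (\<phi> x))\<^sup>2 + (norm (weak_grad \<phi> x))\<^sup>2 + V x * (cmod (\<phi> x))\<^sup>2)"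

definition energy :: "(real ^ 'd::finite \<Rightarrow> real) \<Rightarrow> real \<Rightarrow> (real ^ 'd \<Rightarrow> complex) \<Rightarrow> real" where
  "energy V \<beta> \<phi> = (LINT x|lborel.
      1/2 * (norm (weak_grad \<phi> x))\<^sup>2 + V x * (cmod (\<phi> x))\<^sup>2 + \<beta>/2 * (cmod (\<phi> x))^4)"

(* The time interval [0,T) for T in (0,\<infinity>]. *)
definition time_interval :: "ereal \<Rightarrow> real set" where
  "time_interval T = {t. 0 \<le> t \<and> ereal t < T}"

definition continuous_in_X ::
    "(real ^ 'd::finite \<Rightarrow> real) \<Rightarrow> ereal \<Rightarrow> (real \<Rightarrow> real ^ 'd \<Rightarrow> complex) \<Rightarrow> bool" where
  "continuous_in_X V T \<psi> \<longleftrightarrow>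
     (\<forall>t \<in> time_interval T. \<psi> t \<in> space_X V) \<and>
     (\<forall>t \<in> time_interval T.
        ((\<lambda>s. norm_X V (\<lambda>x. \<psi> s x - \<psi> t x)) \<longlongrightarrow> 0) (at t within time_interval T))"

(* Solutions in C([0,T),X): the equation holds at every time in [0,T) in the sense of
   distributions on R^d (with the one-sided time derivative at t = 0). *)
definition NLS_solution ::
    "(real ^ 'd::finite \<Rightarrow> real) \<Rightarrow> real \<Rightarrow> (real ^ 'd \<Rightarrow> complex) \<Rightarrow> ereal
      \<Rightarrow> (real \<Rightarrow> real ^ 'd \<Rightarrow> complex) \<Rightarrow> bool" where
  "NLS_solution V \<beta> \<psi>0 T \<psi> \<longleftrightarrow>
     0 < T \<and> continuous_in_X V T \<psi> \<and> (AE x in lborel. \<psi> 0 x = \<psi>0 x) \<and>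
     (\<forall>\<eta>. test_function \<eta> \<longrightarrow> (\<forall>t \<in> time_interval T. \<exists>D.
        ((\<lambda>s. LINT x|lborel. \<psi> s x * \<eta> x) has_vector_derivative D) (at t within time_interval T) \<and>
        \<i> * D = - (1/2) * (LINT x|lborel. \<psi> t x * laplacian \<eta> x)
              + (LINT x|lborel. complex_of_real (V x) * \<psi> t x * \<eta> x)
              + complex_of_real \<beta> *
                (LINT x|lborel. complex_of_real ((cmod (\<psi> t x))\<^sup>2) * \<psi> t x * \<eta> x)))"

definition NLS_maximal_solution ::
    "(real ^ 'd::finite \<Rightarrow> real) \<Rightarrow> real \<Rightarrow> (real ^ 'd \<Rightarrow> complex) \<Rightarrow> ereal
      \<Rightarrow> (real \<Rightarrow> real ^ 'd \<Rightarrow> complex) \<Rightarrow> bool" where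
  "NLS_maximal_solution V \<beta> \<psi>0 T \<psi> \<longleftrightarrow>
     NLS_solution V \<beta> \<psi>0 T \<psi> \<and>
     \<not> (\<exists>T' \<phi>. T < T' \<and> NLS_solution V \<beta> \<psi>0 T' \<phi> \<and>
            (\<forall>t \<in> time_interval T. AE x in lborel. \<phi> t x = \<psi> t x))"

(* Im of the integral of conj(phi) (x . grad phi) *)
definition virial_momentum :: "(real ^ 'd::finite \<Rightarrow> complex) \<Rightarrow> real" where
  "virial_momentum \<phi> = Im (LINT x|lborel.
      cnj (\<phi> x) * (\<Sum>i\<in>UNIV. complex_of_real (x $ i) * (weak_grad \<phi> x $ i)))"

end

theory Submission
  imports Defs
begin

text \<open>Suppose the solution is global. Since it only belongs to \<open>H\<^sup>1\<close> and only its initial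
  variance is known to be finite, the virial identity is derived for the weight \<open>r\<^sup>2 (1 - e b (x / r))\<close>
  instead of \<open>|x|\<^sup>2\<close>, where \<open>b\<close> is the bump function \<open>exp (- 1 / (1 - |x|\<^sup>2))\<close>. This weight is nonnegative,
  tends to \<open>|x|\<^sup>2\<close> as \<open>r\<close> grows, and differs from a compactly supported function by a constant, whose
  contribution is the conserved mass. The computation is legitimate for the mollifications of the solution
  in space; the embedding \<open>H\<^sup>1 \<subseteq> L\<^sup>6\<close>, from the Loomis--Whitney argument, controls the
  cubic term when the mollification is removed. The radial derivative of the weight is nonnegative, so
  \<open>d V + x \<cdot> \<nabla>V \<ge> 0\<close> and conservation of energy bound the second derivative by \<open>2 d E\<close> up to an error
  that vanishes as \<open>r \<rightarrow> \<infinity>\<close>. Hence \<open>0 \<le> \<parallel>x \<psi>\<^sub>0\<parallel>\<^sup>2 + 2 m t + d E t\<^sup>2\<close> for all \<open>t \<ge> 0\<close>, where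
  \<open>m\<close> is the virial momentum of \<open>\<psi>\<^sub>0\<close>, and in each of the three cases the right-hand side is negative
  for some \<open>t\<close>.\<close>

section \<open>Partial derivatives and a smooth bump\<close>

text \<open>The equation holds only as a distribution, tested against functions of x alone, so a
  quadratic integral of the solution cannot be differentiated in time directly. Testing with the
  reflected translates of a mollifier turns it into an ordinary differential equation in t at each
  point x. The mollified nonlinearity is not the nonlinearity of the mollified function; for fixed n
  the two are never compared, but both converge in L2 to the same function. As V may be unbounded, V
  psi need not lie in L2, so both are cut off to a ball containing the support of the weight. The
  limits give identities integrated in time. No rate uniform in time is proved for the truncation
  error: only its positive part is estimated, and its integral over [0,T] vanishes by dominated
  convergence, since norms in X are bounded on compact time intervals. The bound 2 d E matches the
  potential and quartic terms exactly; the gradient term enters with 2 in place of d, and 2 <= d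
  gives the right sign. The factor e gives e b the value 1 at 0 and also makes the weight agree with
  |x|^2 to second order there.\<close>

text \<open>Dominated convergence along sequences tending to \<open>t\<close>: on the convex set
  \<open>S\<close> the mean value inequality bounds difference quotients by \<open>G\<close>, hence
  the remainders by \<open>2 * G\<close>. It serves the space variable of a convolution and, through
  the corollary, time and translations.\<close>

lemma has_derivative_lebesgue_integral:
  fixes f :: "'x::real_normed_vector \<Rightarrow> 'a \<Rightarrow> 'b::{banach, second_countable_topology}"
  assumes S: "convex S" "t \<in> S"
    and int: "\<And>s. s \<in> S \<Longrightarrow> integrable M (f s)"
    and der: "\<And>s x. s \<in> S \<Longrightarrow> x \<in> space M \<Longrightarrow> ((\<lambda>s. f s x) has_derivative f' s x) (at s within S)"
    and bnd: "\<And>s x h. s \<in> S \<Longrightarrow> x \<in> space M \<Longrightarrow> norm (f' s x h) \<le> G x * norm h"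
    and G: "integrable M G"
    and meas: "\<And>h. (\<lambda>x. f' t x h) \<in> borel_measurable M"
  shows "((\<lambda>s. \<integral>x. f s x \<partial>M) has_derivative (\<lambda>h. \<integral>x. f' t x h \<partial>M)) (at t within S)"
proof -
  have int': "integrable M (\<lambda>x. f' t x h)" for h
    by (rule Bochner_Integration.integrable_bound[of _ "\<lambda>x. G x * norm h"])
      (use G meas bnd[OF S(2)] in \<open>auto intro!: AE_I2 intro: order_trans[OF _ abs_ge_self]\<close>)
  have lin: "linear (f' t x)" if "x \<in> space M" for x
    using der[OF S(2) that] by (rule has_derivative_linear)
  have bl: "bounded_linear (\<lambda>h. \<integral>x. f' t x h \<partial>M)"
  proof (rule bounded_linear_intro)
    show "(\<integral>x. f' t x (h + k) \<partial>M) = (\<integral>x. f' t x h \<partial>M) + (\<integral>x. f' t x k \<partial>M)" for h k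
      by (subst Bochner_Integration.integral_add[symmetric, OF int' int'])
        (auto intro!: Bochner_Integration.integral_cong simp: linear_add[OF lin])
    show "(\<integral>x. f' t x (r *\<^sub>R h) \<partial>M) = r *\<^sub>R (\<integral>x. f' t x h \<partial>M)" for r h
    proof -
      have "(\<integral>x. f' t x (r *\<^sub>R h) \<partial>M) = (\<integral>x. r *\<^sub>R f' t x h \<partial>M)"
        by (intro Bochner_Integration.integral_cong) (auto simp: linear_cmul[OF lin])
      then show ?thesis by simp
    qed
    show "norm (\<integral>x. f' t x h \<partial>M) \<le> norm h * (\<integral>x. G x \<partial>M)" for h
    proof -
      have "norm (\<integral>x. f' t x h \<partial>M) \<le> (\<integral>x. norm (f' t x h) \<partial>M)"
        by (rule integral_norm_bound)
      also have "\<dots> \<le> (\<integral>x. G x * norm h \<partial>M)"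
        by (rule integral_mono) (use int' G bnd[OF S(2)] in auto)
      finally show ?thesis by (simp add: mult.commute)
    qed
  qed
  have "((\<lambda>y. (1 / norm (y - t)) *\<^sub>R ((\<integral>x. f y x \<partial>M) - ((\<integral>x. f t x \<partial>M) + (\<integral>x. f' t x (y - t) \<partial>M)))) \<longlongrightarrow> 0)
         (at t within S)"
    unfolding tendsto_at_iff_sequentially
  proof (intro allI impI)
    fix X assume X: "\<forall>i. X i \<in> S - {t}" "X \<longlonglongrightarrow> t"
    have XS: "X i \<in> S" "X i \<noteq> t" for i using X by auto
    let ?g = "\<lambda>i x. (1 / norm (X i - t)) *\<^sub>R (f (X i) x - (f t x + f' t x (X i - t)))"
    have "(\<lambda>i. \<integral>x. ?g i x \<partial>M) \<longlonglongrightarrow> (\<integral>x. 0 \<partial>M)"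
    proof (rule integral_dominated_convergence[where w="\<lambda>x. 2 * G x"])
      show "AE x in M. (\<lambda>i. ?g i x) \<longlonglongrightarrow> 0"
      proof (rule AE_I2)
        fix x assume x: "x \<in> space M"
        show "(\<lambda>i. ?g i x) \<longlonglongrightarrow> 0"
          using der[OF S(2) x] X unfolding has_derivative_within tendsto_at_iff_sequentially
          by (auto simp: comp_def)
      qed
      show "AE x in M. norm (?g i x) \<le> 2 * G x" for i
      proof (rule AE_I2)
        fix x assume x: "x \<in> space M"
        have "norm (f (X i) x - f t x) \<le> G x * norm (X i - t)"
        proof (rule differentiable_bound[OF S(1), where f'="\<lambda>s. f' s x"])
          show "onorm (f' s x) \<le> G x" if "s \<in> S" for s
          proof (rule onorm_bound)
            \<comment> \<open>Nonnegativity of \<open>G x\<close> is read off from the bound itself,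
              at the nonzero increment \<open>X i - t\<close>.\<close>
            have "0 \<le> G x * norm (X i - t)"
              using bnd[OF that x] norm_ge_zero order_trans by blast
            then show "0 \<le> G x" using XS(2)[of i] by (simp add: zero_le_mult_iff)
          qed (use bnd[OF that x] in auto)
        qed (use der x XS S in auto)
        moreover have "norm (f' t x (X i - t)) \<le> G x * norm (X i - t)"
          using bnd[OF S(2) x] .
        ultimately have "norm (f (X i) x - (f t x + f' t x (X i - t))) \<le> 2 * G x * norm (X i - t)"
          using norm_triangle_ineq4[of "f (X i) x - f t x" "f' t x (X i - t)"]
          by (simp add: algebra_simps)
        moreover have "norm (?g i x) = norm (f (X i) x - (f t x + f' t x (X i - t))) / norm (X i - t)"
          unfolding norm_scaleR by simp
        ultimately show "norm (?g i x) \<le> 2 * G x"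
          using XS[of i] by (simp add: divide_le_eq del: norm_scaleR)
      qed
    qed (use G int[OF XS(1)] int[OF S(2)] int' in \<open>auto intro!: borel_measurable_scaleR\<close>)
    moreover have "(\<integral>x. ?g i x \<partial>M) = (1 / norm (X i - t)) *\<^sub>R ((\<integral>x. f (X i) x \<partial>M) - ((\<integral>x. f t x \<partial>M) + (\<integral>x. f' t x (X i - t) \<partial>M)))" for i
      using int[OF XS(1)] int[OF S(2)] int' by simp
    ultimately show "((\<lambda>y. (1 / norm (y - t)) *\<^sub>R ((\<integral>x. f y x \<partial>M) - ((\<integral>x. f t x \<partial>M) + (\<integral>x. f' t x (y - t) \<partial>M)))) \<circ> X)
      \<longlonglongrightarrow> 0"
      by (simp only: comp_def Bochner_Integration.integral_zero)
  qed
  with bl show ?thesis by (simp add: has_derivative_within)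
qed

corollary has_vector_derivative_lebesgue_integral:
  fixes f :: "real \<Rightarrow> 'a \<Rightarrow> 'b::{banach, second_countable_topology}"
  assumes "convex S" "t \<in> S"
    and "\<And>s. s \<in> S \<Longrightarrow> integrable M (f s)"
    and "\<And>s x. s \<in> S \<Longrightarrow> x \<in> space M \<Longrightarrow> ((\<lambda>s. f s x) has_vector_derivative f' s x) (at s within S)"
    and "\<And>s x. s \<in> S \<Longrightarrow> x \<in> space M \<Longrightarrow> norm (f' s x) \<le> G x"
    and "integrable M G"
    and "f' t \<in> borel_measurable M"
  shows "((\<lambda>s. \<integral>x. f s x \<partial>M) has_vector_derivative (\<integral>x. f' t x \<partial>M)) (at t within S)"
proof -
  have "integrable M (f' t)"
    by (rule Bochner_Integration.integrable_bound[of _ G])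
      (use assms in \<open>auto intro!: AE_I2 intro: order_trans[OF _ abs_ge_self]\<close>)
  moreover have "((\<lambda>s. \<integral>x. f s x \<partial>M) has_derivative (\<lambda>h. \<integral>x. h *\<^sub>R f' t x \<partial>M)) (at t within S)"
    by (rule has_derivative_lebesgue_integral[where f' = "\<lambda>s x h. h *\<^sub>R f' s x" and G=G])
      (use assms in \<open>auto simp: has_vector_derivative_def mult.commute[of _ "abs _"] intro!: mult_left_mono\<close>)
  ultimately show ?thesis by (simp add: has_vector_derivative_def)
qed

section \<open>Partial derivatives along coordinate lines and the calculus of C_k functions\<close>

text \<open>Differentiability along one coordinate line, with the derivative supplied explicitly.
  Fluxes built from sums and products are then differentiated by rule, whereas
  \<open>partial\<close> evaluates a Frechet derivative.\<close>

definition has_partial :: "'d::finite \<Rightarrow> (real ^ 'd \<Rightarrow> 'b::real_normed_vector) \<Rightarrow> (real ^ 'd \<Rightarrow> 'b) \<Rightarrow> bool" where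
  "has_partial i f f' \<longleftrightarrow> (\<forall>x. ((\<lambda>s. f (x + s *\<^sub>R axis i 1)) has_vector_derivative f' x) (at 0))"

lemma has_derivative_imp_has_vector_derivative_line:
  assumes "(f has_derivative D) (at x)"
  shows "((\<lambda>s. f (x + s *\<^sub>R e)) has_vector_derivative D e) (at 0)"
proof -
  have "((\<lambda>s. x + s *\<^sub>R e) has_derivative (\<lambda>s. s *\<^sub>R e)) (at 0)"
    by (auto intro!: derivative_eq_intros)
  then have "((\<lambda>s. f (x + s *\<^sub>R e)) has_derivative (\<lambda>s. D (s *\<^sub>R e))) (at 0)"
    using has_derivative_compose[of "\<lambda>s. x + s *\<^sub>R e" "\<lambda>s. s *\<^sub>R e" 0 UNIV f D] assms by auto
  moreover have "D (s *\<^sub>R e) = s *\<^sub>R D e" for s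
    using has_derivative_linear[OF assms] by (rule linear_cmul)
  ultimately show ?thesis by (simp add: has_vector_derivative_def)
qed

lemma has_partial_partial:
  assumes "\<And>x. f differentiable (at x)"
  shows "has_partial i f (partial i f)"
  unfolding has_partial_def partial_def
  using assms has_derivative_imp_has_vector_derivative_line frechet_derivative_works by blast

lemma partial_eqI:
  assumes "(f has_derivative D) (at x)"
  shows "partial i f x = D (axis i 1)"
  unfolding partial_def using frechet_derivative_at[OF assms] by simp

lemma has_derivative_partial:
  fixes f :: "real ^ 'd::finite \<Rightarrow> 'b::real_normed_vector"
  assumes "f differentiable (at x)"
  shows "(f has_derivative (\<lambda>h. \<Sum>i\<in>UNIV. (h $ i) *\<^sub>R partial i f x)) (at x)"
proof -
  let ?D = "frechet_derivative f (at x)"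
  have D: "(f has_derivative ?D) (at x)"
    using assms frechet_derivative_works by blast
  have "?D h = (\<Sum>i\<in>UNIV. (h $ i) *\<^sub>R partial i f x)" for h
  proof -
    have "?D (\<Sum>i\<in>UNIV. (h $ i) *\<^sub>R axis i 1) = (\<Sum>i\<in>UNIV. (h $ i) *\<^sub>R partial i f x)"
      by (simp add: linear_sum[OF has_derivative_linear[OF D]] linear_cmul[OF has_derivative_linear[OF D]] partial_def)
    moreover have "(\<Sum>i\<in>UNIV. (h $ i) *\<^sub>R axis i 1) = h"
      by (simp add: vec_eq_iff axis_def if_distrib cong: if_cong)
    ultimately show ?thesis by simp
  qed
  with D show ?thesis by (metis (no_types, lifting) ext)
qed

lemma C_k_Suc_imp: "C_k (Suc k) f \<Longrightarrow> C_k k f"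
  by (induction k arbitrary: f)
    (auto intro: continuous_at_imp_continuous_on differentiable_imp_continuous_within)

lemma C_k_add:
  "C_k k f \<Longrightarrow> C_k k g \<Longrightarrow> C_k k (\<lambda>x. f x + g x)"
proof (induction k arbitrary: f g)
  case (Suc k)
  have "partial i (\<lambda>x. f x + g x) = (\<lambda>x. partial i f x + partial i g x)" for i
    using Suc.prems by (intro ext, subst partial_eqI[OF has_derivative_add])
      (auto simp: frechet_derivative_works partial_def)
  with Suc show ?case by simp
qed (auto intro: continuous_intros)

lemma partial_bounded_linear:
  assumes "bounded_linear L" "f differentiable (at x)"
  shows "partial i (\<lambda>x. L (f x)) x = L (partial i f x)"
  using assms by (subst partial_eqI[OF bounded_linear.has_derivative])
    (auto simp: frechet_derivative_works partial_def)

lemma differentiable_bounded_linear: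
  assumes "bounded_linear L" "f differentiable (at x)"
  shows "(\<lambda>x. L (f x)) differentiable (at x)"
  using bounded_linear.has_derivative[OF assms(1)] assms(2) unfolding differentiable_def by blast

lemma C_k_bounded_linear:
  assumes L: "bounded_linear L"
  shows "C_k k f \<Longrightarrow> C_k k (\<lambda>x. L (f x))"
proof (induction k arbitrary: f)
  case 0
  then show ?case using bounded_linear.continuous_on[OF L] by auto
next
  case (Suc k)
  have "partial i (\<lambda>x. L (f x)) = (\<lambda>x. L (partial i f x))" for i
    using Suc.prems by (intro ext partial_bounded_linear[OF L]) auto
  moreover have "(\<lambda>x. L (f x)) differentiable (at x)" for x
    using Suc.prems by (intro differentiable_bounded_linear[OF L]) auto
  ultimately show ?case using Suc by simp
qed

lemma partial_mult:
  fixes f g :: "real ^ 'd::finite \<Rightarrow> 'b::real_normed_algebra"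
  assumes "f differentiable (at x)" "g differentiable (at x)"
  shows "partial i (\<lambda>x. f x * g x) x = f x * partial i g x + partial i f x * g x"
  using assms by (subst partial_eqI[OF has_derivative_mult])
    (auto simp: frechet_derivative_works partial_def)

lemma C_k_mult:
  fixes f g :: "real ^ 'd::finite \<Rightarrow> 'b::real_normed_algebra"
  shows "C_k k f \<Longrightarrow> C_k k g \<Longrightarrow> C_k k (\<lambda>x. f x * g x)"
proof (induction k arbitrary: f g)
  case (Suc k)
  have "partial i (\<lambda>x. f x * g x) = (\<lambda>x. f x * partial i g x + partial i f x * g x)" for i
    using Suc.prems by (intro ext partial_mult) auto
  then show ?case
    using Suc.IH Suc.prems C_k_Suc_imp[OF Suc.prems(1)] C_k_Suc_imp[OF Suc.prems(2)]
    by (auto intro!: C_k_add)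
qed (auto intro: continuous_intros)

lemma affine_partial:
  fixes f :: "real ^ 'd::finite \<Rightarrow> 'b::real_normed_vector"
  assumes "f differentiable (at (c *\<^sub>R x + a))"
  shows "(\<lambda>x. f (c *\<^sub>R x + a)) differentiable (at x)"
    and "partial i (\<lambda>x. f (c *\<^sub>R x + a)) x = c *\<^sub>R partial i f (c *\<^sub>R x + a)"
proof -
  let ?D = "frechet_derivative f (at (c *\<^sub>R x + a))"
  have D: "(f has_derivative ?D) (at (c *\<^sub>R x + a))"
    using assms frechet_derivative_works by blast
  have "((\<lambda>x. c *\<^sub>R x + a) has_derivative (\<lambda>h. c *\<^sub>R h)) (at x)"
    by (auto intro!: derivative_eq_intros)
  then have *: "((\<lambda>x. f (c *\<^sub>R x + a)) has_derivative (\<lambda>h. ?D (c *\<^sub>R h))) (at x)"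
    using has_derivative_compose[of "\<lambda>x. c *\<^sub>R x + a" "\<lambda>h. c *\<^sub>R h" x UNIV f ?D] D by auto
  then show "(\<lambda>x. f (c *\<^sub>R x + a)) differentiable (at x)"
    unfolding differentiable_def by blast
  show "partial i (\<lambda>x. f (c *\<^sub>R x + a)) x = c *\<^sub>R partial i f (c *\<^sub>R x + a)"
    by (subst partial_eqI[OF *]) (simp add: partial_def linear_cmul[OF has_derivative_linear[OF D]])
qed

lemma C_k_scaleR_const: "C_k k f \<Longrightarrow> C_k k (\<lambda>x. c *\<^sub>R f x)"
  by (rule C_k_bounded_linear) (rule bounded_linear_scaleR_right)

lemma C_k_affine:
  "C_k k f \<Longrightarrow> C_k k (\<lambda>x. f (c *\<^sub>R x + a))"
proof (induction k arbitrary: f)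
  case 0
  then show ?case by (auto intro!: continuous_on_compose2[of UNIV f] continuous_intros)
next
  case (Suc k)
  have "partial i (\<lambda>x. f (c *\<^sub>R x + a)) = (\<lambda>x. c *\<^sub>R partial i f (c *\<^sub>R x + a))" for i
    using Suc.prems by (intro ext affine_partial(2)) auto
  then show ?case using Suc by (auto intro!: C_k_scaleR_const affine_partial(1))
qed

lemma partial_const [simp]: "partial i (\<lambda>x. c) = (\<lambda>x. 0)"
  by (simp add: partial_def fun_eq_iff)

lemma C_k_const: "C_k k (\<lambda>x. c)"
  by (induction k arbitrary: c) auto

lemma C_k_component: "C_k k (\<lambda>x :: real ^ 'd::finite. x $ i)"
proof (cases k)
  case (Suc k')
  have *: "((\<lambda>x :: real ^ 'd. x $ i) has_derivative (\<lambda>h. h $ i)) (at x)" for x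
    by (rule bounded_linear_imp_has_derivative[OF bounded_linear_vec_nth])
  have "partial j (\<lambda>x :: real ^ 'd. x $ i) = (\<lambda>x. axis j 1 $ i)" for j
    by (rule ext) (simp add: partial_eqI[OF *])
  moreover have "(\<lambda>x :: real ^ 'd. x $ i) differentiable (at x)" for x
    using * differentiable_def by blast
  ultimately show ?thesis using Suc by (auto intro: C_k_const)
qed (auto intro: continuous_intros)

section \<open>The flat function exp (-1/r) and the smoothness of the bump\<close>

text \<open>The flat function exp (-1/r) with a pole of order k attached. The span of this family is
  closed under differentiation, which is what the induction in \<open>C_k_expinv_ball\<close>
  uses.\<close>

definition expinv :: "nat \<Rightarrow> real \<Rightarrow> real" where
  "expinv k r = (if 0 < r then exp (- 1 / r) / r ^ k else 0)"

lemma expinv_nonneg: "0 \<le> expinv k r"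
  by (simp add: expinv_def)

text \<open>A single term of the exponential series, that of order k + 1, is at most exp (1/r). The
  linear bound yields differentiability at r = 0 and, with k = 2, a bound on the slope of the
  weight.\<close>

lemma expinv_le:
  assumes "0 < r" shows "expinv k r \<le> fact (Suc k) * r"
proof -
  have "(1 / r) ^ Suc k / fact (Suc k) \<le> exp (1 / r)"
  proof -
    have "summable (\<lambda>n. inverse (fact n) * (1 / r) ^ n)" by (rule summable_exp)
    then have "(\<Sum>n\<in>{Suc k}. inverse (fact n) * (1 / r) ^ n) \<le> (\<Sum>n. inverse (fact n) * (1 / r) ^ n)"
      using assms by (intro sum_le_suminf) auto
    then show ?thesis by (simp add: exp_def divide_inverse scaleR_conv_of_real mult.commute)
  qed
  then have "exp (- 1 / r) * ((1 / r) ^ Suc k / fact (Suc k)) \<le> exp (- 1 / r) * exp (1 / r)"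
    by (intro mult_left_mono) auto
  also have "\<dots> = 1" by (simp add: exp_minus_inverse flip: exp_add)
  finally have "exp (- 1 / r) \<le> fact (Suc k) * r * r ^ k"
    using assms by (simp add: field_simps power_divide del: fact_Suc)
  then show ?thesis using assms by (simp add: expinv_def divide_le_eq del: fact_Suc)
qed

lemma has_real_derivative_expinv:
  "(expinv k has_real_derivative (expinv (k + 2) r - real k * expinv (k + 1) r)) (at r)"
proof -
  consider "r > 0" | "r < 0" | "r = 0" by linarith
  then show ?thesis
  proof cases
    case 1
    have "((\<lambda>r. exp (- 1 / r) * inverse (r ^ k)) has_real_derivative
      (exp (- 1 / r) * (1 / r ^ 2) * inverse (r ^ k) - exp (- 1 / r) * (real k * r ^ (k - 1) / (r ^ k * r ^ k)))) (at r)"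
      using 1 by (auto intro!: derivative_eq_intros simp: power2_eq_square divide_inverse)
    moreover have "exp (- 1 / r) * (1 / r ^ 2) * inverse (r ^ k) - exp (- 1 / r) * (real k * r ^ (k - 1) / (r ^ k * r ^ k))
        = expinv (k + 2) r - real k * expinv (k + 1) r"
      using 1 by (cases k) (auto simp: expinv_def field_simps power2_eq_square)
    moreover have "(\<lambda>r :: real. exp (- 1 / r) * inverse (r ^ k)) = (\<lambda>r. exp (- 1 / r) / r ^ k)"
      by (rule ext) (simp only: divide_inverse)
    ultimately have "((\<lambda>r. exp (- 1 / r) / r ^ k) has_real_derivative
       (expinv (k + 2) r - real k * expinv (k + 1) r)) (at r)"
      by simp
    then show ?thesis
      by (rule has_field_derivative_transform_within_open[where S="{0<..}"]) (use 1 in \<open>auto simp: expinv_def\<close>)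
  next
    case 2
    have "((\<lambda>r. 0) has_real_derivative (expinv (k + 2) r - real k * expinv (k + 1) r)) (at r)"
      using 2 by (simp add: expinv_def)
    then show ?thesis
      by (rule has_field_derivative_transform_within_open[where S="{..<0}"]) (use 2 in \<open>auto simp: expinv_def\<close>)
  next
    case 3
    \<comment> \<open>For h > 0 the difference quotient at the junction is again in the family,
      namely \<open>expinv (Suc k) h\<close>, and is therefore O(h).\<close>
    have "((\<lambda>h. expinv k h / h) \<longlongrightarrow> 0) (at 0)"
    proof (rule Lim_null_comparison)
      show "\<forall>\<^sub>F h in at 0. norm (expinv k h / h) \<le> fact (Suc (Suc k)) * \<bar>h\<bar>"
      proof (rule always_eventually, rule allI)
        fix h :: real
        show "norm (expinv k h / h) \<le> fact (Suc (Suc k)) * \<bar>h\<bar>"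
        proof (cases "h > 0")
          case True
          then have "expinv k h / h = expinv (Suc k) h" by (simp add: expinv_def)
          with expinv_le[OF True, of "Suc k"] True expinv_nonneg[of "Suc k" h] show ?thesis
            by (simp del: fact_Suc)
        next
          case False
          then have "expinv k h = 0" by (simp add: expinv_def)
          moreover have "0 \<le> (fact (Suc (Suc k)) :: real) * \<bar>h\<bar>" by (intro mult_nonneg_nonneg) auto
          ultimately show ?thesis by (simp del: fact_Suc)
        qed
      qed
      show "((\<lambda>h. fact (Suc (Suc k)) * \<bar>h\<bar>) \<longlongrightarrow> 0) (at (0::real))"
        by (auto intro!: tendsto_eq_intros simp del: fact_Suc)
    qed
    then show ?thesis using 3 by (simp add: DERIV_def expinv_def[of _ 0] expinv_def[of _ "0::real"])
  qed
qed

text \<open>The induction runs over all k at once, since each derivative raises the order of the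
  pole and multiplies by a coordinate.\<close>

lemma C_k_expinv_ball:
  "C_k m (\<lambda>x :: real ^ 'd::finite. expinv k (1 - x \<bullet> x))"
proof (induction m arbitrary: k)
  have q: "((\<lambda>x :: real ^ 'd. 1 - x \<bullet> x) has_derivative (\<lambda>h. - (2 * (x \<bullet> h)))) (at x)" for x
    by (auto intro!: derivative_eq_intros simp: inner_commute)
  let ?e = "\<lambda>k r. expinv (k + 2) r - real k * expinv (k + 1) r"
  have D: "((\<lambda>x :: real ^ 'd. expinv k (1 - x \<bullet> x)) has_derivative
      (\<lambda>h. ?e k (1 - x \<bullet> x) * (- (2 * (x \<bullet> h))))) (at x)" for x k
    using has_derivative_compose[OF q has_real_derivative_expinv[of k "1 - x \<bullet> x", unfolded has_field_derivative_def]]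
    by simp
  then have diff: "(\<lambda>x :: real ^ 'd. expinv k (1 - x \<bullet> x)) differentiable (at x)" for x k
    unfolding differentiable_def by blast
  {
    case 0
    show ?case using diff by (auto intro!: continuous_at_imp_continuous_on differentiable_imp_continuous_within)
  next
    case (Suc m)
    have "partial i (\<lambda>x :: real ^ 'd. expinv k (1 - x \<bullet> x)) =
       (\<lambda>x. (expinv (k + 2) (1 - x \<bullet> x) + (- real k) * expinv (k + 1) (1 - x \<bullet> x)) * ((-2) * (x $ i)))" for i
      by (rule ext) (subst partial_eqI[OF D], simp add: inner_axis)
    moreover have "C_k m (\<lambda>x :: real ^ 'd. (expinv (k + 2) (1 - x \<bullet> x) + (- real k) * expinv (k + 1) (1 - x \<bullet> x)) * ((-2) * (x $ i)))" for i
      by (intro C_k_mult C_k_add C_k_const C_k_component Suc)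
    ultimately show ?case using diff by simp
  }
qed

definition bump :: "real ^ 'd::finite \<Rightarrow> real" where
  "bump x = expinv 0 (1 - x \<bullet> x)"

lemma smooth_bump: "smooth bump"
  unfolding smooth_def bump_def using C_k_expinv_ball by blast

lemma bump_nonneg: "0 \<le> bump x"
  by (simp add: bump_def expinv_nonneg)

lemma bump_eq_0: "1 \<le> norm x \<Longrightarrow> bump x = 0"
proof -
  assume "1 \<le> norm x"
  then have "1 \<le> x \<bullet> x" using one_le_power[of "norm x" 2] by (simp only: dot_square_norm)
  then show ?thesis by (simp add: bump_def expinv_def)
qed

lemma bump_0: "bump 0 = exp (- 1)"
  by (simp add: bump_def expinv_def)

lemma bump_le: "bump x \<le> exp (- 1)"
  by (simp add: bump_def expinv_def)

lemma smooth_partial: "smooth f \<Longrightarrow> smooth (partial i f)"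
  unfolding smooth_def by (metis C_k.simps(2))

lemma smooth_differentiable: "smooth f \<Longrightarrow> f differentiable (at x)"
  unfolding smooth_def by (metis C_k.simps(2))

lemma smooth_continuous: "smooth f \<Longrightarrow> continuous_on UNIV f"
  unfolding smooth_def by (metis C_k.simps(1))

lemma smooth_has_partial: "smooth f \<Longrightarrow> has_partial i f (partial i f)"
  by (simp add: has_partial_partial smooth_differentiable)


section \<open>Supports, local integrability and integration by parts\<close>

text \<open>An explicit radius about the origin replaces the compact closure in
  \<open>test_function\<close>, so that supports can be tracked through reflection, convolution and
  scaling.\<close>

definition supp_in :: "real \<Rightarrow> (real ^ 'd::finite \<Rightarrow> 'b::zero) \<Rightarrow> bool" where
  "supp_in r f \<longleftrightarrow> (\<forall>x. r < norm x \<longrightarrow> f x = 0)"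

definition Cc_smooth :: "(real ^ 'd::finite \<Rightarrow> 'b::real_normed_vector) \<Rightarrow> bool" where
  "Cc_smooth f \<longleftrightarrow> smooth f \<and> (\<exists>r. supp_in r f)"

lemma test_function_iff: "test_function \<eta> \<longleftrightarrow> Cc_smooth \<eta>"
proof -
  have "compact (closure {x. \<eta> x \<noteq> 0}) \<longleftrightarrow> (\<exists>r. supp_in r \<eta>)"
    unfolding compact_closure bounded_iff supp_in_def by (auto simp: not_le[symmetric])
  then show ?thesis by (simp add: test_function_def Cc_smooth_def)
qed

lemma partial_0_outside:
  assumes "supp_in r f" "r < norm x"
  shows "partial i f x = 0"
proof -
  have "open {x :: real ^ 'a. r < norm x}"
    by (intro open_Collect_less continuous_intros)
  then have "(f has_derivative (\<lambda>h. 0)) (at x)"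
    by (rule has_derivative_transform_within_open[where f="\<lambda>x. 0", rotated])
      (use assms in \<open>auto simp: supp_in_def\<close>)
  then show ?thesis by (simp add: partial_eqI)
qed

lemma supp_in_partial: "supp_in r f \<Longrightarrow> supp_in r (partial i f)"
  unfolding supp_in_def[of r "partial i f"] using partial_0_outside by blast

lemma Cc_smooth_partial: "Cc_smooth f \<Longrightarrow> Cc_smooth (partial i f)"
  unfolding Cc_smooth_def using smooth_partial supp_in_partial by blast

lemma supp_in_bounded:
  fixes f :: "real ^ 'd::finite \<Rightarrow> 'b::real_normed_vector"
  assumes "continuous_on UNIV f" "supp_in r f"
  obtains B where "0 \<le> B" "\<And>x. norm (f x) \<le> B"
proof -
  have "compact (f ` cball 0 r)"
    by (intro compact_continuous_image continuous_on_subset[OF assms(1)]) auto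
  then obtain B where B: "\<And>y. y \<in> f ` cball 0 r \<Longrightarrow> norm y \<le> B"
    using bounded_iff compact_imp_bounded by metis
  have "norm (f x) \<le> max B 0" for x
    using B[of "f x"] assms(2) by (cases "norm x \<le> r") (auto simp: supp_in_def)
  then show ?thesis by (intro that[of "max B 0"]) auto
qed

lemma Cc_smooth_bounded:
  assumes "Cc_smooth f"
  obtains B where "0 \<le> B" "\<And>x. norm (f x) \<le> B"
  using assms supp_in_bounded smooth_continuous unfolding Cc_smooth_def by metis

definition locally_integrable :: "(real ^ 'd::finite \<Rightarrow> 'b::{banach, second_countable_topology}) \<Rightarrow> bool" where
  "locally_integrable u \<longleftrightarrow> u \<in> borel_measurable borel \<and> (\<forall>r. integrable lborel (\<lambda>x. indicat_real (cball 0 r) x *\<^sub>R u x))"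

lemma continuous_locally_integrable:
  "continuous_on UNIV u \<Longrightarrow> locally_integrable u"
  unfolding locally_integrable_def
  by (auto intro!: borel_integrable_compact continuous_on_subset[of UNIV u] borel_measurable_continuous_onI)

lemma locally_integrable_mult:
  fixes u :: "real ^ 'd::finite \<Rightarrow> 'b::{banach, second_countable_topology, real_normed_algebra}"
  assumes u: "locally_integrable u" and f: "f \<in> borel_measurable borel" "\<And>x. norm (f x) \<le> B" "supp_in r f"
  shows "integrable lborel (\<lambda>x. u x * f x)"
proof (rule Bochner_Integration.integrable_bound)
  show "integrable lborel (\<lambda>x. B *\<^sub>R (indicat_real (cball 0 r) x *\<^sub>R u x))"
    using u by (intro integrable_scaleR_right) (auto simp: locally_integrable_def)
  show "(\<lambda>x. u x * f x) \<in> borel_measurable lborel"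
    using u f by (auto simp: locally_integrable_def intro!: borel_measurable_times)
  have "norm (u x * f x) \<le> norm (B *\<^sub>R (indicat_real (cball 0 r) x *\<^sub>R u x))" for x
  proof (cases "norm x \<le> r")
    case True
    have "norm (u x * f x) \<le> norm (u x) * norm (f x)" by (rule norm_mult_ineq)
    also have "\<dots> \<le> norm (u x) * B" by (intro mult_left_mono f) auto
    also have "\<dots> \<le> norm (u x) * \<bar>B\<bar>" by (intro mult_left_mono) auto
    finally show ?thesis using True by (simp add: mult.commute)
  qed (use f(3) in \<open>auto simp: supp_in_def\<close>)
  then show "AE x in lborel. norm (u x * f x) \<le> norm (B *\<^sub>R (indicat_real (cball 0 r) x *\<^sub>R u x))"
    by simp
qed

lemma integrable_supp_in:
  fixes f :: "real ^ 'd::finite \<Rightarrow> 'b::{banach, second_countable_topology}"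
  assumes "continuous_on UNIV f" "supp_in r f"
  shows "integrable lborel f"
proof -
  have "(\<lambda>x. indicat_real (cball 0 r) x *\<^sub>R f x) = f"
    using assms(2) by (auto simp: fun_eq_iff supp_in_def indicator_def)
  with continuous_locally_integrable[OF assms(1)] show ?thesis
    by (auto simp: locally_integrable_def dest: spec[of _ r])
qed

lemma lborel_integral_translation:
  fixes f :: "'a::euclidean_space \<Rightarrow> 'b::{banach, second_countable_topology}"
  shows "(LINT x|lborel. f (x + a)) = (LINT x|lborel. f x)"
proof (cases "f \<in> borel_measurable borel")
  case True
  then have "(LINT x|distr lborel borel ((+) a). f x) = (LINT x|lborel. f (a + x))"
    by (intro integral_distr) auto
  then show ?thesis by (simp add: lborel_distr_plus add.commute)
next
  case False
  \<comment> \<open>For a non-measurable f both Bochner integrals take the default value 0, and the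
    identity persists.\<close>
  have "\<not> integrable lborel f" using False by auto
  moreover have "\<not> integrable lborel (\<lambda>x. f (x + a))"
  proof
    assume "integrable lborel (\<lambda>x. f (x + a))"
    then have "(\<lambda>x. f (x + a)) \<circ> (\<lambda>x. x - a) \<in> borel_measurable borel"
      by (intro measurable_comp[of _ borel borel]) auto
    with False show False by (simp add: comp_def)
  qed
  ultimately show ?thesis by (simp add: not_integrable_integral_eq)
qed

lemma has_partial_line:
  assumes "has_partial i f f'"
  shows "((\<lambda>s. f (x + s *\<^sub>R axis i 1)) has_vector_derivative f' (x + s *\<^sub>R axis i 1)) (at s)"
proof -
  let ?e = "axis i 1 :: real ^ 'a"
  have "((\<lambda>t. f (x + s *\<^sub>R ?e + t *\<^sub>R ?e)) has_vector_derivative f' (x + s *\<^sub>R ?e)) (at 0)"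
    using assms by (simp add: has_partial_def)
  then have "((\<lambda>t. f (x + s *\<^sub>R ?e + t *\<^sub>R ?e)) \<circ> (\<lambda>t. t - s) has_vector_derivative 1 *\<^sub>R f' (x + s *\<^sub>R ?e)) (at s)"
    by (intro vector_diff_chain_at) (auto intro!: derivative_eq_intros)
  then show ?thesis by (simp add: comp_def algebra_simps)
qed

lemma supp_in_has_partial:
  assumes "has_partial i f f'" "supp_in r f"
  shows "supp_in r f'"
  unfolding supp_in_def
proof (intro allI impI)
  fix x :: "real ^ 'a" assume x: "r < norm x"
  let ?e = "axis i 1 :: real ^ 'a"
  have "open {s. r < norm (x + s *\<^sub>R ?e)}"
    by (intro open_Collect_less continuous_intros)
  then have "((\<lambda>s. f (x + s *\<^sub>R ?e)) has_vector_derivative 0) (at 0)"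
    by (rule has_vector_derivative_transform_within_open[where f="\<lambda>s. 0", rotated])
      (use x assms(2) in \<open>auto simp: supp_in_def\<close>)
  with has_partial_line[OF assms(1), of x 0] have "f' (x + 0 *\<^sub>R ?e) = 0" by (rule vector_derivative_unique_at)
  then show "f' x = 0" by simp
qed

text \<open>The integral of a translate \<open>f (x + s e)\<close> does not depend on s;
  differentiating under the integral at s = 0 gives the integral of \<open>f'\<close>. Every
  integration by parts below reduces to this.\<close>

lemma integral_has_partial_eq_0:
  fixes f :: "real ^ 'd::finite \<Rightarrow> 'b::{banach, second_countable_topology}"
  assumes f: "has_partial i f f'" "continuous_on UNIV f" "continuous_on UNIV f'" "supp_in r f"
  shows "integrable lborel f'" "(LINT x|lborel. f' x) = 0"
proof -
  let ?e = "axis i 1 :: real ^ 'd"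
  note der = has_partial_line[OF f(1)]
  note f'0 = supp_in_has_partial[OF f(1,4)]
  show int': "integrable lborel f'" using integrable_supp_in[OF f(3) f'0] .
  have int: "integrable lborel f" using integrable_supp_in[OF f(2,4)] .
  obtain B where B: "0 \<le> B" "\<And>x. norm (f' x) \<le> B" using supp_in_bounded[OF f(3) f'0] by blast
  have tr: "integrable lborel (\<lambda>x. f (x + a))" for a :: "real ^ 'd"
  proof (rule integrable_supp_in)
    show "continuous_on UNIV (\<lambda>x. f (x + a))"
      by (rule continuous_on_compose2[OF f(2)]) (auto intro!: continuous_intros)
    show "supp_in (r + norm a) (\<lambda>x. f (x + a))"
      unfolding supp_in_def
    proof (intro allI impI)
      fix x :: "real ^ 'd" assume "r + norm a < norm x"
      then have "r < norm (x + a)" using norm_diff_ineq[of x a] by linarith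
      then show "f (x + a) = 0" using f(4) by (simp add: supp_in_def)
    qed
  qed
  have "((\<lambda>s. LINT x|lborel. f (x + s *\<^sub>R ?e)) has_vector_derivative (LINT x|lborel. f' (x + 0 *\<^sub>R ?e))) (at 0 within {-1..1})"
  \<comment> \<open>For s in [-1,1] all translates are supported in the ball of radius r + 1, which
    carries the dominating constant.\<close>
  proof (rule has_vector_derivative_lebesgue_integral[where f'="\<lambda>s x. f' (x + s *\<^sub>R ?e)" and G="\<lambda>x. B * indicator (cball 0 (r + 1)) x"])
    fix s :: real and x :: "real ^ 'd" assume s: "s \<in> {-1..1}"
    show "integrable lborel (\<lambda>x. f (x + s *\<^sub>R ?e))" by (rule tr)
    show "norm (f' (x + s *\<^sub>R ?e)) \<le> B * indicator (cball 0 (r + 1)) x"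
    proof (cases "norm x \<le> r + 1")
      case False
      have "norm (s *\<^sub>R ?e) \<le> 1" using s by (auto simp: norm_axis_1)
      with False have "r < norm (x + s *\<^sub>R ?e)" using norm_diff_ineq[of x "s *\<^sub>R ?e"] by linarith
      then show ?thesis using f'0 B by (simp add: supp_in_def)
    qed (use B in auto)
    show "((\<lambda>s. f (x + s *\<^sub>R ?e)) has_vector_derivative f' (x + s *\<^sub>R ?e)) (at s within {-1..1})"
      using der has_vector_derivative_at_within by blast
  next
    show "integrable lborel (\<lambda>x. B * indicat_real (cball 0 (r + 1)) (x :: real ^ 'd))"
      by (intro integrable_mult_right integrable_real_indicator) (use emeasure_bounded_finite[OF bounded_cball] in auto)
    show "(\<lambda>x. f' (x + 0 *\<^sub>R ?e)) \<in> borel_measurable lborel"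
      using f(3) by (simp add: borel_measurable_continuous_onI)
  qed auto
  then have "((\<lambda>s. LINT x|lborel. f x) has_vector_derivative (LINT x|lborel. f' x)) (at 0 within {-1..1})"
    by (simp add: lborel_integral_translation)
  then have "((\<lambda>s. LINT x|lborel. f x) has_vector_derivative (LINT x|lborel. f' x)) (at 0)"
    using at_within_interior[of 0 "{-1..1::real}"] by simp
  then show "(LINT x|lborel. f' x) = 0"
    using vector_derivative_unique_at[OF has_vector_derivative_const] by metis
qed

section \<open>Square integrable functions\<close>

lemma L2D: 
  assumes "f \<in> L2"
  shows "f \<in> borel_measurable borel" "integrable lborel (\<lambda>x. (norm (f x))\<^sup>2)"
  using assms by (auto simp: L2_def)

lemmas [measurable_dest] = L2D(1)

lemma L2I: "f \<in> borel_measurable borel \<Longrightarrow> integrable lborel (\<lambda>x. (norm (f x))\<^sup>2) \<Longrightarrow> f \<in> L2"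
  by (auto simp: L2_def)

lemma L2I_le:
  assumes "f \<in> borel_measurable borel" "integrable lborel G" "\<And>x. (norm (f x))\<^sup>2 \<le> G x"
  shows "f \<in> L2"
  by (rule L2I[OF assms(1)], rule Bochner_Integration.integrable_bound[OF assms(2)])
    (use assms in \<open>auto intro!: AE_I2 order_trans[OF assms(3) abs_ge_self]\<close>)

lemma norm_add_sq_le: "(norm (a + b :: 'a::real_normed_vector))\<^sup>2 \<le> 2 * (norm a)\<^sup>2 + 2 * (norm b)\<^sup>2"
proof -
  have "(norm (a + b))\<^sup>2 \<le> (norm a + norm b)\<^sup>2"
    by (intro power_mono norm_triangle_ineq) auto
  also have "\<dots> \<le> 2 * (norm a)\<^sup>2 + 2 * (norm b)\<^sup>2"
    using sum_squares_bound[of "norm a" "norm b"] by (simp add: power2_sum)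
  finally show ?thesis .
qed

lemma L2_add: "f \<in> L2 \<Longrightarrow> g \<in> L2 \<Longrightarrow> (\<lambda>x. f x + g x) \<in> L2"
  by (rule L2I_le[where G="\<lambda>x. 2 * (norm (f x))\<^sup>2 + 2 * (norm (g x))\<^sup>2"])
    (auto simp: L2D(2) norm_add_sq_le)

lemma L2_mult_bounded:
  fixes f :: "real ^ 'd::finite \<Rightarrow> complex"
  assumes "f \<in> L2" "c \<in> borel_measurable borel" "\<And>x. norm (c x) \<le> B"
  shows "(\<lambda>x. c x * f x) \<in> L2"
proof (rule L2I_le[where G="\<lambda>x. B\<^sup>2 * (norm (f x))\<^sup>2"])
  show "(norm (c x * f x))\<^sup>2 \<le> B\<^sup>2 * (norm (f x))\<^sup>2" for x
    by (auto simp: norm_mult power_mult_distrib intro!: mult_right_mono power_mono assms)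
qed (use assms in \<open>auto simp: L2D intro!: borel_measurable_times\<close>)

lemma L2_scaleR:
  shows "f \<in> L2 \<Longrightarrow> (\<lambda>x. c *\<^sub>R f x) \<in> L2"
  by (rule L2I_le[where G="\<lambda>x. c\<^sup>2 * (norm (f x))\<^sup>2"])
   (auto intro: L2D simp: power_mult_distrib)

lemma L2_diff: "f \<in> L2 \<Longrightarrow> g \<in> L2 \<Longrightarrow> (\<lambda>x. f x - g x) \<in> L2"
  using L2_add[of f "\<lambda>x. (-1) *\<^sub>R g x"] L2_scaleR[of g "-1"] by simp

lemma L2_cnj: "f \<in> L2 \<Longrightarrow> (\<lambda>x. cnj (f x)) \<in> L2"
  by (rule L2I_le[where G="\<lambda>x. (norm (f x))\<^sup>2"])
   (auto intro!: L2D measurable_compose[OF _ borel_measurable_continuous_onI[OF continuous_on_cnj[OF continuous_on_id]]])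

lemma L2_component: "(f :: real ^ 'd::finite \<Rightarrow> complex ^ 'd) \<in> L2 \<Longrightarrow> (\<lambda>x. f x $ i) \<in> L2"
  by (rule L2I_le[where G="\<lambda>x. (norm (f x))\<^sup>2"])
   (auto intro: L2D intro!: power_mono Finite_Cartesian_Product.norm_nth_le measurable_compose[OF _ borel_measurable_continuous_onI[OF continuous_on_component]])

lemma L2_sq_integral_nonneg: "0 \<le> (LINT x|lborel. (norm (f x))\<^sup>2)"
  by (intro integral_nonneg_AE) auto

lemma norm_L2_nonneg: "0 \<le> norm_L2 f"
  by (simp add: norm_L2_def L2_sq_integral_nonneg)

lemma norm_L2_sq: "(norm_L2 f)\<^sup>2 = (LINT x|lborel. (norm (f x))\<^sup>2)"
  by (simp add: norm_L2_def L2_sq_integral_nonneg)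

lemma nn_integral_L2: "f \<in> L2 \<Longrightarrow> (\<integral>\<^sup>+x. ennreal ((norm (f x))\<^sup>2) \<partial>lborel) = ennreal ((norm_L2 f)\<^sup>2)"
  unfolding norm_L2_sq by (intro nn_integral_eq_integral) (auto simp: L2D)

lemma L2_Cauchy_Schwarz:
  assumes "f \<in> L2" "g \<in> L2"
  shows "integrable lborel (\<lambda>x. norm (f x) * norm (g x))"
    and "(LINT x|lborel. norm (f x) * norm (g x)) \<le> norm_L2 f * norm_L2 g"
proof -
  have [measurable]: "f \<in> borel_measurable lborel" "g \<in> borel_measurable lborel" using assms L2D by auto
  show *: "integrable lborel (\<lambda>x. norm (f x) * norm (g x))"
  proof (rule Bochner_Integration.integrable_bound[where f="\<lambda>x. (norm (f x))\<^sup>2 + (norm (g x))\<^sup>2"])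
    have "norm (f x) * norm (g x) \<le> (norm (f x))\<^sup>2 + (norm (g x))\<^sup>2" for x
      using sum_squares_bound[of "norm (f x)" "norm (g x)"] zero_le_power2[of "norm (f x)"] zero_le_power2[of "norm (g x)"]
      by linarith
    then show "AE x in lborel. norm (norm (f x) * norm (g x)) \<le> norm ((norm (f x))\<^sup>2 + (norm (g x))\<^sup>2)"
      by simp
  qed (use assms in \<open>auto simp: L2D(2)\<close>)
  have "(\<integral>\<^sup>+x. ennreal (norm (f x) * norm (g x)) \<partial>lborel)\<^sup>2 \<le>
    (\<integral>\<^sup>+x. ennreal ((norm (f x))\<^sup>2) \<partial>lborel) * (\<integral>\<^sup>+x. ennreal ((norm (g x))\<^sup>2) \<partial>lborel)"
    using Cauchy_Schwarz_nn_integral[of "\<lambda>x. ennreal (norm (f x))" lborel "\<lambda>x. ennreal (norm (g x))"]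
    by (simp add: ennreal_mult ennreal_power)
  also have "\<dots> = ennreal ((norm_L2 f * norm_L2 g)\<^sup>2)"
    using assms by (simp add: nn_integral_L2 power_mult_distrib ennreal_mult)
  finally have "ennreal ((LINT x|lborel. norm (f x) * norm (g x))\<^sup>2) \<le> ennreal ((norm_L2 f * norm_L2 g)\<^sup>2)"
    by (subst (asm) nn_integral_eq_integral[OF *]) (auto simp: ennreal_power integral_nonneg_AE)
  then have "(LINT x|lborel. norm (f x) * norm (g x))\<^sup>2 \<le> (norm_L2 f * norm_L2 g)\<^sup>2"
    by simp
  then show "(LINT x|lborel. norm (f x) * norm (g x)) \<le> norm_L2 f * norm_L2 g"
    by (rule power2_le_imp_le) (simp add: norm_L2_nonneg)
qed

lemma L2_mult_integrable:
  fixes f g :: "real ^ 'd::finite \<Rightarrow> complex"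
  assumes "f \<in> L2" "g \<in> L2"
  shows "integrable lborel (\<lambda>x. f x * g x)"
  by (rule Bochner_Integration.integrable_bound[OF L2_Cauchy_Schwarz(1)[OF assms]])
    (use assms in \<open>auto simp: norm_mult\<close>)

lemma norm_L2_add:
  assumes "f \<in> L2" "g \<in> L2"
  shows "norm_L2 (\<lambda>x. f x + g x) \<le> norm_L2 f + norm_L2 g"
proof (rule power2_le_imp_le)
  have "(norm_L2 (\<lambda>x. f x + g x))\<^sup>2 \<le> (LINT x|lborel. (norm (f x))\<^sup>2 + (norm (g x))\<^sup>2 + 2 * (norm (f x) * norm (g x)))"
    unfolding norm_L2_sq
  proof (rule integral_mono)
    show "(norm (f x + g x))\<^sup>2 \<le> (norm (f x))\<^sup>2 + (norm (g x))\<^sup>2 + 2 * (norm (f x) * norm (g x))" for x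
      using power_mono[OF norm_triangle_ineq[of "f x" "g x"], of 2] by (simp add: power2_sum)
  qed (use L2D(2)[OF assms(1)] L2D(2)[OF assms(2)] L2D(2)[OF L2_add[OF assms]] L2_Cauchy_Schwarz(1)[OF assms] in auto)
  also have "\<dots> = (norm_L2 f)\<^sup>2 + (norm_L2 g)\<^sup>2 + 2 * (LINT x|lborel. norm (f x) * norm (g x))"
    using L2D(2)[OF assms(1)] L2D(2)[OF assms(2)] L2_Cauchy_Schwarz(1)[OF assms] by (simp add: norm_L2_sq)
  also have "\<dots> \<le> (norm_L2 f + norm_L2 g)\<^sup>2"
    using L2_Cauchy_Schwarz(2)[OF assms] by (simp add: power2_sum)
  finally show "(norm_L2 (\<lambda>x. f x + g x))\<^sup>2 \<le> (norm_L2 f + norm_L2 g)\<^sup>2" .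
qed (simp add: norm_L2_nonneg)

lemma norm_L2_mono:
  assumes "g \<in> L2" "f \<in> borel_measurable borel" "\<And>x. norm (f x) \<le> norm (g x)"
  shows "f \<in> L2" "norm_L2 f \<le> norm_L2 g"
proof -
  show "f \<in> L2" by (rule L2I_le[OF assms(2) L2D(2)[OF assms(1)]]) (auto intro: power_mono assms)
  then show "norm_L2 f \<le> norm_L2 g"
    unfolding norm_L2_def using assms
    by (auto intro!: real_sqrt_le_mono integral_mono power_mono L2D)
qed

lemma L2_0 [simp]: "(\<lambda>x. 0) \<in> L2"
  by (auto intro: L2I)

lemma norm_L2_scaleR: "norm_L2 (\<lambda>x. c *\<^sub>R f x) = \<bar>c\<bar> * norm_L2 f"
  by (simp add: norm_L2_def power_mult_distrib real_sqrt_mult)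

lemma norm_L2_minus: "norm_L2 (\<lambda>x. f x - g x) = norm_L2 (\<lambda>x. g x - f x)"
  by (simp add: norm_L2_def norm_minus_commute)

lemma norm_L2_triangle:
  assumes "f \<in> L2" "g \<in> L2"
  shows "norm_L2 f \<le> norm_L2 g + norm_L2 (\<lambda>x. f x - g x)"
  using norm_L2_add[OF assms(2) L2_diff[OF assms]] by simp

section \<open>Convergence in L2\<close>

text \<open>Membership in \<open>L2\<close> is included because \<open>norm_L2\<close> is 0 by
  default when the square is not integrable.\<close>

definition L2_lim :: "(nat \<Rightarrow> real ^ 'd::finite \<Rightarrow> 'b::euclidean_space) \<Rightarrow> (real ^ 'd \<Rightarrow> 'b) \<Rightarrow> bool" where
  "L2_lim f g \<longleftrightarrow> (\<forall>n. f n \<in> L2) \<and> g \<in> L2 \<and> (\<lambda>n. norm_L2 (\<lambda>x. f n x - g x)) \<longlonglongrightarrow> 0"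

lemma L2_limI_bound:
  assumes "\<And>n. f n \<in> L2" "g \<in> L2" "\<And>n. norm_L2 (\<lambda>x. f n x - g x) \<le> b n" "b \<longlonglongrightarrow> 0"
  shows "L2_lim f g"
  unfolding L2_lim_def using assms
  by (auto intro!: tendsto_sandwich[OF _ _ tendsto_const assms(4)] always_eventually norm_L2_nonneg)

lemma L2_lim_bounded:
  assumes "L2_lim f g"
  obtains B where "0 \<le> B" "\<And>n. norm_L2 (f n) \<le> B"
proof -
  have "Bseq (\<lambda>n. norm_L2 (\<lambda>x. f n x - g x))"
    using assms by (auto simp: L2_lim_def intro: convergent_imp_Bseq convergentI)
  then obtain K where K: "\<And>n. norm (norm_L2 (\<lambda>x. f n x - g x)) \<le> K" by (auto simp: Bseq_def)
  have "norm_L2 (f n) \<le> norm_L2 g + K" for n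
    using norm_L2_triangle[of "f n" g] assms K[of n] by (auto simp: L2_lim_def)
  moreover have "0 \<le> norm_L2 g + K" using order_trans[OF norm_ge_zero K[of 0]] norm_L2_nonneg[of g] by linarith
  ultimately show ?thesis using that by blast
qed

lemma L2_lim_const: "f \<in> L2 \<Longrightarrow> L2_lim (\<lambda>n. f) f"
  by (simp add: L2_lim_def norm_L2_def)

lemma L2_lim_add:
  assumes "L2_lim f f0" "L2_lim g g0"
  shows "L2_lim (\<lambda>n x. f n x + g n x) (\<lambda>x. f0 x + g0 x)"
proof (rule L2_limI_bound[where b="\<lambda>n. norm_L2 (\<lambda>x. f n x - f0 x) + norm_L2 (\<lambda>x. g n x - g0 x)"])
  show "norm_L2 (\<lambda>x. f n x + g n x - (f0 x + g0 x)) \<le> norm_L2 (\<lambda>x. f n x - f0 x) + norm_L2 (\<lambda>x. g n x - g0 x)" for n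
    using norm_L2_add[of "\<lambda>x. f n x - f0 x" "\<lambda>x. g n x - g0 x"] assms
    by (simp add: L2_lim_def L2_diff algebra_simps)
  show "(\<lambda>n. norm_L2 (\<lambda>x. f n x - f0 x) + norm_L2 (\<lambda>x. g n x - g0 x)) \<longlonglongrightarrow> 0"
    using tendsto_add[of _ 0 _ _ 0] assms by (auto simp: L2_lim_def)
qed (use assms in \<open>auto simp: L2_lim_def L2_add\<close>)

lemma L2_lim_mult_bounded:
  fixes f :: "nat \<Rightarrow> real ^ 'd::finite \<Rightarrow> complex"
  assumes "L2_lim f f0" "c \<in> borel_measurable borel" "\<And>x. norm (c x) \<le> B"
  shows "L2_lim (\<lambda>n x. c x * f n x) (\<lambda>x. c x * f0 x)"
proof (rule L2_limI_bound[where b="\<lambda>n. \<bar>B\<bar> * norm_L2 (\<lambda>x. f n x - f0 x)"])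
  show "norm_L2 (\<lambda>x. c x * f n x - c x * f0 x) \<le> \<bar>B\<bar> * norm_L2 (\<lambda>x. f n x - f0 x)" for n
    unfolding norm_L2_scaleR[symmetric]
  proof (rule norm_L2_mono(2))
    show "norm (c x * f n x - c x * f0 x) \<le> norm (B *\<^sub>R (f n x - f0 x))" for x
      using assms(3)[of x] abs_ge_self[of B] 
      by (simp add: right_diff_distrib[symmetric] norm_mult) (meson mult_right_mono norm_ge_zero order_trans)
  next
    have "f n \<in> L2" "f0 \<in> L2" using assms(1) by (auto simp: L2_lim_def)
    with assms(2) show "(\<lambda>x. B *\<^sub>R (f n x - f0 x)) \<in> L2" "(\<lambda>x. c x * f n x - c x * f0 x) \<in> borel_measurable borel"
      by (auto intro!: L2_scaleR L2_diff)
  qed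
  show "(\<lambda>n. \<bar>B\<bar> * norm_L2 (\<lambda>x. f n x - f0 x)) \<longlonglongrightarrow> 0"
    using tendsto_mult_right_zero assms(1) by (auto simp: L2_lim_def)
qed (use assms in \<open>auto simp: L2_lim_def intro!: L2_mult_bounded\<close>)

lemma L2_lim_cnj:
  assumes "L2_lim f f0"
  shows "L2_lim (\<lambda>n x. cnj (f n x)) (\<lambda>x. cnj (f0 x))"
proof -
  have "norm_L2 (\<lambda>x. cnj (f n x) - cnj (f0 x)) = norm_L2 (\<lambda>x. f n x - f0 x)" for n
    unfolding norm_L2_def by (simp flip: complex_cnj_diff)
  then show ?thesis using assms by (simp add: L2_lim_def L2_cnj)
qed

lemma norm_integral_mult_le:
  fixes f g :: "real ^ 'd::finite \<Rightarrow> complex"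
  assumes "f \<in> L2" "g \<in> L2"
  shows "norm (LINT x|lborel. f x * g x) \<le> norm_L2 f * norm_L2 g"
proof -
  have "norm (LINT x|lborel. f x * g x) \<le> (LINT x|lborel. norm (f x) * norm (g x))"
    using integral_norm_bound[of lborel "\<lambda>x. f x * g x"] by (simp add: norm_mult)
  also have "\<dots> \<le> norm_L2 f * norm_L2 g" by (rule L2_Cauchy_Schwarz(2)[OF assms])
  finally show ?thesis .
qed

text \<open>Split \<open>f n * g n - f0 * g0\<close> as
  \<open>(f n - f0) * g n + f0 * (g n - g0)\<close> and use that \<open>g n\<close> is bounded in
  L2. All bilinear terms of the virial identities pass to the limit through this lemma, which is why
  they are later grouped as products of two L2 functions.\<close>

lemma tendsto_integral_mult_L2:
  fixes f g :: "nat \<Rightarrow> real ^ 'd::finite \<Rightarrow> complex"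
  assumes "L2_lim f f0" "L2_lim g g0"
  shows "(\<lambda>n. LINT x|lborel. f n x * g n x) \<longlonglongrightarrow> (LINT x|lborel. f0 x * g0 x)"
proof -
  obtain B where B: "0 \<le> B" "\<And>n. norm_L2 (g n) \<le> B" using L2_lim_bounded[OF assms(2)] by blast
  note m = assms[unfolded L2_lim_def]
  have "norm ((LINT x|lborel. f n x * g n x) - (LINT x|lborel. f0 x * g0 x))
     \<le> norm_L2 (\<lambda>x. f n x - f0 x) * B + norm_L2 f0 * norm_L2 (\<lambda>x. g n x - g0 x)" for n
  proof -
    have eq: "(LINT x|lborel. f n x * g n x) - (LINT x|lborel. f0 x * g0 x) =
      (LINT x|lborel. (f n x - f0 x) * g n x) + (LINT x|lborel. f0 x * (g n x - g0 x))"
    proof -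
      have "integrable lborel (\<lambda>x. (f n x - f0 x) * g n x)" "integrable lborel (\<lambda>x. f0 x * (g n x - g0 x))"
        "integrable lborel (\<lambda>x. f n x * g n x)" "integrable lborel (\<lambda>x. f0 x * g0 x)"
        using m by (auto intro!: L2_mult_integrable L2_diff)
      then show ?thesis
        by (simp flip: Bochner_Integration.integral_add Bochner_Integration.integral_diff add: algebra_simps)
    qed
    have "norm (LINT x|lborel. (f n x - f0 x) * g n x) \<le> norm_L2 (\<lambda>x. f n x - f0 x) * norm_L2 (g n)"
      using m by (intro norm_integral_mult_le L2_diff) auto
    moreover have "norm_L2 (\<lambda>x. f n x - f0 x) * norm_L2 (g n) \<le> norm_L2 (\<lambda>x. f n x - f0 x) * B"
      by (intro mult_left_mono B norm_L2_nonneg)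
    moreover have "norm (LINT x|lborel. f0 x * (g n x - g0 x)) \<le> norm_L2 f0 * norm_L2 (\<lambda>x. g n x - g0 x)"
      using m by (intro norm_integral_mult_le L2_diff) auto
    ultimately show ?thesis
      unfolding eq using norm_triangle_ineq[of "LINT x|lborel. (f n x - f0 x) * g n x" "LINT x|lborel. f0 x * (g n x - g0 x)"]
      by linarith
  qed
  moreover have "(\<lambda>n. norm_L2 (\<lambda>x. f n x - f0 x) * B + norm_L2 f0 * norm_L2 (\<lambda>x. g n x - g0 x)) \<longlonglongrightarrow> 0 * B + norm_L2 f0 * 0"
    using m by (intro tendsto_intros) auto
  ultimately have "(\<lambda>n. (LINT x|lborel. f n x * g n x) - (LINT x|lborel. f0 x * g0 x)) \<longlonglongrightarrow> 0"
    using Lim_null_comparison[OF always_eventually, OF allI] by force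
  then show ?thesis by (simp add: LIM_zero_iff)
qed


section \<open>Density of continuous functions and continuity of translations in L2\<close>

text \<open>The notion \<open>measurable_on\<close> is by definition a limit of continuous functions
  off a negligible set; completion moves that set from \<open>lebesgue\<close> to
  \<open>lborel\<close>.\<close>

lemma AE_limit_of_continuous:
  fixes f :: "'a::euclidean_space \<Rightarrow> 'b::euclidean_space"
  assumes "f \<in> borel_measurable borel"
  obtains g where "\<And>n :: nat. continuous_on UNIV (g n)" "AE x in lborel. (\<lambda>n. g n x) \<longlonglongrightarrow> f x"
proof -
  have "f measurable_on UNIV"
    using assms by (intro lebesgue_measurable_imp_measurable_on) (auto simp: measurable_completion)
  then obtain N g where N: "negligible N" "\<And>n. continuous_on UNIV (g n)" "\<And>x. x \<notin> N \<Longrightarrow> (\<lambda>n. g n x) \<longlonglongrightarrow> f x"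
    by (auto simp: measurable_on_def)
  have "AE x in lebesgue. x \<notin> N" using N(1) by (simp add: negligible_iff_null_sets AE_not_in)
  then have "AE x in lebesgue. (\<lambda>n. g n x) \<longlonglongrightarrow> f x" by eventually_elim (use N in auto)
  then have "AE x in lborel. (\<lambda>n. g n x) \<longlonglongrightarrow> f x" by (simp add: AE_completion_iff)
  with N that show ?thesis by blast
qed

lemma norm_L2_tendsto_0:
  fixes f :: "nat \<Rightarrow> real ^ 'd::finite \<Rightarrow> 'b::euclidean_space"
  assumes "\<And>n. f n \<in> borel_measurable borel" "AE x in lborel. (\<lambda>n. f n x) \<longlonglongrightarrow> 0"
    and "G \<in> L2" "\<And>n x. norm (f n x) \<le> norm (G x)"
  shows "(\<lambda>n. norm_L2 (f n)) \<longlonglongrightarrow> 0"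
proof -
  have "(\<lambda>n. LINT x|lborel. (norm (f n x))\<^sup>2) \<longlonglongrightarrow> (LINT x|(lborel :: (real ^ 'd) measure). 0)"
  proof (rule integral_dominated_convergence[where w="\<lambda>x. (norm (G x))\<^sup>2"])
    show "AE x in lborel. (\<lambda>n. (norm (f n x))\<^sup>2) \<longlonglongrightarrow> 0"
      using assms(2) by eventually_elim (metis tendsto_norm_zero tendsto_null_power zero_less_numeral pos2)
    show "AE x in lborel. norm ((norm (f n x))\<^sup>2) \<le> (norm (G x))\<^sup>2" for n
      using assms(4) by (auto intro!: power_mono)
  qed (use assms L2D in auto)
  then have "(\<lambda>n. sqrt (LINT x|lborel. (norm (f n x))\<^sup>2)) \<longlonglongrightarrow> sqrt 0"
    by (intro tendsto_real_sqrt) simp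
  then show ?thesis by (simp add: norm_L2_def)
qed

text \<open>Radial truncation, written as the nearest point projection onto a ball: continuity then
  follows from convexity, and it is the identity inside the ball.\<close>

definition clamp_norm :: "nat \<Rightarrow> 'b::euclidean_space \<Rightarrow> 'b" where
  "clamp_norm k = closest_point (cball 0 (real k))"

lemma continuous_on_clamp_norm: "continuous_on A (clamp_norm k)"
  unfolding clamp_norm_def by (rule continuous_on_closest_point) auto

lemma norm_clamp_norm_le: "norm (clamp_norm k z) \<le> real k"
  using closest_point_in_set[of "cball 0 (real k)" z] by (simp add: clamp_norm_def)

lemma clamp_norm_eq: "norm z \<le> real k \<Longrightarrow> clamp_norm k z = z"
  unfolding clamp_norm_def by (rule closest_point_self) auto

definition cutoff :: "nat \<Rightarrow> 'a::real_normed_vector \<Rightarrow> real" where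
  "cutoff k x = max 0 (min 1 (real k + 1 - norm x))"

lemma cutoff_simps: "0 \<le> cutoff k x" "cutoff k x \<le> 1" "norm x \<le> real k \<Longrightarrow> cutoff k x = 1" "real k + 1 < norm x \<Longrightarrow> cutoff k x = 0"
  by (auto simp: cutoff_def)

lemma continuous_on_cutoff: "continuous_on A (cutoff k)"
  unfolding cutoff_def by (intro continuous_intros)

lemma L2_supp_in:
  fixes f :: "real ^ 'd::finite \<Rightarrow> 'b::euclidean_space"
  assumes "continuous_on UNIV f" "supp_in r f"
  shows "f \<in> L2"
proof (rule L2I)
  show "integrable lborel (\<lambda>x. (norm (f x))\<^sup>2)"
    by (rule integrable_supp_in) (use assms in \<open>auto intro!: continuous_intros simp: supp_in_def\<close>)
qed (use assms in \<open>auto intro: borel_measurable_continuous_onI\<close>)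

text \<open>Two dominated limits. First f is truncated in space and in size; then, inside the
  truncation, f is replaced by continuous approximants \<open>h n\<close>. These have no common
  bound themselves, but after truncation the error is at most \<open>2 * real k\<close> times the
  cutoff.\<close>

lemma L2_approx_continuous:
  fixes f :: "real ^ 'd::finite \<Rightarrow> 'b::euclidean_space"
  assumes f: "f \<in> L2" and e: "0 < e"
  obtains g r where "continuous_on UNIV g" "supp_in r g" "norm_L2 (\<lambda>x. f x - g x) < e"
proof -
  have [measurable]: "f \<in> borel_measurable borel" using f L2D by auto
  have [measurable]: "(clamp_norm k :: 'b \<Rightarrow> 'b) \<in> borel_measurable borel" for k
    by (intro borel_measurable_continuous_onI continuous_on_clamp_norm)
  have [measurable]: "(cutoff k :: real ^ 'd \<Rightarrow> real) \<in> borel_measurable borel" for k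
    by (intro borel_measurable_continuous_onI continuous_on_cutoff)
  let ?w = "\<lambda>k x. cutoff k x *\<^sub>R clamp_norm k (f x)"
  have le: "norm (clamp_norm k z) \<le> norm z" for k and z :: 'b
    using norm_clamp_norm_le[of k z] clamp_norm_eq[of z k] by (cases "norm z \<le> real k") auto
  have "(\<lambda>k. norm_L2 (\<lambda>x. f x - ?w k x)) \<longlonglongrightarrow> 0"
  proof (rule norm_L2_tendsto_0[where G="\<lambda>x. 2 *\<^sub>R f x"])
    show "AE x in lborel. (\<lambda>k. f x - ?w k x) \<longlonglongrightarrow> 0"
    proof (intro AE_I2)
      fix x
      have "\<forall>\<^sub>F k in sequentially. f x - ?w k x = 0"
        using eventually_ge_at_top[of "nat \<lceil>max (norm x) (norm (f x))\<rceil>"]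
      proof eventually_elim
        case (elim k)
        then have "norm x \<le> real k" "norm (f x) \<le> real k" by linarith+
        then show ?case by (simp add: cutoff_simps clamp_norm_eq)
      qed
      then show "(\<lambda>k. f x - ?w k x) \<longlonglongrightarrow> 0" by (rule tendsto_eventually)
    qed
    show "norm (f x - ?w k x) \<le> norm (2 *\<^sub>R f x)" for k x
    proof -
      have "norm (?w k x) \<le> 1 * norm (f x)"
        unfolding norm_scaleR by (intro mult_mono) (auto simp: cutoff_simps le)
      then show ?thesis using norm_triangle_ineq4[of "f x" "?w k x"] by simp
    qed
  qed (use f in \<open>auto intro: L2_scaleR\<close>)
  then obtain k where k: "norm_L2 (\<lambda>x. f x - ?w k x) < e / 2"
    using e order_tendstoD(2)[of _ 0 sequentially "e / 2"] eventually_happens'[OF sequentially_bot] by (metis (lifting) half_gt_zero)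
  obtain h where h: "\<And>n :: nat. continuous_on UNIV (h n)" "AE x in lborel. (\<lambda>n. h n x) \<longlonglongrightarrow> f x"
    using AE_limit_of_continuous[OF L2D(1)[OF f]] by blast
  have [measurable]: "h n \<in> borel_measurable borel" for n using h by (intro borel_measurable_continuous_onI)
  let ?g = "\<lambda>n x. cutoff k x *\<^sub>R clamp_norm k (h n x)"
  have gcont: "continuous_on UNIV (?g n)" for n
    by (intro continuous_intros continuous_on_cutoff continuous_on_compose2[OF continuous_on_clamp_norm h(1)]) auto
  have gsupp: "supp_in (real k + 1) (?g n)" for n
    by (auto simp: supp_in_def cutoff_simps)
  have wL2: "?w k \<in> L2"
    by (rule norm_L2_mono(1)[OF f]) (auto intro!: order_trans[OF mult_mono[OF cutoff_simps(2) le]] simp: cutoff_simps)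
  have "(\<lambda>n. norm_L2 (\<lambda>x. ?w k x - ?g n x)) \<longlonglongrightarrow> 0"
  proof (rule norm_L2_tendsto_0[where G="\<lambda>x. (2 * real k) *\<^sub>R cutoff k x"])
    show "AE x in lborel. (\<lambda>n. ?w k x - ?g n x) \<longlonglongrightarrow> 0"
      using h(2)
    proof eventually_elim
      case (elim x)
      then have "(\<lambda>n. clamp_norm k (h n x)) \<longlonglongrightarrow> clamp_norm k (f x)"
        by (intro continuous_on_tendsto_compose[OF continuous_on_clamp_norm[of UNIV]]) auto
      then have "(\<lambda>n. ?w k x - ?g n x) \<longlonglongrightarrow> ?w k x - ?w k x"
        by (intro tendsto_intros)
      then show ?case by simp
    qed
    show "(\<lambda>x. (2 * real k) *\<^sub>R cutoff k x) \<in> L2"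
      by (intro L2_scaleR L2_supp_in[of _ "real k + 1"] continuous_on_cutoff) (auto simp: supp_in_def cutoff_simps)
    show "norm (?w k x - ?g n x) \<le> norm ((2 * real k) *\<^sub>R cutoff k x)" for n x
    proof -
      have "norm (clamp_norm k (f x) - clamp_norm k (h n x)) \<le> 2 * real k"
        using norm_triangle_ineq4[of "clamp_norm k (f x)" "clamp_norm k (h n x)"] norm_clamp_norm_le[of k "f x"]
          norm_clamp_norm_le[of k "h n x"] by linarith
      then show ?thesis
        using mult_left_mono[of _ _ "\<bar>cutoff k x\<bar>"]
        by (simp flip: scaleR_right_diff_distrib add: abs_mult mult.commute[of _ "\<bar>cutoff k x\<bar>"])
    qed
  qed auto
  then obtain n where n: "norm_L2 (\<lambda>x. ?w k x - ?g n x) < e / 2"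
    using e order_tendstoD(2)[of _ 0 sequentially "e / 2"] eventually_happens'[OF sequentially_bot] by (metis (lifting) half_gt_zero)
  have "norm_L2 (\<lambda>x. f x - ?g n x) \<le> norm_L2 (\<lambda>x. f x - ?w k x) + norm_L2 (\<lambda>x. ?w k x - ?g n x)"
    using norm_L2_add[OF L2_diff[OF f wL2] L2_diff[OF wL2 L2_supp_in[OF gcont gsupp, of n]]] by simp
  with k n have "norm_L2 (\<lambda>x. f x - ?g n x) < e" by linarith
  with gcont gsupp that show ?thesis by blast
qed

lemma norm_L2_translate:
  fixes f :: "real ^ 'd::finite \<Rightarrow> 'b::euclidean_space"
  shows "norm_L2 (\<lambda>x. f (x - z)) = norm_L2 f"
  unfolding norm_L2_def using lborel_integral_translation[of "\<lambda>x. (norm (f x))\<^sup>2" "- z"] by simp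

lemma L2_translate:
  fixes f :: "real ^ 'd::finite \<Rightarrow> 'b::euclidean_space"
  assumes "f \<in> L2"
  shows "(\<lambda>x. f (x - z)) \<in> L2"
proof (rule L2I)
  have m[measurable]: "f \<in> borel_measurable borel" using assms by (rule L2D)
  then show "(\<lambda>x. f (x - z)) \<in> borel_measurable borel" by simp
  have "integrable (distr lborel borel ((+) (-z))) (\<lambda>x. (norm (f x))\<^sup>2)"
    using L2D(2)[OF assms] by (simp add: lborel_distr_plus)
  then show "integrable lborel (\<lambda>x. (norm (f (x - z)))\<^sup>2)"
    by (subst (asm) integrable_distr_eq) auto
qed

text \<open>Approximate f by a continuous g of bounded support, for which uniform continuity gives
  the claim. The two approximation errors are equal because translation preserves the L2
  norm.\<close>

lemma L2_translation_continuous: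
  fixes f :: "real ^ 'd::finite \<Rightarrow> 'b::euclidean_space"
  assumes f: "f \<in> L2" and e: "0 < e"
  obtains d where "0 < d" "\<And>z. norm z < d \<Longrightarrow> norm_L2 (\<lambda>x. f (x - z) - f x) \<le> e"
proof -
  obtain g r where g: "continuous_on UNIV g" "supp_in r g" "norm_L2 (\<lambda>x. f x - g x) < e / 3"
    using L2_approx_continuous[OF f, of "e / 3"] e by auto
  have gL: "g \<in> L2" using L2_supp_in[OF g(1,2)] .
  \<comment> \<open>For shifts shorter than 1, g and its translate both vanish outside this ball.
    The modulus of continuity is taken as \<open>e / (3 * (c + 1))\<close>, so that multiplying by
    c, possibly 0, leaves at most e / 3.\<close>
  let ?K = "cball (0 :: real ^ 'd) (r + 2)"
  define c where "c = norm_L2 (indicat_real ?K)"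
  have indL: "indicat_real ?K \<in> L2"
    using emeasure_bounded_finite[OF bounded_cball, of 0 "r + 2"]
    by (intro L2I) (auto simp: power2_eq_square simp flip: indicator_inter_arith intro!: borel_measurable_indicator)
  have c: "0 \<le> c" by (simp add: c_def norm_L2_nonneg)
  have "uniformly_continuous_on (cball 0 (r + 3)) g"
    by (intro compact_uniformly_continuous continuous_on_subset[OF g(1)]) auto
  then obtain d where d: "0 < d" "\<And>x y. x \<in> cball 0 (r + 3) \<Longrightarrow> y \<in> cball 0 (r + 3) \<Longrightarrow> dist x y < d \<Longrightarrow> dist (g x) (g y) < e / (3 * (c + 1))"
    unfolding uniformly_continuous_on_def using e c by (metis divide_pos_pos add_nonneg_pos mult_pos_pos zero_less_numeral zero_less_one)
  have "norm_L2 (\<lambda>x. f (x - z) - f x) \<le> e" if z: "norm z < min d 1" for z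
  proof -
    have zz: "norm z < d" "norm z < 1" using z by auto
    have "norm_L2 (\<lambda>x. g (x - z) - g x) \<le> norm_L2 (\<lambda>x. (e / (3 * (c + 1))) *\<^sub>R indicat_real ?K x)"
    proof (rule norm_L2_mono(2))
      show "norm (g (x - z) - g x) \<le> norm ((e / (3 * (c + 1))) *\<^sub>R indicat_real ?K x)" for x
      proof (cases "norm x \<le> r + 2")
        case True
        have "norm (x - z) \<le> r + 3" using True zz norm_triangle_ineq4[of x z] by linarith
        then have "dist (g (x - z)) (g x) < e / (3 * (c + 1))"
          using True zz norm_minus_commute[of x z] by (intro d) (auto simp: dist_norm)
        then show ?thesis using True e c by (simp add: dist_norm)
      next
        case False
        then have "r < norm x" "r < norm (x - z)" using zz norm_diff_ineq[of x "-z"] by auto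
        then show ?thesis using g(2) by (simp add: supp_in_def)
      qed
      show "(\<lambda>x. g (x - z) - g x) \<in> borel_measurable borel"
        using L2D(1)[OF L2_diff[OF L2_translate[OF gL] gL]] .
    qed (intro L2_scaleR indL)
    also have "\<dots> = e / (3 * (c + 1)) * c" using e c by (simp only: norm_L2_scaleR c_def[symmetric]) simp
    also have "\<dots> \<le> e / 3" using e c by (simp add: field_simps)
    finally have 1: "norm_L2 (\<lambda>x. g (x - z) - g x) \<le> e / 3" .
    have 2: "norm_L2 (\<lambda>x. f (x - z) - g (x - z)) \<le> e / 3"
      using norm_L2_translate[of "\<lambda>x. f x - g x" z] g(3) by simp
    have 3: "norm_L2 (\<lambda>x. g x - f x) \<le> e / 3" using g(3) norm_L2_minus[of f g] by simp
    note L = L2_translate[OF f, of z] L2_translate[OF gL, of z]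
    have "norm_L2 (\<lambda>x. f (x - z) - f x) \<le> norm_L2 (\<lambda>x. f (x - z) - g (x - z)) + norm_L2 (\<lambda>x. g (x - z) - f x)"
      using norm_L2_add[OF L2_diff[OF L] L2_diff[OF L(2) f]] by simp
    moreover have "norm_L2 (\<lambda>x. g (x - z) - f x) \<le> norm_L2 (\<lambda>x. g (x - z) - g x) + norm_L2 (\<lambda>x. g x - f x)"
      using norm_L2_add[OF L2_diff[OF L(2) gL] L2_diff[OF gL f]] by simp
    ultimately show ?thesis using 1 2 3 by linarith
  qed
  then show ?thesis using that[of "min d 1"] d(1) by auto
qed

section \<open>Mollification\<close>

text \<open>Arranged as the pairing of u with the test function \<open>\<eta> (x - y)\<close> of y,
  so that weak gradients and the weak equation apply to its values directly.\<close>

definition conv :: "(real ^ 'd::finite \<Rightarrow> real) \<Rightarrow> (real ^ 'd \<Rightarrow> complex) \<Rightarrow> real ^ 'd \<Rightarrow> complex" where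
  "conv \<eta> u x = (LINT y|lborel. u y * complex_of_real (\<eta> (x - y)))"

lemma Cc_smooth_measurable: "Cc_smooth f \<Longrightarrow> f \<in> borel_measurable borel"
  by (auto simp: Cc_smooth_def intro: borel_measurable_continuous_onI smooth_continuous)

lemma smooth_affine: "smooth f \<Longrightarrow> smooth (\<lambda>x. f (c *\<^sub>R x + a))"
  by (simp add: smooth_def C_k_affine)

lemma smooth_mult:
  fixes f g :: "real ^ 'd::finite \<Rightarrow> 'b::real_normed_algebra"
  shows "smooth f \<Longrightarrow> smooth g \<Longrightarrow> smooth (\<lambda>x. f x * g x)"
  by (simp add: smooth_def C_k_mult)

lemma smooth_bounded_linear: "bounded_linear L \<Longrightarrow> smooth f \<Longrightarrow> smooth (\<lambda>x. L (f x))"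
  by (simp add: smooth_def C_k_bounded_linear)

lemma supp_in_reflect:
  fixes f :: "real ^ 'd::finite \<Rightarrow> 'b::zero"
  assumes "supp_in r f" shows "supp_in (r + norm x) (\<lambda>y. f (x - y))"
  unfolding supp_in_def
proof (intro allI impI)
  fix y :: "real ^ 'd" assume "r + norm x < norm y"
  then have "r < norm (x - y)" using norm_triangle_ineq2[of y x] by (simp add: norm_minus_commute)
  then show "f (x - y) = 0" using assms by (simp add: supp_in_def)
qed

lemma Cc_smooth_reflect:
  assumes "Cc_smooth \<eta>" shows "Cc_smooth (\<lambda>y. \<eta> (x - y))"
proof -
  have "smooth (\<lambda>y. \<eta> ((-1) *\<^sub>R y + x))" using assms by (intro smooth_affine) (simp add: Cc_smooth_def)
  then show ?thesis using assms supp_in_reflect by (auto simp: Cc_smooth_def)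
qed

lemma Cc_smooth_of_real: "Cc_smooth \<eta> \<Longrightarrow> Cc_smooth (\<lambda>x. complex_of_real (\<eta> x))"
  by (auto simp: Cc_smooth_def supp_in_def intro: smooth_bounded_linear[OF bounded_linear_of_real])

lemma Cc_smooth_integrable_mult:
  fixes u \<eta> :: "real ^ 'd::finite \<Rightarrow> complex"
  assumes "locally_integrable u" "Cc_smooth \<eta>"
  shows "integrable lborel (\<lambda>x. u x * \<eta> x)"
proof -
  obtain B where "0 \<le> B" "\<And>x. norm (\<eta> x) \<le> B" using Cc_smooth_bounded[OF assms(2)] by blast
  moreover obtain r where "supp_in r \<eta>" using assms(2) by (auto simp: Cc_smooth_def)
  ultimately show ?thesis using locally_integrable_mult[OF assms(1) Cc_smooth_measurable[OF assms(2)]] by blast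
qed

lemma conv_integrable:
  assumes "locally_integrable u" "Cc_smooth \<eta>"
  shows "integrable lborel (\<lambda>y. u y * complex_of_real (\<eta> (x - y)))"
  using Cc_smooth_integrable_mult[OF assms(1) Cc_smooth_of_real[OF Cc_smooth_reflect[OF assms(2)]]] .

lemma conv_has_derivative:
  fixes u :: "real ^ 'd::finite \<Rightarrow> complex"
  assumes u: "locally_integrable u" and \<eta>: "Cc_smooth \<eta>"
  shows "(conv \<eta> u has_derivative (\<lambda>h. \<Sum>i\<in>UNIV. (h $ i) *\<^sub>R conv (partial i \<eta>) u x)) (at x)"
proof -
  obtain r where r: "supp_in r \<eta>" using \<eta> by (auto simp: Cc_smooth_def)
  have "\<exists>B\<ge>0. \<forall>x. norm (partial i \<eta> x) \<le> B" for i
    using Cc_smooth_bounded[OF Cc_smooth_partial[OF \<eta>]] by metis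
  then obtain B where B: "\<And>i. 0 \<le> B i" "\<And>i x. \<bar>partial i \<eta> x\<bar> \<le> B i" by (metis real_norm_def)
  define C where "C = (\<Sum>i\<in>UNIV. B i)"
  have C: "0 \<le> C" by (auto simp: C_def B intro: sum_nonneg)
  \<comment> \<open>For s in the unit ball about x, the kernel \<open>\<eta> (s - y)\<close> and its
    derivatives vanish once \<open>norm y\<close> exceeds R.\<close>
  define R where "R = r + norm x + 1"
  let ?f' = "\<lambda>s y h. \<Sum>i\<in>UNIV. (h $ i) *\<^sub>R (u y * complex_of_real (partial i \<eta> (s - y)))"
  have dd: "((\<lambda>s. \<eta> (s - y)) has_derivative (\<lambda>h. \<Sum>i\<in>UNIV. (h $ i) *\<^sub>R partial i \<eta> (s - y))) (at s)" for s y
  proof -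
    have "\<eta> differentiable (at (s - y))" using \<eta> by (auto simp: Cc_smooth_def intro: smooth_differentiable)
    from has_derivative_partial[OF this]
    have "(\<eta> has_derivative (\<lambda>h. \<Sum>i\<in>UNIV. (h $ i) *\<^sub>R partial i \<eta> (s - y))) (at (s - y))" .
    moreover have "((\<lambda>s. s - y) has_derivative (\<lambda>h. h)) (at s)" by (auto intro!: derivative_eq_intros)
    ultimately show ?thesis using has_derivative_compose by blast
  qed
  have "((\<lambda>s. LINT y|lborel. u y * complex_of_real (\<eta> (s - y))) has_derivative (\<lambda>h. LINT y|lborel. ?f' x y h)) (at x within ball x 1)"
  proof (rule has_derivative_lebesgue_integral[where G="\<lambda>y. C * norm (indicat_real (cball 0 R) y *\<^sub>R u y)"])
    fix s y assume s: "s \<in> ball x 1"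
    show "integrable lborel (\<lambda>y. u y * complex_of_real (\<eta> (s - y)))" by (rule conv_integrable[OF u \<eta>])
    have "((\<lambda>s. u y * complex_of_real (\<eta> (s - y))) has_derivative (\<lambda>h. u y * complex_of_real (\<Sum>i\<in>UNIV. (h $ i) *\<^sub>R partial i \<eta> (s - y)))) (at s)"
      by (intro has_derivative_mult_right bounded_linear.has_derivative[OF bounded_linear_of_real] dd)
    moreover have "(\<lambda>h. u y * complex_of_real (\<Sum>i\<in>UNIV. (h $ i) *\<^sub>R partial i \<eta> (s - y))) = ?f' s y"
      by (simp add: fun_eq_iff sum_distrib_left scaleR_conv_of_real mult_ac)
    ultimately show "((\<lambda>s. u y * complex_of_real (\<eta> (s - y))) has_derivative ?f' s y) (at s within ball x 1)"
      using has_derivative_at_withinI by simp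
    fix h
    show "norm (?f' s y h) \<le> C * norm (indicat_real (cball 0 R) y *\<^sub>R u y) * norm h"
    proof (cases "norm y \<le> R")
      case True
      have "norm (?f' s y h) \<le> (\<Sum>i\<in>UNIV. norm h * (norm (u y) * B i))"
      proof (rule sum_norm_le)
        show "norm ((h $ i) *\<^sub>R (u y * complex_of_real (partial i \<eta> (s - y)))) \<le> norm h * (norm (u y) * B i)" for i
          using component_le_norm_cart[of h i] B(2)[of i "s - y"] by (auto simp: norm_mult intro!: mult_mono B)
      qed
      also have "\<dots> = C * norm (u y) * norm h" by (simp add: C_def sum_distrib_right sum_distrib_left mult_ac)
      finally show ?thesis using True by simp
    next
      case False
      have "norm s < norm x + 1" using s norm_triangle_ineq2[of s x] by (auto simp: dist_norm norm_minus_commute)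
      then have "r < norm (s - y)" using False norm_triangle_ineq2[of y s] by (auto simp: R_def norm_minus_commute)
      then have "partial i \<eta> (s - y) = 0" for i using r partial_0_outside by blast
      then show ?thesis using C by simp
    qed
  next
    show "integrable lborel (\<lambda>y. C * norm (indicat_real (cball 0 R) y *\<^sub>R u y))"
      using u by (intro integrable_mult_right integrable_norm) (auto simp: locally_integrable_def)
    have [measurable]: "u \<in> borel_measurable borel" using u by (auto simp: locally_integrable_def)
    have [measurable]: "partial i \<eta> \<in> borel_measurable borel" for i
      using Cc_smooth_measurable[OF Cc_smooth_partial[OF \<eta>]] .
    show "(\<lambda>y. ?f' x y h) \<in> borel_measurable lborel" for h by simp
  qed auto
  then have "(conv \<eta> u has_derivative (\<lambda>h. LINT y|lborel. ?f' x y h)) (at x)"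
    unfolding conv_def[abs_def] by (simp add: at_within_open[of x "ball x 1"])
  moreover have "(LINT y|lborel. ?f' x y h) = (\<Sum>i\<in>UNIV. (h $ i) *\<^sub>R conv (partial i \<eta>) u x)" for h
    unfolding conv_def
    by (subst Bochner_Integration.integral_sum) (auto intro!: conv_integrable u Cc_smooth_partial \<eta>)
  ultimately show ?thesis by simp
qed

lemma conv_differentiable:
  "locally_integrable u \<Longrightarrow> Cc_smooth \<eta> \<Longrightarrow> conv \<eta> u differentiable (at x)"
  using conv_has_derivative differentiable_def by blast

lemma partial_conv:
  assumes "locally_integrable u" "Cc_smooth \<eta>"
  shows "partial i (conv \<eta> u) = conv (partial i \<eta>) u"
proof
  fix x
  have "(\<Sum>j\<in>UNIV. (axis i 1 $ j) *\<^sub>R conv (partial j \<eta>) u x) = conv (partial i \<eta>) u x"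
    by (simp add: axis_def if_distrib[of "\<lambda>c. c *\<^sub>R _"] cong: if_cong)
  then show "partial i (conv \<eta> u) x = conv (partial i \<eta>) u x"
    using partial_eqI[OF conv_has_derivative[OF assms]] by simp
qed

lemma smooth_conv:
  assumes u: "locally_integrable u"
  shows "Cc_smooth \<eta> \<Longrightarrow> smooth (conv \<eta> u)"
proof -
  have "Cc_smooth \<eta> \<Longrightarrow> C_k k (conv \<eta> u)" for k
  proof (induction k arbitrary: \<eta>)
    case 0
    then show ?case
      by (auto intro!: continuous_at_imp_continuous_on differentiable_imp_continuous_within conv_differentiable u)
  next
    case (Suc k)
    then show ?case by (simp add: conv_differentiable[OF u] partial_conv[OF u] Cc_smooth_partial)
  qed
  then show "Cc_smooth \<eta> \<Longrightarrow> smooth (conv \<eta> u)" by (simp add: smooth_def)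
qed

lemma nn_integral_lborel_reflect:
  fixes f :: "'a::euclidean_space \<Rightarrow> ennreal"
  assumes [measurable]: "f \<in> borel_measurable borel"
  shows "(\<integral>\<^sup>+y. f (x - y) \<partial>lborel) = (\<integral>\<^sup>+y. f y \<partial>lborel)"
proof -
  have "(\<integral>\<^sup>+y. f y \<partial>lborel) = (\<integral>\<^sup>+y. f y \<partial>distr lborel borel (\<lambda>y. x + (-1) *\<^sub>R y))"
    using lborel_affine[of "-1" x] by (simp add: density_1)
  also have "\<dots> = (\<integral>\<^sup>+y. f (x - y) \<partial>lborel)"
    by (subst nn_integral_distr) auto
  finally show ?thesis by simp
qed

text \<open>Jensen's inequality for the probability density \<open>\<eta> (x - \<cdot>)\<close>, integrated in \<open>x\<close>.\<close>
lemma average_L2_bound: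
  fixes F :: "real ^ 'd::finite \<Rightarrow> real ^ 'd \<Rightarrow> complex"
  assumes F[measurable]: "case_prod F \<in> borel_measurable (borel \<Otimes>\<^sub>M borel)"
    and \<eta>: "\<eta> \<in> borel_measurable borel" "\<And>x. 0 \<le> \<eta> x" "(\<integral>\<^sup>+x. ennreal (\<eta> x) \<partial>lborel) = 1" "supp_in r \<eta>"
    and bound: "\<And>z. norm z \<le> r \<Longrightarrow> (\<integral>\<^sup>+x. ennreal ((norm (F x (x - z)))\<^sup>2) \<partial>lborel) \<le> C"
  shows "(\<integral>\<^sup>+x. ennreal ((norm (LINT y|lborel. F x y * complex_of_real (\<eta> (x - y))))\<^sup>2) \<partial>lborel) \<le> C"
proof -
  note [measurable] = \<eta>(1)
  have F1[measurable]: "F x \<in> borel_measurable borel" for x by measurable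
  have jensen: "ennreal ((norm (LINT y|lborel. F x y * complex_of_real (\<eta> (x - y))))\<^sup>2)
     \<le> (\<integral>\<^sup>+y. ennreal (\<eta> (x - y)) * ennreal ((norm (F x y))\<^sup>2) \<partial>lborel)" for x
  proof -
    let ?I = "LINT y|lborel. F x y * complex_of_real (\<eta> (x - y))"
    have "ennreal (norm ?I) \<le> (\<integral>\<^sup>+y. ennreal (norm (F x y * complex_of_real (\<eta> (x - y)))) \<partial>lborel)"
      by (cases "integrable lborel (\<lambda>y. F x y * complex_of_real (\<eta> (x - y)))")
        (auto simp: not_integrable_integral_eq intro: integral_norm_bound_ennreal)
    also have "\<dots> = (\<integral>\<^sup>+y. ennreal (sqrt (\<eta> (x - y))) * ennreal (sqrt (\<eta> (x - y)) * norm (F x y)) \<partial>lborel)"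
      using \<eta>(2) by (intro nn_integral_cong) (simp add: norm_mult mult_ac flip: ennreal_mult)
    finally have "(ennreal (norm ?I))\<^sup>2 \<le> (\<integral>\<^sup>+y. ennreal (sqrt (\<eta> (x - y))) * ennreal (sqrt (\<eta> (x - y)) * norm (F x y)) \<partial>lborel)\<^sup>2"
      by (rule power_mono) simp
    also have "\<dots> \<le> (\<integral>\<^sup>+y. (ennreal (sqrt (\<eta> (x - y))))\<^sup>2 \<partial>lborel) * (\<integral>\<^sup>+y. (ennreal (sqrt (\<eta> (x - y)) * norm (F x y)))\<^sup>2 \<partial>lborel)"
      by (rule Cauchy_Schwarz_nn_integral) measurable
    also have "(\<integral>\<^sup>+y. (ennreal (sqrt (\<eta> (x - y))))\<^sup>2 \<partial>lborel) = (\<integral>\<^sup>+y. ennreal (\<eta> (x - y)) \<partial>lborel)"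
      using \<eta>(2) by (intro nn_integral_cong) (simp add: ennreal_power)
    also have "\<dots> = 1" using nn_integral_lborel_reflect[of "\<lambda>y. ennreal (\<eta> y)" x] \<eta>(3) by simp
    also have "(\<integral>\<^sup>+y. (ennreal (sqrt (\<eta> (x - y)) * norm (F x y)))\<^sup>2 \<partial>lborel) = (\<integral>\<^sup>+y. ennreal (\<eta> (x - y)) * ennreal ((norm (F x y))\<^sup>2) \<partial>lborel)"
      using \<eta>(2) by (intro nn_integral_cong) (simp add: ennreal_power power_mult_distrib ennreal_mult)
    finally show ?thesis by (simp add: ennreal_power)
  qed
  have "(\<integral>\<^sup>+x. ennreal ((norm (LINT y|lborel. F x y * complex_of_real (\<eta> (x - y))))\<^sup>2) \<partial>lborel)
     \<le> (\<integral>\<^sup>+x. \<integral>\<^sup>+y. ennreal (\<eta> (x - y)) * ennreal ((norm (F x y))\<^sup>2) \<partial>lborel \<partial>lborel)"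
    by (intro nn_integral_mono jensen)
  also have "\<dots> = (\<integral>\<^sup>+x. \<integral>\<^sup>+z. ennreal (\<eta> z) * ennreal ((norm (F x (x - z)))\<^sup>2) \<partial>lborel \<partial>lborel)"
  proof (rule nn_integral_cong)
    show "(\<integral>\<^sup>+y. ennreal (\<eta> (x - y)) * ennreal ((norm (F x y))\<^sup>2) \<partial>lborel) =
       (\<integral>\<^sup>+z. ennreal (\<eta> z) * ennreal ((norm (F x (x - z)))\<^sup>2) \<partial>lborel)" for x
      using nn_integral_lborel_reflect[of "\<lambda>z. ennreal (\<eta> z) * ennreal ((norm (F x (x - z)))\<^sup>2)" x] by simp
  qed
  also have "\<dots> = (\<integral>\<^sup>+z. \<integral>\<^sup>+x. ennreal (\<eta> z) * ennreal ((norm (F x (x - z)))\<^sup>2) \<partial>lborel \<partial>lborel)"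
    by (rule lborel_pair.Fubini') measurable
  also have "\<dots> = (\<integral>\<^sup>+z. ennreal (\<eta> z) * (\<integral>\<^sup>+x. ennreal ((norm (F x (x - z)))\<^sup>2) \<partial>lborel) \<partial>lborel)"
    by (intro nn_integral_cong nn_integral_cmult) measurable
  also have "\<dots> \<le> (\<integral>\<^sup>+z. ennreal (\<eta> z) * C \<partial>lborel)"
  proof (rule nn_integral_mono)
    show "ennreal (\<eta> z) * (\<integral>\<^sup>+x. ennreal ((norm (F x (x - z)))\<^sup>2) \<partial>lborel) \<le> ennreal (\<eta> z) * C" for z
      using bound[of z] \<eta>(4) by (cases "norm z \<le> r") (auto simp: supp_in_def intro: mult_left_mono)
  qed
  also have "\<dots> = C" using \<eta>(3) by (subst nn_integral_multc) auto
  finally show ?thesis .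
qed


section \<open>Mollifiers and approximation in L2\<close>

text \<open>Division by its own integral makes the total mass 1 by construction. With
  \<open>Suc n\<close> the support radius never exceeds 1, and this is the 1 by which balls are
  enlarged later.\<close>

definition mollifier :: "nat \<Rightarrow> real ^ 'd::finite \<Rightarrow> real" where
  "mollifier n x = bump (real (Suc n) *\<^sub>R x) / (LINT y|lborel. bump (real (Suc n) *\<^sub>R (y :: real ^ 'd)))"

lemma smooth_bump_scaled: "smooth (\<lambda>x. bump (c *\<^sub>R x))"
  using smooth_affine[OF smooth_bump, of c 0] by simp

lemma supp_in_bump_scaled: "0 < c \<Longrightarrow> supp_in (1 / c) (\<lambda>x. bump (c *\<^sub>R x))"
  by (auto simp: supp_in_def field_simps intro!: bump_eq_0)

text \<open>If the integral vanished, the closed zero set would have full measure and hence contain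
  the origin, where the bump equals exp (-1).\<close>

lemma integral_bump_scaled_pos:
  assumes "0 < c"
  shows "0 < (LINT y|lborel. bump (c *\<^sub>R (y :: real ^ 'd::finite)))"
proof -
  let ?f = "\<lambda>y :: real ^ 'd. bump (c *\<^sub>R y)"
  have cont: "continuous_on UNIV ?f" by (rule smooth_continuous[OF smooth_bump_scaled])
  have int: "integrable lborel ?f" by (rule integrable_supp_in[OF cont supp_in_bump_scaled[OF assms]])
  have "(LINT y|lborel. ?f y) \<noteq> 0"
  proof
    assume "(LINT y|lborel. ?f y) = 0"
    then have "AE y in lborel. ?f y = 0"
      using integral_nonneg_eq_0_iff_AE[OF int] by (simp add: bump_nonneg)
    then have "AE y in lebesgue. y \<in> {y. ?f y = 0}" by (simp add: AE_completion)
    moreover have "closed {y. ?f y = 0}" using cont by (intro closed_Collect_eq) auto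
    ultimately have "(0 :: real ^ 'd) \<in> {y. ?f y = 0}" by (rule mem_closed_if_AE_lebesgue[rotated])
    then show False by (simp add: bump_0)
  qed
  moreover have "0 \<le> (LINT y|lborel. ?f y)" by (intro integral_nonneg_AE) (auto simp: bump_nonneg)
  ultimately show ?thesis by linarith
qed

lemma mollifier_nonneg: "0 \<le> mollifier n x"
  using integral_bump_scaled_pos[of "real (Suc n)", where 'd='a] by (simp add: mollifier_def bump_nonneg)

lemma supp_in_mollifier: "supp_in (1 / real (Suc n)) (mollifier n)"
  using supp_in_bump_scaled[of "real (Suc n)"] by (auto simp: supp_in_def mollifier_def)

lemma Cc_smooth_mollifier: "Cc_smooth (mollifier n)"
proof -
  have "smooth (\<lambda>x. bump (real (Suc n) *\<^sub>R x) * inverse (LINT y|lborel. bump (real (Suc n) *\<^sub>R (y :: real ^ 'a))))"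
    by (intro smooth_bounded_linear[OF bounded_linear_mult_left] smooth_bump_scaled)
  then show ?thesis
    using supp_in_mollifier by (auto simp: Cc_smooth_def mollifier_def[abs_def] divide_inverse)
qed

lemma continuous_mollifier: "continuous_on UNIV (mollifier n)"
  using Cc_smooth_mollifier by (auto simp: Cc_smooth_def intro: smooth_continuous)

lemma mollifier_measurable [measurable]: "mollifier n \<in> borel_measurable borel"
  by (intro borel_measurable_continuous_onI continuous_mollifier)

lemma nn_integral_mollifier: "(\<integral>\<^sup>+x. ennreal (mollifier n (x :: real ^ 'd::finite)) \<partial>lborel) = 1"
proof -
  have "(\<integral>\<^sup>+x. ennreal (mollifier n (x :: real ^ 'd)) \<partial>lborel) = ennreal (LINT x|lborel. mollifier n (x :: real ^ 'd))"
    by (intro nn_integral_eq_integral integrable_supp_in[OF continuous_mollifier supp_in_mollifier])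
      (auto simp: mollifier_nonneg)
  also have "(LINT x|lborel. mollifier n (x :: real ^ 'd)) = 1"
    unfolding mollifier_def using integral_bump_scaled_pos[of "real (Suc n)", where 'd='d] by simp
  finally show ?thesis by simp
qed

lemma L2_locally_integrable:
  fixes u :: "real ^ 'd::finite \<Rightarrow> complex"
  assumes "u \<in> L2"
  shows "locally_integrable u"
  unfolding locally_integrable_def
proof (intro conjI allI)
  show "u \<in> borel_measurable borel" using assms by (rule L2D)
  fix r
  have [measurable]: "indicat_real (cball (0 :: real ^ 'd) r) \<in> borel_measurable borel"
    by (intro borel_measurable_indicator) auto
  have "(\<lambda>x :: real ^ 'd. complex_of_real (indicat_real (cball 0 r) x)) \<in> L2"
    using emeasure_bounded_finite[OF bounded_cball, of "0 :: real ^ 'd" r]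
    by (intro L2I) (auto simp: power2_eq_square simp flip: indicator_inter_arith)
  from L2_mult_integrable[OF this assms]
  show "integrable lborel (\<lambda>x. indicat_real (cball 0 r) x *\<^sub>R u x)"
    by (simp add: scaleR_conv_of_real)
qed

lemma L2_from_nn_integral:
  assumes "f \<in> borel_measurable borel" "(\<integral>\<^sup>+x. ennreal ((norm (f x))\<^sup>2) \<partial>lborel) \<le> ennreal (c\<^sup>2)" "0 \<le> c"
  shows "f \<in> L2" "norm_L2 f \<le> c"
proof -
  have "integrable lborel (\<lambda>x. (norm (f x))\<^sup>2)"
    using assms by (intro integrableI_bounded) (auto intro: le_less_trans[OF _ ennreal_less_top])
  with assms(1) show f: "f \<in> L2" by (rule L2I)
  have "ennreal ((norm_L2 f)\<^sup>2) \<le> ennreal (c\<^sup>2)" using nn_integral_L2[OF f] assms(2) by simp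
  then have "(norm_L2 f)\<^sup>2 \<le> c\<^sup>2" by simp
  then show "norm_L2 f \<le> c" using assms(3) by (rule power2_le_imp_le)
qed

lemma conv_mollifier_L2:
  fixes u :: "real ^ 'd::finite \<Rightarrow> complex"
  assumes u: "u \<in> L2"
  shows "conv (mollifier n) u \<in> L2" "norm_L2 (conv (mollifier n) u) \<le> norm_L2 u"
proof -
  have [measurable]: "u \<in> borel_measurable borel" using u by (rule L2D)
  have m: "conv (mollifier n) u \<in> borel_measurable borel"
    by (intro borel_measurable_continuous_onI smooth_continuous smooth_conv L2_locally_integrable u Cc_smooth_mollifier)
  have "(\<integral>\<^sup>+x. ennreal ((norm (LINT y|lborel. (\<lambda>x y. u y) x y * complex_of_real (mollifier n (x - y))))\<^sup>2) \<partial>lborel) \<le> ennreal ((norm_L2 u)\<^sup>2)"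
  proof (rule average_L2_bound[OF _ _ mollifier_nonneg nn_integral_mollifier supp_in_mollifier])
    show "(\<integral>\<^sup>+x. ennreal ((cmod (u (x - z)))\<^sup>2) \<partial>lborel) \<le> ennreal ((norm_L2 u)\<^sup>2)" for z
      using nn_integral_L2[OF L2_translate[OF u]] by (simp add: norm_L2_translate)
  qed (auto intro: borel_measurable_continuous_onI continuous_mollifier)
  then have "(\<integral>\<^sup>+x. ennreal ((norm (conv (mollifier n) u x))\<^sup>2) \<partial>lborel) \<le> ennreal ((norm_L2 u)\<^sup>2)"
    by (simp add: conv_def)
  from L2_from_nn_integral[OF m this norm_L2_nonneg]
  show "conv (mollifier n) u \<in> L2" "norm_L2 (conv (mollifier n) u) \<le> norm_L2 u" .
qed

text \<open>The error at x is the mollifier average of \<open>u y - u x\<close>. By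
  \<open>average_L2_bound\<close> its L2 norm is at most that of u minus a translate by some z with
  \<open>norm z \<le> 1 / Suc n\<close>, which is small by continuity of translations.\<close>

lemma conv_mollifier_L2_lim:
  fixes u :: "real ^ 'd::finite \<Rightarrow> complex"
  assumes u: "u \<in> L2"
  shows "L2_lim (\<lambda>n. conv (mollifier n) u) u"
  unfolding L2_lim_def
proof (intro conjI allI conv_mollifier_L2(1) u)
  have [measurable]: "u \<in> borel_measurable borel" using u by (rule L2D)
  note loc = L2_locally_integrable[OF u]
  show "(\<lambda>n. norm_L2 (\<lambda>x. conv (mollifier n) u x - u x)) \<longlonglongrightarrow> 0"
  proof (rule LIMSEQ_I)
    fix e :: real assume "0 < e"
    then obtain d where d: "0 < d" "\<And>z. norm z < d \<Longrightarrow> norm_L2 (\<lambda>x. u (x - z) - u x) \<le> e / 2"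
      using L2_translation_continuous[OF u, of "e / 2"] by auto
    obtain N where N: "1 / real (Suc N) < d" using nat_approx_posE[OF d(1)] by blast
    have "norm (norm_L2 (\<lambda>x. conv (mollifier n) u x - u x) - 0) < e" if n: "N \<le> n" for n
    proof -
      have eq: "conv (mollifier n) u x - u x = (LINT y|lborel. (u y - u x) * complex_of_real (mollifier n (x - y)))" for x
      proof -
        have 1: "integrable lborel (\<lambda>y. u y * complex_of_real (mollifier n (x - y)))"
          by (rule conv_integrable[OF loc Cc_smooth_mollifier])
        have 2: "integrable lborel (\<lambda>y. u x * complex_of_real (mollifier n (x - y)))"
          by (intro conv_integrable[OF _ Cc_smooth_mollifier] continuous_locally_integrable continuous_on_const)
        have 3: "(LINT y|lborel. mollifier n (x - y)) = 1"
        proof -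
          have "(LINT y|lborel. mollifier n (x - y)) = enn2real (\<integral>\<^sup>+y. ennreal (mollifier n (x - y)) \<partial>lborel)"
            by (rule integral_eq_nn_integral) (auto simp: mollifier_nonneg intro!: borel_measurable_continuous_onI continuous_on_compose2[OF continuous_mollifier] continuous_intros)
          also have "(\<integral>\<^sup>+y. ennreal (mollifier n (x - y)) \<partial>lborel) = 1"
            using nn_integral_lborel_reflect[of "\<lambda>y. ennreal (mollifier n y)" x] nn_integral_mollifier[of n, where 'd='d]
            by simp
          finally show ?thesis by simp
        qed
        show ?thesis
          unfolding left_diff_distrib conv_def using 3
          by (simp add: Bochner_Integration.integral_diff[OF 1 2])
      qed
      have "(\<integral>\<^sup>+x. ennreal ((norm (LINT y|lborel. (\<lambda>x y. u y - u x) x y * complex_of_real (mollifier n (x - y))))\<^sup>2) \<partial>lborel) \<le> ennreal ((e / 2)\<^sup>2)"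
      proof (rule average_L2_bound[OF _ _ mollifier_nonneg nn_integral_mollifier supp_in_mollifier])
        fix z :: "real ^ 'd" assume "norm z \<le> 1 / real (Suc n)"
        also have "\<dots> \<le> 1 / real (Suc N)" using n by (intro divide_left_mono) auto
        finally have "norm z < d" using N by linarith
        then have "(norm_L2 (\<lambda>x. u (x - z) - u x))\<^sup>2 \<le> (e / 2)\<^sup>2"
          by (intro power_mono d norm_L2_nonneg)
        then show "(\<integral>\<^sup>+x. ennreal ((cmod (u (x - z) - u x))\<^sup>2) \<partial>lborel) \<le> ennreal ((e / 2)\<^sup>2)"
          using nn_integral_L2[OF L2_diff[OF L2_translate[OF u] u], of z] by (simp add: ennreal_leI)
      qed (auto intro: borel_measurable_continuous_onI continuous_mollifier)
      then have "(\<integral>\<^sup>+x. ennreal ((norm (conv (mollifier n) u x - u x))\<^sup>2) \<partial>lborel) \<le> ennreal ((e / 2)\<^sup>2)"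
        by (simp add: eq)
      then have "norm_L2 (\<lambda>x. conv (mollifier n) u x - u x) \<le> e / 2"
        using \<open>0 < e\<close> L2D(1)[OF L2_diff[OF conv_mollifier_L2(1)[OF u] u]] by (intro L2_from_nn_integral(2)) auto
      then show ?thesis using \<open>0 < e\<close> norm_L2_nonneg[of "\<lambda>x. conv (mollifier n) u x - u x"] by simp
    qed
    then show "\<exists>no. \<forall>n\<ge>no. norm (norm_L2 (\<lambda>x. conv (mollifier n) u x - u x) - 0) < e" by blast
  qed
qed

section \<open>The Sobolev inequality\<close>

lemma abs_le_nn_integral_deriv:
  fixes f f' :: "real \<Rightarrow> real"
  assumes der: "\<And>s. (f has_vector_derivative f' s) (at s)" and cont: "continuous_on UNIV f'"
    and f0: "f a = 0" "a \<le> t"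
  shows "ennreal \<bar>f t\<bar> \<le> (\<integral>\<^sup>+s. ennreal \<bar>f' s\<bar> \<partial>lborel)"
proof -
  have [measurable]: "f' \<in> borel_measurable borel" by (intro borel_measurable_continuous_onI cont)
  have h: "has_bochner_integral lborel (\<lambda>s. indicator {a..t} s *\<^sub>R f' s) (f t - f a)"
    by (rule has_bochner_integral_FTC_Icc) (use assms in \<open>auto intro: continuous_on_subset has_vector_derivative_at_within\<close>)
  have "ennreal (norm (LINT s|lborel. indicator {a..t} s *\<^sub>R f' s)) \<le> (\<integral>\<^sup>+s. ennreal (norm (indicator {a..t} s *\<^sub>R f' s)) \<partial>lborel)"
    using h by (intro integral_norm_bound_ennreal) (auto simp: has_bochner_integral_iff)
  also have "\<dots> \<le> (\<integral>\<^sup>+s. ennreal \<bar>f' s\<bar> \<partial>lborel)"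
    by (intro nn_integral_mono) (auto simp: indicator_def)
  finally show ?thesis using h f0 by (simp add: has_bochner_integral_iff)
qed

section \<open>Loomis-Whitney inequalities and iterated integrals\<close>

text \<open>Cauchy-Schwarz twice: over (a, b), where \<open>G3\<close> splits off because it does
  not depend on c, and then in c for the other two factors, whose squared integrals depend on b and
  on a alone.\<close>

lemma Loomis_Whitney_3:
  fixes G1 G2 G3 :: "real \<Rightarrow> real \<Rightarrow> ennreal"
  assumes [measurable]: "case_prod G1 \<in> borel_measurable (borel \<Otimes>\<^sub>M borel)"
    "case_prod G2 \<in> borel_measurable (borel \<Otimes>\<^sub>M borel)" "case_prod G3 \<in> borel_measurable (borel \<Otimes>\<^sub>M borel)"
  shows "(\<integral>\<^sup>+a. \<integral>\<^sup>+b. \<integral>\<^sup>+c. G1 b c * G2 a c * G3 a b \<partial>lborel \<partial>lborel \<partial>lborel)\<^sup>2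
    \<le> (\<integral>\<^sup>+b. \<integral>\<^sup>+c. (G1 b c)\<^sup>2 \<partial>lborel \<partial>lborel) * (\<integral>\<^sup>+a. \<integral>\<^sup>+c. (G2 a c)\<^sup>2 \<partial>lborel \<partial>lborel)
       * (\<integral>\<^sup>+a. \<integral>\<^sup>+b. (G3 a b)\<^sup>2 \<partial>lborel \<partial>lborel)"
proof -
  let ?M = "lborel \<Otimes>\<^sub>M lborel :: (real \<times> real) measure"
  let ?H = "\<lambda>p. \<integral>\<^sup>+c. G1 (snd p) c * G2 (fst p) c \<partial>lborel"
  have "(\<integral>\<^sup>+a. \<integral>\<^sup>+b. \<integral>\<^sup>+c. G1 b c * G2 a c * G3 a b \<partial>lborel \<partial>lborel \<partial>lborel)
      = (\<integral>\<^sup>+a. \<integral>\<^sup>+b. ?H (a, b) * case_prod G3 (a, b) \<partial>lborel \<partial>lborel)"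
    by (simp add: nn_integral_multc)
  also have "\<dots> = (\<integral>\<^sup>+p. ?H p * case_prod G3 p \<partial>?M)"
    by (rule lborel.nn_integral_fst) measurable
  finally have "(\<integral>\<^sup>+a. \<integral>\<^sup>+b. \<integral>\<^sup>+c. G1 b c * G2 a c * G3 a b \<partial>lborel \<partial>lborel \<partial>lborel)\<^sup>2
      = (\<integral>\<^sup>+p. ?H p * case_prod G3 p \<partial>?M)\<^sup>2" by simp
  also have "\<dots> \<le> (\<integral>\<^sup>+p. (?H p)\<^sup>2 \<partial>?M) * (\<integral>\<^sup>+p. (case_prod G3 p)\<^sup>2 \<partial>?M)"
    by (rule Cauchy_Schwarz_nn_integral) measurable
  also have "(\<integral>\<^sup>+p. (case_prod G3 p)\<^sup>2 \<partial>?M) = (\<integral>\<^sup>+a. \<integral>\<^sup>+b. (G3 a b)\<^sup>2 \<partial>lborel \<partial>lborel)"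
    by (subst lborel.nn_integral_fst[symmetric]) auto
  also have "(\<integral>\<^sup>+p. (?H p)\<^sup>2 \<partial>?M) \<le> (\<integral>\<^sup>+p. (\<integral>\<^sup>+c. (G1 (snd p) c)\<^sup>2 \<partial>lborel) * (\<integral>\<^sup>+c. (G2 (fst p) c)\<^sup>2 \<partial>lborel) \<partial>?M)"
    by (intro nn_integral_mono Cauchy_Schwarz_nn_integral) measurable
  also have "\<dots> = (\<integral>\<^sup>+a. \<integral>\<^sup>+b. (\<integral>\<^sup>+c. (G1 b c)\<^sup>2 \<partial>lborel) * (\<integral>\<^sup>+c. (G2 a c)\<^sup>2 \<partial>lborel) \<partial>lborel \<partial>lborel)"
    by (subst lborel.nn_integral_fst[symmetric]) auto
  also have "\<dots> = (\<integral>\<^sup>+b. \<integral>\<^sup>+c. (G1 b c)\<^sup>2 \<partial>lborel \<partial>lborel) * (\<integral>\<^sup>+a. \<integral>\<^sup>+c. (G2 a c)\<^sup>2 \<partial>lborel \<partial>lborel)"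
    by (simp add: nn_integral_multc nn_integral_cmult)
  finally show ?thesis by (simp add: mult_right_mono)
qed

text \<open>In the plane \<open>G1\<close> and \<open>G2\<close> already separate the variables, so
  one Cauchy-Schwarz suffices. The third factor \<open>W\<close> stands in for the missing
  direction; in the application it is the squared modulus of the function.\<close>

lemma Loomis_Whitney_2:
  fixes G1 G2 :: "real \<Rightarrow> ennreal" and W :: "real \<Rightarrow> real \<Rightarrow> ennreal"
  assumes [measurable]: "G1 \<in> borel_measurable borel" "G2 \<in> borel_measurable borel"
    "case_prod W \<in> borel_measurable (borel \<Otimes>\<^sub>M borel)"
  shows "(\<integral>\<^sup>+a. \<integral>\<^sup>+b. G1 b * G2 a * W a b \<partial>lborel \<partial>lborel)\<^sup>2
    \<le> (\<integral>\<^sup>+b. (G1 b)\<^sup>2 \<partial>lborel) * (\<integral>\<^sup>+a. (G2 a)\<^sup>2 \<partial>lborel) * (\<integral>\<^sup>+a. \<integral>\<^sup>+b. (W a b)\<^sup>2 \<partial>lborel \<partial>lborel)"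
proof -
  let ?M = "lborel \<Otimes>\<^sub>M lborel :: (real \<times> real) measure"
  have "(\<integral>\<^sup>+a. \<integral>\<^sup>+b. G1 b * G2 a * W a b \<partial>lborel \<partial>lborel) = (\<integral>\<^sup>+p. (G1 (snd p) * G2 (fst p)) * case_prod W p \<partial>?M)"
    by (subst lborel.nn_integral_fst[symmetric]) auto
  then have "(\<integral>\<^sup>+a. \<integral>\<^sup>+b. G1 b * G2 a * W a b \<partial>lborel \<partial>lborel)\<^sup>2
      \<le> (\<integral>\<^sup>+p. (G1 (snd p) * G2 (fst p))\<^sup>2 \<partial>?M) * (\<integral>\<^sup>+p. (case_prod W p)\<^sup>2 \<partial>?M)"
    by (simp only:) (rule Cauchy_Schwarz_nn_integral, measurable)
  also have "(\<integral>\<^sup>+p. (case_prod W p)\<^sup>2 \<partial>?M) = (\<integral>\<^sup>+a. \<integral>\<^sup>+b. (W a b)\<^sup>2 \<partial>lborel \<partial>lborel)"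
    by (subst lborel.nn_integral_fst[symmetric]) auto
  also have "(\<integral>\<^sup>+p. (G1 (snd p) * G2 (fst p))\<^sup>2 \<partial>?M) = (\<integral>\<^sup>+b. (G1 b)\<^sup>2 \<partial>lborel) * (\<integral>\<^sup>+a. (G2 a)\<^sup>2 \<partial>lborel)"
    by (subst lborel.nn_integral_fst[symmetric]) (auto simp: power_mult_distrib nn_integral_multc nn_integral_cmult)
  finally show ?thesis .
qed

lemma prod_Basis_cart: "(\<Prod>b\<in>(Basis :: (real ^ 'd::finite) set). f b) = (\<Prod>i\<in>UNIV. f (axis i 1))"
proof -
  have B: "(Basis :: (real ^ 'd) set) = range (\<lambda>i. axis i 1)" by (auto simp: Basis_vec_def)
  have inj: "inj (\<lambda>i. axis i 1 :: real ^ 'd)" by (auto simp: inj_on_def axis_eq_axis)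
  show ?thesis unfolding B prod.reindex[OF inj] by (simp add: comp_def)
qed

text \<open>\<open>lborel\<close> is the image of the product measure under the coordinate map,
  because both assign to a box the product of its side lengths.\<close>

lemma nn_integral_cart_3:
  fixes F :: "real ^ 'd::finite \<Rightarrow> ennreal"
  assumes U: "UNIV = {i, j, k :: 'd}" and ne: "i \<noteq> j" "i \<noteq> k" "j \<noteq> k" and [measurable]: "F \<in> borel_measurable borel"
  shows "(\<integral>\<^sup>+x. F x \<partial>lborel) =
    (\<integral>\<^sup>+a. \<integral>\<^sup>+b. \<integral>\<^sup>+c. F (a *\<^sub>R axis i 1 + b *\<^sub>R axis j 1 + c *\<^sub>R axis k 1) \<partial>lborel \<partial>lborel \<partial>lborel)"
proof -
  let ?T = "\<lambda>(a, b, c). a *\<^sub>R axis i 1 + b *\<^sub>R axis j 1 + c *\<^sub>R axis k 1 :: real ^ 'd"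
  let ?M = "lborel \<Otimes>\<^sub>M (lborel \<Otimes>\<^sub>M lborel) :: (real \<times> real \<times> real) measure"
  have [measurable]: "?T \<in> borel \<Otimes>\<^sub>M (borel \<Otimes>\<^sub>M borel) \<rightarrow>\<^sub>M borel" by measurable
  have sf: "sigma_finite_measure (lborel \<Otimes>\<^sub>M lborel :: (real \<times> real) measure)"
    unfolding lborel_prod by (rule sigma_finite_lborel)
  have "lborel = distr ?M borel ?T"
  proof (rule lborel_eqI)
    fix l u :: "real ^ 'd" assume lu: "\<And>b. b \<in> Basis \<Longrightarrow> l \<bullet> b \<le> u \<bullet> b"
    have ax: "axis p (1 :: real) $ q = (if q = p then 1 else 0)" for p q :: 'd by (simp add: axis_def)
    have lu': "l $ m \<le> u $ m" for m using lu[of "axis m 1"] by (simp add: inner_axis axis_in_Basis_iff)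
    have "?T -` box l u = {l $ i <..< u $ i} \<times> {l $ j <..< u $ j} \<times> {l $ k <..< u $ k}"
    proof (rule set_eqI)
      fix p :: "real \<times> real \<times> real"
      obtain a b c where p: "p = (a, b, c)" by (metis prod.exhaust)
      have "?T p $ i = a" "?T p $ j = b" "?T p $ k = c" using ne by (auto simp: p ax)
      moreover have "?T p \<in> box l u \<longleftrightarrow> (\<forall>m\<in>{i, j, k}. l $ m < ?T p $ m \<and> ?T p $ m < u $ m)"
        unfolding mem_box_cart U[symmetric] by simp
      ultimately show "p \<in> ?T -` box l u \<longleftrightarrow> p \<in> {l $ i <..< u $ i} \<times> {l $ j <..< u $ j} \<times> {l $ k <..< u $ k}"
        using ne ne[symmetric] by (simp add: p ax)
    qed
    then have "emeasure (distr ?M borel ?T) (box l u) = emeasure ?M ({l $ i <..< u $ i} \<times> {l $ j <..< u $ j} \<times> {l $ k <..< u $ k})"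
      by (subst emeasure_distr) (auto simp: space_pair_measure)
    also have "\<dots> = ennreal ((u $ i - l $ i) * ((u $ j - l $ j) * (u $ k - l $ k)))"
      using lu' by (simp add: sigma_finite_measure.emeasure_pair_measure_Times[OF sf] lborel.emeasure_pair_measure_Times ennreal_mult)
    also have "\<dots> = ennreal (\<Prod>b\<in>Basis. (u - l) \<bullet> b)"
      unfolding prod_Basis_cart U using ne by (simp add: inner_axis)
    finally show "emeasure (distr ?M borel ?T) (box l u) = ennreal (\<Prod>b\<in>Basis. (u - l) \<bullet> b)" .
  qed simp
  then have "(\<integral>\<^sup>+x. F x \<partial>lborel) = (\<integral>\<^sup>+x. F x \<partial>distr ?M borel ?T)" by simp
  also have "\<dots> = (\<integral>\<^sup>+p. F (?T p) \<partial>?M)" by (subst nn_integral_distr) auto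
  also have "\<dots> = (\<integral>\<^sup>+a. \<integral>\<^sup>+q. F (?T (a, q)) \<partial>(lborel \<Otimes>\<^sub>M lborel) \<partial>lborel)"
    by (subst sigma_finite_measure.nn_integral_fst[OF sf, symmetric]) auto
  also have "\<dots> = (\<integral>\<^sup>+a. \<integral>\<^sup>+b. \<integral>\<^sup>+c. F (?T (a, b, c)) \<partial>lborel \<partial>lborel \<partial>lborel)"
    by (subst lborel.nn_integral_fst[symmetric]) auto
  finally show ?thesis by simp
qed

lemma nn_integral_cart_2:
  fixes F :: "real ^ 'd::finite \<Rightarrow> ennreal"
  assumes U: "UNIV = {i, j :: 'd}" and ne: "i \<noteq> j" and [measurable]: "F \<in> borel_measurable borel"
  shows "(\<integral>\<^sup>+x. F x \<partial>lborel) = (\<integral>\<^sup>+a. \<integral>\<^sup>+b. F (a *\<^sub>R axis i 1 + b *\<^sub>R axis j 1) \<partial>lborel \<partial>lborel)"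
proof -
  let ?T = "\<lambda>(a, b). a *\<^sub>R axis i 1 + b *\<^sub>R axis j 1 :: real ^ 'd"
  let ?M = "lborel \<Otimes>\<^sub>M lborel :: (real \<times> real) measure"
  have [measurable]: "?T \<in> borel \<Otimes>\<^sub>M borel \<rightarrow>\<^sub>M borel" by measurable
  have "lborel = distr ?M borel ?T"
  proof (rule lborel_eqI)
    fix l u :: "real ^ 'd" assume lu: "\<And>b. b \<in> Basis \<Longrightarrow> l \<bullet> b \<le> u \<bullet> b"
    have ax: "axis p (1 :: real) $ q = (if q = p then 1 else 0)" for p q :: 'd by (simp add: axis_def)
    have lu': "l $ m \<le> u $ m" for m using lu[of "axis m 1"] by (simp add: inner_axis axis_in_Basis_iff)
    have "?T -` box l u = {l $ i <..< u $ i} \<times> {l $ j <..< u $ j}"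
    proof (rule set_eqI)
      fix p :: "real \<times> real"
      obtain a b where p: "p = (a, b)" by (metis prod.exhaust)
      have "?T p $ i = a" "?T p $ j = b" using ne by (auto simp: p ax)
      moreover have "?T p \<in> box l u \<longleftrightarrow> (\<forall>m\<in>{i, j}. l $ m < ?T p $ m \<and> ?T p $ m < u $ m)"
        unfolding mem_box_cart U[symmetric] by simp
      ultimately show "p \<in> ?T -` box l u \<longleftrightarrow> p \<in> {l $ i <..< u $ i} \<times> {l $ j <..< u $ j}"
        using ne ne[symmetric] by (simp add: p ax)
    qed
    then have "emeasure (distr ?M borel ?T) (box l u) = emeasure ?M ({l $ i <..< u $ i} \<times> {l $ j <..< u $ j})"
      by (subst emeasure_distr) (auto simp: space_pair_measure)
    also have "\<dots> = ennreal ((u $ i - l $ i) * (u $ j - l $ j))"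
      using lu' by (simp add: lborel.emeasure_pair_measure_Times ennreal_mult)
    also have "\<dots> = ennreal (\<Prod>b\<in>Basis. (u - l) \<bullet> b)"
      unfolding prod_Basis_cart U using ne by (simp add: inner_axis)
    finally show "emeasure (distr ?M borel ?T) (box l u) = ennreal (\<Prod>b\<in>Basis. (u - l) \<bullet> b)" .
  qed simp
  then have "(\<integral>\<^sup>+x. F x \<partial>lborel) = (\<integral>\<^sup>+x. F x \<partial>distr ?M borel ?T)" by simp
  also have "\<dots> = (\<integral>\<^sup>+p. F (?T p) \<partial>?M)" by (subst nn_integral_distr) auto
  also have "\<dots> = (\<integral>\<^sup>+a. \<integral>\<^sup>+b. F (?T (a, b)) \<partial>lborel \<partial>lborel)"
    by (subst lborel.nn_integral_fst[symmetric]) auto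
  finally show ?thesis by simp
qed


section \<open>The L6 bound for compactly supported C1 functions\<close>

locale Cc1_function =
  fixes v :: "real ^ 'd::finite \<Rightarrow> complex" and v' :: "'d \<Rightarrow> real ^ 'd \<Rightarrow> complex" and r :: real
  assumes v_cont: "continuous_on UNIV v" and v_supp: "supp_in r v"
    and v_partial: "\<And>i. has_partial i v (v' i)" and v'_cont: "\<And>i. continuous_on UNIV (v' i)"
begin

text \<open>A majorant of the derivative of the fourth power of |v| in direction i. The exponent 4
  is chosen so that its square root |v|^2, multiplied over three directions, is |v|^6.\<close>

definition h :: "'d \<Rightarrow> real ^ 'd \<Rightarrow> real" where
  "h i x = 4 * (norm (v x))^3 * norm (v' i x)"

definition line_integral :: "'d \<Rightarrow> real ^ 'd \<Rightarrow> ennreal" where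
  "line_integral i x = (\<integral>\<^sup>+s. ennreal (h i (x + s *\<^sub>R axis i 1)) \<partial>lborel)"

text \<open>The square root is taken through the reals; \<open>line_integral_finite\<close> rules
  out the default value of \<open>enn2real\<close> at infinity.\<close>

definition G :: "'d \<Rightarrow> real ^ 'd \<Rightarrow> ennreal" where
  "G i x = ennreal (sqrt (enn2real (line_integral i x)))"

lemma v'_supp: "supp_in r (v' i)"
  using supp_in_has_partial[OF v_partial v_supp] .

lemma h_cont: "continuous_on UNIV (h i)"
  unfolding h_def by (intro continuous_intros v_cont v'_cont)

lemma h_supp: "supp_in r (h i)"
  using v_supp by (auto simp: h_def supp_in_def)

lemma h_measurable [measurable]: "h i \<in> borel_measurable borel"
  by (intro borel_measurable_continuous_onI h_cont)

lemma line_integral_measurable [measurable]: "line_integral i \<in> borel_measurable borel"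
  unfolding line_integral_def by measurable

lemma G_measurable [measurable]: "G i \<in> borel_measurable borel"
  unfolding G_def by measurable

text \<open>Translation invariance on the line. It makes \<open>G i\<close> independent of the i-th
  coordinate, as the Loomis-Whitney inequalities require.\<close>

lemma line_integral_shift: "line_integral i (x + t *\<^sub>R axis i 1) = line_integral i x"
proof -
  have "(\<integral>\<^sup>+s. ennreal (h i (x + s *\<^sub>R axis i 1)) \<partial>lborel) =
     (\<integral>\<^sup>+s. ennreal (h i (x + s *\<^sub>R axis i 1)) \<partial>distr lborel borel ((+) t))"
    by (simp add: lborel_distr_plus)
  also have "\<dots> = (\<integral>\<^sup>+s. ennreal (h i (x + (t + s) *\<^sub>R axis i 1)) \<partial>lborel)"
    by (subst nn_integral_distr) auto
  finally show ?thesis by (simp add: line_integral_def algebra_simps)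
qed

lemma line_integral_finite: "line_integral i x < \<infinity>"
proof -
  obtain B where B: "0 \<le> B" "\<And>x. norm (h i x) \<le> B" using supp_in_bounded[OF h_cont h_supp] by blast
  let ?e = "axis i 1 :: real ^ 'd"
  let ?R = "r + norm x"
  have "line_integral i x \<le> (\<integral>\<^sup>+s. ennreal B * indicator {- ?R..?R} s \<partial>lborel)"
    unfolding line_integral_def
  proof (rule nn_integral_mono)
    fix s
    show "ennreal (h i (x + s *\<^sub>R ?e)) \<le> ennreal B * indicator {- ?R..?R} s"
    proof (cases "\<bar>s\<bar> \<le> ?R")
      case True
      then have "s \<in> {- ?R..?R}" by auto
      then show ?thesis using B(2)[of "x + s *\<^sub>R ?e"] by (simp add: ennreal_leI)
    next
      case False
      have "norm (s *\<^sub>R ?e) \<le> norm (x + s *\<^sub>R ?e) + norm x" using norm_triangle_ineq4[of "x + s *\<^sub>R ?e" x] by simp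
      then have "r < norm (x + s *\<^sub>R ?e)" using False by (simp add: norm_axis_1)
      then show ?thesis using h_supp[of i] by (simp add: supp_in_def)
    qed
  qed
  also have "\<dots> < \<infinity>"
    by (subst nn_integral_cmult_indicator) (auto simp: ennreal_mult_less_top emeasure_lborel_Icc_eq)
  finally show ?thesis .
qed

lemma G_sq: "(G i x)\<^sup>2 = line_integral i x"
  using line_integral_finite[of i x] by (simp add: G_def ennreal_power ennreal_enn2real_if less_top)

lemma G_shift: "G i (x + t *\<^sub>R axis i 1) = G i x"
  by (simp add: G_def line_integral_shift)

text \<open>Along each line |v|^4 starts from 0 outside the support, so it is at most the integral
  of its derivative, hence of \<open>h i\<close>. Then take square roots.\<close>

lemma v_sq_le_G: "ennreal ((norm (v x))\<^sup>2) \<le> G i x"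
proof -
  let ?e = "axis i 1 :: real ^ 'd"
  let ?w = "\<lambda>s. v (x + s *\<^sub>R ?e)" and ?w' = "\<lambda>s. v' i (x + s *\<^sub>R ?e)"
  \<comment> \<open>|v|^4 is written as the square of an inner product, which is differentiable also
    where v vanishes.\<close>
  let ?f = "\<lambda>s. (?w s \<bullet> ?w s)\<^sup>2" and ?f' = "\<lambda>s. 2 * (?w s \<bullet> ?w s) * (2 * (?w s \<bullet> ?w' s))"
  have c: "continuous_on UNIV ?w" "continuous_on UNIV ?w'"
    by (auto intro!: continuous_on_compose2[OF v_cont] continuous_on_compose2[OF v'_cont] continuous_intros)
  have "ennreal \<bar>?f 0\<bar> \<le> (\<integral>\<^sup>+s. ennreal \<bar>?f' s\<bar> \<partial>lborel)"
  proof (rule abs_le_nn_integral_deriv[where a="- (\<bar>r\<bar> + norm x + 1)" and t=0 and f="?f" and f'="?f'"])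
    show "(?f has_vector_derivative ?f' s) (at s)" for s
    proof -
      have w: "(?w has_derivative (\<lambda>h. h *\<^sub>R ?w' s)) (at s)"
        using has_partial_line[OF v_partial[of i], where x=x and s=s] by (simp add: has_vector_derivative_def)
      have "((\<lambda>s. ?w s \<bullet> ?w s) has_real_derivative (2 * (?w s \<bullet> ?w' s))) (at s)"
        unfolding has_field_derivative_def
        using has_derivative_inner[OF w w] by (simp add: inner_commute algebra_simps mult_commute_abs)
      from DERIV_power[OF this, of 2] show ?thesis
        by (simp add: has_real_derivative_iff_has_vector_derivative mult_ac)
    qed
    show "continuous_on UNIV ?f'" by (intro continuous_intros c)
    have "norm (K *\<^sub>R ?e) - norm x \<le> norm (x + (- K) *\<^sub>R ?e)" for K
      using norm_triangle_ineq2[of "K *\<^sub>R ?e" x] by (simp add: norm_minus_commute)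
    from this[of "\<bar>r\<bar> + norm x + 1"] have "r < norm (x + (- (\<bar>r\<bar> + norm x + 1)) *\<^sub>R ?e)" by (simp add: norm_axis_1)
    then have "v (x + (- (\<bar>r\<bar> + norm x + 1)) *\<^sub>R ?e) = 0" using v_supp by (auto simp: supp_in_def)
    then show "?f (- (\<bar>r\<bar> + norm x + 1)) = 0" by simp
    show "- (\<bar>r\<bar> + norm x + 1) \<le> 0" using norm_ge_zero[of x] by linarith
  qed
  also have "\<dots> \<le> line_integral i x"
    unfolding line_integral_def
  proof (intro nn_integral_mono ennreal_leI)
    fix s
    have "\<bar>?f' s\<bar> = 4 * (norm (?w s))\<^sup>2 * \<bar>?w s \<bullet> ?w' s\<bar>"
      by (simp add: abs_mult dot_square_norm)
    also have "\<dots> \<le> 4 * (norm (?w s))\<^sup>2 * (norm (?w s) * norm (?w' s))"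
      by (intro mult_left_mono Cauchy_Schwarz_ineq2) auto
    finally show "\<bar>?f' s\<bar> \<le> h i (x + s *\<^sub>R ?e)"
      by (simp add: h_def power2_eq_square power3_eq_cube mult_ac)
  qed
  finally have *: "ennreal ((norm (v x))^4) \<le> line_integral i x"
    by (simp add: dot_square_norm power_mult[symmetric])
  have "(norm (v x))^4 \<le> enn2real (line_integral i x)"
    using * line_integral_finite[of i x] by (cases "line_integral i x") auto
  then have "sqrt ((norm (v x))^4) \<le> sqrt (enn2real (line_integral i x))" by (rule real_sqrt_le_mono)
  moreover have "sqrt ((norm (v x))^4) = (norm (v x))\<^sup>2"
    by (rule real_sqrt_unique) (auto simp: power_mult[symmetric])
  ultimately show ?thesis by (simp add: G_def ennreal_leI)
qed

lemma integrable_cont_supp: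
  "continuous_on UNIV f \<Longrightarrow> supp_in r f \<Longrightarrow> integrable lborel (f :: real ^ 'd \<Rightarrow> real)"
  by (rule integrable_supp_in)

definition I6 :: real where "I6 = (LINT x|lborel. (norm (v x))^6)"
definition M2 :: real where "M2 = (LINT x|lborel. (norm (v x))^2)"
definition D2 :: "'d \<Rightarrow> real" where "D2 i = (LINT x|lborel. (norm (v' i x))^2)"

lemma v_power_integrable: "0 < k \<Longrightarrow> integrable lborel (\<lambda>x. (norm (v x))^k)"
  by (rule integrable_cont_supp) (use v_supp in \<open>auto intro!: continuous_intros v_cont simp: supp_in_def\<close>)

lemma v'_power_integrable: "integrable lborel (\<lambda>x. (norm (v' i x))^2)"
  by (rule integrable_cont_supp) (use v'_supp[of i] in \<open>auto intro!: continuous_intros v'_cont simp: supp_in_def\<close>)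

lemma nonneg: "0 \<le> I6" "0 \<le> M2" "0 \<le> D2 i"
  by (auto simp: I6_def M2_def D2_def intro!: integral_nonneg_AE)

lemma nn_I6: "(\<integral>\<^sup>+x. ennreal ((norm (v x))^6) \<partial>lborel) = ennreal I6"
  unfolding I6_def by (rule nn_integral_eq_integral) (auto intro: v_power_integrable)

text \<open>Cauchy-Schwarz between \<open>4 * norm (v x) ^ 3\<close> and the derivative. The cube
  contributes again the sixth power integral \<open>I6\<close>, and 16 is the square of 4.\<close>

lemma h_integral_le: "(\<integral>\<^sup>+x. ennreal (h i x) \<partial>lborel)\<^sup>2 \<le> ennreal (16 * I6 * D2 i)"
proof -
  have [measurable]: "v \<in> borel_measurable borel" "v' i \<in> borel_measurable borel" for i
    by (auto intro!: borel_measurable_continuous_onI v_cont v'_cont)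
  have "(\<integral>\<^sup>+x. ennreal (h i x) \<partial>lborel) = (\<integral>\<^sup>+x. ennreal (4 * norm (v x)^3) * ennreal (norm (v' i x)) \<partial>lborel)"
    by (intro nn_integral_cong) (simp add: h_def flip: ennreal_mult)
  then have "(\<integral>\<^sup>+x. ennreal (h i x) \<partial>lborel)\<^sup>2
     \<le> (\<integral>\<^sup>+x. (ennreal (4 * norm (v x)^3))\<^sup>2 \<partial>lborel) * (\<integral>\<^sup>+x. (ennreal (norm (v' i x)))\<^sup>2 \<partial>lborel)"
    by (simp only:) (rule Cauchy_Schwarz_nn_integral, measurable)
  also have "(\<integral>\<^sup>+x. (ennreal (4 * norm (v x)^3))\<^sup>2 \<partial>lborel) = (\<integral>\<^sup>+x. 16 * ennreal (norm (v x)^6) \<partial>lborel)"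
    by (intro nn_integral_cong) (simp add: ennreal_power power_mult_distrib ennreal_mult power_mult[symmetric])
  also have "\<dots> = ennreal (16 * I6)"
    by (subst nn_integral_cmult) (auto simp: nn_I6 ennreal_mult nonneg)
  also have "(\<integral>\<^sup>+x. (ennreal (norm (v' i x)))\<^sup>2 \<partial>lborel) = ennreal (D2 i)"
    unfolding D2_def by (simp add: ennreal_power) (rule nn_integral_eq_integral, auto intro: v'_power_integrable)
  finally show ?thesis by (simp add: nonneg ennreal_mult)
qed

text \<open>Loomis-Whitney bounds \<open>I6\<close> squared by the product of the three integrals of
  \<open>h\<close>. Squaring once more and using \<open>h_integral_le\<close> gives
  \<open>I6 ^ 4\<close> at most \<open>16 ^ 3 * I6 ^ 3\<close> times the product of the
  \<open>D2\<close>; the finite factor \<open>I6 ^ 3\<close> cancels, leaving 4096 = 16^3.\<close>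

lemma I6_le_3:
  assumes U: "UNIV = {i, j, k :: 'd}" and ne: "i \<noteq> j" "i \<noteq> k" "j \<noteq> k"
  shows "I6 \<le> 4096 * (D2 i * D2 j * D2 k)"
proof -
  let ?e = "\<lambda>i. axis i 1 :: real ^ 'd"
  let ?T = "\<lambda>a b c. a *\<^sub>R ?e i + b *\<^sub>R ?e j + c *\<^sub>R ?e k"
  have [measurable]: "v \<in> borel_measurable borel" by (auto intro!: borel_measurable_continuous_onI v_cont)
  have "ennreal I6 = (\<integral>\<^sup>+a. \<integral>\<^sup>+b. \<integral>\<^sup>+c. ennreal ((norm (v (?T a b c)))^6) \<partial>lborel \<partial>lborel \<partial>lborel)"
    unfolding nn_I6[symmetric] by (rule nn_integral_cart_3[OF U ne]) measurable
  also have "\<dots> \<le> (\<integral>\<^sup>+a. \<integral>\<^sup>+b. \<integral>\<^sup>+c. G i (b *\<^sub>R ?e j + c *\<^sub>R ?e k) * G j (a *\<^sub>R ?e i + c *\<^sub>R ?e k) * G k (a *\<^sub>R ?e i + b *\<^sub>R ?e j) \<partial>lborel \<partial>lborel \<partial>lborel)"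
  proof (intro nn_integral_mono)
    fix a b c
    have "ennreal ((norm (v (?T a b c)))^6) = ennreal ((norm (v (?T a b c)))^2) * ennreal ((norm (v (?T a b c)))^2) * ennreal ((norm (v (?T a b c)))^2)"
      by (simp flip: ennreal_mult power_add)
    also have "\<dots> \<le> G i (?T a b c) * G j (?T a b c) * G k (?T a b c)"
      by (intro mult_mono v_sq_le_G) auto
    also have "G i (?T a b c) = G i (b *\<^sub>R ?e j + c *\<^sub>R ?e k)"
      using G_shift[of i "b *\<^sub>R ?e j + c *\<^sub>R ?e k" a] by (simp add: add_ac)
    also have "G j (?T a b c) = G j (a *\<^sub>R ?e i + c *\<^sub>R ?e k)"
      using G_shift[of j "a *\<^sub>R ?e i + c *\<^sub>R ?e k" b] by (simp add: add_ac)
    also have "G k (?T a b c) = G k (a *\<^sub>R ?e i + b *\<^sub>R ?e j)"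
      using G_shift[of k "a *\<^sub>R ?e i + b *\<^sub>R ?e j" c] by (simp add: add_ac)
    finally show "ennreal ((norm (v (?T a b c)))^6) \<le> G i (b *\<^sub>R ?e j + c *\<^sub>R ?e k) * G j (a *\<^sub>R ?e i + c *\<^sub>R ?e k) * G k (a *\<^sub>R ?e i + b *\<^sub>R ?e j)" .
  qed
  finally have "(ennreal I6)\<^sup>2 \<le> (\<integral>\<^sup>+a. \<integral>\<^sup>+b. \<integral>\<^sup>+c. G i (b *\<^sub>R ?e j + c *\<^sub>R ?e k) * G j (a *\<^sub>R ?e i + c *\<^sub>R ?e k) * G k (a *\<^sub>R ?e i + b *\<^sub>R ?e j) \<partial>lborel \<partial>lborel \<partial>lborel)\<^sup>2"
    by (rule power_mono) simp
  also have "\<dots> \<le> (\<integral>\<^sup>+b. \<integral>\<^sup>+c. (G i (b *\<^sub>R ?e j + c *\<^sub>R ?e k))\<^sup>2 \<partial>lborel \<partial>lborel) * (\<integral>\<^sup>+a. \<integral>\<^sup>+c. (G j (a *\<^sub>R ?e i + c *\<^sub>R ?e k))\<^sup>2 \<partial>lborel \<partial>lborel)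
       * (\<integral>\<^sup>+a. \<integral>\<^sup>+b. (G k (a *\<^sub>R ?e i + b *\<^sub>R ?e j))\<^sup>2 \<partial>lborel \<partial>lborel)"
    by (rule Loomis_Whitney_3) measurable
  also have "(\<integral>\<^sup>+b. \<integral>\<^sup>+c. (G i (b *\<^sub>R ?e j + c *\<^sub>R ?e k))\<^sup>2 \<partial>lborel \<partial>lborel) = (\<integral>\<^sup>+x. ennreal (h i x) \<partial>lborel)"
    unfolding G_sq line_integral_def
    by (rule nn_integral_cart_3[symmetric]) (use U ne in auto)
  also have "(\<integral>\<^sup>+a. \<integral>\<^sup>+c. (G j (a *\<^sub>R ?e i + c *\<^sub>R ?e k))\<^sup>2 \<partial>lborel \<partial>lborel) = (\<integral>\<^sup>+x. ennreal (h j x) \<partial>lborel)"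
    unfolding G_sq line_integral_def
    by (rule nn_integral_cart_3[symmetric]) (use U ne in auto)
  also have "(\<integral>\<^sup>+a. \<integral>\<^sup>+b. (G k (a *\<^sub>R ?e i + b *\<^sub>R ?e j))\<^sup>2 \<partial>lborel \<partial>lborel) = (\<integral>\<^sup>+x. ennreal (h k x) \<partial>lborel)"
    unfolding G_sq line_integral_def
    by (rule nn_integral_cart_3[symmetric]) (use U ne in auto)
  finally have "((ennreal I6)\<^sup>2)\<^sup>2 \<le> ((\<integral>\<^sup>+x. ennreal (h i x) \<partial>lborel) * (\<integral>\<^sup>+x. ennreal (h j x) \<partial>lborel) * (\<integral>\<^sup>+x. ennreal (h k x) \<partial>lborel))\<^sup>2"
    by (rule power_mono) simp
  also have "\<dots> \<le> ennreal (16 * I6 * D2 i) * ennreal (16 * I6 * D2 j) * ennreal (16 * I6 * D2 k)"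
    unfolding power_mult_distrib by (intro mult_mono h_integral_le) auto
  also have "\<dots> = ennreal ((16 * I6 * D2 i) * (16 * I6 * D2 j) * (16 * I6 * D2 k))"
    by (simp add: nonneg flip: ennreal_mult)
  finally have "ennreal (I6 ^ 4) \<le> ennreal ((16 * I6 * D2 i) * (16 * I6 * D2 j) * (16 * I6 * D2 k))"
    by (simp add: ennreal_power nonneg power_mult[symmetric])
  then have "I6 ^ 4 \<le> (16 * I6 * D2 i) * (16 * I6 * D2 j) * (16 * I6 * D2 k)"
    by (subst (asm) ennreal_le_iff) (auto simp: nonneg)
  then have "I6 ^ 3 * I6 \<le> I6 ^ 3 * (4096 * (D2 i * D2 j * D2 k))"
    by (simp add: power3_eq_cube power4_eq_xxxx mult_ac)
  then show ?thesis
    using nonneg by (cases "I6 = 0") (auto simp: mult_le_cancel_left)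
qed

text \<open>Only two of the three factors |v|^2 are replaced by \<open>G\<close>. The remaining one
  produces the fourth power integral \<open>I4\<close>, whose square is at most
  \<open>M2 * I6\<close> by Cauchy-Schwarz; again \<open>I6 ^ 3\<close> cancels, and 256 =
  16^2.\<close>

lemma I6_le_2:
  assumes U: "UNIV = {i, j :: 'd}" and ne: "i \<noteq> j"
  shows "I6 \<le> 256 * (M2 * D2 i * D2 j)"
proof -
  let ?e = "\<lambda>i. axis i 1 :: real ^ 'd"
  let ?T = "\<lambda>a b. a *\<^sub>R ?e i + b *\<^sub>R ?e j"
  define I4 where "I4 = (LINT x|lborel. (norm (v x))^4)"
  have I4: "0 \<le> I4" by (auto simp: I4_def intro!: integral_nonneg_AE)
  have [measurable]: "v \<in> borel_measurable borel" by (auto intro!: borel_measurable_continuous_onI v_cont)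
  have nn_I4: "(\<integral>\<^sup>+x. ennreal ((norm (v x))^4) \<partial>lborel) = ennreal I4"
    unfolding I4_def by (rule nn_integral_eq_integral) (auto intro: v_power_integrable)
  have nn_M2: "(\<integral>\<^sup>+x. ennreal ((norm (v x))^2) \<partial>lborel) = ennreal M2"
    unfolding M2_def by (rule nn_integral_eq_integral) (auto intro: v_power_integrable)
  have "ennreal I6 = (\<integral>\<^sup>+a. \<integral>\<^sup>+b. ennreal ((norm (v (?T a b)))^6) \<partial>lborel \<partial>lborel)"
    unfolding nn_I6[symmetric] by (rule nn_integral_cart_2[OF U ne]) measurable
  also have "\<dots> \<le> (\<integral>\<^sup>+a. \<integral>\<^sup>+b. G i (b *\<^sub>R ?e j) * G j (a *\<^sub>R ?e i) * ennreal ((norm (v (?T a b)))^2) \<partial>lborel \<partial>lborel)"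
  proof (intro nn_integral_mono)
    fix a b
    have "ennreal ((norm (v (?T a b)))^6) = ennreal ((norm (v (?T a b)))^2) * ennreal ((norm (v (?T a b)))^2) * ennreal ((norm (v (?T a b)))^2)"
      by (simp flip: ennreal_mult power_add)
    also have "\<dots> \<le> G i (?T a b) * G j (?T a b) * ennreal ((norm (v (?T a b)))^2)"
      by (intro mult_mono v_sq_le_G) auto
    also have "G i (?T a b) = G i (b *\<^sub>R ?e j)"
      using G_shift[of i "b *\<^sub>R ?e j" a] by (simp add: add_ac)
    also have "G j (?T a b) = G j (a *\<^sub>R ?e i)"
      using G_shift[of j "a *\<^sub>R ?e i" b] by (simp add: add_ac)
    finally show "ennreal ((norm (v (?T a b)))^6) \<le> G i (b *\<^sub>R ?e j) * G j (a *\<^sub>R ?e i) * ennreal ((norm (v (?T a b)))^2)" .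
  qed
  finally have "(ennreal I6)\<^sup>2 \<le> (\<integral>\<^sup>+a. \<integral>\<^sup>+b. G i (b *\<^sub>R ?e j) * G j (a *\<^sub>R ?e i) * ennreal ((norm (v (?T a b)))^2) \<partial>lborel \<partial>lborel)\<^sup>2"
    by (rule power_mono) simp
  also have "\<dots> \<le> (\<integral>\<^sup>+b. (G i (b *\<^sub>R ?e j))\<^sup>2 \<partial>lborel) * (\<integral>\<^sup>+a. (G j (a *\<^sub>R ?e i))\<^sup>2 \<partial>lborel)
       * (\<integral>\<^sup>+a. \<integral>\<^sup>+b. (ennreal ((norm (v (?T a b)))^2))\<^sup>2 \<partial>lborel \<partial>lborel)"
    by (rule Loomis_Whitney_2) measurable
  also have "(\<integral>\<^sup>+b. (G i (b *\<^sub>R ?e j))\<^sup>2 \<partial>lborel) = (\<integral>\<^sup>+x. ennreal (h i x) \<partial>lborel)"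
    unfolding G_sq line_integral_def
    by (rule nn_integral_cart_2[symmetric]) (use U ne in auto)
  also have "(\<integral>\<^sup>+a. (G j (a *\<^sub>R ?e i))\<^sup>2 \<partial>lborel) = (\<integral>\<^sup>+x. ennreal (h j x) \<partial>lborel)"
    unfolding G_sq line_integral_def
    by (rule nn_integral_cart_2[symmetric]) (use U ne in auto)
  also have "(\<integral>\<^sup>+a. \<integral>\<^sup>+b. (ennreal ((norm (v (?T a b)))^2))\<^sup>2 \<partial>lborel \<partial>lborel) = ennreal I4"
    unfolding nn_I4[symmetric] nn_integral_cart_2[OF U ne, of "\<lambda>x. ennreal ((norm (v x))^4)", simplified]
    by (simp add: ennreal_power power_mult[symmetric])
  finally have "((ennreal I6)\<^sup>2)\<^sup>2 \<le> ((\<integral>\<^sup>+x. ennreal (h i x) \<partial>lborel) * (\<integral>\<^sup>+x. ennreal (h j x) \<partial>lborel) * ennreal I4)\<^sup>2"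
    by (rule power_mono) simp
  also have "\<dots> \<le> ennreal (16 * I6 * D2 i) * ennreal (16 * I6 * D2 j) * (ennreal I4)\<^sup>2"
    unfolding power_mult_distrib by (intro mult_mono h_integral_le) auto
  also have "(ennreal I4)\<^sup>2 = (\<integral>\<^sup>+x. ennreal (norm (v x)) * ennreal ((norm (v x))^3) \<partial>lborel)\<^sup>2"
    unfolding nn_I4[symmetric] by (simp add: power_eq_if flip: ennreal_mult)
  also have "\<dots> \<le> (\<integral>\<^sup>+x. (ennreal (norm (v x)))\<^sup>2 \<partial>lborel) * (\<integral>\<^sup>+x. (ennreal ((norm (v x))^3))\<^sup>2 \<partial>lborel)"
    by (rule Cauchy_Schwarz_nn_integral) measurable
  also have "\<dots> = ennreal M2 * ennreal I6"
    by (simp add: ennreal_power power_mult[symmetric] nn_M2 nn_I6)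
  finally have "((ennreal I6)\<^sup>2)\<^sup>2 \<le> ennreal (16 * I6 * D2 i) * ennreal (16 * I6 * D2 j) * (ennreal M2 * ennreal I6)"
    by (simp add: mult_left_mono)
  also have "\<dots> = ennreal ((16 * I6 * D2 i) * (16 * I6 * D2 j) * (M2 * I6))"
    by (simp add: nonneg flip: ennreal_mult)
  finally have "ennreal (I6 ^ 4) \<le> ennreal ((16 * I6 * D2 i) * (16 * I6 * D2 j) * (M2 * I6))"
    by (simp add: ennreal_power nonneg power_mult[symmetric])
  then have "I6 ^ 4 \<le> (16 * I6 * D2 i) * (16 * I6 * D2 j) * (M2 * I6)"
    by (subst (asm) ennreal_le_iff) (auto simp: nonneg)
  then have "I6 ^ 3 * I6 \<le> I6 ^ 3 * (256 * (M2 * D2 i * D2 j))"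
    by (simp add: power3_eq_cube power4_eq_xxxx mult_ac)
  then show ?thesis
    using nonneg by (cases "I6 = 0") (auto simp: mult_le_cancel_left)
qed

text \<open>The squared H1 norm dominates each factor on the right of both dimensional bounds, so a
  single inequality with the larger constant 4096 covers d = 2 and d = 3.\<close>

lemma Sobolev:
  assumes dim: "CARD('d) \<in> {2, 3}"
  shows "I6 \<le> 4096 * (M2 + (\<Sum>i\<in>UNIV. D2 i)) ^ 3"
proof -
  let ?S = "M2 + (\<Sum>i\<in>UNIV. D2 i)"
  have D: "D2 i \<le> ?S" for i
    using member_le_sum[of i UNIV D2] nonneg by (auto simp: add_increasing)
  have M: "M2 \<le> ?S" using nonneg by (auto intro: sum_nonneg)
  have S: "0 \<le> ?S" using nonneg by (auto intro!: add_nonneg_nonneg sum_nonneg)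
  consider "CARD('d) = 2" | "CARD('d) = 3" using dim by auto
  then show ?thesis
  proof cases
    case 1
    then obtain i j :: 'd where U: "UNIV = {i, j}" "i \<noteq> j" by (auto simp: card_2_iff)
    have "M2 * D2 i * D2 j \<le> ?S * ?S * ?S" using nonneg S D M by (intro mult_mono) auto
    then have "I6 \<le> 256 * ?S ^ 3" using I6_le_2[OF U] unfolding power3_eq_cube by linarith
    then show ?thesis using zero_le_power[OF S, of 3] by linarith
  next
    case 2
    then obtain i j k :: 'd where U: "UNIV = {i, j, k}" "i \<noteq> j" "j \<noteq> k" "i \<noteq> k" by (auto simp: card_3_iff)
    have "D2 i * D2 j * D2 k \<le> ?S * ?S * ?S" using nonneg S D by (intro mult_mono) auto
    then show ?thesis using I6_le_3[OF U(1,2,4,3)] by (simp add: power3_eq_cube)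
  qed
qed

end

section \<open>Weak gradients\<close>

lemma norm_vec_sq: "(norm (x :: complex ^ 'd::finite))\<^sup>2 = (\<Sum>i\<in>UNIV. (cmod (x $ i))\<^sup>2)"
  by (simp add: norm_vec_def L2_set_def sum_nonneg)

lemma norm_L2_vec_sq:
  fixes g :: "real ^ 'd::finite \<Rightarrow> complex ^ 'd"
  assumes "g \<in> L2"
  shows "(norm_L2 g)\<^sup>2 = (\<Sum>i\<in>UNIV. (norm_L2 (\<lambda>x. g x $ i))\<^sup>2)"
  unfolding norm_L2_sq norm_vec_sq using L2D(2)[OF L2_component[OF assms]]
  by (subst Bochner_Integration.integral_sum) auto

lemma norm_L2_eq_0_AE:
  assumes "f \<in> L2" "norm_L2 f = 0"
  shows "AE x in lborel. f x = 0"
proof -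
  have "(LINT x|lborel. (norm (f x))\<^sup>2) = 0" using assms(2) norm_L2_sq[of f] by simp
  then have "AE x in lborel. (norm (f x))\<^sup>2 = 0"
    using L2D(2)[OF assms(1)] by (subst (asm) integral_nonneg_eq_0_iff_AE) auto
  then show ?thesis by simp
qed

lemma partial_of_real_reflect:
  assumes "Cc_smooth \<eta>"
  shows "partial i (\<lambda>y. complex_of_real (\<eta> (x - y))) = (\<lambda>y. - complex_of_real (partial i \<eta> (x - y)))"
proof
  fix y
  have d: "\<eta> differentiable (at y)" for y using assms by (auto simp: Cc_smooth_def intro: smooth_differentiable)
  have 1: "(\<lambda>y. \<eta> ((-1) *\<^sub>R y + x)) differentiable (at y)" by (rule affine_partial(1)[OF d])
  have "partial i (\<lambda>y. \<eta> ((-1) *\<^sub>R y + x)) y = (-1) *\<^sub>R partial i \<eta> ((-1) *\<^sub>R y + x)" by (rule affine_partial(2)[OF d])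
  then show "partial i (\<lambda>y. complex_of_real (\<eta> (x - y))) y = - complex_of_real (partial i \<eta> (x - y))"
    using partial_bounded_linear[OF bounded_linear_of_real[where 'a=complex] 1, of i] by simp
qed

text \<open>The reflected kernel is itself a test function in y. The minus sign from reflection
  cancels the one in the definition of the weak gradient.\<close>

lemma partial_conv_weak:
  fixes \<phi> :: "real ^ 'd::finite \<Rightarrow> complex"
  assumes "locally_integrable \<phi>" "is_weak_gradient \<phi> g" "Cc_smooth \<eta>"
  shows "partial i (conv \<eta> \<phi>) = conv \<eta> (\<lambda>x. g x $ i)"
proof
  fix x
  let ?z = "\<lambda>y. complex_of_real (\<eta> (x - y))"
  have "partial i ?z y = - complex_of_real (partial i \<eta> (x - y))" for y
    by (simp add: partial_of_real_reflect[OF assms(3)])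
  moreover have "test_function ?z"
    unfolding test_function_iff by (intro Cc_smooth_of_real Cc_smooth_reflect assms)
  ultimately have "(LINT y|lborel. \<phi> y * (- complex_of_real (partial i \<eta> (x - y)))) = - (LINT y|lborel. g y $ i * ?z y)"
    using assms(2) unfolding is_weak_gradient_def by (metis (no_types, lifting) Bochner_Integration.integral_cong)
  then show "partial i (conv \<eta> \<phi>) x = conv \<eta> (\<lambda>x. g x $ i) x"
    unfolding partial_conv[OF assms(1,3)] by (simp add: conv_def)
qed

text \<open>Both gradients have the same mollifications, namely the classical derivatives of the
  mollified function, and each is the L2 limit of its own mollifications.\<close>

lemma weak_gradient_unique:
  assumes \<phi>: "\<phi> \<in> L2" and g: "g \<in> L2" "is_weak_gradient \<phi> g" and k: "k \<in> L2" "is_weak_gradient \<phi> k"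
  shows "AE x in lborel. g x = k x"
proof -
  have "AE x in lborel. g x $ i = k x $ i" for i
  proof -
    have eq: "conv (mollifier n) (\<lambda>x. g x $ i) = conv (mollifier n) (\<lambda>x. k x $ i)" for n
      using partial_conv_weak[OF L2_locally_integrable[OF \<phi>] _ Cc_smooth_mollifier] g k by metis
    let ?c = "\<lambda>n. conv (mollifier n) (\<lambda>x. g x $ i)"
    have 1: "L2_lim ?c (\<lambda>x. g x $ i)" by (intro conv_mollifier_L2_lim L2_component g)
    have 2: "L2_lim ?c (\<lambda>x. k x $ i)" unfolding eq by (intro conv_mollifier_L2_lim L2_component k)
    have "L2_lim (\<lambda>n x. (- 1) * ?c n x) (\<lambda>x. (- 1) * (k x $ i))"
      by (rule L2_lim_mult_bounded[OF 2, where B=1]) auto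
    from L2_lim_add[OF 1 this] have "(\<lambda>n :: nat. norm_L2 (\<lambda>x. - (g x $ i - k x $ i))) \<longlonglongrightarrow> 0"
      by (simp add: L2_lim_def)
    then have "norm_L2 (\<lambda>x. - (g x $ i - k x $ i)) = 0" by (simp add: LIMSEQ_const_iff)
    then have "norm_L2 (\<lambda>x. g x $ i - k x $ i) = 0" by (simp add: norm_L2_def norm_minus_commute)
    from norm_L2_eq_0_AE[OF L2_diff[OF L2_component[OF g(1)] L2_component[OF k(1)]] this]
    show ?thesis by simp
  qed
  then have "AE x in lborel. \<forall>i\<in>UNIV. g x $ i = k x $ i"
    by (intro AE_finite_allI) auto
  then show ?thesis by eventually_elim (simp add: vec_eq_iff)
qed

lemma is_weak_gradient_diff:
  fixes \<phi> \<psi> :: "real ^ 'd::finite \<Rightarrow> complex"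
  assumes "\<phi> \<in> L2" "g \<in> L2" "is_weak_gradient \<phi> g" "\<psi> \<in> L2" "k \<in> L2" "is_weak_gradient \<psi> k"
  shows "is_weak_gradient (\<lambda>x. \<phi> x - \<psi> x) (\<lambda>x. g x - k x)"
  unfolding is_weak_gradient_def
proof (intro allI impI)
  fix \<eta> :: "real ^ 'd \<Rightarrow> complex" and i assume t: "test_function \<eta>"
  then have \<eta>: "Cc_smooth \<eta>" by (simp add: test_function_iff)
  note int = Cc_smooth_integrable_mult[OF L2_locally_integrable]
  have "integrable lborel (\<lambda>x. \<phi> x * partial i \<eta> x)" "integrable lborel (\<lambda>x. \<psi> x * partial i \<eta> x)"
    "integrable lborel (\<lambda>x. g x $ i * \<eta> x)" "integrable lborel (\<lambda>x. k x $ i * \<eta> x)"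
    by (auto intro!: int Cc_smooth_partial \<eta> assms L2_component)
  then show "(LINT x|lborel. (\<phi> x - \<psi> x) * partial i \<eta> x) = - (LINT x|lborel. (g x - k x) $ i * \<eta> x)"
    using assms t by (simp add: left_diff_distrib is_weak_gradient_def)
qed

lemma is_weak_gradient_smooth:
  fixes v :: "real ^ 'd::finite \<Rightarrow> complex"
  assumes "smooth v"
  shows "is_weak_gradient v (\<lambda>x. \<chi> i. partial i v x)"
  unfolding is_weak_gradient_def
proof (intro allI impI)
  fix \<eta> :: "real ^ 'd \<Rightarrow> complex" and i assume "test_function \<eta>"
  then have \<eta>: "Cc_smooth \<eta>" by (simp add: test_function_iff)
  then obtain r where r: "supp_in r \<eta>" and s: "smooth \<eta>" by (auto simp: Cc_smooth_def)
  have d: "v differentiable (at x)" "\<eta> differentiable (at x)" for x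
    using assms s by (auto intro: smooth_differentiable)
  have sm: "smooth (\<lambda>x. v x * \<eta> x)" by (intro smooth_mult assms s)
  have eq: "partial i (\<lambda>x. v x * \<eta> x) = (\<lambda>x. v x * partial i \<eta> x + partial i v x * \<eta> x)"
    by (intro ext partial_mult d)
  have "(LINT x|lborel. v x * partial i \<eta> x + partial i v x * \<eta> x) = 0"
    unfolding eq[symmetric]
    by (rule integral_has_partial_eq_0(2)[OF smooth_has_partial[OF sm] smooth_continuous[OF sm]])
      (use r in \<open>auto intro: smooth_continuous smooth_partial sm simp: supp_in_def\<close>)
  moreover have "integrable lborel (\<lambda>x. v x * partial i \<eta> x)" "integrable lborel (\<lambda>x. partial i v x * \<eta> x)"
    by (auto intro!: Cc_smooth_integrable_mult continuous_locally_integrable smooth_continuous smooth_partial assms Cc_smooth_partial \<eta>)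
  ultimately show "(LINT x|lborel. v x * partial i \<eta> x) = - (LINT x|lborel. (\<chi> i. partial i v x) $ i * \<eta> x)"
    by (simp add: eq_neg_iff_add_eq_0)
qed

lemma L2_lim_AE_subseq:
  fixes f :: "nat \<Rightarrow> real ^ 'd::finite \<Rightarrow> 'b::euclidean_space"
  assumes "L2_lim f g"
  obtains r where "strict_mono r" "AE x in lborel. (\<lambda>n. f (r n) x) \<longlonglongrightarrow> g x"
proof -
  note m = assms[unfolded L2_lim_def]
  have "(\<lambda>n. (norm_L2 (\<lambda>x. f n x - g x))\<^sup>2) \<longlonglongrightarrow> 0\<^sup>2" using m by (intro tendsto_power) auto
  then have "(\<lambda>n. LINT x|lborel. norm ((norm (f n x - g x))\<^sup>2)) \<longlonglongrightarrow> 0"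
    unfolding norm_L2_sq by simp
  from tendsto_L1_AE_subseq[OF _ this]
  obtain r :: "nat \<Rightarrow> nat" where r: "strict_mono r" "AE x in lborel. (\<lambda>n. (norm (f (r n) x - g x))\<^sup>2) \<longlonglongrightarrow> 0"
    using m L2D(2)[OF L2_diff] by blast
  have "AE x in lborel. (\<lambda>n. f (r n) x) \<longlonglongrightarrow> g x"
    using r(2)
  proof eventually_elim
    case (elim x)
    then have "(\<lambda>n. sqrt ((norm (f (r n) x - g x))\<^sup>2)) \<longlonglongrightarrow> sqrt 0" by (rule tendsto_real_sqrt)
    then have "(\<lambda>n. norm (f (r n) x - g x)) \<longlonglongrightarrow> 0" by simp
    then show ?case by (simp add: tendsto_norm_zero_iff LIM_zero_iff)
  qed
  with r(1) show ?thesis using that by blast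
qed

text \<open>Mollify, multiply by a wide cutoff, apply the inequality for compact supports, and let
  the mollification and the cutoff go at the same time. Fatou's lemma gives integrability of the
  sixth power together with the bound.\<close>

lemma Sobolev_H1:
  fixes \<phi> :: "real ^ 'd::finite \<Rightarrow> complex"
  assumes dim: "CARD('d) \<in> {2, 3}" and \<phi>: "\<phi> \<in> L2" and g: "g \<in> L2" "is_weak_gradient \<phi> g"
  shows "integrable lborel (\<lambda>x. (cmod (\<phi> x))^6)"
    and "(LINT x|lborel. (cmod (\<phi> x))^6) \<le> 4096 * ((norm_L2 \<phi>)\<^sup>2 + (norm_L2 g)\<^sup>2)^3"
proof -
  define w where "w n = conv (mollifier n) \<phi>" for n
  note loc = L2_locally_integrable[OF \<phi>]
  have ws: "smooth (w n)" for n unfolding w_def by (intro smooth_conv loc Cc_smooth_mollifier)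
  have wL: "L2_lim w \<phi>" unfolding w_def by (rule conv_mollifier_L2_lim[OF \<phi>])
  have wn: "w n \<in> L2" "norm_L2 (w n) \<le> norm_L2 \<phi>" for n unfolding w_def using conv_mollifier_L2[OF \<phi>] by auto
  have pw: "partial i (w n) \<in> L2" "norm_L2 (partial i (w n)) \<le> norm_L2 (\<lambda>x. g x $ i)" for i n
    unfolding w_def partial_conv_weak[OF loc g(2) Cc_smooth_mollifier]
    using conv_mollifier_L2[OF L2_component[OF g(1)]] by auto
  let ?c = "\<lambda>n :: nat. 1 / real (Suc n)"
  \<comment> \<open>The factor \<open>exp 1\<close> normalises the bump to the value 1 at the
    origin, so the cutoffs stay in [0,1] and tend to 1 at every point.\<close>
  define cut where "cut n x = exp 1 * bump (?c n *\<^sub>R x)" for n and x :: "real ^ 'd"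
  have cuts: "smooth (cut n)" for n unfolding cut_def by (intro smooth_bounded_linear[OF bounded_linear_mult_right] smooth_bump_scaled)
  have cutsupp: "supp_in (real (Suc n)) (cut n)" for n
    using supp_in_bump_scaled[of "?c n"] by (auto simp: supp_in_def cut_def)
  have cut01: "0 \<le> cut n x" "cut n x \<le> 1" for n x
    using bump_le[of "?c n *\<^sub>R x"] by (auto simp: cut_def bump_nonneg exp_minus field_simps)
  have cut1: "(\<lambda>n. cut n x) \<longlonglongrightarrow> 1" for x
  proof -
    have c0: "?c \<longlonglongrightarrow> 0" by (rule LIMSEQ_Suc[OF lim_1_over_n])
    have "(\<lambda>n. exp 1 * bump (?c n *\<^sub>R x)) \<longlonglongrightarrow> exp 1 * bump (0 *\<^sub>R x)"
      by (intro tendsto_mult tendsto_const continuous_on_tendsto_compose[OF smooth_continuous[OF smooth_bump]]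
          tendsto_scaleR c0) auto
    then show ?thesis by (simp add: cut_def bump_0 flip: exp_add)
  qed
  have "\<exists>B\<ge>0. \<forall>x. norm (partial i bump (x :: real ^ 'd)) \<le> B" for i
    using Cc_smooth_bounded[OF Cc_smooth_partial, of bump] smooth_bump supp_in_bump_scaled[of 1]
    unfolding Cc_smooth_def by (metis (no_types, lifting) div_by_1 scaleR_one supp_in_def zero_less_one)
  then obtain B where B: "\<And>i. 0 \<le> B i" "\<And>i x. \<bar>partial i bump (x :: real ^ 'd)\<bar> \<le> B i" by (metis real_norm_def)
  have pcut: "partial i (cut n) x = exp 1 * (?c n * partial i bump (?c n *\<^sub>R x))" for i n x
  proof -
    have d: "bump differentiable (at (?c n *\<^sub>R x + 0))" by (rule smooth_differentiable[OF smooth_bump])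
    have "partial i (\<lambda>x. exp 1 * bump (?c n *\<^sub>R x + 0)) x = exp 1 * partial i (\<lambda>x. bump (?c n *\<^sub>R x + 0)) x"
      by (intro partial_bounded_linear[OF bounded_linear_mult_right] affine_partial(1)[OF d])
    then show ?thesis unfolding cut_def affine_partial(2)[OF d] by simp
  qed
  define v where "v n x = complex_of_real (cut n x) * w n x" for n x
  have ccut: "smooth (\<lambda>x. complex_of_real (cut n x))" for n
    by (rule smooth_bounded_linear[OF bounded_linear_of_real cuts])
  have vs: "smooth (v n)" for n unfolding v_def by (intro smooth_mult ccut ws)
  have pv: "partial i (v n) = (\<lambda>x. complex_of_real (cut n x) * partial i (w n) x + complex_of_real (partial i (cut n) x) * w n x)" for i n
    unfolding v_def using partial_bounded_linear[OF bounded_linear_of_real[where 'a=complex] smooth_differentiable[OF cuts]]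
    by (subst partial_mult[OF smooth_differentiable[OF ccut] smooth_differentiable[OF ws], abs_def]) auto
  have vL: "norm_L2 (v n) \<le> norm_L2 \<phi>" for n
  proof -
    have "norm_L2 (v n) \<le> norm_L2 (w n)"
    proof (rule norm_L2_mono(2)[OF wn(1)])
      show "norm (v n x) \<le> norm (w n x)" for x
        using mult_right_mono[OF cut01(2)[of n x], of "norm (w n x)"] cut01(1)[of n x] by (simp add: v_def norm_mult)
    qed (intro borel_measurable_continuous_onI smooth_continuous vs)
    then show ?thesis using wn(2)[of n] by linarith
  qed
  \<comment> \<open>The second summand comes from differentiating the cutoff of width
    \<open>Suc n\<close>; it vanishes as n grows, so no lower order term survives in the final
    bound.\<close>
  let ?b = "\<lambda>n i. norm_L2 (\<lambda>x. g x $ i) + ?c n * (exp 1 * B i * norm_L2 \<phi>)"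
  have pvL: "norm_L2 (partial i (v n)) \<le> ?b n i" for i n
  proof -
    have m: "(\<lambda>x. complex_of_real (cut n x)) \<in> borel_measurable borel" "(\<lambda>x. complex_of_real (partial i (cut n) x)) \<in> borel_measurable borel"
      by (intro borel_measurable_continuous_onI smooth_continuous smooth_bounded_linear[OF bounded_linear_of_real] smooth_partial cuts)+
    have b2: "\<bar>partial i (cut n) x\<bar> \<le> exp 1 * ?c n * B i" for x
      unfolding pcut using B(2)[of i "?c n *\<^sub>R x"] by (simp add: abs_mult divide_right_mono)
    have L1: "(\<lambda>x. complex_of_real (cut n x) * partial i (w n) x) \<in> L2"
      by (rule L2_mult_bounded[OF pw(1) m(1), where B=1]) (use cut01 in auto)
    have L2': "(\<lambda>x. complex_of_real (partial i (cut n) x) * w n x) \<in> L2"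
      by (rule L2_mult_bounded[OF wn(1) m(2)]) (use b2 in auto)
    have "norm_L2 (\<lambda>x. complex_of_real (cut n x) * partial i (w n) x) \<le> norm_L2 (partial i (w n))"
    proof (rule norm_L2_mono(2)[OF pw(1) L2D(1)[OF L1]])
      show "norm (complex_of_real (cut n x) * partial i (w n) x) \<le> norm (partial i (w n) x)" for x
        using mult_right_mono[OF cut01(2)[of n x], of "norm (partial i (w n) x)"] cut01(1)[of n x] by (simp add: norm_mult)
    qed
    moreover have "norm_L2 (\<lambda>x. complex_of_real (partial i (cut n) x) * w n x) \<le> norm_L2 (\<lambda>x. (exp 1 * ?c n * B i) *\<^sub>R w n x)"
    proof (rule norm_L2_mono(2)[OF L2_scaleR[OF wn(1)] L2D(1)[OF L2']])
      show "norm (complex_of_real (partial i (cut n) x) * w n x) \<le> norm ((exp 1 * ?c n * B i) *\<^sub>R w n x)" for x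
        using mult_right_mono[OF b2[of x], of "norm (w n x)"] B(1)[of i] by (simp add: norm_mult)
    qed
    moreover have "norm_L2 (\<lambda>x. (exp 1 * ?c n * B i) *\<^sub>R w n x) = exp 1 * ?c n * B i * norm_L2 (w n)"
      unfolding norm_L2_scaleR using B(1)[of i] by simp
    moreover have "\<dots> \<le> exp 1 * ?c n * B i * norm_L2 \<phi>"
      using B(1)[of i] by (intro mult_left_mono wn) auto
    ultimately show ?thesis
      using norm_L2_add[OF L1 L2'] pw(2)[of i n] unfolding pv by (simp add: mult_ac)
  qed
  have bound: "(\<integral>\<^sup>+x. ennreal ((cmod (v n x))^6) \<partial>lborel) \<le> ennreal (4096 * ((norm_L2 \<phi>)\<^sup>2 + (\<Sum>i\<in>UNIV. (?b n i)\<^sup>2))^3)" for n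
  proof -
    have vsupp: "supp_in (real (Suc n)) (v n)" using cutsupp[of n] by (simp add: supp_in_def v_def)
    interpret Cc1_function "v n" "\<lambda>i. partial i (v n)" "real (Suc n)"
      by standard (intro vsupp smooth_continuous smooth_partial smooth_has_partial vs)+
    have "M2 + (\<Sum>i\<in>UNIV. D2 i) \<le> (norm_L2 \<phi>)\<^sup>2 + (\<Sum>i\<in>UNIV. (?b n i)\<^sup>2)"
      unfolding M2_def D2_def norm_L2_sq[symmetric]
      by (intro add_mono sum_mono power_mono vL pvL norm_L2_nonneg)
    then have "(M2 + (\<Sum>i\<in>UNIV. D2 i)) ^ 3 \<le> ((norm_L2 \<phi>)\<^sup>2 + (\<Sum>i\<in>UNIV. (?b n i)\<^sup>2)) ^ 3"
      using nonneg by (intro power_mono) (auto intro!: add_nonneg_nonneg sum_nonneg)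
    then have "I6 \<le> 4096 * ((norm_L2 \<phi>)\<^sup>2 + (\<Sum>i\<in>UNIV. (?b n i)\<^sup>2)) ^ 3"
      using Sobolev[OF dim] by linarith
    then show ?thesis unfolding nn_I6 by (rule ennreal_leI)
  qed
  \<comment> \<open>L2 convergence of the mollifications gives convergence almost everywhere only
    along a subsequence, which is enough for Fatou's lemma.\<close>
  obtain r where r: "strict_mono r" "AE x in lborel. (\<lambda>n. w (r n) x) \<longlonglongrightarrow> \<phi> x"
    using L2_lim_AE_subseq[OF wL] by blast
  have lim: "AE x in lborel. (\<lambda>n. ennreal ((cmod (v (r n) x))^6)) \<longlonglongrightarrow> ennreal ((cmod (\<phi> x))^6)"
    using r(2)
  proof eventually_elim
    case (elim x)
    have "(\<lambda>n. cut (r n) x) \<longlonglongrightarrow> 1" using LIMSEQ_subseq_LIMSEQ[OF cut1 r(1)] by (simp add: comp_def)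
    then have "(\<lambda>n. v (r n) x) \<longlonglongrightarrow> complex_of_real 1 * \<phi> x"
      unfolding v_def by (intro tendsto_mult tendsto_of_real elim)
    then show ?case by (intro tendsto_ennrealI tendsto_power tendsto_norm) simp
  qed
  have [measurable]: "v n \<in> borel_measurable borel" for n
    by (intro borel_measurable_continuous_onI smooth_continuous vs)
  have [measurable]: "\<phi> \<in> borel_measurable borel" using \<phi> by (rule L2D)
  have "(\<integral>\<^sup>+x. ennreal ((cmod (\<phi> x))^6) \<partial>lborel) = (\<integral>\<^sup>+x. liminf (\<lambda>n. ennreal ((cmod (v (r n) x))^6)) \<partial>lborel)"
  proof (rule nn_integral_cong_AE)
    show "AE x in lborel. ennreal ((cmod (\<phi> x))^6) = liminf (\<lambda>n. ennreal ((cmod (v (r n) x))^6))"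
      using lim by eventually_elim (rule lim_imp_Liminf[symmetric, OF sequentially_bot])
  qed
  also have "\<dots> \<le> liminf (\<lambda>n. \<integral>\<^sup>+x. ennreal ((cmod (v (r n) x))^6) \<partial>lborel)"
    by (rule nn_integral_liminf) measurable
  also have "\<dots> \<le> liminf (\<lambda>n. ennreal (4096 * ((norm_L2 \<phi>)\<^sup>2 + (\<Sum>i\<in>UNIV. (?b (r n) i)\<^sup>2))^3))"
    by (intro Liminf_mono always_eventually allI bound)
  also have "\<dots> = ennreal (4096 * ((norm_L2 \<phi>)\<^sup>2 + (\<Sum>i\<in>UNIV. (norm_L2 (\<lambda>x. g x $ i) + 0 * (exp 1 * B i * norm_L2 \<phi>))\<^sup>2))^3)"
  proof (rule lim_imp_Liminf)
    have "?c \<longlonglongrightarrow> 0" by (rule LIMSEQ_Suc[OF lim_1_over_n])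
    then have "(\<lambda>n. ?c (r n)) \<longlonglongrightarrow> 0" using LIMSEQ_subseq_LIMSEQ[OF _ r(1), of ?c 0] by (simp add: comp_def)
    then show "(\<lambda>n. ennreal (4096 * ((norm_L2 \<phi>)\<^sup>2 + (\<Sum>i\<in>UNIV. (?b (r n) i)\<^sup>2))^3)) \<longlonglongrightarrow>
      ennreal (4096 * ((norm_L2 \<phi>)\<^sup>2 + (\<Sum>i\<in>UNIV. (norm_L2 (\<lambda>x. g x $ i) + 0 * (exp 1 * B i * norm_L2 \<phi>))\<^sup>2))^3)"
      by (intro tendsto_ennrealI tendsto_intros)
  qed simp
  also have "\<dots> = ennreal (4096 * ((norm_L2 \<phi>)\<^sup>2 + (norm_L2 g)\<^sup>2)^3)"
    by (simp add: norm_L2_vec_sq[OF g(1)])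
  finally have *: "(\<integral>\<^sup>+x. ennreal ((cmod (\<phi> x))^6) \<partial>lborel) \<le> ennreal (4096 * ((norm_L2 \<phi>)\<^sup>2 + (norm_L2 g)\<^sup>2)^3)" .
  show int: "integrable lborel (\<lambda>x. (cmod (\<phi> x))^6)"
    by (rule integrableI_bounded) (use * in \<open>auto intro: le_less_trans[OF _ ennreal_less_top]\<close>)
  have "ennreal (LINT x|lborel. (cmod (\<phi> x))^6) \<le> ennreal (4096 * ((norm_L2 \<phi>)\<^sup>2 + (norm_L2 g)\<^sup>2)^3)"
    using * nn_integral_eq_integral[OF int] by simp
  then show "(LINT x|lborel. (cmod (\<phi> x))^6) \<le> 4096 * ((norm_L2 \<phi>)\<^sup>2 + (norm_L2 g)\<^sup>2)^3"
    by (subst (asm) ennreal_le_iff) auto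
qed

section \<open>Virial identities for smooth functions\<close>

lemma has_partial_mult:
  fixes f g :: "real ^ 'd::finite \<Rightarrow> 'b::real_normed_algebra"
  assumes "has_partial i f f'" "has_partial i g g'"
  shows "has_partial i (\<lambda>x. f x * g x) (\<lambda>x. f x * g' x + f' x * g x)"
  using assms has_vector_derivative_mult unfolding has_partial_def by fastforce

lemma has_partial_add:
  "has_partial i f f' \<Longrightarrow> has_partial i g g' \<Longrightarrow> has_partial i (\<lambda>x. f x + g x) (\<lambda>x. f' x + g' x)"
  unfolding has_partial_def by (auto intro: has_vector_derivative_add)

lemma has_partial_sum:
  "(\<And>j. j \<in> A \<Longrightarrow> has_partial i (f j) (f' j)) \<Longrightarrow> has_partial i (\<lambda>x. \<Sum>j\<in>A. f j x) (\<lambda>x. \<Sum>j\<in>A. f' j x)"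
  unfolding has_partial_def by (auto intro: has_vector_derivative_sum)

lemma has_partial_bounded_linear:
  "bounded_linear L \<Longrightarrow> has_partial i f f' \<Longrightarrow> has_partial i (\<lambda>x. L (f x)) (\<lambda>x. L (f' x))"
  unfolding has_partial_def by (auto intro: bounded_linear.has_vector_derivative)

lemmas has_partial_cnj = has_partial_bounded_linear[OF bounded_linear_cnj]
lemmas has_partial_of_real = has_partial_bounded_linear[OF bounded_linear_of_real]

lemma has_partial_cmult:
  fixes f :: "real ^ 'd::finite \<Rightarrow> complex"
  shows "has_partial i f f' \<Longrightarrow> has_partial i (\<lambda>x. c * f x) (\<lambda>x. c * f' x)"
  by (rule has_partial_bounded_linear[OF bounded_linear_mult_right])

lemma integral_divergence_eq_0:
  fixes \<Phi> :: "'d::finite \<Rightarrow> real ^ 'd \<Rightarrow> complex"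
  assumes "\<And>k. has_partial k (\<Phi> k) (\<Phi>' k)" "\<And>k. continuous_on UNIV (\<Phi> k)" "\<And>k. continuous_on UNIV (\<Phi>' k)"
    "\<And>k. supp_in r (\<Phi> k)"
  shows "(LINT x|lborel. (\<Sum>k\<in>UNIV. \<Phi>' k x)) = 0"
proof -
  have "integrable lborel (\<Phi>' k) \<and> (LINT x|lborel. \<Phi>' k x) = 0" for k
    using integral_has_partial_eq_0 assms by blast
  then show ?thesis by (simp add: Bochner_Integration.integral_sum)
qed

lemma smooth_add: "smooth f \<Longrightarrow> smooth g \<Longrightarrow> smooth (\<lambda>x. f x + g x)"
  by (simp add: smooth_def C_k_add)

lemma smooth_const: "smooth (\<lambda>x. c)"
  by (simp add: smooth_def C_k_const)

lemma smooth_sum: "(\<And>i. i \<in> A \<Longrightarrow> smooth (f i)) \<Longrightarrow> smooth (\<lambda>x. \<Sum>i\<in>A. f i x)"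
  by (induction A rule: infinite_finite_induct) (auto intro: smooth_add smooth_const)

lemma smooth_laplacian: "smooth f \<Longrightarrow> smooth (laplacian f)"
  unfolding laplacian_def[abs_def] by (intro smooth_sum smooth_partial)

lemma supp_in_laplacian: "supp_in r f \<Longrightarrow> supp_in r (laplacian f)"
  by (auto simp: supp_in_def[of _ "laplacian f"] laplacian_def partial_0_outside[OF supp_in_partial])

text \<open>Only the weight has bounded support; w is merely smooth, and every flux below contains a
  or one of its derivatives as a factor. Symmetry of the second derivatives of w is inherited later
  from the convolution kernel.\<close>

locale smooth_virial =
  fixes a :: "real ^ 'd::finite \<Rightarrow> real" and w :: "real ^ 'd \<Rightarrow> complex" and R :: real
  assumes a_smooth: "smooth a" and a_supp: "supp_in R a" and w_smooth: "smooth w"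
    and w_symm: "\<And>j k. partial k (partial j w) = partial j (partial k w)"
begin

abbreviation "b j x \<equiv> complex_of_real (partial j a x)"
abbreviation "b2 k j x \<equiv> complex_of_real (partial k (partial j a) x)"
abbreviation "L x \<equiv> complex_of_real (laplacian a x)"
abbreviation "L1 k x \<equiv> complex_of_real (partial k (laplacian a) x)"
abbreviation "LL x \<equiv> complex_of_real (laplacian (laplacian a) x)"

text \<open>The commutator of the Laplacian with multiplication by a, applied to w:
  \<open>2 \<nabla>a \<cdot> \<nabla>w + (\<Delta>a) w\<close>. The equation is tested against this
  multiplier.\<close>

definition G :: "real ^ 'd \<Rightarrow> complex" where
  "G x = 2 * (\<Sum>j\<in>UNIV. b j x * partial j w x) + L x * w x"

lemma outside:
  assumes "R < norm x"
  shows "a x = 0" "partial j a x = 0" "partial k (partial j a) x = 0" "laplacian a x = 0"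
    "partial k (laplacian a) x = 0" "laplacian (laplacian a) x = 0"
  using a_supp assms supp_in_partial[OF a_supp] supp_in_partial[OF supp_in_partial[OF a_supp]] supp_in_laplacian[OF a_supp]
    supp_in_partial[OF supp_in_laplacian[OF a_supp]] supp_in_laplacian[OF supp_in_laplacian[OF a_supp]]
  by (auto simp: supp_in_def)

lemma outside_G: "R < norm x \<Longrightarrow> G x = 0"
  by (simp add: G_def outside)

lemma cont [continuous_intros]:
  "continuous_on UNIV w" "continuous_on UNIV (partial j w)" "continuous_on UNIV (partial k (partial j w))"
  "continuous_on UNIV a" "continuous_on UNIV (partial j a)" "continuous_on UNIV (partial k (partial j a))"
  "continuous_on UNIV (laplacian a)" "continuous_on UNIV (partial k (laplacian a))"
  "continuous_on UNIV (partial j (partial k (laplacian a)))" "continuous_on UNIV (laplacian (laplacian a))"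
  "continuous_on UNIV (laplacian w)"
  by (intro smooth_continuous smooth_partial smooth_laplacian a_smooth w_smooth)+

lemma hp:
  "has_partial k w (partial k w)" "has_partial k (partial j w) (partial k (partial j w))"
  "has_partial k (\<lambda>x. complex_of_real (a x)) (b k)"
  "has_partial k (b j) (b2 k j)" "has_partial k L (L1 k)"
  "has_partial k (L1 j) (\<lambda>x. complex_of_real (partial k (partial j (laplacian a)) x))"
  by (intro has_partial_of_real smooth_has_partial smooth_partial smooth_laplacian a_smooth w_smooth)+

lemma cont_G [continuous_intros]: "continuous_on UNIV G"
  unfolding G_def[abs_def] by (intro continuous_intros)

lemma integrable_outside:
  fixes f :: "real ^ 'd \<Rightarrow> complex"
  assumes "continuous_on UNIV f" "\<And>x. R < norm x \<Longrightarrow> f x = 0"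
  shows "integrable lborel f"
  using integrable_supp_in[of f R] assms by (auto simp: supp_in_def)

definition G1 :: "'d \<Rightarrow> real ^ 'd \<Rightarrow> complex" where
  "G1 k x = 2 * (\<Sum>j\<in>UNIV. b j x * partial k (partial j w) x + b2 k j x * partial j w x)
     + (L x * partial k w x + L1 k x * w x)"

lemma outside_G1: "R < norm x \<Longrightarrow> G1 k x = 0"
  by (simp add: G1_def outside)

lemma hp_G: "has_partial k G (G1 k)"
  unfolding G_def[abs_def] G1_def[abs_def]
  by (intro has_partial_add has_partial_cmult has_partial_sum has_partial_mult hp)

definition E :: "real ^ 'd \<Rightarrow> complex" where
  "E x = (\<Sum>m\<in>UNIV. cnj (partial m w x) * partial m w x)"

definition E1 :: "'d \<Rightarrow> real ^ 'd \<Rightarrow> complex" where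
  "E1 k x = (\<Sum>m\<in>UNIV. cnj (partial m w x) * partial k (partial m w) x + cnj (partial k (partial m w) x) * partial m w x)"

lemma hp_E: "has_partial k E (E1 k)"
  unfolding E_def[abs_def] E1_def[abs_def]
  by (intro has_partial_sum has_partial_mult has_partial_cnj hp)

lemma cont_E [continuous_intros]: "continuous_on UNIV E" "continuous_on UNIV (E1 k)" "continuous_on UNIV (G1 k)"
  unfolding E_def[abs_def] E1_def[abs_def] G1_def[abs_def] by (intro continuous_intros)+

text \<open>In the real part, the second derivatives of w in \<open>G1\<close> and \<open>E1\<close>
  cancel by symmetry, the terms with the Laplacian of a times the squared gradient cancel, and so do
  those with the gradient of that Laplacian. The Hessian of a, tested on the gradient of w,
  remains.\<close>

lemma kinetic_pointwise:
  "Re (\<Sum>k\<in>UNIV. (- 1 / 2) * (cnj (partial k w x) * G1 k x) + (1 / 2) * (b k x * E1 k x) + (1 / 2) * (b2 k k x * E x)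
     + (1 / 4) * (L1 k x * (cnj w' * partial k w x + cnj (partial k w x) * w')))
   = - Re (\<Sum>k\<in>UNIV. \<Sum>j\<in>UNIV. b2 k j x * (cnj (partial k w x) * partial j w x))"
  if "w' = w x"
proof -
  let ?W = "\<lambda>k. partial k w x" and ?W2 = "\<lambda>k j. partial k (partial j w) x"
  have 1: "(\<Sum>k\<in>UNIV. cnj (?W k) * G1 k x) = 2 * (\<Sum>k\<in>UNIV. \<Sum>j\<in>UNIV. b j x * (cnj (?W k) * ?W2 k j))
    + 2 * (\<Sum>k\<in>UNIV. \<Sum>j\<in>UNIV. b2 k j x * (cnj (?W k) * ?W j)) + L x * E x + (\<Sum>k\<in>UNIV. L1 k x * (cnj (?W k) * w x))"
    by (simp add: G1_def E_def distrib_left sum.distrib sum_distrib_left sum_distrib_right mult_ac)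
  have 2: "Re (\<Sum>k\<in>UNIV. b k x * E1 k x) = 2 * Re (\<Sum>k\<in>UNIV. \<Sum>j\<in>UNIV. b j x * (cnj (?W k) * ?W2 k j))"
  proof -
    have "Re (\<Sum>k\<in>UNIV. b k x * E1 k x) = (\<Sum>k\<in>UNIV. \<Sum>m\<in>UNIV. 2 * (partial k a x * Re (cnj (?W m) * ?W2 k m)))"
      unfolding Re_sum E1_def by (intro sum.cong refl) (simp add: sum_distrib_left algebra_simps)
    also have "\<dots> = (\<Sum>m\<in>UNIV. \<Sum>k\<in>UNIV. 2 * (partial k a x * Re (cnj (?W m) * ?W2 m k)))"
      by (subst sum.swap, subst w_symm) (rule refl)
    also have "\<dots> = 2 * Re (\<Sum>k\<in>UNIV. \<Sum>j\<in>UNIV. b j x * (cnj (?W k) * ?W2 k j))"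
      by (simp add: Re_sum sum_distrib_left algebra_simps)
    finally show ?thesis .
  qed
  have 3: "(\<Sum>k\<in>UNIV. b2 k k x) = L x" by (simp add: laplacian_def)
  have 4: "Re (\<Sum>k\<in>UNIV. L1 k x * (cnj (w x) * ?W k + cnj (?W k) * w x)) = 2 * Re (\<Sum>k\<in>UNIV. L1 k x * (cnj (?W k) * w x))"
    by (simp add: Re_sum sum_distrib_left algebra_simps)
  have eq: "(\<Sum>k\<in>UNIV. (- 1 / 2) * (cnj (?W k) * G1 k x) + (1 / 2) * (b k x * E1 k x) + (1 / 2) * (b2 k k x * E x)
     + (1 / 4) * (L1 k x * (cnj w' * ?W k + cnj (?W k) * w')))
    = (- 1 / 2) * (\<Sum>k\<in>UNIV. cnj (?W k) * G1 k x) + (1 / 2) * (\<Sum>k\<in>UNIV. b k x * E1 k x) + (1 / 2) * ((\<Sum>k\<in>UNIV. b2 k k x) * E x)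
     + (1 / 4) * (\<Sum>k\<in>UNIV. L1 k x * (cnj (w x) * ?W k + cnj (?W k) * w x))"
    unfolding that by (simp only: sum.distrib sum_distrib_left sum_distrib_right)
  have gen: "Re ((- 1 / 2) * (2 * A + 2 * B + T + C) + (1 / 2) * Y + (1 / 2) * T + (1 / 4) * Q) = - Re B"
    if "Re Y = 2 * Re A" "Re Q = 2 * Re C" for A B T C Y Q :: complex
    using that by (simp add: field_simps)
  show ?thesis unfolding eq 1 3 by (rule gen[OF 2 4])
qed

text \<open>The combination of the left integrand with the Hessian and bilaplacian terms is
  pointwise the real part of a divergence with bounded support.\<close>

lemma kinetic_identity:
  "- 1 / 2 * Re (LINT x|lborel. cnj (laplacian w x) * G x)
   = Re (LINT x|lborel. (\<Sum>k\<in>UNIV. \<Sum>j\<in>UNIV. b2 k j x * (cnj (partial k w x) * partial j w x)))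
     - 1 / 4 * Re (LINT x|lborel. LL x * (cnj (w x) * w x))"
proof -
  \<comment> \<open>The first summand integrates the Laplacian of w by parts, the second removes the
    second derivatives of w that this produces, and the third trades the gradient of the Laplacian
    of a for its bilaplacian.\<close>
  let ?\<Phi> = "\<lambda>k x. (- 1 / 2) * (cnj (partial k w x) * G x) + (1 / 2) * (b k x * E x) + (1 / 4) * (L1 k x * (cnj (w x) * w x))"
  let ?\<Phi>' = "\<lambda>k x. (- 1 / 2) * (cnj (partial k w x) * G1 k x + cnj (partial k (partial k w) x) * G x)
     + (1 / 2) * (b k x * E1 k x + b2 k k x * E x)
     + (1 / 4) * (L1 k x * (cnj (w x) * partial k w x + cnj (partial k w x) * w x) +
         complex_of_real (partial k (partial k (laplacian a)) x) * (cnj (w x) * w x))"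
  have zero: "(LINT x|lborel. (\<Sum>k\<in>UNIV. ?\<Phi>' k x)) = 0"
  proof (rule integral_divergence_eq_0[where \<Phi>="?\<Phi>" and r=R])
    show "has_partial k (?\<Phi> k) (?\<Phi>' k)" for k
      by (intro has_partial_add has_partial_cmult has_partial_mult has_partial_cnj hp hp_G hp_E)
    show "supp_in R (?\<Phi> k)" for k by (auto simp: supp_in_def outside outside_G)
  qed (intro continuous_intros)+
  let ?A = "\<lambda>x. cnj (laplacian w x) * G x"
  let ?B = "\<lambda>x. \<Sum>k\<in>UNIV. \<Sum>j\<in>UNIV. b2 k j x * (cnj (partial k w x) * partial j w x)"
  let ?C = "\<lambda>x. LL x * (cnj (w x) * w x)"
  have iA: "integrable lborel ?A" by (rule integrable_outside) (auto intro!: continuous_intros simp: outside_G)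
  have iB: "integrable lborel ?B" by (rule integrable_outside) (auto intro!: continuous_intros simp: outside)
  have iC: "integrable lborel ?C" by (rule integrable_outside) (auto intro!: continuous_intros simp: outside)
  have iP: "integrable lborel (\<lambda>x. \<Sum>k\<in>UNIV. ?\<Phi>' k x)"
    by (rule integrable_outside) (auto intro!: continuous_intros simp: outside outside_G outside_G1 supp_in_partial[OF supp_in_partial[OF supp_in_laplacian[OF a_supp]], unfolded supp_in_def, rule_format])
  have pt: "Re (\<Sum>k\<in>UNIV. ?\<Phi>' k x) = - 1 / 2 * Re (?A x) - Re (?B x) + 1 / 4 * Re (?C x)" for x
  proof -
    have "(\<Sum>k\<in>UNIV. ?\<Phi>' k x) = (\<Sum>k\<in>UNIV. (- 1 / 2) * (cnj (partial k w x) * G1 k x) + (1 / 2) * (b k x * E1 k x) + (1 / 2) * (b2 k k x * E x)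
     + (1 / 4) * (L1 k x * (cnj (w x) * partial k w x + cnj (partial k w x) * w x)))
      + ((- 1 / 2) * (\<Sum>k\<in>UNIV. cnj (partial k (partial k w) x) * G x) + (1 / 4) * (\<Sum>k\<in>UNIV. complex_of_real (partial k (partial k (laplacian a)) x) * (cnj (w x) * w x)))"
      by (simp only: sum.distrib[symmetric] sum_distrib_left) (simp add: algebra_simps)
    moreover have "(\<Sum>k\<in>UNIV. cnj (partial k (partial k w) x) * G x) = ?A x"
      by (simp add: laplacian_def sum_distrib_right)
    moreover have "(\<Sum>k\<in>UNIV. complex_of_real (partial k (partial k (laplacian a)) x) * (cnj (w x) * w x)) = ?C x"
      by (simp add: laplacian_def[of "laplacian a"] sum_distrib_right)
    ultimately show ?thesis using kinetic_pointwise[of "w x" x] by simp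
  qed
  have "0 = Re (LINT x|lborel. (\<Sum>k\<in>UNIV. ?\<Phi>' k x))" using zero by simp
  also have "\<dots> = (LINT x|lborel. Re (\<Sum>k\<in>UNIV. ?\<Phi>' k x))" using iP by (rule integral_Re[symmetric])
  also have "\<dots> = (LINT x|lborel. - 1 / 2 * Re (?A x) - Re (?B x) + 1 / 4 * Re (?C x))" by (simp only: pt)
  also have "\<dots> = - 1 / 2 * (LINT x|lborel. Re (?A x)) - (LINT x|lborel. Re (?B x)) + 1 / 4 * (LINT x|lborel. Re (?C x))"
    using integrable_Re[OF iA] integrable_Re[OF iB] integrable_Re[OF iC] by simp
  finally show ?thesis using integral_Re[OF iA] integral_Re[OF iB] integral_Re[OF iC] by simp
qed

text \<open>Here F plays the role of the time derivative of w, and the left side is the resulting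
  rate of the momentum. Integrating the flux \<open>b k * (cnj w * F)\<close> by parts takes the
  derivative off F, and the two halves combine into the multiplier \<open>G\<close>.\<close>

lemma momentum_identity:
  assumes F: "smooth F"
  shows "(LINT x|lborel. (\<Sum>j\<in>UNIV. partial j a x * Im (cnj (F x) * partial j w x + cnj (w x) * partial j F x)))
    = Im (LINT x|lborel. cnj (F x) * G x)"
proof -
  let ?\<Phi> = "\<lambda>k x. b k x * (cnj (w x) * F x)"
  let ?\<Phi>' = "\<lambda>k x. b k x * (cnj (w x) * partial k F x + cnj (partial k w x) * F x) + b2 k k x * (cnj (w x) * F x)"
  have c[continuous_intros]: "continuous_on UNIV F" "continuous_on UNIV (partial k F)" for k
    by (intro smooth_continuous smooth_partial F)+
  have zero: "(LINT x|lborel. (\<Sum>k\<in>UNIV. ?\<Phi>' k x)) = 0"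
  proof (rule integral_divergence_eq_0[where \<Phi>="?\<Phi>" and r=R])
    show "has_partial k (?\<Phi> k) (?\<Phi>' k)" for k
      by (intro has_partial_add has_partial_cmult has_partial_mult has_partial_cnj hp smooth_has_partial F)
    show "supp_in R (?\<Phi> k)" for k by (auto simp: supp_in_def outside)
  qed (intro continuous_intros)+
  let ?A = "\<lambda>x. cnj (F x) * G x"
  have iA: "integrable lborel ?A" by (rule integrable_outside) (auto intro!: continuous_intros simp: outside_G)
  have iP: "integrable lborel (\<lambda>x. \<Sum>k\<in>UNIV. ?\<Phi>' k x)"
    by (rule integrable_outside) (auto intro!: continuous_intros simp: outside)
  have pt: "(\<Sum>j\<in>UNIV. partial j a x * Im (cnj (F x) * partial j w x + cnj (w x) * partial j F x))
    = Im (?A x) + Im (\<Sum>k\<in>UNIV. ?\<Phi>' k x)" for x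
  proof -
    let ?S = "\<Sum>j\<in>UNIV. b j x * partial j w x"
    have 1: "(\<Sum>j\<in>UNIV. partial j a x * Im (cnj (F x) * partial j w x + cnj (w x) * partial j F x))
      = Im (cnj (F x) * ?S + (\<Sum>j\<in>UNIV. b j x * (cnj (w x) * partial j F x)))"
    proof -
      have "(\<Sum>j\<in>UNIV. partial j a x * Im (cnj (F x) * partial j w x + cnj (w x) * partial j F x))
        = Im (\<Sum>j\<in>UNIV. b j x * (cnj (F x) * partial j w x + cnj (w x) * partial j F x))"
        by (simp add: Im_sum)
      also have "(\<Sum>j\<in>UNIV. b j x * (cnj (F x) * partial j w x + cnj (w x) * partial j F x))
        = cnj (F x) * ?S + (\<Sum>j\<in>UNIV. b j x * (cnj (w x) * partial j F x))"
        by (simp add: distrib_left sum.distrib sum_distrib_left mult_ac)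
      finally show ?thesis .
    qed
    have 2: "(\<Sum>k\<in>UNIV. ?\<Phi>' k x) = (\<Sum>j\<in>UNIV. b j x * (cnj (w x) * partial j F x)) + cnj ?S * F x + L x * (cnj (w x) * F x)"
    proof -
      have "(\<Sum>k\<in>UNIV. ?\<Phi>' k x) = (\<Sum>j\<in>UNIV. b j x * (cnj (w x) * partial j F x)) + (\<Sum>j\<in>UNIV. b j x * (cnj (partial j w x) * F x))
         + (\<Sum>k\<in>UNIV. b2 k k x * (cnj (w x) * F x))"
        by (simp only: distrib_left sum.distrib)
      moreover have "(\<Sum>j\<in>UNIV. b j x * (cnj (partial j w x) * F x)) = cnj ?S * F x"
        by (simp add: sum_distrib_right sum_distrib_left mult_ac)
      moreover have "(\<Sum>k\<in>UNIV. b2 k k x * (cnj (w x) * F x)) = L x * (cnj (w x) * F x)"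
        by (simp add: laplacian_def sum_distrib_right)
      ultimately show ?thesis by simp
    qed
    have gen: "Im (cnj f * S + T) = Im (cnj f * (2 * S + complex_of_real l * z)) + Im (T + cnj S * f + complex_of_real l * (cnj z * f))"
      for f S T z :: complex and l
      by (simp add: algebra_simps)
    show ?thesis unfolding 1 2 G_def by (rule gen)
  qed
  have "(LINT x|lborel. (\<Sum>j\<in>UNIV. partial j a x * Im (cnj (F x) * partial j w x + cnj (w x) * partial j F x)))
     = (LINT x|lborel. Im (?A x)) + (LINT x|lborel. Im (\<Sum>k\<in>UNIV. ?\<Phi>' k x))"
    unfolding pt by (rule Bochner_Integration.integral_add[OF integrable_Im[OF iA] integrable_Im[OF iP]])
  also have "\<dots> = Im (LINT x|lborel. ?A x)"
    unfolding integral_Im[OF iA] integral_Im[OF iP] zero by simp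
  finally show ?thesis .
qed

text \<open>The flux is the gradient of a times \<open>V |w|^2 + \<beta>/2 |w|^4\<close>. In the V
  part only the derivative falling on V survives; in the quartic part the Laplacian of a survives
  with half of its coefficient.\<close>

lemma potential_identity:
  fixes V :: "real ^ 'd \<Rightarrow> real" and \<beta> :: real
  assumes V: "smooth V"
  shows "Re (LINT x|lborel. cnj (complex_of_real (V x) * w x + complex_of_real \<beta> * (complex_of_real ((cmod (w x))\<^sup>2) * w x)) * G x)
    = - Re (LINT x|lborel. (\<Sum>j\<in>UNIV. b j x * complex_of_real (partial j V x)) * (cnj (w x) * w x))
      + \<beta> / 2 * Re (LINT x|lborel. L x * (cnj (w x) * (complex_of_real ((cmod (w x))\<^sup>2) * w x)))"
proof -
  let ?q = "\<lambda>x. cnj (w x) * w x"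
  let ?q1 = "\<lambda>k x. cnj (w x) * partial k w x + cnj (partial k w x) * w x"
  let ?V = "\<lambda>x. complex_of_real (V x)" and ?V1 = "\<lambda>k x. complex_of_real (partial k V x)"
  let ?\<beta> = "complex_of_real \<beta>"
  have qq: "complex_of_real ((cmod (w x))\<^sup>2) = ?q x" for x by (simp only: complex_norm_square mult.commute)
  let ?\<Phi> = "\<lambda>k x. b k x * (?V x * ?q x + ?\<beta> / 2 * (?q x * ?q x))"
  let ?\<Phi>' = "\<lambda>k x. b k x * ((?V x * ?q1 k x + ?V1 k x * ?q x) + ?\<beta> / 2 * (?q x * ?q1 k x + ?q1 k x * ?q x))
     + b2 k k x * (?V x * ?q x + ?\<beta> / 2 * (?q x * ?q x))"
  have c[continuous_intros]: "continuous_on UNIV V" "continuous_on UNIV (partial k V)" for k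
    by (intro smooth_continuous smooth_partial V)+
  have zero: "(LINT x|lborel. (\<Sum>k\<in>UNIV. ?\<Phi>' k x)) = 0"
  proof (rule integral_divergence_eq_0[where \<Phi>="?\<Phi>" and r=R])
    show "has_partial k (?\<Phi> k) (?\<Phi>' k)" for k
      by (intro has_partial_add has_partial_cmult has_partial_mult has_partial_cnj hp has_partial_of_real[OF smooth_has_partial[OF V]])
    show "supp_in R (?\<Phi> k)" for k by (auto simp: supp_in_def outside)
  qed (intro continuous_intros)+
  let ?A = "\<lambda>x. cnj (?V x * w x + ?\<beta> * (?q x * w x)) * G x"
  let ?B = "\<lambda>x. (\<Sum>j\<in>UNIV. b j x * ?V1 j x) * ?q x"
  let ?C = "\<lambda>x. L x * (cnj (w x) * (?q x * w x))"
  have iA: "integrable lborel ?A" by (rule integrable_outside) (auto intro!: continuous_intros simp: outside_G)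
  have iB: "integrable lborel ?B" by (rule integrable_outside) (auto intro!: continuous_intros simp: outside)
  have iC: "integrable lborel ?C" by (rule integrable_outside) (auto intro!: continuous_intros simp: outside)
  have iP: "integrable lborel (\<lambda>x. \<Sum>k\<in>UNIV. ?\<Phi>' k x)"
    by (rule integrable_outside) (auto intro!: continuous_intros simp: outside)
  have pt: "Re (?A x) = Re (\<Sum>k\<in>UNIV. ?\<Phi>' k x) - Re (?B x) + \<beta> / 2 * Re (?C x)" for x
  proof -
    let ?S = "\<Sum>j\<in>UNIV. b j x * partial j w x"
    have S: "(\<Sum>k\<in>UNIV. b k x * ?q1 k x) = cnj (w x) * ?S + cnj ?S * w x"
      by (simp add: sum_distrib_left sum_distrib_right distrib_left sum.distrib mult_ac)
    have L: "L x = (\<Sum>k\<in>UNIV. b2 k k x)" by (simp add: laplacian_def)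
    have "(\<Sum>k\<in>UNIV. ?\<Phi>' k x) = (\<Sum>k\<in>UNIV. (?V x + ?\<beta> * ?q x) * (b k x * ?q1 k x) + b k x * ?V1 k x * ?q x + b2 k k x * (?V x * ?q x + ?\<beta> / 2 * (?q x * ?q x)))"
      by (intro sum.cong refl) (simp add: algebra_simps)
    also have "\<dots> = (?V x + ?\<beta> * ?q x) * (\<Sum>k\<in>UNIV. b k x * ?q1 k x) + ?B x + L x * (?V x * ?q x + ?\<beta> / 2 * (?q x * ?q x))"
      unfolding L by (simp only: sum.distrib sum_distrib_left sum_distrib_right)
    finally have 1: "(\<Sum>k\<in>UNIV. ?\<Phi>' k x) = (?V x + ?\<beta> * ?q x) * (cnj (w x) * ?S + cnj ?S * w x) + ?B x + L x * (?V x * ?q x + ?\<beta> / 2 * (?q x * ?q x))"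
      unfolding S .
    have gen: "Re (cnj (complex_of_real v * z + ?\<beta> * (complex_of_real q * z)) * (2 * S + complex_of_real l * z)) =
        Re ((complex_of_real v + ?\<beta> * complex_of_real q) * (cnj z * S + cnj S * z) + B + complex_of_real l * (complex_of_real v * complex_of_real q + ?\<beta> / 2 * (complex_of_real q * complex_of_real q))) - Re B
        + \<beta> / 2 * Re (complex_of_real l * (cnj z * (complex_of_real q * z)))" if "q = (cmod z)\<^sup>2" for v q l and z S B :: complex
      unfolding that cmod_power2 by (simp add: power2_eq_square) (simp add: field_simps)
    show ?thesis unfolding 1 unfolding G_def qq[symmetric] by (rule gen) (rule refl)
  qed
  have "Re (LINT x|lborel. ?A x) = (LINT x|lborel. Re (\<Sum>k\<in>UNIV. ?\<Phi>' k x) - Re (?B x) + \<beta> / 2 * Re (?C x))"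
    unfolding integral_Re[OF iA, symmetric] pt ..
  also have "\<dots> = (LINT x|lborel. Re (\<Sum>k\<in>UNIV. ?\<Phi>' k x)) - (LINT x|lborel. Re (?B x)) + \<beta> / 2 * (LINT x|lborel. Re (?C x))"
    using integrable_Re[OF iP] integrable_Re[OF iB] integrable_Re[OF iC] by simp
  finally show ?thesis
    unfolding qq integral_Re[OF iP] integral_Re[OF iB] integral_Re[OF iC] zero by simp
qed

text \<open>The function H is arbitrary because it will be the mollified nonlinearity: at the
  mollified level \<open>cnj w * H\<close> need not be real, and its imaginary part must be carried
  along.\<close>

lemma mass_identity:
  assumes H: "continuous_on UNIV H"
  shows "(LINT x|lborel. a x * (2 * Re (cnj (w x) * (\<i> / 2 * laplacian w x - \<i> * H x))))
    = Im (LINT x|lborel. cnj (w x) * (\<Sum>j\<in>UNIV. b j x * partial j w x)) + 2 * Im (LINT x|lborel. cnj (w x) * (complex_of_real (a x) * H x))"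
proof -
  let ?a = "\<lambda>x. complex_of_real (a x)"
  let ?\<Phi> = "\<lambda>k x. ?a x * (cnj (w x) * partial k w x)"
  let ?\<Phi>' = "\<lambda>k x. ?a x * (cnj (w x) * partial k (partial k w) x + cnj (partial k w x) * partial k w x) + b k x * (cnj (w x) * partial k w x)"
  note H[continuous_intros]
  have zero: "(LINT x|lborel. (\<Sum>k\<in>UNIV. ?\<Phi>' k x)) = 0"
  proof (rule integral_divergence_eq_0[where \<Phi>="?\<Phi>" and r=R])
    show "has_partial k (?\<Phi> k) (?\<Phi>' k)" for k
      by (intro has_partial_add has_partial_cmult has_partial_mult has_partial_cnj hp)
    show "supp_in R (?\<Phi> k)" for k by (auto simp: supp_in_def outside)
  qed (intro continuous_intros)+
  let ?A = "\<lambda>x. cnj (w x) * (\<Sum>j\<in>UNIV. b j x * partial j w x)"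
  let ?B = "\<lambda>x. cnj (w x) * (?a x * H x)"
  have iA: "integrable lborel ?A" by (rule integrable_outside) (auto intro!: continuous_intros simp: outside)
  have iB: "integrable lborel ?B" by (rule integrable_outside) (auto intro!: continuous_intros simp: outside)
  have iP: "integrable lborel (\<lambda>x. \<Sum>k\<in>UNIV. ?\<Phi>' k x)"
    by (rule integrable_outside) (auto intro!: continuous_intros simp: outside)
  have pt: "a x * (2 * Re (cnj (w x) * (\<i> / 2 * laplacian w x - \<i> * H x))) = - Im (\<Sum>k\<in>UNIV. ?\<Phi>' k x) + Im (?A x) + 2 * Im (?B x)" for x
  proof -
    have "(\<Sum>k\<in>UNIV. ?\<Phi>' k x) = ?a x * (cnj (w x) * laplacian w x) + ?a x * (\<Sum>k\<in>UNIV. cnj (partial k w x) * partial k w x) + ?A x"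
      by (simp add: laplacian_def distrib_left sum.distrib sum_distrib_left mult_ac)
    moreover have "Im (?a x * (\<Sum>k\<in>UNIV. cnj (partial k w x) * partial k w x)) = 0"
      by (simp add: Im_sum)
    ultimately have "Im (\<Sum>k\<in>UNIV. ?\<Phi>' k x) = Im (?a x * (cnj (w x) * laplacian w x)) + Im (?A x)"
      by (simp del: Im_sum Im_complex_of_real)
    moreover have "a x * (2 * Re (cnj z * (\<i> / 2 * l - \<i> * h))) = - Im (?a x * (cnj z * l)) + 2 * Im (cnj z * (?a x * h))" for z l h
      by (simp add: field_simps)
    ultimately show ?thesis by simp
  qed
  have "(LINT x|lborel. a x * (2 * Re (cnj (w x) * (\<i> / 2 * laplacian w x - \<i> * H x))))
     = - (LINT x|lborel. Im (\<Sum>k\<in>UNIV. ?\<Phi>' k x)) + (LINT x|lborel. Im (?A x)) + 2 * (LINT x|lborel. Im (?B x))"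
  proof -
    have "(LINT x|lborel. - p x + q x + 2 * r x) = - (LINT x|lborel. p x) + (LINT x|lborel. q x) + 2 * (LINT x|lborel. r x)"
      if "integrable lborel p" "integrable lborel q" "integrable lborel r" for p q r :: "real ^ 'd \<Rightarrow> real"
      using that by simp
    from this[OF integrable_Im[OF iP] integrable_Im[OF iA] integrable_Im[OF iB]] show ?thesis unfolding pt .
  qed
  then show ?thesis unfolding integral_Im[OF iP] integral_Im[OF iA] integral_Im[OF iB] zero by simp
qed

end

section \<open>Virial identities at a fixed time\<close>

text \<open>The mean value theorem in direction j, applied to the increment of f in direction k, and
  then in direction k.\<close>

lemma second_difference_eq_mixed_partial:
  fixes f :: "real ^ 'd::finite \<Rightarrow> real"
  assumes f: "smooth f" and h: "0 < h"
  obtains s t where "0 < s" "s < h" "0 < t" "t < h"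
    "f (x + h *\<^sub>R axis j 1 + h *\<^sub>R axis k 1) - f (x + h *\<^sub>R axis j 1) - f (x + h *\<^sub>R axis k 1) + f x
      = h * h * partial k (partial j f) (x + s *\<^sub>R axis j 1 + t *\<^sub>R axis k 1)"
proof -
  let ?e = "axis j 1 :: real ^ 'd" and ?d = "axis k 1 :: real ^ 'd"
  have line: "DERIV (\<lambda>s. g (y + s *\<^sub>R axis i 1)) s :> partial i g (y + s *\<^sub>R axis i 1)" if "smooth g" for g :: "real ^ 'd \<Rightarrow> real" and y i s
    using has_partial_line[OF smooth_has_partial[OF that, of i], where x=y and s=s]
    by (simp add: has_real_derivative_iff_has_vector_derivative)
  have "DERIV (\<lambda>s. f (x + h *\<^sub>R ?d + s *\<^sub>R ?e) - f (x + s *\<^sub>R ?e)) s :> partial j f (x + h *\<^sub>R ?d + s *\<^sub>R ?e) - partial j f (x + s *\<^sub>R ?e)" for s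
    by (intro DERIV_diff line f)
  from MVT2[OF h, of "\<lambda>s. f (x + h *\<^sub>R ?d + s *\<^sub>R ?e) - f (x + s *\<^sub>R ?e)", OF this]
  obtain s where s: "0 < s" "s < h" "f (x + h *\<^sub>R ?d + h *\<^sub>R ?e) - f (x + h *\<^sub>R ?e) - (f (x + h *\<^sub>R ?d) - f x)
     = h * (partial j f (x + h *\<^sub>R ?d + s *\<^sub>R ?e) - partial j f (x + s *\<^sub>R ?e))" by auto
  have "DERIV (\<lambda>t. partial j f (x + s *\<^sub>R ?e + t *\<^sub>R ?d)) t :> partial k (partial j f) (x + s *\<^sub>R ?e + t *\<^sub>R ?d)" for t
    by (intro line smooth_partial f)
  from MVT2[OF h, of "\<lambda>t. partial j f (x + s *\<^sub>R ?e + t *\<^sub>R ?d)", OF this]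
  obtain t where t: "0 < t" "t < h" "partial j f (x + s *\<^sub>R ?e + h *\<^sub>R ?d) - partial j f (x + s *\<^sub>R ?e) = h * partial k (partial j f) (x + s *\<^sub>R ?e + t *\<^sub>R ?d)"
    by auto
  have "f (x + h *\<^sub>R ?e + h *\<^sub>R ?d) - f (x + h *\<^sub>R ?e) - f (x + h *\<^sub>R ?d) + f x = h * h * partial k (partial j f) (x + s *\<^sub>R ?e + t *\<^sub>R ?d)"
    using s(3) t(3) by (simp add: algebra_simps)
  with s t that show ?thesis by blast
qed

text \<open>The second difference is symmetric in j and k, so the two mixed derivatives agree at a
  pair of points whose distance to x is of the order of the step. Let the step tend to 0 and use
  continuity.\<close>

lemma mixed_partials_commute:
  fixes f :: "real ^ 'd::finite \<Rightarrow> real"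
  assumes f: "smooth f"
  shows "partial k (partial j f) = partial j (partial k f)"
proof
  fix x
  let ?e = "axis j 1 :: real ^ 'd" and ?d = "axis k 1 :: real ^ 'd"
  let ?h = "\<lambda>n :: nat. 1 / real (Suc n)"
  have "\<exists>s t s' t'. 0 < s \<and> s < ?h n \<and> 0 < t \<and> t < ?h n \<and> 0 < s' \<and> s' < ?h n \<and> 0 < t' \<and> t' < ?h n \<and>
     partial k (partial j f) (x + s *\<^sub>R ?e + t *\<^sub>R ?d) = partial j (partial k f) (x + s' *\<^sub>R ?d + t' *\<^sub>R ?e)" for n
  proof -
    obtain s t where 1: "0 < s" "s < ?h n" "0 < t" "t < ?h n"
      "f (x + ?h n *\<^sub>R ?e + ?h n *\<^sub>R ?d) - f (x + ?h n *\<^sub>R ?e) - f (x + ?h n *\<^sub>R ?d) + f x = ?h n * ?h n * partial k (partial j f) (x + s *\<^sub>R ?e + t *\<^sub>R ?d)"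
      using second_difference_eq_mixed_partial[OF f, of "?h n" x j k] by auto
    obtain s' t' where 2: "0 < s'" "s' < ?h n" "0 < t'" "t' < ?h n"
      "f (x + ?h n *\<^sub>R ?d + ?h n *\<^sub>R ?e) - f (x + ?h n *\<^sub>R ?d) - f (x + ?h n *\<^sub>R ?e) + f x = ?h n * ?h n * partial j (partial k f) (x + s' *\<^sub>R ?d + t' *\<^sub>R ?e)"
      using second_difference_eq_mixed_partial[OF f, of "?h n" x k j] by auto
    have "?h n * ?h n * partial k (partial j f) (x + s *\<^sub>R ?e + t *\<^sub>R ?d) = ?h n * ?h n * partial j (partial k f) (x + s' *\<^sub>R ?d + t' *\<^sub>R ?e)"
      using 1(5) 2(5) by (simp add: algebra_simps)
    then have "partial k (partial j f) (x + s *\<^sub>R ?e + t *\<^sub>R ?d) = partial j (partial k f) (x + s' *\<^sub>R ?d + t' *\<^sub>R ?e)" by simp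
    with 1 2 show ?thesis by blast
  qed
  then obtain s t s' t' where st: "\<And>n. 0 < s n" "\<And>n. s n < ?h n" "\<And>n. 0 < t n" "\<And>n. t n < ?h n" "\<And>n. 0 < s' n" "\<And>n. s' n < ?h n" "\<And>n. 0 < t' n" "\<And>n. t' n < ?h n"
    and eq: "\<And>n. partial k (partial j f) (x + s n *\<^sub>R ?e + t n *\<^sub>R ?d) = partial j (partial k f) (x + s' n *\<^sub>R ?d + t' n *\<^sub>R ?e)"
    by metis
  have h0: "?h \<longlonglongrightarrow> 0" by (rule LIMSEQ_Suc[OF lim_1_over_n])
  have lim: "r \<longlonglongrightarrow> 0" if "\<And>n. 0 < r n" "\<And>n. r n < ?h n" for r :: "nat \<Rightarrow> real"
    by (rule tendsto_sandwich[OF _ _ tendsto_const h0]) (use that in \<open>auto intro!: always_eventually less_imp_le\<close>)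
  have "(\<lambda>n. x + s n *\<^sub>R ?e + t n *\<^sub>R ?d) \<longlonglongrightarrow> x + 0 *\<^sub>R ?e + 0 *\<^sub>R ?d"
    by (intro tendsto_intros lim st)
  then have 1: "(\<lambda>n. partial k (partial j f) (x + s n *\<^sub>R ?e + t n *\<^sub>R ?d)) \<longlonglongrightarrow> partial k (partial j f) x"
    by (intro continuous_on_tendsto_compose[OF smooth_continuous[OF smooth_partial[OF smooth_partial[OF f]]]]) auto
  have "(\<lambda>n. x + s' n *\<^sub>R ?d + t' n *\<^sub>R ?e) \<longlonglongrightarrow> x + 0 *\<^sub>R ?d + 0 *\<^sub>R ?e"
    by (intro tendsto_intros lim st)
  then have 2: "(\<lambda>n. partial j (partial k f) (x + s' n *\<^sub>R ?d + t' n *\<^sub>R ?e)) \<longlonglongrightarrow> partial j (partial k f) x"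
    by (intro continuous_on_tendsto_compose[OF smooth_continuous[OF smooth_partial[OF smooth_partial[OF f]]]]) auto
  show "partial k (partial j f) x = partial j (partial k f) x"
    using LIMSEQ_unique[OF 1] 2 by (simp add: eq)
qed

lemma Cc_smooth_laplacian: "Cc_smooth \<eta> \<Longrightarrow> Cc_smooth (laplacian \<eta>)"
  using smooth_laplacian supp_in_laplacian unfolding Cc_smooth_def by blast

lemma partial_sum:
  assumes "\<And>i. i \<in> A \<Longrightarrow> f i differentiable (at x)"
  shows "partial j (\<lambda>x. \<Sum>i\<in>A. f i x) x = (\<Sum>i\<in>A. partial j (f i) x)"
proof -
  have "((\<lambda>x. \<Sum>i\<in>A. f i x) has_derivative (\<lambda>h. \<Sum>i\<in>A. frechet_derivative (f i) (at x) h)) (at x)"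
    using assms frechet_derivative_works by (intro has_derivative_sum) blast
  from partial_eqI[OF this] show ?thesis by (simp add: partial_def)
qed

lemma laplacian_partial_commute:
  fixes f :: "real ^ 'd::finite \<Rightarrow> real"
  assumes f: "smooth f"
  shows "laplacian (partial j f) = partial j (laplacian f)"
proof
  fix x
  have "partial j (laplacian f) x = (\<Sum>i\<in>UNIV. partial j (partial i (partial i f)) x)"
    unfolding laplacian_def[abs_def]
    by (intro partial_sum smooth_differentiable smooth_partial f)
  also have "\<dots> = (\<Sum>i\<in>UNIV. partial i (partial i (partial j f)) x)"
    using mixed_partials_commute[OF f] mixed_partials_commute[OF smooth_partial[OF f]] by metis
  finally show "laplacian (partial j f) x = partial j (laplacian f) x" by (simp add: laplacian_def)
qed

text \<open>All derivatives fall on the kernel, which is real and smooth, so the symmetry for real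
  functions carries over to a complex u that is merely locally integrable.\<close>

lemma conv_partial_commute:
  assumes "locally_integrable u" "Cc_smooth \<eta>"
  shows "partial k (partial j (conv \<eta> u)) = partial j (partial k (conv \<eta> u))"
  using assms mixed_partials_commute[of \<eta> k j]
  by (simp add: partial_conv Cc_smooth_partial) (simp add: Cc_smooth_def)

lemma conv_add_kernel:
  assumes "locally_integrable u" "\<And>i. i \<in> A \<Longrightarrow> Cc_smooth (\<eta> i)"
  shows "conv (\<lambda>x. \<Sum>i\<in>A. \<eta> i x) u x = (\<Sum>i\<in>A. conv (\<eta> i) u x)"
  unfolding conv_def of_real_sum sum_distrib_left
  by (rule Bochner_Integration.integral_sum) (intro conv_integrable assms)

lemma laplacian_conv:
  assumes "locally_integrable u" "Cc_smooth \<eta>"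
  shows "laplacian (conv \<eta> u) = conv (laplacian \<eta>) u"
proof
  fix x
  have "laplacian (conv \<eta> u) x = (\<Sum>i\<in>UNIV. conv (partial i (partial i \<eta>)) u x)"
    using assms by (simp add: laplacian_def partial_conv Cc_smooth_partial)
  also have "\<dots> = conv (laplacian \<eta>) u x"
    unfolding laplacian_def[abs_def] by (rule conv_add_kernel[symmetric]) (use assms in \<open>auto intro: Cc_smooth_partial\<close>)
  finally show "laplacian (conv \<eta> u) x = conv (laplacian \<eta>) u x" .
qed

lemma norm_L2_reflect:
  fixes f :: "real ^ 'd::finite \<Rightarrow> 'b::euclidean_space"
  assumes "f \<in> L2"
  shows "(\<lambda>y. f (x - y)) \<in> L2" "norm_L2 (\<lambda>y. f (x - y)) \<le> norm_L2 f"
proof -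
  have [measurable]: "f \<in> borel_measurable borel" using assms by (rule L2D)
  have "(\<integral>\<^sup>+y. ennreal ((norm (f (x - y)))\<^sup>2) \<partial>lborel) = ennreal ((norm_L2 f)\<^sup>2)"
    using nn_integral_lborel_reflect[of "\<lambda>y. ennreal ((norm (f y))\<^sup>2)" x] nn_integral_L2[OF assms] by simp
  then show "(\<lambda>y. f (x - y)) \<in> L2" "norm_L2 (\<lambda>y. f (x - y)) \<le> norm_L2 f"
    by (auto intro!: L2_from_nn_integral norm_L2_nonneg)
qed

lemma Cc_smooth_L2: 
  fixes f :: "real ^ 'd::finite \<Rightarrow> 'b::euclidean_space"
  shows "Cc_smooth f \<Longrightarrow> f \<in> L2"
  using L2_supp_in smooth_continuous unfolding Cc_smooth_def by blast

lemma norm_conv_le: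
  assumes u: "u \<in> L2" and \<eta>: "Cc_smooth \<eta>"
  shows "norm (conv \<eta> u x) \<le> norm_L2 \<eta> * norm_L2 u"
proof -
  let ?f = "\<lambda>y. complex_of_real (\<eta> (x - y))"
  have r: "(\<lambda>y. \<eta> (x - y)) \<in> L2" "norm_L2 (\<lambda>y. \<eta> (x - y)) \<le> norm_L2 \<eta>"
    using norm_L2_reflect[OF Cc_smooth_L2[OF \<eta>]] by auto
  have n: "norm_L2 ?f = norm_L2 (\<lambda>y. \<eta> (x - y))" by (simp add: norm_L2_def)
  have "?f \<in> L2" using L2D[OF r(1)] by (auto intro!: L2I)
  then have "norm (conv \<eta> u x) \<le> norm_L2 u * norm_L2 ?f"
    unfolding conv_def by (rule norm_integral_mult_le[OF u])
  also have "\<dots> \<le> norm_L2 u * norm_L2 \<eta>" unfolding n by (intro mult_left_mono r norm_L2_nonneg)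
  finally show ?thesis by (simp add: mult.commute)
qed

text \<open>A kernel of radius r evaluated at x sees u only within distance r. Hence on the support
  of the weight the mollified nonlinearity depends only on its truncation to a larger ball.\<close>

lemma conv_local:
  assumes "supp_in r \<eta>" "norm x \<le> R" "R + r \<le> S"
  shows "conv \<eta> u x = conv \<eta> (\<lambda>y. complex_of_real (indicat_real (cball 0 S) y) * u y) x"
  unfolding conv_def
proof (rule Bochner_Integration.integral_cong[OF refl])
  fix y
  show "u y * complex_of_real (\<eta> (x - y)) = complex_of_real (indicat_real (cball 0 S) y) * u y * complex_of_real (\<eta> (x - y))"
  proof (cases "norm y \<le> S")
    case False
    then have "r < norm (x - y)" using assms norm_triangle_ineq2[of y x] by (simp add: norm_minus_commute)
    then show ?thesis using assms(1) by (simp add: supp_in_def)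
  qed simp
qed

section \<open>The cubic nonlinearity as a continuous map from L6 to L2\<close>

definition cub :: "complex \<Rightarrow> complex" where
  "cub z = complex_of_real ((cmod z)\<^sup>2) * z"

lemma norm_cub: "cmod (cub z) = cmod z ^ 3"
  by (simp add: cub_def norm_mult norm_power power2_eq_square power3_eq_cube)

lemma cub_measurable [measurable]: "cub \<in> borel_measurable borel"
  unfolding cub_def by (intro borel_measurable_continuous_onI continuous_intros)

lemma L2_cub:
  fixes u :: "real ^ 'd::finite \<Rightarrow> complex"
  assumes "u \<in> borel_measurable borel" "integrable lborel (\<lambda>x. cmod (u x) ^ 6)"
  shows "(\<lambda>x. cub (u x)) \<in> L2"
  using assms by (intro L2I) (auto simp: norm_cub simp flip: power_mult)

text \<open>The bound involves only the limit b and the difference a - b, the two quantities whose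
  sixth powers are controlled. The 5 absorbs \<open>|a|^2 \<le> 2 |b|^2 + 2 |a - b|^2\<close> and
  \<open>2 |a| |b| \<le> |a|^2 + |b|^2\<close>.\<close>

lemma cub_diff_le:
  fixes a b :: complex
  shows "cmod (cub a - cub b) \<le> 5 * ((cmod b)\<^sup>2 + (cmod (a - b))\<^sup>2) * cmod (a - b)"
proof -
  let ?z = "cmod (a - b)"
  have ab: "cmod a \<le> cmod b + ?z" using norm_triangle_ineq[of b "a - b"] by simp
  have "cub a - cub b = complex_of_real ((cmod a)\<^sup>2) * (a - b) + complex_of_real ((cmod a)\<^sup>2 - (cmod b)\<^sup>2) * b"
    by (simp add: cub_def algebra_simps)
  then have "cmod (cub a - cub b) \<le> (cmod a)\<^sup>2 * ?z + \<bar>(cmod a)\<^sup>2 - (cmod b)\<^sup>2\<bar> * cmod b"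
    using norm_triangle_ineq[of "complex_of_real ((cmod a)\<^sup>2) * (a - b)" "complex_of_real ((cmod a)\<^sup>2 - (cmod b)\<^sup>2) * b"]
    by (simp only: norm_mult norm_of_real) simp
  also have "\<bar>(cmod a)\<^sup>2 - (cmod b)\<^sup>2\<bar> \<le> ?z * (cmod a + cmod b)"
  proof -
    have "(cmod a)\<^sup>2 - (cmod b)\<^sup>2 = (cmod a - cmod b) * (cmod a + cmod b)" by (simp add: power2_eq_square algebra_simps)
    moreover have "\<bar>cmod a - cmod b\<bar> \<le> ?z" by (rule norm_triangle_ineq3)
    ultimately show ?thesis by (simp add: abs_mult mult_right_mono)
  qed
  finally have "cmod (cub a - cub b) \<le> (cmod a)\<^sup>2 * ?z + ?z * (cmod a + cmod b) * cmod b" by (simp add: mult_right_mono)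
  also have "\<dots> = ((cmod a)\<^sup>2 + cmod a * cmod b + (cmod b)\<^sup>2) * ?z" by (simp add: algebra_simps power2_eq_square)
  also have "\<dots> \<le> 5 * ((cmod b)\<^sup>2 + ?z\<^sup>2) * ?z"
  proof (rule mult_right_mono)
    have 1: "(cmod a)\<^sup>2 \<le> 2 * (cmod b)\<^sup>2 + 2 * ?z\<^sup>2" using norm_add_sq_le[of b "a - b"] by simp
    have 2: "2 * (cmod a * cmod b) \<le> (cmod a)\<^sup>2 + (cmod b)\<^sup>2" using sum_squares_bound[of "cmod a" "cmod b"] by simp
    show "(cmod a)\<^sup>2 + cmod a * cmod b + (cmod b)\<^sup>2 \<le> 5 * ((cmod b)\<^sup>2 + ?z\<^sup>2)"
    proof -
      have gen: "A + X + B \<le> 5 * (B + Z)" if "A \<le> 2 * B + 2 * Z" "2 * X \<le> A + B" "0 \<le> B" "0 \<le> Z" for A B X Z :: real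
        unfolding distrib_left using that by linarith
      show ?thesis by (rule gen[OF 1 2]) auto
    qed
  qed simp
  finally show ?thesis .
qed

text \<open>A weighted Young inequality by comparing q with d p. A small d gives the p term, later
  the sixth power of the fixed limit, a small coefficient.\<close>

lemma young_3:
  fixes p q d :: real
  assumes "0 \<le> p" "0 \<le> q" "0 < d"
  shows "p\<^sup>2 * q \<le> d * p ^ 3 + q ^ 3 / d\<^sup>2"
proof (cases "q \<le> d * p")
  case True
  then have "p\<^sup>2 * q \<le> p\<^sup>2 * (d * p)" by (intro mult_left_mono) auto
  also have "\<dots> = d * p ^ 3" by (simp add: power2_eq_square power3_eq_cube)
  finally show ?thesis using assms by (simp add: add_increasing2)
next
  case False
  then have "p \<le> q / d" using assms by (simp add: field_simps)
  then have "p\<^sup>2 * q \<le> (q / d)\<^sup>2 * q" using assms by (intro mult_right_mono power_mono) auto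
  also have "\<dots> = q ^ 3 / d\<^sup>2" by (simp add: power2_eq_square power3_eq_cube)
  finally show ?thesis using assms by (simp add: add_increasing)
qed

text \<open>By \<open>cub_diff_le\<close> and \<open>young_3\<close> the squared L2 distance of the
  cubes is at most a small multiple of the L6 quantity of u plus a large multiple of that of the
  difference, which tends to 0.\<close>

lemma L2_lim_cub:
  fixes w :: "nat \<Rightarrow> real ^ 'd::finite \<Rightarrow> complex"
  assumes w: "\<And>n. w n \<in> borel_measurable borel" "\<And>n. integrable lborel (\<lambda>x. cmod (w n x) ^ 6)"
    and u: "u \<in> borel_measurable borel" "integrable lborel (\<lambda>x. cmod (u x) ^ 6)"
    and d: "\<And>n. integrable lborel (\<lambda>x. cmod (w n x - u x) ^ 6)" "(\<lambda>n. LINT x|lborel. cmod (w n x - u x) ^ 6) \<longlonglongrightarrow> 0"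
  shows "L2_lim (\<lambda>n x. cub (w n x)) (\<lambda>x. cub (u x))"
  unfolding L2_lim_def
proof (intro conjI allI)
  have cw: "(\<lambda>x. cub (w n x)) \<in> L2" for n by (rule L2_cub[OF w])
  have cu: "(\<lambda>x. cub (u x)) \<in> L2" by (rule L2_cub[OF u])
  show "(\<lambda>x. cub (w n x)) \<in> L2" "(\<lambda>x. cub (u x)) \<in> L2" for n by fact+
  define U where "U = (LINT x|lborel. cmod (u x) ^ 6)"
  have U: "0 \<le> U" by (auto simp: U_def intro!: integral_nonneg_AE)
  let ?Z = "\<lambda>n. LINT x|lborel. cmod (w n x - u x) ^ 6"
  have le: "(norm_L2 (\<lambda>x. cub (w n x) - cub (u x)))\<^sup>2 \<le> 50 * e * U + 50 * (1 + 1 / e\<^sup>2) * ?Z n" if e: "0 < e" for e n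
  proof -
    have pt: "(norm (cub (w n x) - cub (u x)))\<^sup>2 \<le> 50 * e * cmod (u x) ^ 6 + 50 * (1 + 1 / e\<^sup>2) * cmod (w n x - u x) ^ 6" for x
    proof -
      let ?b = "cmod (u x)" and ?z = "cmod (w n x - u x)"
      have "(norm (cub (w n x) - cub (u x)))\<^sup>2 \<le> (5 * (?b\<^sup>2 + ?z\<^sup>2) * ?z)\<^sup>2"
        by (intro power_mono cub_diff_le) auto
      also have "\<dots> = 25 * ((?b\<^sup>2 + ?z\<^sup>2)\<^sup>2 * ?z\<^sup>2)" by (simp only: power_mult_distrib) simp
      also have "\<dots> \<le> 25 * ((2 * (?b\<^sup>2)\<^sup>2 + 2 * (?z\<^sup>2)\<^sup>2) * ?z\<^sup>2)"
        using norm_add_sq_le[of "?b\<^sup>2" "?z\<^sup>2"] by (intro mult_left_mono mult_right_mono) auto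
      also have "\<dots> = 50 * ((?b\<^sup>2)\<^sup>2 * ?z\<^sup>2) + 50 * ?z ^ 6" by (simp add: algebra_simps flip: power_mult power_add)
      also have "(?b\<^sup>2)\<^sup>2 * ?z\<^sup>2 \<le> e * (?b\<^sup>2) ^ 3 + (?z\<^sup>2) ^ 3 / e\<^sup>2" by (rule young_3) (use e in auto)
      finally have "(norm (cub (w n x) - cub (u x)))\<^sup>2 \<le> 50 * (e * (?b\<^sup>2) ^ 3 + (?z\<^sup>2) ^ 3 / e\<^sup>2) + 50 * ?z ^ 6" by simp
      also have "\<dots> = 50 * e * ?b ^ 6 + 50 * (1 + 1 / e\<^sup>2) * ?z ^ 6" by (simp add: field_simps flip: power_mult)
      finally show ?thesis .
    qed
    have "(norm_L2 (\<lambda>x. cub (w n x) - cub (u x)))\<^sup>2 \<le> (LINT x|lborel. 50 * e * cmod (u x) ^ 6 + 50 * (1 + 1 / e\<^sup>2) * cmod (w n x - u x) ^ 6)"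
      unfolding norm_L2_sq by (intro integral_mono pt L2D(2)[OF L2_diff[OF cw cu]] Bochner_Integration.integrable_add integrable_mult_right u d)
    also have "\<dots> = 50 * e * U + 50 * (1 + 1 / e\<^sup>2) * ?Z n"
      using u d by (simp add: U_def)
    finally show ?thesis .
  qed
  have "(\<lambda>n. (norm_L2 (\<lambda>x. cub (w n x) - cub (u x)))\<^sup>2) \<longlonglongrightarrow> 0"
  proof (rule LIMSEQ_I)
    fix r :: real assume r: "0 < r"
    \<comment> \<open>With this choice \<open>50 * e * U\<close> is at most r / 2; the summand 1
      keeps the denominator positive when u vanishes.\<close>
    define e where "e = r / (100 * (U + 1))"
    have e: "0 < e" using r U by (simp add: e_def)
    have eU: "50 * e * U < r"
    proof -
      have "50 * e * U = r / 2 * (U / (U + 1))" using U by (simp add: e_def field_simps)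
      also have "\<dots> \<le> r / 2 * 1" using r U by (intro mult_left_mono) auto
      finally show ?thesis using r by simp
    qed
    have "(\<lambda>n. 50 * e * U + 50 * (1 + 1 / e\<^sup>2) * ?Z n) \<longlonglongrightarrow> 50 * e * U + 50 * (1 + 1 / e\<^sup>2) * 0"
      by (intro tendsto_intros d)
    then have "\<forall>\<^sub>F n in sequentially. 50 * e * U + 50 * (1 + 1 / e\<^sup>2) * ?Z n < r"
      using eU by (intro order_tendstoD(2)) auto
    then obtain N where "\<And>n. N \<le> n \<Longrightarrow> 50 * e * U + 50 * (1 + 1 / e\<^sup>2) * ?Z n < r" by (auto simp: eventually_sequentially)
    then have "norm ((norm_L2 (\<lambda>x. cub (w n x) - cub (u x)))\<^sup>2 - 0) < r" if "N \<le> n" for n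
      using le[OF e, of n] that by (simp add: order_le_less_trans)
    then show "\<exists>no. \<forall>n\<ge>no. norm ((norm_L2 (\<lambda>x. cub (w n x) - cub (u x)))\<^sup>2 - 0) < r" by blast
  qed
  then have "(\<lambda>n. sqrt ((norm_L2 (\<lambda>x. cub (w n x) - cub (u x)))\<^sup>2)) \<longlonglongrightarrow> sqrt 0" by (rule tendsto_real_sqrt)
  then show "(\<lambda>n. norm_L2 (\<lambda>x. cub (w n x) - cub (u x))) \<longlonglongrightarrow> 0" by (simp add: norm_L2_nonneg)
qed


lemma L2_lim_sum:
  fixes f :: "'i \<Rightarrow> nat \<Rightarrow> real ^ 'd::finite \<Rightarrow> 'b::euclidean_space"
  shows "(\<And>j. j \<in> A \<Longrightarrow> L2_lim (f j) (f0 j)) \<Longrightarrow> L2_lim (\<lambda>n x. \<Sum>j\<in>A. f j n x) (\<lambda>x. \<Sum>j\<in>A. f0 j x)"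
  by (induction A rule: infinite_finite_induct) (auto intro: L2_lim_add L2_lim_const)

lemma norm_L2_mult_bounded:
  fixes f :: "real ^ 'd::finite \<Rightarrow> complex"
  assumes "f \<in> L2" "c \<in> borel_measurable borel" "\<And>x. norm (c x) \<le> B"
  shows "norm_L2 (\<lambda>x. c x * f x) \<le> B * norm_L2 f"
proof -
  have B: "0 \<le> B" using assms(3) norm_ge_zero order_trans by blast
  have "norm_L2 (\<lambda>x. c x * f x) \<le> norm_L2 (\<lambda>x. B *\<^sub>R f x)"
  proof (rule norm_L2_mono(2)[OF L2_scaleR[OF assms(1)]])
    show "(\<lambda>x. c x * f x) \<in> borel_measurable borel" using L2_mult_bounded[OF assms] by (rule L2D)
    show "norm (c x * f x) \<le> norm (B *\<^sub>R f x)" for x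
      using mult_right_mono[OF assms(3), of "norm (f x)" x] B by (simp add: norm_mult)
  qed
  then show ?thesis using B by (simp add: norm_L2_scaleR)
qed

lemma norm_L2_sum_le:
  fixes f :: "'i \<Rightarrow> real ^ 'd::finite \<Rightarrow> 'b::euclidean_space"
  shows "(\<And>j. j \<in> A \<Longrightarrow> f j \<in> L2 \<and> norm_L2 (f j) \<le> b j) \<Longrightarrow> (\<lambda>x. \<Sum>j\<in>A. f j x) \<in> L2 \<and> norm_L2 (\<lambda>x. \<Sum>j\<in>A. f j x) \<le> (\<Sum>j\<in>A. b j)"
proof (induction A rule: infinite_finite_induct)
  case (insert i A)
  then have "norm_L2 (\<lambda>x. f i x + (\<Sum>j\<in>A. f j x)) \<le> b i + (\<Sum>j\<in>A. b j)"
    using norm_L2_add[of "f i" "\<lambda>x. \<Sum>j\<in>A. f j x"] by fastforce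
  with insert show ?case by (auto intro!: L2_add)
qed (auto simp: norm_L2_def)

text \<open>The nonlinearity enters only on the support of the weight \<open>a\<close>, enlarged by the radius of the
  mollifier; cutting it off there makes it square integrable.\<close>
locale weight =
  fixes a :: "real ^ 'd::finite \<Rightarrow> real" and R :: real and V :: "real ^ 'd \<Rightarrow> real" and \<beta> :: real
  assumes a_smooth: "smooth a" and a_supp: "supp_in R a" and V_smooth: "smooth V"
    and dim: "CARD('d) \<in> {2, 3}"
begin

definition ind :: "real ^ 'd \<Rightarrow> complex" where
  "ind x = complex_of_real (indicat_real (cball 0 (R + 1)) x)"

definition nonlin :: "(real ^ 'd \<Rightarrow> complex) \<Rightarrow> real ^ 'd \<Rightarrow> complex" where
  "nonlin u x = complex_of_real (V x) * u x + complex_of_real \<beta> * cub (u x)"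

text \<open>Written as a sum of bounded coefficients times \<open>u\<close> and
  \<open>cub u\<close>, both in L2, so that the estimates for bounded multipliers apply term by
  term.\<close>

definition local_nonlin :: "(real ^ 'd \<Rightarrow> complex) \<Rightarrow> real ^ 'd \<Rightarrow> complex" where
  "local_nonlin u x = ind x * complex_of_real (V x) * u x + complex_of_real \<beta> * ind x * cub (u x)"

lemma local_nonlin_eq: "local_nonlin u x = ind x * nonlin u x"
  by (simp add: local_nonlin_def nonlin_def algebra_simps)

definition mass_a :: "(real ^ 'd \<Rightarrow> complex) \<Rightarrow> real" where
  "mass_a u = (LINT x|lborel. a x * (cmod (u x))\<^sup>2)"

text \<open>The gradient is a separate argument: it is the classical one for mollifications and a
  chosen weak gradient for the limit.\<close>

definition momentum_a :: "(real ^ 'd \<Rightarrow> complex) \<Rightarrow> ('d \<Rightarrow> real ^ 'd \<Rightarrow> complex) \<Rightarrow> real" where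
  "momentum_a u g = Im (LINT x|lborel. cnj (u x) * (\<Sum>j\<in>UNIV. complex_of_real (partial j a x) * g j x))"

text \<open>The right side of \<open>kinetic_identity\<close>, with sums outside the integrals and
  each integrand grouped as a product of two L2 functions, as
  \<open>tendsto_integral_mult_L2\<close> requires.\<close>

definition kinetic_a :: "(real ^ 'd \<Rightarrow> complex) \<Rightarrow> ('d \<Rightarrow> real ^ 'd \<Rightarrow> complex) \<Rightarrow> real" where
  "kinetic_a u g = Re (\<Sum>k\<in>UNIV. \<Sum>j\<in>UNIV. LINT x|lborel. (complex_of_real (partial k (partial j a) x) * cnj (g k x)) * g j x)
     - 1 / 4 * Re (LINT x|lborel. (complex_of_real (laplacian (laplacian a) x) * cnj (u x)) * u x)"

definition potential_a :: "(real ^ 'd \<Rightarrow> complex) \<Rightarrow> real" where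
  "potential_a u = - Re (LINT x|lborel. ((\<Sum>j\<in>UNIV. complex_of_real (partial j a x) * complex_of_real (partial j V x)) * cnj (u x)) * u x)
      + \<beta> / 2 * Re (LINT x|lborel. (complex_of_real (laplacian a x) * cnj (u x)) * cub (u x))"

definition Ga :: "(real ^ 'd \<Rightarrow> complex) \<Rightarrow> ('d \<Rightarrow> real ^ 'd \<Rightarrow> complex) \<Rightarrow> real ^ 'd \<Rightarrow> complex" where
  "Ga u g x = 2 * (\<Sum>j\<in>UNIV. complex_of_real (partial j a x) * g j x) + complex_of_real (laplacian a x) * u x"

lemma Cc_a: "Cc_smooth a" using a_smooth a_supp by (auto simp: Cc_smooth_def)

lemma ind_measurable [measurable]: "ind \<in> borel_measurable borel"
proof -
  have [measurable]: "indicat_real (cball (0 :: real ^ 'd) (R + 1)) \<in> borel_measurable borel"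
    by (intro borel_measurable_indicator) auto
  show ?thesis unfolding ind_def[abs_def] by measurable
qed

lemma norm_ind: "norm (ind x) \<le> 1" by (simp add: ind_def indicator_def)

lemma V_cont: "continuous_on UNIV V" "continuous_on UNIV (partial j V)"
  by (intro smooth_continuous smooth_partial V_smooth)+

lemma V_measurable [measurable]: "V \<in> borel_measurable borel" "partial j V \<in> borel_measurable borel"
  by (intro borel_measurable_continuous_onI V_cont)+

lemma Cc_coeff:
  assumes "Cc_smooth f"
  shows "(\<lambda>x. complex_of_real (f x)) \<in> borel_measurable borel" "\<exists>B\<ge>0. \<forall>x. norm (complex_of_real (f x)) \<le> B"
proof -
  have "f \<in> borel_measurable borel" using assms by (rule Cc_smooth_measurable)
  then show "(\<lambda>x. complex_of_real (f x)) \<in> borel_measurable borel" by simp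
  show "\<exists>B\<ge>0. \<forall>x. norm (complex_of_real (f x)) \<le> B" using Cc_smooth_bounded[OF assms] by (metis norm_of_real real_norm_def)
qed

lemma a_coeffs: "Cc_smooth (partial j a)" "Cc_smooth (partial k (partial j a))" "Cc_smooth (laplacian a)" "Cc_smooth (laplacian (laplacian a))"
  by (intro Cc_smooth_partial Cc_smooth_laplacian Cc_a)+

lemma V_local_bound: "\<exists>B\<ge>0. \<forall>x. norm (ind x * complex_of_real (V x)) \<le> B"
proof -
  have "compact (V ` cball 0 (R + 1))"
    by (intro compact_continuous_image continuous_on_subset[OF V_cont(1)]) auto
  then obtain B where B: "\<And>y. y \<in> V ` cball 0 (R + 1) \<Longrightarrow> norm y \<le> B"
    using bounded_iff compact_imp_bounded by metis
  have "norm (ind x * complex_of_real (V x)) \<le> max B 0" for x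
    using B[of "V x"] by (cases "x \<in> cball 0 (R + 1)") (auto simp: ind_def)
  then show ?thesis by (intro exI[of _ "max B 0"]) auto
qed

lemma V_virial_coeff: "continuous_on UNIV (\<lambda>x. \<Sum>j\<in>UNIV. complex_of_real (partial j a x) * complex_of_real (partial j V x))"
  "supp_in R (\<lambda>x. \<Sum>j\<in>UNIV. complex_of_real (partial j a x) * complex_of_real (partial j V x))"
  by (intro continuous_intros V_cont smooth_continuous smooth_partial a_smooth)
    (use supp_in_partial[OF a_supp] in \<open>auto simp: supp_in_def\<close>)

lemma smooth_nonlin_eq: "nonlin u x = complex_of_real (V x) * u x + complex_of_real \<beta> * (complex_of_real ((cmod (u x))\<^sup>2) * u x)"
  by (simp add: nonlin_def cub_def)

end

section \<open>Limits of the virial identities at one time\<close>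

locale fixed_time = weight +
  fixes u :: "real ^ 'a \<Rightarrow> complex" and g :: "real ^ 'a \<Rightarrow> complex ^ 'a"
  assumes u: "u \<in> L2" and g: "g \<in> L2" and wg: "is_weak_gradient u g"
begin

abbreviation "w n \<equiv> conv (mollifier n) u"
abbreviation "gr k x \<equiv> g x $ k"
abbreviation "H n \<equiv> conv (mollifier n) (nonlin u)"

lemma u_loc: "locally_integrable u" by (rule L2_locally_integrable[OF u])

lemma [measurable]: "u \<in> borel_measurable borel" using u by (rule L2D)

lemma u6: "integrable lborel (\<lambda>x. cmod (u x) ^ 6)"
  by (rule Sobolev_H1(1)[OF dim u g wg])

lemma cub_L2: "(\<lambda>x. cub (u x)) \<in> L2" by (rule L2_cub[OF _ u6]) measurable

lemma nonlin_loc: "locally_integrable (nonlin u)"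
proof -
  have "integrable lborel (\<lambda>x. indicat_real (cball 0 r) x *\<^sub>R nonlin u x)" for r
  proof -
    have 1: "integrable lborel (\<lambda>x. u x * (complex_of_real (V x) * complex_of_real (indicat_real (cball 0 r) x)))"
    proof -
      have "compact (V ` cball 0 r)" by (intro compact_continuous_image continuous_on_subset[OF V_cont(1)]) auto
      then obtain B where B: "\<And>y. y \<in> V ` cball 0 r \<Longrightarrow> norm y \<le> B" using bounded_iff compact_imp_bounded by metis
      have "\<bar>V x\<bar> \<le> max B 0" if "norm x \<le> r" for x using B[of "V x"] that by auto
      then show ?thesis
        by (intro locally_integrable_mult[OF u_loc, where B="max B 0" and r=r])
          (auto simp: supp_in_def indicator_def)
    qed
    have "locally_integrable (\<lambda>x. cub (u x))" by (rule L2_locally_integrable[OF cub_L2])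
    then have "integrable lborel (\<lambda>x. indicat_real (cball 0 r) x *\<^sub>R cub (u x))" by (simp add: locally_integrable_def)
    from Bochner_Integration.integrable_add[OF 1 integrable_mult_right[OF this, of "complex_of_real \<beta>"]]
    show ?thesis by (simp add: nonlin_def scaleR_conv_of_real algebra_simps)
  qed
  moreover have "nonlin u \<in> borel_measurable borel" unfolding nonlin_def[abs_def] by measurable
  ultimately show ?thesis by (simp add: locally_integrable_def)
qed

lemma w_smooth: "smooth (w n)" by (intro smooth_conv u_loc Cc_smooth_mollifier)

lemma H_smooth: "smooth (H n)" by (intro smooth_conv nonlin_loc Cc_smooth_mollifier)

sublocale sv: smooth_virial a "w n" R for n
  by standard (intro a_smooth a_supp w_smooth conv_partial_commute[OF u_loc Cc_smooth_mollifier])+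

lemma pw: "partial k (w n) = conv (mollifier n) (gr k)"
  by (rule partial_conv_weak[OF u_loc wg Cc_smooth_mollifier])

lemma w_L2: "w n \<in> L2" "norm_L2 (w n) \<le> norm_L2 u" using conv_mollifier_L2[OF u] by auto

lemma gr_L2: "gr k \<in> L2" "norm_L2 (gr k) \<le> norm_L2 g"
proof -
  show gk: "gr k \<in> L2" by (rule L2_component[OF g])
  show "norm_L2 (gr k) \<le> norm_L2 g"
    by (rule norm_L2_mono(2)[OF g L2D(1)[OF gk]]) (rule Finite_Cartesian_Product.norm_nth_le)
qed

lemma pw_L2: "partial k (w n) \<in> L2" "norm_L2 (partial k (w n)) \<le> norm_L2 g"
proof -
  show "partial k (w n) \<in> L2" unfolding pw by (rule conv_mollifier_L2[OF gr_L2(1)])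
  have "norm_L2 (partial k (w n)) \<le> norm_L2 (gr k)" unfolding pw by (rule conv_mollifier_L2[OF gr_L2(1)])
  then show "norm_L2 (partial k (w n)) \<le> norm_L2 g" using gr_L2(2)[of k] by linarith
qed

lemma w_lim: "L2_lim w u" by (rule conv_mollifier_L2_lim[OF u])

lemma pw_lim: "L2_lim (\<lambda>n. partial k (w n)) (gr k)"
  unfolding pw by (rule conv_mollifier_L2_lim[OF gr_L2(1)])

definition grad_w :: "nat \<Rightarrow> real ^ 'a \<Rightarrow> complex ^ 'a" where
  "grad_w n x = (\<chi> k. partial k (w n) x)"

lemma grad_w_L2: "grad_w n \<in> L2"
proof (rule L2I)
  have c: "continuous_on UNIV (grad_w n)"
    unfolding grad_w_def[abs_def] by (intro continuous_on_vec_lambda smooth_continuous smooth_partial w_smooth)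
  then show "grad_w n \<in> borel_measurable borel" by (rule borel_measurable_continuous_onI)
  show "integrable lborel (\<lambda>x. (norm (grad_w n x))\<^sup>2)"
    unfolding norm_vec_sq grad_w_def by (auto intro!: L2D(2) pw_L2)
qed

lemma grad_w_weak: "is_weak_gradient (w n) (grad_w n)"
  unfolding grad_w_def[abs_def] by (rule is_weak_gradient_smooth[OF w_smooth])

lemma w6: "integrable lborel (\<lambda>x. cmod (w n x) ^ 6)"
  by (rule Sobolev_H1(1)[OF dim w_L2(1) grad_w_L2 grad_w_weak])

text \<open>The Sobolev inequality for the difference \<open>w n - u\<close>, whose weak gradient is
  the difference of the gradients, upgrades H1 convergence to L6 convergence.\<close>

lemma cub_lim: "L2_lim (\<lambda>n x. cub (w n x)) (\<lambda>x. cub (u x))"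
proof (rule L2_lim_cub[OF _ w6 _ u6])
  have dL: "(\<lambda>x. w n x - u x) \<in> L2" "(\<lambda>x. grad_w n x - g x) \<in> L2" for n
    by (intro L2_diff w_L2 u g grad_w_L2)+
  have dw: "is_weak_gradient (\<lambda>x. w n x - u x) (\<lambda>x. grad_w n x - g x)" for n
    by (rule is_weak_gradient_diff[OF w_L2(1) grad_w_L2 grad_w_weak u g wg])
  note S = Sobolev_H1[OF dim dL dw]
  show "integrable lborel (\<lambda>x. cmod (w n x - u x) ^ 6)" for n by (rule S(1))
  have 1: "(\<lambda>n. (norm_L2 (\<lambda>x. grad_w n x - g x))\<^sup>2) \<longlonglongrightarrow> (\<Sum>k\<in>(UNIV :: 'a set). 0\<^sup>2)"
    unfolding norm_L2_vec_sq[OF dL(2)]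
  proof (intro tendsto_sum tendsto_power)
    show "(\<lambda>n. norm_L2 (\<lambda>x. (grad_w n x - g x) $ k)) \<longlonglongrightarrow> 0" for k
      using pw_lim[of k] by (simp add: L2_lim_def grad_w_def)
  qed
  have 2: "(\<lambda>n. (norm_L2 (\<lambda>x. w n x - u x))\<^sup>2) \<longlonglongrightarrow> 0\<^sup>2"
    using w_lim by (intro tendsto_power) (simp add: L2_lim_def)
  have "(\<lambda>n. 4096 * ((norm_L2 (\<lambda>x. w n x - u x))\<^sup>2 + (norm_L2 (\<lambda>x. grad_w n x - g x))\<^sup>2)^3) \<longlonglongrightarrow> 4096 * (0\<^sup>2 + (\<Sum>k\<in>(UNIV :: 'a set). 0\<^sup>2))^3"
    by (rule tendsto_mult[OF tendsto_const tendsto_power[OF tendsto_add[OF 2 1]]])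
  then have b: "(\<lambda>n. 4096 * ((norm_L2 (\<lambda>x. w n x - u x))\<^sup>2 + (norm_L2 (\<lambda>x. grad_w n x - g x))\<^sup>2)^3) \<longlonglongrightarrow> 0" by simp
  show "(\<lambda>n. LINT x|lborel. cmod (w n x - u x) ^ 6) \<longlonglongrightarrow> 0"
    by (rule tendsto_sandwich[OF _ _ tendsto_const b]) (use S(2) in \<open>auto intro!: always_eventually integral_nonneg_AE\<close>)
qed (use L2D(1)[OF w_L2(1)] in auto)

lemma coeff_lim:
  assumes "Cc_smooth f" "L2_lim h h0"
  shows "L2_lim (\<lambda>n x. complex_of_real (f x) * h n x) (\<lambda>x. complex_of_real (f x) * h0 x)"
  using Cc_coeff[OF assms(1)] L2_lim_mult_bounded[OF assms(2)] by metis

lemma Ga_lim: "L2_lim (\<lambda>n. Ga (w n) (\<lambda>j. partial j (w n))) (Ga u gr)"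
  unfolding Ga_def[abs_def]
  by (intro L2_lim_add L2_lim_sum coeff_lim a_coeffs pw_lim w_lim
      L2_lim_mult_bounded[where c="\<lambda>x. 2" and B=2]) auto

lemma mass_lim: "(\<lambda>n. mass_a (w n)) \<longlonglongrightarrow> mass_a u"
proof -
  have "(\<lambda>n. Re (LINT x|lborel. (complex_of_real (a x) * cnj (w n x)) * w n x)) \<longlonglongrightarrow> Re (LINT x|lborel. (complex_of_real (a x) * cnj (u x)) * u x)"
    by (intro tendsto_Re tendsto_integral_mult_L2 coeff_lim Cc_a L2_lim_cnj w_lim)
  moreover have "Re (LINT x|lborel. (complex_of_real (a x) * cnj (v x)) * v x) = mass_a v" if "v \<in> L2" for v
  proof -
    have "integrable lborel (\<lambda>x. (complex_of_real (a x) * cnj (v x)) * v x)"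
      using Cc_coeff[OF Cc_a] L2_mult_bounded[OF L2_cnj[OF that]] by (metis L2_mult_integrable that)
    then have "Re (LINT x|lborel. (complex_of_real (a x) * cnj (v x)) * v x) = (LINT x|lborel. Re ((complex_of_real (a x) * cnj (v x)) * v x))"
      by (rule integral_Re[symmetric])
    also have "\<dots> = mass_a v"
      unfolding mass_a_def cmod_power2 by (intro Bochner_Integration.integral_cong refl) (simp add: algebra_simps power2_eq_square)
    finally show ?thesis .
  qed
  ultimately show ?thesis using w_L2(1) u by simp
qed

lemma momentum_lim: "(\<lambda>n. momentum_a (w n) (\<lambda>j. partial j (w n))) \<longlonglongrightarrow> momentum_a u gr"
  unfolding momentum_a_def
  by (intro tendsto_Im tendsto_integral_mult_L2 L2_lim_cnj L2_lim_sum coeff_lim a_coeffs pw_lim w_lim)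

lemma kinetic_lim: "(\<lambda>n. kinetic_a (w n) (\<lambda>j. partial j (w n))) \<longlonglongrightarrow> kinetic_a u gr"
  unfolding kinetic_a_def
  by (intro tendsto_intros tendsto_Re tendsto_sum tendsto_integral_mult_L2 coeff_lim a_coeffs L2_lim_cnj pw_lim w_lim)

lemma potential_lim: "(\<lambda>n. potential_a (w n)) \<longlonglongrightarrow> potential_a u"
proof -
  let ?c = "\<lambda>x. \<Sum>j\<in>UNIV. complex_of_real (partial j a x) * complex_of_real (partial j V x)"
  obtain B where "\<And>x. norm (?c x) \<le> B" using supp_in_bounded[OF V_virial_coeff] by blast
  then have 1: "L2_lim (\<lambda>n x. ?c x * cnj (w n x)) (\<lambda>x. ?c x * cnj (u x))"
    by (intro L2_lim_mult_bounded L2_lim_cnj w_lim borel_measurable_continuous_onI V_virial_coeff(1))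
  show ?thesis
    unfolding potential_a_def
    by (intro tendsto_intros tendsto_Re tendsto_integral_mult_L2 1 coeff_lim a_coeffs L2_lim_cnj w_lim cub_lim)
qed

lemma local_nonlin_lim: "L2_lim (\<lambda>n. local_nonlin (w n)) (local_nonlin u)"
proof -
  obtain B where "\<And>x. norm (ind x * complex_of_real (V x)) \<le> B" using V_local_bound by blast
  then have 1: "L2_lim (\<lambda>n x. ind x * complex_of_real (V x) * w n x) (\<lambda>x. ind x * complex_of_real (V x) * u x)"
    by (intro L2_lim_mult_bounded w_lim) auto
  have 2: "L2_lim (\<lambda>n x. complex_of_real \<beta> * ind x * cub (w n x)) (\<lambda>x. complex_of_real \<beta> * ind x * cub (u x))"
    by (rule L2_lim_mult_bounded[OF cub_lim, where B="\<bar>\<beta>\<bar>"]) (auto simp: norm_mult intro!: mult_left_le norm_ind)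
  show ?thesis using L2_lim_add[OF 1 2] by (simp add: local_nonlin_def[abs_def])
qed

lemma local_nonlin_L2: "local_nonlin u \<in> L2"
  using local_nonlin_lim by (simp add: L2_lim_def)

lemma Ga_outside: "R < norm x \<Longrightarrow> Ga v h x = 0"
  using supp_in_partial[OF a_supp] supp_in_laplacian[OF a_supp] by (simp add: Ga_def supp_in_def)

lemma Ga_eq_G: "Ga (w n) (\<lambda>j. partial j (w n)) = sv.G n"
  by (simp add: fun_eq_iff Ga_def sv.G_def)

lemma mult_Ga_cong: "(norm x \<le> R \<Longrightarrow> p = q) \<Longrightarrow> p * Ga v h x = q * Ga v h x"
  using Ga_outside[of x v h] by (cases "norm x \<le> R") auto

lemma ind_1: "norm x \<le> R \<Longrightarrow> ind x = 1"
  by (simp add: ind_def)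

lemma H_local: "norm x \<le> R \<Longrightarrow> H n x = conv (mollifier n) (local_nonlin u) x"
  using conv_local[OF supp_in_mollifier, of x R n "R + 1" "nonlin u"]
  by (simp add: local_nonlin_eq[abs_def] ind_def)

text \<open>The identity for \<open>u\<close> is the limit of the identities for its mollifications.\<close>
lemma potential_identity_weak: "Re (LINT x|lborel. cnj (local_nonlin u x) * Ga u gr x) = potential_a u"
proof -
  have "(\<lambda>n. Re (LINT x|lborel. cnj (local_nonlin (w n) x) * Ga (w n) (\<lambda>j. partial j (w n)) x)) \<longlonglongrightarrow> Re (LINT x|lborel. cnj (local_nonlin u x) * Ga u gr x)"
    by (intro tendsto_Re tendsto_integral_mult_L2 L2_lim_cnj local_nonlin_lim Ga_lim)
  moreover have "Re (LINT x|lborel. cnj (local_nonlin (w n) x) * Ga (w n) (\<lambda>j. partial j (w n)) x) = potential_a (w n)" for n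
  proof -
    have "(LINT x|lborel. cnj (local_nonlin (w n) x) * Ga (w n) (\<lambda>j. partial j (w n)) x)
       = (LINT x|lborel. cnj (nonlin (w n) x) * Ga (w n) (\<lambda>j. partial j (w n)) x)"
      by (intro Bochner_Integration.integral_cong refl mult_Ga_cong) (simp add: local_nonlin_eq ind_1)
    then show ?thesis
      unfolding Ga_eq_G smooth_nonlin_eq using sv.potential_identity[OF V_smooth, of n \<beta>]
      by (simp add: potential_a_def cub_def mult.assoc)
  qed
  ultimately show ?thesis using potential_lim LIMSEQ_unique by simp
qed

text \<open>The time derivative that the equation prescribes for the mollified solution. The
  nonlinearity is applied before mollifying, so this is not the right side of the equation for
  \<open>w n\<close>.\<close>

definition F :: "nat \<Rightarrow> real ^ 'a \<Rightarrow> complex" where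
  "F n x = \<i> / 2 * laplacian (w n) x - \<i> * H n x"

lemma F_smooth: "smooth (F n)"
proof -
  have "smooth (\<lambda>x. \<i> / 2 * laplacian (w n) x + (- \<i>) * H n x)"
    by (intro smooth_add smooth_bounded_linear[OF bounded_linear_mult_right] smooth_laplacian w_smooth H_smooth)
  then show ?thesis by (simp add: F_def[abs_def])
qed

text \<open>The derivative of \<open>mass_a (w n)\<close> obtained by formally inserting
  \<open>F n\<close> for the time derivative of \<open>w n\<close>; \<open>momentum_rate\<close> is
  its analogue. That these are true derivatives along the flow is shown in
  \<open>mass_derivative\<close> and \<open>momentum_derivative\<close>.\<close>

definition mass_rate :: "nat \<Rightarrow> real" where
  "mass_rate n = (LINT x|lborel. a x * (2 * Re (cnj (w n x) * F n x)))"

definition momentum_rate :: "nat \<Rightarrow> real" where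
  "momentum_rate n = (LINT x|lborel. (\<Sum>j\<in>UNIV. partial j a x * Im (cnj (F n x) * partial j (w n) x + cnj (w n x) * partial j (F n) x)))"

abbreviation "Hl n \<equiv> conv (mollifier n) (local_nonlin u)"

lemma Hl_L2: "Hl n \<in> L2" "norm_L2 (Hl n) \<le> norm_L2 (local_nonlin u)"
  using conv_mollifier_L2[OF local_nonlin_L2] by auto

text \<open>On the support of a, \<open>H n\<close> agrees with the mollification
  \<open>Hl n\<close> of the truncated nonlinearity. The latter is in L2, so the last integral has a
  limit.\<close>

lemma mass_rate_eq: "mass_rate n = momentum_a (w n) (\<lambda>j. partial j (w n)) + 2 * Im (LINT x|lborel. cnj (w n x) * (complex_of_real (a x) * Hl n x))"
proof -
  have "(LINT x|lborel. cnj (w n x) * (complex_of_real (a x) * H n x)) = (LINT x|lborel. cnj (w n x) * (complex_of_real (a x) * Hl n x))"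
  proof (intro Bochner_Integration.integral_cong refl)
    show "cnj (w n x) * (complex_of_real (a x) * H n x) = cnj (w n x) * (complex_of_real (a x) * Hl n x)" for x
      using H_local[of x n] a_supp by (cases "norm x \<le> R") (auto simp: supp_in_def)
  qed
  then show ?thesis
    using sv.mass_identity[OF smooth_continuous[OF H_smooth], of n n] by (simp add: mass_rate_def F_def momentum_a_def)
qed

text \<open>\<open>momentum_identity\<close> followed by \<open>kinetic_identity\<close>. The
  nonlinear term stays as a pairing with the multiplier, since \<open>Hl n\<close> is not the
  nonlinearity of \<open>w n\<close>; it is turned into \<open>potential_a\<close> only after the
  limit.\<close>

lemma momentum_rate_eq: "momentum_rate n = kinetic_a (w n) (\<lambda>j. partial j (w n)) + Re (LINT x|lborel. cnj (Hl n x) * Ga (w n) (\<lambda>j. partial j (w n)) x)"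
proof -
  have c: "continuous_on UNIV (H n)" "continuous_on UNIV (sv.G n)"
    by (intro smooth_continuous[OF H_smooth] sv.cont_G)+
  have i1: "integrable lborel (\<lambda>x. cnj (laplacian (w n) x) * sv.G n x)"
    by (rule sv.integrable_outside[of _]) (auto intro!: continuous_intros sv.cont c simp: sv.outside_G)
  have i2: "integrable lborel (\<lambda>x. cnj (H n x) * sv.G n x)"
    by (rule sv.integrable_outside[of _]) (auto intro!: continuous_intros sv.cont c simp: sv.outside_G)
  have i3: "integrable lborel (\<lambda>x. (complex_of_real (partial k (partial j a) x) * cnj (partial k (w n) x)) * partial j (w n) x)" for k j
    by (rule sv.integrable_outside) (auto intro!: continuous_intros sv.cont simp: sv.outside)
  have "momentum_rate n = Im (LINT x|lborel. cnj (F n x) * sv.G n x)"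
    unfolding momentum_rate_def by (rule sv.momentum_identity[OF F_smooth])
  also have "(LINT x|lborel. cnj (F n x) * sv.G n x) = (LINT x|lborel. (- \<i> / 2) * (cnj (laplacian (w n) x) * sv.G n x) + \<i> * (cnj (H n x) * sv.G n x))"
    by (intro Bochner_Integration.integral_cong refl) (simp add: F_def algebra_simps)
  also have "\<dots> = (- \<i> / 2) * (LINT x|lborel. cnj (laplacian (w n) x) * sv.G n x) + \<i> * (LINT x|lborel. cnj (H n x) * sv.G n x)"
    using i1 i2 by simp
  finally have "momentum_rate n = - 1 / 2 * Re (LINT x|lborel. cnj (laplacian (w n) x) * sv.G n x) + Re (LINT x|lborel. cnj (H n x) * sv.G n x)"
    by simp
  moreover have "(LINT x|lborel. cnj (H n x) * sv.G n x) = (LINT x|lborel. cnj (Hl n x) * Ga (w n) (\<lambda>j. partial j (w n)) x)"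
    unfolding Ga_eq_G[symmetric] by (intro Bochner_Integration.integral_cong refl mult_Ga_cong) (simp add: H_local)
  moreover have "(LINT x|lborel. (\<Sum>k\<in>UNIV. \<Sum>j\<in>UNIV. complex_of_real (partial k (partial j a) x) * (cnj (partial k (w n) x) * partial j (w n) x)))
    = (\<Sum>k\<in>UNIV. \<Sum>j\<in>UNIV. LINT x|lborel. (complex_of_real (partial k (partial j a) x) * cnj (partial k (w n) x)) * partial j (w n) x)"
    using i3 by (simp add: mult.assoc)
  ultimately show ?thesis
    using sv.kinetic_identity[of n] by (simp add: kinetic_a_def mult.assoc)
qed

text \<open>In the limit the extra term pairs u with its own nonlinearity, and \<open>cnj u\<close>
  times a real multiple of u has no imaginary part.\<close>

lemma mass_rate_lim: "(\<lambda>n. mass_rate n) \<longlonglongrightarrow> momentum_a u gr"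
proof -
  have "(\<lambda>n. LINT x|lborel. cnj (w n x) * (complex_of_real (a x) * Hl n x)) \<longlonglongrightarrow> (LINT x|lborel. cnj (u x) * (complex_of_real (a x) * local_nonlin u x))"
    by (intro tendsto_integral_mult_L2 L2_lim_cnj w_lim coeff_lim Cc_a conv_mollifier_L2_lim local_nonlin_L2)
  then have "(\<lambda>n. mass_rate n) \<longlonglongrightarrow> momentum_a u gr + 2 * Im (LINT x|lborel. cnj (u x) * (complex_of_real (a x) * local_nonlin u x))"
    unfolding mass_rate_eq by (intro tendsto_intros tendsto_Im momentum_lim)
  moreover have "Im (LINT x|lborel. cnj (u x) * (complex_of_real (a x) * local_nonlin u x)) = 0"
  proof -
    have "integrable lborel (\<lambda>x. cnj (u x) * (complex_of_real (a x) * local_nonlin u x))"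
      using coeff_lim[OF Cc_a L2_lim_const[OF local_nonlin_L2]] by (intro L2_mult_integrable L2_cnj u) (simp add: L2_lim_def)
    then have "Im (LINT x|lborel. cnj (u x) * (complex_of_real (a x) * local_nonlin u x)) = (LINT x|lborel. Im (cnj (u x) * (complex_of_real (a x) * local_nonlin u x)))"
      by (rule integral_Im[symmetric])
    also have "\<dots> = (LINT x|(lborel :: (real ^ 'a) measure). 0)"
      by (intro Bochner_Integration.integral_cong refl) (simp add: local_nonlin_def cub_def ind_def algebra_simps)
    finally show ?thesis by simp
  qed
  ultimately show ?thesis by simp
qed

text \<open>Both \<open>Hl n\<close> and \<open>local_nonlin (w n)\<close> tend to
  \<open>local_nonlin u\<close> in L2. Hence the pairing here and the one inside
  \<open>potential_identity_weak\<close> have the same limit.\<close>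

lemma momentum_rate_lim: "(\<lambda>n. momentum_rate n) \<longlonglongrightarrow> kinetic_a u gr + potential_a u"
  unfolding momentum_rate_eq potential_identity_weak[symmetric]
  by (intro tendsto_add kinetic_lim tendsto_Re tendsto_integral_mult_L2 L2_lim_cnj conv_mollifier_L2_lim local_nonlin_L2 Ga_lim)

end

section \<open>Evolution in time\<close>

lemma laplacian_of_real_reflect:
  assumes "Cc_smooth \<eta>"
  shows "laplacian (\<lambda>y. complex_of_real (\<eta> (x - y))) = (\<lambda>y. complex_of_real (laplacian \<eta> (x - y)))"
proof
  fix y
  have "partial i (partial i (\<lambda>y. complex_of_real (\<eta> (x - y)))) y = complex_of_real (partial i (partial i \<eta>) (x - y))" for i
  proof -
    have c: "Cc_smooth (partial i \<eta>)" using assms by (rule Cc_smooth_partial)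
    have d: "(\<lambda>y. complex_of_real (partial i \<eta> (x - y))) differentiable (at y)"
      using Cc_smooth_of_real[OF Cc_smooth_reflect[OF c]] by (auto simp: Cc_smooth_def intro: smooth_differentiable)
    show ?thesis
      unfolding partial_of_real_reflect[OF assms]
      using partial_bounded_linear[OF bounded_linear_minus[OF bounded_linear_ident] d, of i] partial_of_real_reflect[OF c, of i x]
      by simp
  qed
  then show "laplacian (\<lambda>y. complex_of_real (\<eta> (x - y))) y = complex_of_real (laplacian \<eta> (x - y))"
    by (simp add: laplacian_def)
qed

section \<open>Bounds on the rates, uniform in the state and in the mollification\<close>

context weight
begin

text \<open>Fixed once for the ball, so that the bounds below depend on a state only through its
  norms and are therefore uniform over a time interval.\<close>

definition V_bound :: real where
  "V_bound = (SOME B. 0 \<le> B \<and> (\<forall>x. norm (ind x * complex_of_real (V x)) \<le> B))"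

lemma V_bound: "0 \<le> V_bound" "norm (ind x * complex_of_real (V x)) \<le> V_bound"
proof -
  have "\<exists>B. 0 \<le> B \<and> (\<forall>x. norm (ind x * complex_of_real (V x)) \<le> B)" using V_local_bound by blast
  from someI_ex[OF this] show "0 \<le> V_bound" "norm (ind x * complex_of_real (V x)) \<le> V_bound"
    unfolding V_bound_def by blast+
qed

text \<open>The square root is the L2 norm of the cube as bounded by \<open>Sobolev_H1\<close>, with
  both norms at most M.\<close>

definition nonlin_bound :: "real \<Rightarrow> real" where
  "nonlin_bound M = V_bound * M + \<bar>\<beta>\<bar> * sqrt (4096 * (2 * M\<^sup>2)^3)"

lemma nonlin_bound_nonneg: "0 \<le> M \<Longrightarrow> 0 \<le> nonlin_bound M"
  by (simp add: nonlin_bound_def V_bound(1))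

lemma norm_local_nonlin_le:
  assumes "fixed_time a R V u g" and M: "norm_L2 u \<le> M" "norm_L2 g \<le> M"
  shows "norm_L2 (local_nonlin u) \<le> nonlin_bound M"
proof -
  interpret fixed_time a R V \<beta> u g by fact
  have M0: "0 \<le> M" using M norm_L2_nonneg order_trans by blast
  have 1: "(\<lambda>x. ind x * complex_of_real (V x) * u x) \<in> L2" "norm_L2 (\<lambda>x. ind x * complex_of_real (V x) * u x) \<le> V_bound * norm_L2 u"
    by (rule L2_mult_bounded[OF u _ V_bound(2)] norm_L2_mult_bounded[OF u _ V_bound(2)], measurable)+
  have b: "norm (complex_of_real \<beta> * ind x) \<le> \<bar>\<beta>\<bar>" for x by (auto simp: norm_mult intro!: mult_left_le norm_ind)
  have 2: "(\<lambda>x. complex_of_real \<beta> * ind x * cub (u x)) \<in> L2" "norm_L2 (\<lambda>x. complex_of_real \<beta> * ind x * cub (u x)) \<le> \<bar>\<beta>\<bar> * norm_L2 (\<lambda>x. cub (u x))"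
    by (rule L2_mult_bounded[OF cub_L2 _ b] norm_L2_mult_bounded[OF cub_L2 _ b], measurable)+
  have "norm_L2 (\<lambda>x. cub (u x)) = sqrt (LINT x|lborel. cmod (u x) ^ 6)"
    by (simp add: norm_L2_def norm_cub flip: power_mult)
  also have "\<dots> \<le> sqrt (4096 * ((norm_L2 u)\<^sup>2 + (norm_L2 g)\<^sup>2)^3)"
    by (intro real_sqrt_le_mono Sobolev_H1(2)[OF dim u g wg])
  also have "\<dots> \<le> sqrt (4096 * (2 * M\<^sup>2)^3)"
    using power_mono[OF M(1) norm_L2_nonneg, of 2] power_mono[OF M(2) norm_L2_nonneg, of 2]
    by (intro real_sqrt_le_mono mult_left_mono power_mono) auto
  finally have 3: "norm_L2 (\<lambda>x. cub (u x)) \<le> sqrt (4096 * (2 * M\<^sup>2)^3)" .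
  have "norm_L2 (local_nonlin u) \<le> V_bound * norm_L2 u + \<bar>\<beta>\<bar> * norm_L2 (\<lambda>x. cub (u x))"
    unfolding local_nonlin_def using norm_L2_add[OF 1(1) 2(1)] 1(2) 2(2) by linarith
  also have "\<dots> \<le> V_bound * M + \<bar>\<beta>\<bar> * sqrt (4096 * (2 * M\<^sup>2)^3)"
    by (intro add_mono mult_left_mono M 3 V_bound) auto
  finally show ?thesis by (simp add: nonlin_bound_def)
qed

lemma norm_coeff_integral_le:
  assumes "\<And>x. norm (complex_of_real (f x)) \<le> B" "Cc_smooth f" and p: "p \<in> L2" "norm_L2 p \<le> P" and q: "q \<in> L2" "norm_L2 q \<le> Q" "0 \<le> P" "0 \<le> Q"
  shows "norm (LINT x|lborel. (complex_of_real (f x) * p x) * q x) \<le> B * P * Q"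
proof -
  have B: "0 \<le> B" using assms(1) norm_ge_zero order_trans by blast
  have "norm (LINT x|lborel. (complex_of_real (f x) * p x) * q x) \<le> norm_L2 (\<lambda>x. complex_of_real (f x) * p x) * norm_L2 q"
    by (intro norm_integral_mult_le q L2_mult_bounded[OF p(1) Cc_coeff(1)[OF assms(2)] assms(1)])
  also have "\<dots> \<le> (B * norm_L2 p) * norm_L2 q"
    by (intro mult_right_mono norm_L2_mult_bounded[OF p(1) Cc_coeff(1)[OF assms(2)] assms(1)] norm_L2_nonneg)
  also have "\<dots> \<le> B * P * Q"
    using B p q by (intro mult_mono mult_nonneg_nonneg norm_L2_nonneg) auto
  finally show ?thesis .
qed

text \<open>Supplies the constant that dominates the rates when n tends to infinity under the time
  integral. Mollification does not increase L2 norms, so the bound does not see n.\<close>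

lemma rate_bounds:
  assumes M: "0 \<le> M"
  shows "\<exists>C. \<forall>u g n. fixed_time a R V u g \<longrightarrow> norm_L2 u \<le> M \<longrightarrow> norm_L2 g \<le> M \<longrightarrow>
    \<bar>fixed_time.mass_rate a V \<beta> u n\<bar> \<le> C \<and> \<bar>fixed_time.momentum_rate a V \<beta> u n\<bar> \<le> C"
proof -
  have "\<exists>B. 0 \<le> B \<and> (\<forall>x. norm (complex_of_real (a x)) \<le> B)" using Cc_coeff(2)[OF Cc_a] by blast
  then obtain Ba where Ba: "0 \<le> Ba" "\<And>x. norm (complex_of_real (a x)) \<le> Ba" by blast
  have "\<exists>B. 0 \<le> B \<and> (\<forall>x. norm (complex_of_real (partial j a x)) \<le> B)" for j using Cc_coeff(2)[OF a_coeffs(1)] by blast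
  then obtain B1 where B1: "\<And>j. 0 \<le> B1 j" "\<And>j x. norm (complex_of_real (partial j a x)) \<le> B1 j" by metis
  have "\<exists>B. 0 \<le> B \<and> (\<forall>x. norm (complex_of_real (partial k (partial j a) x)) \<le> B)" for k j using Cc_coeff(2)[OF a_coeffs(2)] by blast
  then obtain B2 where B2: "\<And>k j. 0 \<le> B2 k j" "\<And>k j x. norm (complex_of_real (partial k (partial j a) x)) \<le> B2 k j" by metis
  obtain BL where BL: "0 \<le> BL" "\<And>x. norm (complex_of_real (laplacian a x)) \<le> BL" using Cc_coeff(2)[OF a_coeffs(3)] by blast
  obtain BLL where BLL: "0 \<le> BLL" "\<And>x. norm (complex_of_real (laplacian (laplacian a) x)) \<le> BLL" using Cc_coeff(2)[OF a_coeffs(4)] by blast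
  let ?N = "nonlin_bound M"
  have N: "0 \<le> ?N" by (rule nonlin_bound_nonneg[OF M])
  define S where "S = (\<Sum>j\<in>UNIV. B1 j * M)"
  have S: "0 \<le> S" using B1 M by (auto simp: S_def intro: sum_nonneg)
  define C1 where "C1 = M * S + 2 * (M * (Ba * ?N))"
  define C2 where "C2 = (\<Sum>k\<in>UNIV. \<Sum>j\<in>UNIV. B2 k j * M * M) + 1 / 4 * (BLL * M * M) + ?N * (2 * S + BL * M)"
  have "\<bar>fixed_time.mass_rate a V \<beta> u n\<bar> \<le> max C1 C2 \<and> \<bar>fixed_time.momentum_rate a V \<beta> u n\<bar> \<le> max C1 C2"
    if ft: "fixed_time a R V u g" and uM: "norm_L2 u \<le> M" and gM: "norm_L2 g \<le> M" for u g n
  proof -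
    interpret fixed_time a R V \<beta> u g by fact
    have wn: "w n \<in> L2" "norm_L2 (w n) \<le> M" using w_L2[of n] uM by auto
    have pn: "partial j (w n) \<in> L2" "norm_L2 (partial j (w n)) \<le> M" for j using pw_L2[of j n] gM by auto
    have cw: "(\<lambda>x. cnj (w n x)) \<in> L2" "norm_L2 (\<lambda>x. cnj (w n x)) \<le> M" using wn L2_cnj by (auto simp: norm_L2_def)
    have cp: "(\<lambda>x. cnj (partial j (w n) x)) \<in> L2" "norm_L2 (\<lambda>x. cnj (partial j (w n) x)) \<le> M" for j
      using pn[of j] L2_cnj by (auto simp: norm_L2_def)
    have Hn: "Hl n \<in> L2" "norm_L2 (Hl n) \<le> ?N"
      using Hl_L2[of n] norm_local_nonlin_le[OF ft uM gM] by auto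
    have cH: "(\<lambda>x. cnj (Hl n x)) \<in> L2" "norm_L2 (\<lambda>x. cnj (Hl n x)) \<le> ?N" using Hn L2_cnj by (auto simp: norm_L2_def)
    have s: "(\<lambda>x. \<Sum>j\<in>UNIV. complex_of_real (partial j a x) * partial j (w n) x) \<in> L2 \<and> norm_L2 (\<lambda>x. \<Sum>j\<in>UNIV. complex_of_real (partial j a x) * partial j (w n) x) \<le> S"
      unfolding S_def
    proof (rule norm_L2_sum_le, intro conjI)
      fix j
      show "(\<lambda>x. complex_of_real (partial j a x) * partial j (w n) x) \<in> L2"
        by (rule L2_mult_bounded[OF pn(1) Cc_coeff(1)[OF a_coeffs(1)] B1(2)])
      have "norm_L2 (\<lambda>x. complex_of_real (partial j a x) * partial j (w n) x) \<le> B1 j * norm_L2 (partial j (w n))"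
        by (rule norm_L2_mult_bounded[OF pn(1) Cc_coeff(1)[OF a_coeffs(1)] B1(2)])
      also have "\<dots> \<le> B1 j * M" by (intro mult_left_mono pn B1)
      finally show "norm_L2 (\<lambda>x. complex_of_real (partial j a x) * partial j (w n) x) \<le> B1 j * M" .
    qed
    have G: "Ga (w n) (\<lambda>j. partial j (w n)) \<in> L2" "norm_L2 (Ga (w n) (\<lambda>j. partial j (w n))) \<le> 2 * S + BL * M"
    proof -
      have 1: "(\<lambda>x. 2 *\<^sub>R (\<Sum>j\<in>UNIV. complex_of_real (partial j a x) * partial j (w n) x)) \<in> L2" using s by (intro L2_scaleR) auto
      have 2: "(\<lambda>x. complex_of_real (laplacian a x) * w n x) \<in> L2" by (rule L2_mult_bounded[OF wn(1) Cc_coeff(1)[OF a_coeffs(3)] BL(2)])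
      have eq: "Ga (w n) (\<lambda>j. partial j (w n)) = (\<lambda>x. 2 *\<^sub>R (\<Sum>j\<in>UNIV. complex_of_real (partial j a x) * partial j (w n) x) + complex_of_real (laplacian a x) * w n x)"
        by (simp add: Ga_def fun_eq_iff scaleR_conv_of_real)
      show "Ga (w n) (\<lambda>j. partial j (w n)) \<in> L2" unfolding eq by (rule L2_add[OF 1 2])
      have "norm_L2 (\<lambda>x. complex_of_real (laplacian a x) * w n x) \<le> BL * norm_L2 (w n)"
        by (rule norm_L2_mult_bounded[OF wn(1) Cc_coeff(1)[OF a_coeffs(3)] BL(2)])
      also have "\<dots> \<le> BL * M" by (intro mult_left_mono wn BL)
      finally show "norm_L2 (Ga (w n) (\<lambda>j. partial j (w n))) \<le> 2 * S + BL * M"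
        unfolding eq using norm_L2_add[OF 1 2] s norm_L2_scaleR[of 2 "\<lambda>x. \<Sum>j\<in>UNIV. complex_of_real (partial j a x) * partial j (w n) x"] by linarith
    qed
    have "\<bar>mass_rate n\<bar> \<le> C1"
    proof -
      have "\<bar>momentum_a (w n) (\<lambda>j. partial j (w n))\<bar> \<le> M * S"
      proof -
        have "\<bar>momentum_a (w n) (\<lambda>j. partial j (w n))\<bar> \<le> norm_L2 (\<lambda>x. cnj (w n x)) * norm_L2 (\<lambda>x. \<Sum>j\<in>UNIV. complex_of_real (partial j a x) * partial j (w n) x)"
          unfolding momentum_a_def using s by (intro order_trans[OF abs_Im_le_cmod] norm_integral_mult_le cw) auto
        also have "\<dots> \<le> M * S" using s M cw by (intro mult_mono norm_L2_nonneg) auto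
        finally show ?thesis .
      qed
      moreover have "\<bar>Im (LINT x|lborel. cnj (w n x) * (complex_of_real (a x) * Hl n x))\<bar> \<le> M * (Ba * ?N)"
      proof -
        have h: "(\<lambda>x. complex_of_real (a x) * Hl n x) \<in> L2" "norm_L2 (\<lambda>x. complex_of_real (a x) * Hl n x) \<le> Ba * norm_L2 (Hl n)"
          using L2_mult_bounded[OF Hn(1) Cc_coeff(1)[OF Cc_a] Ba(2)] norm_L2_mult_bounded[OF Hn(1) Cc_coeff(1)[OF Cc_a] Ba(2)] by auto
        have "\<bar>Im (LINT x|lborel. cnj (w n x) * (complex_of_real (a x) * Hl n x))\<bar> \<le> norm_L2 (\<lambda>x. cnj (w n x)) * norm_L2 (\<lambda>x. complex_of_real (a x) * Hl n x)"
          by (intro order_trans[OF abs_Im_le_cmod] norm_integral_mult_le cw h)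
        also have "\<dots> \<le> M * (Ba * ?N)"
          using h(2) mult_left_mono[OF Hn(2) Ba(1)] M cw by (intro mult_mono norm_L2_nonneg) auto
        finally show ?thesis .
      qed
      ultimately show ?thesis unfolding mass_rate_eq C1_def by (simp add: abs_le_iff)
    qed
    moreover have "\<bar>momentum_rate n\<bar> \<le> C2"
    proof -
      have 1: "\<bar>Re (\<Sum>k\<in>UNIV. \<Sum>j\<in>UNIV. LINT x|lborel. (complex_of_real (partial k (partial j a) x) * cnj (partial k (w n) x)) * partial j (w n) x)\<bar>
        \<le> (\<Sum>k\<in>UNIV. \<Sum>j\<in>UNIV. B2 k j * M * M)"
        by (intro order_trans[OF abs_Re_le_cmod] sum_norm_le norm_coeff_integral_le B2 a_coeffs cp pn M)
      have 2: "\<bar>Re (LINT x|lborel. (complex_of_real (laplacian (laplacian a) x) * cnj (w n x)) * w n x)\<bar> \<le> BLL * M * M"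
        by (intro order_trans[OF abs_Re_le_cmod] norm_coeff_integral_le BLL a_coeffs cw wn M)
      have "\<bar>Re (LINT x|lborel. cnj (Hl n x) * Ga (w n) (\<lambda>j. partial j (w n)) x)\<bar> \<le> norm_L2 (\<lambda>x. cnj (Hl n x)) * norm_L2 (Ga (w n) (\<lambda>j. partial j (w n)))"
        by (intro order_trans[OF abs_Re_le_cmod] norm_integral_mult_le cH G)
      also have "\<dots> \<le> ?N * (2 * S + BL * M)"
        by (intro mult_mono cH G N norm_L2_nonneg)
      finally have 3: "\<bar>Re (LINT x|lborel. cnj (Hl n x) * Ga (w n) (\<lambda>j. partial j (w n)) x)\<bar> \<le> ?N * (2 * S + BL * M)" .
      have gen: "\<bar>p - 1 / 4 * q + r\<bar> \<le> P + 1 / 4 * Q + R'" if "\<bar>p\<bar> \<le> P" "\<bar>q\<bar> \<le> Q" "\<bar>r\<bar> \<le> R'" for p q r P Q R' :: real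
        using that by linarith
      show ?thesis unfolding momentum_rate_eq kinetic_a_def C2_def by (rule gen[OF 1 2 3])
    qed
    ultimately show ?thesis by (simp add: max.coboundedI1 max.coboundedI2)
  qed
  then show ?thesis by blast
qed

end


lemma smooth_mollifier: "smooth (mollifier n)"
  using Cc_smooth_mollifier unfolding Cc_smooth_def by blast

section \<open>The mollified solution as a function of time\<close>

definition weak_NLS :: "(real ^ 'd::finite \<Rightarrow> real) \<Rightarrow> real \<Rightarrow> (real \<Rightarrow> real ^ 'd \<Rightarrow> complex) \<Rightarrow> bool" where
  "weak_NLS V \<beta> \<psi> \<longleftrightarrow> (\<forall>\<eta> t. test_function \<eta> \<longrightarrow> 0 \<le> t \<longrightarrow> (\<exists>D.
        ((\<lambda>s. LINT x|lborel. \<psi> s x * \<eta> x) has_vector_derivative D) (at t within {0..}) \<and>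
        \<i> * D = - (1/2) * (LINT x|lborel. \<psi> t x * laplacian \<eta> x)
              + (LINT x|lborel. complex_of_real (V x) * \<psi> t x * \<eta> x)
              + complex_of_real \<beta> * (LINT x|lborel. complex_of_real ((cmod (\<psi> t x))\<^sup>2) * \<psi> t x * \<eta> x)))"

locale nls_flow = weight +
  fixes \<psi> :: "real \<Rightarrow> real ^ 'a \<Rightarrow> complex" and g :: "real \<Rightarrow> real ^ 'a \<Rightarrow> complex ^ 'a"
  assumes flow_H1: "\<And>t. 0 \<le> t \<Longrightarrow> \<psi> t \<in> L2" "\<And>t. 0 \<le> t \<Longrightarrow> g t \<in> L2" "\<And>t. 0 \<le> t \<Longrightarrow> is_weak_gradient (\<psi> t) (g t)"
    and flow_eq: "weak_NLS V \<beta> \<psi>"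
    and flow_bound: "\<And>T. \<exists>M. \<forall>t\<in>{0..T}. norm_L2 (\<psi> t) \<le> M \<and> norm_L2 (g t) \<le> M"
begin

lemma ft: "0 \<le> t \<Longrightarrow> fixed_time a R V (\<psi> t) (g t)"
  by unfold_locales (auto intro: flow_H1)

text \<open>The test function \<open>\<eta> (x - y)\<close> of y makes the weak equation a
  differential equation in time at the fixed point x. Stated for general kernels, so that it also
  covers space derivatives of the mollified solution.\<close>

lemma conv_time_derivative:
  assumes \<eta>: "Cc_smooth \<eta>" and t: "0 \<le> t"
  shows "((\<lambda>s. conv \<eta> (\<psi> s) x) has_vector_derivative
     (\<i> / 2 * conv (laplacian \<eta>) (\<psi> t) x - \<i> * conv \<eta> (nonlin (\<psi> t)) x)) (at t within {0..})"
proof -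
  interpret fixed_time a R V \<beta> "\<psi> t" "g t" by (rule ft[OF t])
  let ?z = "\<lambda>y. complex_of_real (\<eta> (x - y))"
  have z: "Cc_smooth ?z" by (intro Cc_smooth_of_real Cc_smooth_reflect \<eta>)
  then obtain D where D: "((\<lambda>s. LINT y|lborel. \<psi> s y * ?z y) has_vector_derivative D) (at t within {0..})"
    "\<i> * D = - (1/2) * (LINT y|lborel. \<psi> t y * laplacian ?z y)
              + (LINT y|lborel. complex_of_real (V y) * \<psi> t y * ?z y)
              + complex_of_real \<beta> * (LINT y|lborel. complex_of_real ((cmod (\<psi> t y))\<^sup>2) * \<psi> t y * ?z y)"
    using flow_eq t unfolding weak_NLS_def test_function_iff by blast
  have c: "integrable lborel (\<lambda>y. cub (\<psi> t y) * ?z y)"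
    by (rule Cc_smooth_integrable_mult[OF L2_locally_integrable[OF cub_L2] z])
  have n: "integrable lborel (\<lambda>y. nonlin (\<psi> t) y * ?z y)"
    by (rule Cc_smooth_integrable_mult[OF nonlin_loc z])
  \<comment> \<open>Obtained by subtracting the cubic part from the whole nonlinearity, whose local
    integrability is known.\<close>
  have v: "integrable lborel (\<lambda>y. complex_of_real (V y) * \<psi> t y * ?z y)"
    using Bochner_Integration.integrable_diff[OF n integrable_mult_right[OF c, of "complex_of_real \<beta>"]]
    by (simp add: nonlin_def algebra_simps)
  have "conv \<eta> (nonlin (\<psi> t)) x = (LINT y|lborel. complex_of_real (V y) * \<psi> t y * ?z y + complex_of_real \<beta> * (cub (\<psi> t y) * ?z y))"
    unfolding conv_def by (intro Bochner_Integration.integral_cong refl) (simp add: nonlin_def algebra_simps)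
  also have "\<dots> = (LINT y|lborel. complex_of_real (V y) * \<psi> t y * ?z y) + complex_of_real \<beta> * (LINT y|lborel. cub (\<psi> t y) * ?z y)"
    using v c by simp
  finally have "\<i> * D = - (1/2) * conv (laplacian \<eta>) (\<psi> t) x + conv \<eta> (nonlin (\<psi> t)) x"
    unfolding D(2) laplacian_of_real_reflect[OF \<eta>] by (simp add: conv_def cub_def)
  then have "- \<i> * (\<i> * D) = - \<i> * (- (1/2) * conv (laplacian \<eta>) (\<psi> t) x + conv \<eta> (nonlin (\<psi> t)) x)" by simp
  then have "D = \<i> / 2 * conv (laplacian \<eta>) (\<psi> t) x - \<i> * conv \<eta> (nonlin (\<psi> t)) x"
    by (simp add: algebra_simps)
  with D(1) show ?thesis by (simp add: conv_def)
qed

abbreviation "moll n t \<equiv> conv (mollifier n) (\<psi> t)"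
abbreviation "rhs n t \<equiv> fixed_time.F V \<beta> (\<psi> t) n"

lemma rhs_eq:
  assumes "0 \<le> t"
  shows "rhs n t x = \<i> / 2 * conv (laplacian (mollifier n)) (\<psi> t) x - \<i> * conv (mollifier n) (nonlin (\<psi> t)) x"
proof -
  interpret fixed_time a R V \<beta> "\<psi> t" "g t" by (rule ft[OF assms])
  show ?thesis by (simp add: F_def laplacian_conv[OF u_loc Cc_smooth_mollifier])
qed

lemma partial_rhs_eq:
  assumes "0 \<le> t"
  shows "partial j (rhs n t) x = \<i> / 2 * conv (laplacian (partial j (mollifier n))) (\<psi> t) x - \<i> * conv (partial j (mollifier n)) (nonlin (\<psi> t)) x"
proof -
  interpret fixed_time a R V \<beta> "\<psi> t" "g t" by (rule ft[OF assms])
  let ?f = "conv (laplacian (mollifier n)) (\<psi> t)" and ?h = "conv (mollifier n) (nonlin (\<psi> t))"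
  have d: "?f differentiable (at x)" "?h differentiable (at x)"
    by (intro conv_differentiable u_loc nonlin_loc Cc_smooth_laplacian Cc_smooth_mollifier)+
  have "((\<lambda>x. \<i> / 2 * ?f x - \<i> * ?h x) has_derivative (\<lambda>h. \<i> / 2 * frechet_derivative ?f (at x) h - \<i> * frechet_derivative ?h (at x) h)) (at x)"
    using d unfolding frechet_derivative_works by (intro has_derivative_diff has_derivative_mult_right)
  moreover have "rhs n t = (\<lambda>x. \<i> / 2 * ?f x - \<i> * ?h x)" using rhs_eq[OF assms] by (simp add: fun_eq_iff)
  ultimately have "partial j (rhs n t) x = \<i> / 2 * partial j ?f x - \<i> * partial j ?h x"
    by (simp add: partial_eqI) (simp add: partial_def)
  then show ?thesis
    by (simp add: partial_conv[OF u_loc] partial_conv[OF nonlin_loc] Cc_smooth_laplacian Cc_smooth_mollifier laplacian_partial_commute[OF smooth_mollifier])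
qed

lemma moll_derivative:
  assumes "0 \<le> t"
  shows "((\<lambda>s. moll n s x) has_vector_derivative rhs n t x) (at t within {0..})"
  unfolding rhs_eq[OF assms] by (rule conv_time_derivative[OF Cc_smooth_mollifier assms])

lemma partial_moll: "0 \<le> t \<Longrightarrow> partial j (moll n t) = conv (partial j (mollifier n)) (\<psi> t)"
  by (intro partial_conv L2_locally_integrable flow_H1 Cc_smooth_mollifier)

lemma partial_moll_derivative:
  assumes "0 \<le> t"
  shows "((\<lambda>s. partial j (moll n s) x) has_vector_derivative partial j (rhs n t) x) (at t within {0..})"
proof -
  have "((\<lambda>s. conv (partial j (mollifier n)) (\<psi> s) x) has_vector_derivative partial j (rhs n t) x) (at t within {0..})"
    unfolding partial_rhs_eq[OF assms] by (rule conv_time_derivative[OF Cc_smooth_partial[OF Cc_smooth_mollifier] assms])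
  then show ?thesis
    by (rule has_vector_derivative_transform[rotated -1]) (use assms partial_moll in auto)
qed

text \<open>For fixed n, the constants that dominate differentiation under the space integral. The
  restriction to \<open>norm x \<le> R\<close> lets the truncated nonlinearity replace the full one,
  which need not be in L2.\<close>

lemma flow_bounds:
  obtains C where "0 \<le> C" "\<And>t (x :: real ^ 'a) j. t \<in> {0..T} \<Longrightarrow> norm x \<le> R \<Longrightarrow>
    norm (moll n t x) \<le> C \<and> norm (partial j (moll n t) x) \<le> C \<and> norm (rhs n t x) \<le> C \<and> norm (partial j (rhs n t) x) \<le> C"
proof -
  obtain M0 where M0: "\<And>t. t \<in> {0..T} \<Longrightarrow> norm_L2 (\<psi> t) \<le> M0 \<and> norm_L2 (g t) \<le> M0" using flow_bound by blast
  define M where "M = max M0 0"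
  have M: "0 \<le> M" "\<And>t. t \<in> {0..T} \<Longrightarrow> norm_L2 (\<psi> t) \<le> M" "\<And>t. t \<in> {0..T} \<Longrightarrow> norm_L2 (g t) \<le> M"
    using M0 by (auto simp: M_def max.coboundedI1)
  let ?N = "nonlin_bound M"
  let ?\<rho> = "mollifier n :: real ^ 'a \<Rightarrow> real"
  have N: "0 \<le> ?N" by (rule nonlin_bound_nonneg[OF M(1)])
  have r1: "1 / real (Suc n) \<le> 1" by simp
  have cu: "norm (conv \<eta> (\<psi> t) x) \<le> norm_L2 \<eta> * M" if "t \<in> {0..T}" "Cc_smooth \<eta>" for t \<eta> x
    using norm_conv_le[OF flow_H1(1) that(2), of t x] mult_left_mono[OF M(2)[OF that(1)] norm_L2_nonneg[of \<eta>]] that(1) by auto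
  have cn: "norm (conv \<eta> (nonlin (\<psi> t)) x) \<le> norm_L2 \<eta> * ?N"
    if t: "t \<in> {0..T}" and \<eta>: "Cc_smooth \<eta>" "supp_in (1 / real (Suc n)) \<eta>" and x: "norm x \<le> R" for t \<eta> x
  proof -
    have t0: "0 \<le> t" using t by simp
    interpret fixed_time a R V \<beta> "\<psi> t" "g t" by (rule ft[OF t0])
    have "conv \<eta> (nonlin (\<psi> t)) x = conv \<eta> (local_nonlin (\<psi> t)) x"
      using conv_local[OF \<eta>(2) x, of "R + 1" "nonlin (\<psi> t)"] r1 by (simp add: local_nonlin_eq[abs_def] ind_def)
    also have "norm \<dots> \<le> norm_L2 \<eta> * norm_L2 (local_nonlin (\<psi> t))" by (rule norm_conv_le[OF local_nonlin_L2 \<eta>(1)])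
    also have "\<dots> \<le> norm_L2 \<eta> * ?N"
      by (intro mult_left_mono norm_local_nonlin_le[OF ft[OF t0] M(2)[OF t] M(3)[OF t]] norm_L2_nonneg)
    finally show ?thesis .
  qed
  define A where "A \<eta> = norm_L2 \<eta> * M + norm_L2 (laplacian \<eta>) * M + norm_L2 \<eta> * ?N" for \<eta> :: "real ^ 'a \<Rightarrow> real"
  have A: "0 \<le> A \<eta>" for \<eta> unfolding A_def by (intro add_nonneg_nonneg mult_nonneg_nonneg norm_L2_nonneg M N)
  have est: "norm (conv \<eta> (\<psi> t) x) \<le> A \<eta> \<and> norm (\<i> / 2 * conv (laplacian \<eta>) (\<psi> t) x - \<i> * conv \<eta> (nonlin (\<psi> t)) x) \<le> A \<eta>"
    if "t \<in> {0..T}" "Cc_smooth \<eta>" "supp_in (1 / real (Suc n)) \<eta>" "norm x \<le> R" for t \<eta> x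
  proof -
    have "norm (\<i> / 2 * conv (laplacian \<eta>) (\<psi> t) x - \<i> * conv \<eta> (nonlin (\<psi> t)) x) \<le> norm (conv (laplacian \<eta>) (\<psi> t) x) / 2 + norm (conv \<eta> (nonlin (\<psi> t)) x)"
      using norm_triangle_ineq4[of "\<i> / 2 * conv (laplacian \<eta>) (\<psi> t) x" "\<i> * conv \<eta> (nonlin (\<psi> t)) x"] by (simp add: norm_mult)
    moreover have "0 \<le> norm_L2 \<eta> * M" "0 \<le> norm_L2 (laplacian \<eta>) * M" "0 \<le> norm_L2 \<eta> * ?N"
      by (intro mult_nonneg_nonneg norm_L2_nonneg M N)+
    ultimately show ?thesis
      using cu[OF that(1,2), of x] cu[OF that(1) Cc_smooth_laplacian[OF that(2)], of x] cn[OF that(1,2,3,4)] unfolding A_def by linarith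
  qed
  define C where "C = A ?\<rho> + (\<Sum>j\<in>UNIV. A (partial j ?\<rho>))"
  have C1: "A ?\<rho> \<le> C" using A by (auto simp: C_def intro: sum_nonneg)
  have C2: "A (partial j ?\<rho>) \<le> C" for j using A member_le_sum[of j UNIV "\<lambda>j. A (partial j ?\<rho>)"] by (auto simp: C_def intro: add_increasing)
  show ?thesis
  proof (rule that[of C])
    show "0 \<le> C" using A[of ?\<rho>] C1 by linarith
    fix t j and x :: "real ^ 'a" assume t: "t \<in> {0..T}" and x: "norm x \<le> R"
    then have t0: "0 \<le> t" by simp
    show "norm (moll n t x) \<le> C \<and> norm (partial j (moll n t) x) \<le> C \<and> norm (rhs n t x) \<le> C \<and> norm (partial j (rhs n t) x) \<le> C"
      using est[OF t Cc_smooth_mollifier supp_in_mollifier x] est[OF t Cc_smooth_partial[OF Cc_smooth_mollifier] supp_in_partial[OF supp_in_mollifier] x, of j]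
        C1 C2[of j] unfolding rhs_eq[OF t0] partial_rhs_eq[OF t0] partial_moll[OF t0] by linarith
  qed
qed

lemma mass_derivative:
  assumes t: "t \<in> {0..T}"
  shows "((\<lambda>s. mass_a (moll n s)) has_vector_derivative fixed_time.mass_rate a V \<beta> (\<psi> t) n) (at t within {0..T})"
proof -
  have t0: "0 \<le> t" using t by simp
  obtain C where C: "0 \<le> C" "\<And>t x j. t \<in> {0..T} \<Longrightarrow> norm x \<le> R \<Longrightarrow>
    norm (moll n t x) \<le> C \<and> norm (partial j (moll n t) x) \<le> C \<and> norm (rhs n t x) \<le> C \<and> norm (partial j (rhs n t) x) \<le> C"
    using flow_bounds by blast
  let ?f' = "\<lambda>s x. a x * (2 * Re (cnj (moll n s x) * rhs n s x))"
  have "((\<lambda>s. LINT x|lborel. a x * (cmod (moll n s x))\<^sup>2) has_vector_derivative (LINT x|lborel. ?f' t x)) (at t within {0..T})"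
  proof (rule has_vector_derivative_lebesgue_integral[where G="\<lambda>x. \<bar>a x\<bar> * (2 * (C * C))"])
    fix s x assume s: "s \<in> {0..T}"
    then have s0: "0 \<le> s" by simp
    interpret fixed_time a R V \<beta> "\<psi> s" "g s" by (rule ft[OF s0])
    show "integrable lborel (\<lambda>x. a x * (cmod (moll n s x))\<^sup>2)"
      by (rule integrable_supp_in[where r=R])
        (use a_supp in \<open>auto intro!: continuous_intros smooth_continuous[OF a_smooth] smooth_continuous[OF w_smooth] simp: supp_in_def\<close>)
    have "((\<lambda>s. moll n s x) has_derivative (\<lambda>h. h *\<^sub>R rhs n s x)) (at s within {0..T})"
      using moll_derivative[OF s0, of n x] has_derivative_subset by (fastforce simp: has_vector_derivative_def)
    from has_derivative_inner[OF this this]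
    have "((\<lambda>s. a x * (moll n s x \<bullet> moll n s x)) has_derivative (\<lambda>h. a x * (h * (2 * (moll n s x \<bullet> rhs n s x))))) (at s within {0..T})"
      by (intro has_derivative_mult_right) (simp add: inner_commute algebra_simps)
    then show "((\<lambda>s. a x * (cmod (moll n s x))\<^sup>2) has_vector_derivative ?f' s x) (at s within {0..T})"
      by (simp add: has_vector_derivative_def dot_square_norm inner_complex_def algebra_simps)
    show "norm (?f' s x) \<le> \<bar>a x\<bar> * (2 * (C * C))"
    proof (cases "norm x \<le> R")
      case True
      have "\<bar>Re (cnj (moll n s x) * rhs n s x)\<bar> \<le> norm (moll n s x) * norm (rhs n s x)"
        using abs_Re_le_cmod[of "cnj (moll n s x) * rhs n s x"] by (simp only: norm_mult complex_mod_cnj)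
      also have "\<dots> \<le> C * C" using C(2)[OF s True] C(1) by (intro mult_mono) auto
      finally show ?thesis by (auto simp: abs_mult intro!: mult_left_mono)
    qed (use a_supp in \<open>auto simp: supp_in_def\<close>)
  next
    show "integrable lborel (\<lambda>x. \<bar>a x\<bar> * (2 * (C * C)))"
      by (rule integrable_supp_in[where r=R]) (use a_supp in \<open>auto intro!: continuous_intros smooth_continuous[OF a_smooth] simp: supp_in_def\<close>)
    interpret fixed_time a R V \<beta> "\<psi> t" "g t" by (rule ft[OF t0])
    show "?f' t \<in> borel_measurable lborel"
      by (auto intro!: borel_measurable_continuous_onI continuous_intros smooth_continuous[OF a_smooth] smooth_continuous[OF w_smooth] smooth_continuous[OF F_smooth])
  qed (use t in auto)
  moreover have "(LINT x|lborel. ?f' t x) = fixed_time.mass_rate a V \<beta> (\<psi> t) n"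
    using fixed_time.mass_rate_def[OF ft[OF t0], of \<beta> n] by simp
  ultimately show ?thesis by (simp add: mass_a_def)
qed

lemma momentum_derivative:
  assumes t: "t \<in> {0..T}"
  shows "((\<lambda>s. momentum_a (moll n s) (\<lambda>j. partial j (moll n s))) has_vector_derivative fixed_time.momentum_rate a V \<beta> (\<psi> t) n) (at t within {0..T})"
proof -
  have t0: "0 \<le> t" using t by simp
  obtain C where C: "0 \<le> C" "\<And>t x j. t \<in> {0..T} \<Longrightarrow> norm x \<le> R \<Longrightarrow>
    norm (moll n t x) \<le> C \<and> norm (partial j (moll n t) x) \<le> C \<and> norm (rhs n t x) \<le> C \<and> norm (partial j (rhs n t) x) \<le> C"
    using flow_bounds by blast
  let ?f = "\<lambda>s x. \<Sum>j\<in>UNIV. partial j a x * Im (cnj (moll n s x) * partial j (moll n s) x)"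
  let ?f' = "\<lambda>s x. \<Sum>j\<in>UNIV. partial j a x * Im (cnj (rhs n s x) * partial j (moll n s) x + cnj (moll n s x) * partial j (rhs n s) x)"
  have outside: "partial j a x = 0" if "\<not> norm x \<le> R" for j x using partial_0_outside[OF a_supp] that by auto
  note a_cont = smooth_continuous[OF smooth_partial[OF a_smooth]]
  have 1: "((\<lambda>s. LINT x|lborel. ?f s x) has_vector_derivative (LINT x|lborel. ?f' t x)) (at t within {0..T})"
  proof (rule has_vector_derivative_lebesgue_integral[where G="\<lambda>x. \<Sum>j\<in>UNIV. \<bar>partial j a x\<bar> * (2 * (C * C))"])
    fix s x assume s: "s \<in> {0..T}"
    then have s0: "0 \<le> s" by simp
    interpret fixed_time a R V \<beta> "\<psi> s" "g s" by (rule ft[OF s0])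
    show "integrable lborel (?f s)"
      by (rule integrable_supp_in[where r=R])
        (auto intro!: continuous_intros a_cont smooth_continuous[OF w_smooth] smooth_continuous[OF smooth_partial[OF w_smooth]] simp: supp_in_def outside)
    have d: "((\<lambda>s. moll n s x) has_vector_derivative rhs n s x) (at s within {0..T})"
      "((\<lambda>s. partial j (moll n s) x) has_vector_derivative partial j (rhs n s) x) (at s within {0..T})" for j
      by (rule has_vector_derivative_within_subset[OF moll_derivative[OF s0]] has_vector_derivative_within_subset[OF partial_moll_derivative[OF s0]], auto)+
    have "((\<lambda>s. Im (cnj (moll n s x) * partial j (moll n s) x)) has_vector_derivative
        Im (cnj (moll n s x) * partial j (rhs n s) x + cnj (rhs n s x) * partial j (moll n s) x)) (at s within {0..T})" for j
      by (intro bounded_linear.has_vector_derivative[OF bounded_linear_Im] has_vector_derivative_mult bounded_linear.has_vector_derivative[OF bounded_linear_cnj] d)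
    then show "((\<lambda>s. ?f s x) has_vector_derivative ?f' s x) (at s within {0..T})"
      by (intro has_vector_derivative_sum has_vector_derivative_mult_right) (simp add: add.commute)
    show "norm (?f' s x) \<le> (\<Sum>j\<in>UNIV. \<bar>partial j a x\<bar> * (2 * (C * C)))"
    proof (rule sum_norm_le)
      fix j
      show "norm (partial j a x * Im (cnj (rhs n s x) * partial j (moll n s) x + cnj (moll n s x) * partial j (rhs n s) x)) \<le> \<bar>partial j a x\<bar> * (2 * (C * C))"
      proof (cases "norm x \<le> R")
        case True
        have "\<bar>Im (cnj (rhs n s x) * partial j (moll n s) x + cnj (moll n s x) * partial j (rhs n s) x)\<bar>
           \<le> norm (rhs n s x) * norm (partial j (moll n s) x) + norm (moll n s x) * norm (partial j (rhs n s) x)"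
          using abs_Im_le_cmod[of "cnj (rhs n s x) * partial j (moll n s) x + cnj (moll n s x) * partial j (rhs n s) x"]
            norm_triangle_ineq[of "cnj (rhs n s x) * partial j (moll n s) x" "cnj (moll n s x) * partial j (rhs n s) x"]
          by (simp only: norm_mult complex_mod_cnj)
        also have "\<dots> \<le> C * C + C * C" using C(2)[OF s True, of j] C(1) by (intro add_mono mult_mono) auto
        finally have "\<bar>Im (cnj (rhs n s x) * partial j (moll n s) x + cnj (moll n s x) * partial j (rhs n s) x)\<bar> \<le> 2 * (C * C)" by linarith
        then show ?thesis unfolding real_norm_def abs_mult by (intro mult_left_mono) auto
      qed (simp add: outside)
    qed
  next
    show "integrable lborel (\<lambda>x. \<Sum>j\<in>UNIV. \<bar>partial j a x\<bar> * (2 * (C * C)))"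
      by (rule integrable_supp_in[where r=R]) (auto intro!: continuous_intros a_cont simp: supp_in_def outside)
    interpret fixed_time a R V \<beta> "\<psi> t" "g t" by (rule ft[OF t0])
    show "?f' t \<in> borel_measurable lborel"
      by (auto intro!: borel_measurable_continuous_onI continuous_intros a_cont smooth_continuous[OF w_smooth] smooth_continuous[OF smooth_partial[OF w_smooth]]
        smooth_continuous[OF F_smooth] smooth_continuous[OF smooth_partial[OF F_smooth]])
  qed (use t in auto)
  have 2: "(LINT x|lborel. ?f' t x) = fixed_time.momentum_rate a V \<beta> (\<psi> t) n"
    using fixed_time.momentum_rate_def[OF ft[OF t0], of \<beta> n] by simp
  have 3: "(LINT x|lborel. ?f s x) = momentum_a (moll n s) (\<lambda>j. partial j (moll n s))" if "s \<in> {0..T}" for s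
  proof -
    have s0: "0 \<le> s" using that by simp
    interpret fixed_time a R V \<beta> "\<psi> s" "g s" by (rule ft[OF s0])
    have i: "integrable lborel (\<lambda>x. cnj (moll n s x) * (\<Sum>j\<in>UNIV. complex_of_real (partial j a x) * partial j (moll n s) x))"
      by (rule integrable_supp_in[where r=R])
        (auto intro!: continuous_intros a_cont smooth_continuous[OF w_smooth] smooth_continuous[OF smooth_partial[OF w_smooth]] simp: supp_in_def outside)
    show ?thesis
      unfolding momentum_a_def integral_Im[OF i, symmetric]
      by (intro Bochner_Integration.integral_cong refl) (simp add: sum_distrib_left mult.left_commute[of "cnj _"] Im_sum)
  qed
  show ?thesis
    using has_vector_derivative_transform[OF t 3[symmetric] 1[unfolded 2]] .
qed

text \<open>For each n the fundamental theorem of calculus applies to the mollified quantities.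
  Their rates converge at every time and are bounded uniformly in n, which is enough for dominated
  convergence in time and yields the identities in integrated form.\<close>

theorem virial_evolution:
  assumes T: "0 \<le> T"
  shows "((\<lambda>s. momentum_a (\<psi> s) (\<lambda>j x. g s x $ j)) has_integral (mass_a (\<psi> T) - mass_a (\<psi> 0))) {0..T}"
    and "((\<lambda>s. kinetic_a (\<psi> s) (\<lambda>j x. g s x $ j) + potential_a (\<psi> s)) has_integral
      (momentum_a (\<psi> T) (\<lambda>j x. g T x $ j) - momentum_a (\<psi> 0) (\<lambda>j x. g 0 x $ j))) {0..T}"
proof -
  obtain M0 where M0: "\<And>t. t \<in> {0..T} \<Longrightarrow> norm_L2 (\<psi> t) \<le> M0 \<and> norm_L2 (g t) \<le> M0" using flow_bound by blast
  obtain C where C: "\<And>u g n. fixed_time a R V u g \<Longrightarrow> norm_L2 u \<le> max M0 0 \<Longrightarrow> norm_L2 g \<le> max M0 0 \<Longrightarrow>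
    \<bar>fixed_time.mass_rate a V \<beta> u n\<bar> \<le> C \<and> \<bar>fixed_time.momentum_rate a V \<beta> u n\<bar> \<le> C"
    using rate_bounds[of "max M0 0"] by auto
  have b: "\<bar>fixed_time.mass_rate a V \<beta> (\<psi> t) n\<bar> \<le> C \<and> \<bar>fixed_time.momentum_rate a V \<beta> (\<psi> t) n\<bar> \<le> C" if "t \<in> {0..T}" for t n
    using that M0[OF that] by (intro C[of "\<psi> t" "g t" n] ft) (auto simp: max.coboundedI1)
  \<comment> \<open>Both identities follow from this one passage to the limit, with Q the mollified
    quantity, r its rate, and L and f their limits.\<close>
  have lim: "f integrable_on {0..T} \<and> integral {0..T} f = L T - L 0"
    if der: "\<And>n t. t \<in> {0..T} \<Longrightarrow> (Q n has_vector_derivative r n t) (at t within {0..T})"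
      and bd: "\<And>n t. t \<in> {0..T} \<Longrightarrow> \<bar>r n t\<bar> \<le> C"
      and r: "\<And>t. t \<in> {0..T} \<Longrightarrow> (\<lambda>n. r n t) \<longlonglongrightarrow> f t" and Q: "\<And>t. t \<in> {0..T} \<Longrightarrow> (\<lambda>n. Q n t) \<longlonglongrightarrow> L t"
    for Q r :: "nat \<Rightarrow> real \<Rightarrow> real" and f L :: "real \<Rightarrow> real"
  proof -
    have ftc: "(r n has_integral (Q n T - Q n 0)) {0..T}" for n
      using der T by (intro fundamental_theorem_of_calculus) auto
    have "f integrable_on {0..T} \<and> (\<lambda>n. integral {0..T} (r n)) \<longlonglongrightarrow> integral {0..T} f"
    proof (rule conjI)
      show "f integrable_on {0..T}" by (rule dominated_convergence(1)[where f=r and h="\<lambda>x. C"]) (use ftc bd r in auto)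
      show "(\<lambda>n. integral {0..T} (r n)) \<longlonglongrightarrow> integral {0..T} f" by (rule dominated_convergence(2)[where f=r and h="\<lambda>x. C"]) (use ftc bd r in auto)
    qed
    moreover have "(\<lambda>n. integral {0..T} (r n)) \<longlonglongrightarrow> L T - L 0"
    proof -
      have "integral {0..T} (r n) = Q n T - Q n 0" for n using ftc by (rule integral_unique)
      then show ?thesis using tendsto_diff[OF Q[of T] Q[of 0]] T by simp
    qed
    ultimately show ?thesis using LIMSEQ_unique by blast
  qed
  have "(\<lambda>s. momentum_a (\<psi> s) (\<lambda>j x. g s x $ j)) integrable_on {0..T} \<and> integral {0..T} (\<lambda>s. momentum_a (\<psi> s) (\<lambda>j x. g s x $ j)) = mass_a (\<psi> T) - mass_a (\<psi> 0)"
    by (rule lim[where Q="\<lambda>n s. mass_a (moll n s)" and r="\<lambda>n s. fixed_time.mass_rate a V \<beta> (\<psi> s) n", OF mass_derivative])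
      (use b in \<open>auto intro: fixed_time.mass_rate_lim[OF ft] fixed_time.mass_lim[OF ft]\<close>)
  then show "((\<lambda>s. momentum_a (\<psi> s) (\<lambda>j x. g s x $ j)) has_integral (mass_a (\<psi> T) - mass_a (\<psi> 0))) {0..T}"
    by (simp only: has_integral_iff)
  let ?L = "\<lambda>s. momentum_a (\<psi> s) (\<lambda>j x. g s x $ j)" and ?K = "\<lambda>s. kinetic_a (\<psi> s) (\<lambda>j x. g s x $ j) + potential_a (\<psi> s)"
  have "?K integrable_on {0..T} \<and> integral {0..T} ?K = ?L T - ?L 0"
    by (rule lim[where Q="\<lambda>n s. momentum_a (moll n s) (\<lambda>j. partial j (moll n s))" and r="\<lambda>n s. fixed_time.momentum_rate a V \<beta> (\<psi> s) n", OF momentum_derivative])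
      (use b in \<open>auto intro: fixed_time.momentum_rate_lim[OF ft] fixed_time.momentum_lim[OF ft]\<close>)
  then show "(?K has_integral (?L T - ?L 0)) {0..T}"
    by (simp only: has_integral_iff)
qed

end

text \<open>The bound passes from the mollified rates to their limit. It turns integrability of the
  limit rate into absolute integrability, so that its positive part can be integrated.\<close>

lemma (in nls_flow) virial_rate_bounded:
  "\<exists>C. \<forall>t\<in>{0..T}. \<bar>kinetic_a (\<psi> t) (\<lambda>j x. g t x $ j) + potential_a (\<psi> t)\<bar> \<le> C"
proof -
  obtain M0 where M0: "\<And>t. t \<in> {0..T} \<Longrightarrow> norm_L2 (\<psi> t) \<le> M0 \<and> norm_L2 (g t) \<le> M0" using flow_bound by blast
  obtain C where C: "\<And>u g n. fixed_time a R V u g \<Longrightarrow> norm_L2 u \<le> max M0 0 \<Longrightarrow> norm_L2 g \<le> max M0 0 \<Longrightarrow>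
    \<bar>fixed_time.momentum_rate a V \<beta> u n\<bar> \<le> C"
    using rate_bounds[of "max M0 0"] by auto
  have "\<bar>kinetic_a (\<psi> t) (\<lambda>j x. g t x $ j) + potential_a (\<psi> t)\<bar> \<le> C" if t: "t \<in> {0..T}" for t
  proof -
    have f: "fixed_time a R V (\<psi> t) (g t)" using t by (intro ft) auto
    have "\<bar>fixed_time.momentum_rate a V \<beta> (\<psi> t) n\<bar> \<le> C" for n
      by (rule C[OF f]) (use M0[OF t] in \<open>auto simp: max.coboundedI1\<close>)
    then show ?thesis
      using tendsto_rabs[OF fixed_time.momentum_rate_lim[OF f, of \<beta>]] by (intro LIMSEQ_le_const2) auto
  qed
  then show ?thesis by blast
qed

section \<open>The truncated variance\<close>

text \<open>The compactly supported part of 1 - e b; the constant 1 returns in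
  \<open>weighted_variance_eq\<close>.\<close>

definition virial_weight :: "real ^ 'd::finite \<Rightarrow> real" where
  "virial_weight x = - exp 1 * bump x"

text \<open>The derivative of the weight with respect to |x|^2; its value at the origin is 1, as for
  |x|^2 itself.\<close>

definition virial_slope :: "real ^ 'd::finite \<Rightarrow> real" where
  "virial_slope x = exp 1 * expinv 2 (1 - x \<bullet> x)"

lemma virial_weight_smooth: "smooth virial_weight"
  unfolding virial_weight_def[abs_def] by (intro smooth_bounded_linear[OF bounded_linear_mult_right] smooth_bump)

lemma supp_in_virial_weight: "supp_in 1 virial_weight"
  by (auto simp: supp_in_def virial_weight_def bump_eq_0)

lemma Cc_smooth_virial_weight: "Cc_smooth virial_weight"
  using virial_weight_smooth supp_in_virial_weight by (auto simp: Cc_smooth_def)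

lemma DERIV_expinv_0: "DERIV (expinv 0) r :> expinv 2 r"
  using has_real_derivative_expinv[of 0 r] by (simp add: numeral_2_eq_2)

lemma partial_virial_weight: "partial j virial_weight x = 2 * (x $ j) * virial_slope x"
proof -
  have q: "((\<lambda>x :: real ^ 'a. 1 - x \<bullet> x) has_derivative (\<lambda>h. - (2 * (x \<bullet> h)))) (at x)"
    by (auto intro!: derivative_eq_intros simp: inner_commute)
  have "(virial_weight has_derivative (\<lambda>h. - exp 1 * (expinv 2 (1 - x \<bullet> x) * (- (2 * (x \<bullet> h)))))) (at x)"
    unfolding virial_weight_def[abs_def] bump_def
    using has_derivative_mult_right[OF has_derivative_compose[OF q DERIV_expinv_0[of "1 - x \<bullet> x", unfolded has_field_derivative_def]], of "- exp 1"]
    by simp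
  from partial_eqI[OF this] show ?thesis by (simp add: virial_slope_def inner_axis)
qed

lemma virial_slope_nonneg: "0 \<le> virial_slope x"
  by (simp add: virial_slope_def expinv_nonneg)

lemma expinv_continuous: "continuous_on S (expinv k)"
  using DERIV_isCont[OF has_real_derivative_expinv] by (intro continuous_at_imp_continuous_on) blast

lemma virial_slope_continuous: "continuous_on UNIV virial_slope"
  unfolding virial_slope_def[abs_def] by (intro continuous_intros continuous_on_compose2[OF expinv_continuous[of UNIV]]) auto

text \<open>The constant is 3! from \<open>expinv_le\<close> with k = 2.\<close>

lemma expinv_2_le: "r \<le> 1 \<Longrightarrow> expinv 2 r \<le> 6"
  using expinv_le[of r 2] by (cases "0 < r") (auto simp: expinv_def fact_numeral eval_nat_numeral)

lemma virial_slope_le: "virial_slope x \<le> 6 * exp 1"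
  using expinv_2_le[of "1 - x \<bullet> x"] by (simp add: virial_slope_def)

lemma virial_slope_abs: "\<bar>virial_slope x\<bar> \<le> 6 * exp 1"
  using virial_slope_nonneg[of x] virial_slope_le[of x] by simp

lemma virial_slope_0: "virial_slope 0 = 1"
  by (simp add: virial_slope_def expinv_def flip: exp_add)

text \<open>The mean value theorem in the variable |x|^2. The nonnegative factor
  \<open>expinv 2 r\<close> gives both the sign and the quadratic bound of the weight, and r near 1
  gives its limit under rescaling.\<close>

lemma virial_weight_expansion:
  obtains r where "1 - x \<bullet> x \<le> r" "r \<le> 1" "1 + virial_weight x = exp 1 * (x \<bullet> x) * expinv 2 r"
proof (cases "x = 0")
  case True
  then show ?thesis using that[of 1] by (simp add: virial_weight_def bump_0 flip: exp_add)
next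
  case False
  then have "1 - x \<bullet> x < 1" by simp
  from MVT2[OF this, of "expinv 0" "expinv 2"]
  obtain r where r: "1 - x \<bullet> x < r" "r < 1" "expinv 0 1 - expinv 0 (1 - x \<bullet> x) = (x \<bullet> x) * expinv 2 r"
    using DERIV_expinv_0 by auto
  have "exp 1 * (expinv 0 1 - expinv 0 (1 - x \<bullet> x)) = 1 + virial_weight x"
    by (simp add: virial_weight_def bump_def expinv_def[of 0 1] right_diff_distrib flip: exp_add)
  then show ?thesis using that[of r] r by simp
qed

lemma virial_weight_bounds: "0 \<le> 1 + virial_weight x" "1 + virial_weight x \<le> 6 * exp 1 * (x \<bullet> x)"
proof -
  obtain r where r: "r \<le> 1" "1 + virial_weight x = exp 1 * (x \<bullet> x) * expinv 2 r" using virial_weight_expansion by metis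
  show "0 \<le> 1 + virial_weight x" unfolding r(2) by (simp add: expinv_nonneg)
  have "exp 1 * (x \<bullet> x) * expinv 2 r \<le> exp 1 * (x \<bullet> x) * 6" by (intro mult_left_mono expinv_2_le r) auto
  then show "1 + virial_weight x \<le> 6 * exp 1 * (x \<bullet> x)" unfolding r(2) by simp
qed

text \<open>The gradient is explicit, \<open>2 x\<close> times the slope, so its difference quotient
  at the origin is \<open>2\<close> times a component of the unit vector times a slope that tends to
  1. The Hessian there is that of |x|^2.\<close>

lemma virial_weight_second_partial_0: "partial k (partial j virial_weight) 0 = (if j = k then 2 else 0)"
proof -
  let ?e = "axis k 1 :: real ^ 'a"
  have "((\<lambda>s. partial j virial_weight (0 + s *\<^sub>R ?e)) has_real_derivative partial k (partial j virial_weight) 0) (at 0)"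
    using smooth_has_partial[OF smooth_partial[OF virial_weight_smooth], of k j]
    unfolding has_partial_def has_real_derivative_iff_has_vector_derivative by blast
  then have "((\<lambda>s. (partial j virial_weight (s *\<^sub>R ?e) - partial j virial_weight 0) / s) \<longlongrightarrow> partial k (partial j virial_weight) 0) (at 0)"
    by (simp add: DERIV_def)
  moreover have "((\<lambda>s. (partial j virial_weight (s *\<^sub>R ?e) - partial j virial_weight 0) / s) \<longlongrightarrow> (if j = k then 2 else 0)) (at 0)"
  proof -
    have "((\<lambda>s. 2 * (?e $ j) * virial_slope (s *\<^sub>R ?e)) \<longlongrightarrow> 2 * (?e $ j) * virial_slope (0 *\<^sub>R ?e)) (at 0)"
      by (intro tendsto_intros continuous_on_tendsto_compose[OF virial_slope_continuous]) auto
    then have l: "((\<lambda>s. 2 * (?e $ j) * virial_slope (s *\<^sub>R ?e)) \<longlongrightarrow> (if j = k then 2 else 0)) (at 0)"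
      by (cases "j = k") (simp_all add: virial_slope_0 axis_def)
    show ?thesis
      by (rule Lim_transform_eventually[OF l]) (auto simp: partial_virial_weight eventually_at_filter intro!: always_eventually)
  qed
  ultimately show ?thesis by (rule LIM_unique[rotated -1, rotated]) 
qed

lemma laplacian_virial_weight_0: "laplacian virial_weight (0 :: real ^ 'd::finite) = 2 * real CARD('d)"
  by (simp add: laplacian_def virial_weight_second_partial_0)

section \<open>Rescaling the weight\<close>

text \<open>The factor \<open>r\<^sup>2\<close> makes second derivatives functions of x / r without
  a prefactor, while the fourth order term decays like 1 / r^2.\<close>

definition scaled_weight :: "real \<Rightarrow> real ^ 'd::finite \<Rightarrow> real" where
  "scaled_weight r x = r\<^sup>2 * virial_weight ((1 / r) *\<^sub>R x)"

lemma partial_scaled: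
  fixes f :: "real ^ 'd::finite \<Rightarrow> real"
  assumes "smooth f"
  shows "partial i (\<lambda>x. c * f (s *\<^sub>R x)) = (\<lambda>x. (c * s) * partial i f (s *\<^sub>R x))"
proof
  fix x
  have d: "f differentiable (at (s *\<^sub>R x + 0))" by (rule smooth_differentiable[OF assms])
  have "partial i (\<lambda>x. c * f (s *\<^sub>R x + 0)) x = c * partial i (\<lambda>x. f (s *\<^sub>R x + 0)) x"
    by (intro partial_bounded_linear[OF bounded_linear_mult_right] affine_partial(1)[OF d])
  then show "partial i (\<lambda>x. c * f (s *\<^sub>R x)) x = (c * s) * partial i f (s *\<^sub>R x)"
    unfolding affine_partial(2)[OF d] by simp
qed

lemma laplacian_scaled:
  fixes f :: "real ^ 'd::finite \<Rightarrow> real"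
  assumes "smooth f"
  shows "laplacian (\<lambda>x. c * f (s *\<^sub>R x)) = (\<lambda>x. (c * s * s) * laplacian f (s *\<^sub>R x))"
  by (simp add: laplacian_def fun_eq_iff partial_scaled[OF assms] partial_scaled[OF smooth_partial[OF assms]] sum_distrib_left)

lemma scaled_weight_partials:
  assumes "0 < r"
  shows "partial j (scaled_weight r) x = 2 * (x $ j) * virial_slope ((1 / r) *\<^sub>R x)"
    and "partial k (partial j (scaled_weight r)) x = partial k (partial j virial_weight) ((1 / r) *\<^sub>R x)"
    and "laplacian (scaled_weight r) x = laplacian virial_weight ((1 / r) *\<^sub>R x)"
    and "laplacian (laplacian (scaled_weight r)) x = (1 / r)\<^sup>2 * laplacian (laplacian virial_weight) ((1 / r) *\<^sub>R x)"
proof -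
  have 1: "partial j (scaled_weight r) = (\<lambda>x. r * partial j virial_weight ((1 / r) *\<^sub>R x))" for j :: 'a
    unfolding scaled_weight_def[abs_def] partial_scaled[OF virial_weight_smooth] using assms by (simp add: power2_eq_square)
  then show "partial j (scaled_weight r) x = 2 * (x $ j) * virial_slope ((1 / r) *\<^sub>R x)"
    using assms by (simp add: partial_virial_weight)
  show "partial k (partial j (scaled_weight r)) x = partial k (partial j virial_weight) ((1 / r) *\<^sub>R x)"
    unfolding 1 partial_scaled[OF smooth_partial[OF virial_weight_smooth]] using assms by simp
  have 2: "laplacian (scaled_weight r) = (\<lambda>x :: real ^ 'a. 1 * laplacian virial_weight ((1 / r) *\<^sub>R x))"
    unfolding scaled_weight_def[abs_def] laplacian_scaled[OF virial_weight_smooth] using assms by (simp add: power2_eq_square)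
  then show "laplacian (scaled_weight r) x = laplacian virial_weight ((1 / r) *\<^sub>R x)" by simp
  show "laplacian (laplacian (scaled_weight r)) x = (1 / r)\<^sup>2 * laplacian (laplacian virial_weight) ((1 / r) *\<^sub>R x)"
    unfolding 2 laplacian_scaled[OF smooth_laplacian[OF virial_weight_smooth]] by (simp add: power2_eq_square)
qed

lemma smooth_scaled_weight: "smooth (scaled_weight r)"
proof -
  have "smooth (\<lambda>x. virial_weight ((1 / r) *\<^sub>R x + 0))" by (rule smooth_affine[OF virial_weight_smooth])
  then show ?thesis unfolding scaled_weight_def[abs_def] by (intro smooth_bounded_linear[OF bounded_linear_mult_right]) simp
qed

lemma supp_in_scaled_weight: "0 < r \<Longrightarrow> supp_in r (scaled_weight r)"
proof -
  assume r: "0 < r"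
  have "virial_weight ((1 / r) *\<^sub>R x) = 0" if "r < norm x" for x :: "real ^ 'a"
  proof -
    have "1 < norm ((1 / r) *\<^sub>R x)" using r that by (simp add: less_divide_eq)
    then show ?thesis by (rule supp_in_virial_weight[unfolded supp_in_def, rule_format])
  qed
  then show ?thesis by (simp add: supp_in_def scaled_weight_def)
qed

text \<open>A bounded continuous coefficient, stretched by a growing factor, flattens to its value
  at the origin. In this way the terms of the truncated identity approach those belonging to
  |x|^2.\<close>

lemma scaled_coeff_tendsto:
  fixes f :: "real ^ 'd::finite \<Rightarrow> real" and p :: "real ^ 'd \<Rightarrow> 'b::{banach, second_countable_topology}"
  assumes f: "continuous_on UNIV f" "\<And>x. \<bar>f x\<bar> \<le> B" and p: "integrable lborel p"
  shows "(\<lambda>m. LINT x|lborel. f ((1 / real (Suc m)) *\<^sub>R x) *\<^sub>R p x) \<longlonglongrightarrow> f 0 *\<^sub>R (LINT x|lborel. p x)"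
proof -
  have [measurable]: "f \<in> borel_measurable borel" by (intro borel_measurable_continuous_onI f)
  have [measurable]: "p \<in> borel_measurable borel" using p by auto
  have "(\<lambda>m. LINT x|lborel. f ((1 / real (Suc m)) *\<^sub>R x) *\<^sub>R p x) \<longlonglongrightarrow> (LINT x|lborel. f 0 *\<^sub>R p x)"
  proof (rule integral_dominated_convergence[where w="\<lambda>x. B * norm (p x)"])
    show "AE x in lborel. (\<lambda>m. f ((1 / real (Suc m)) *\<^sub>R x) *\<^sub>R p x) \<longlonglongrightarrow> f 0 *\<^sub>R p x"
    proof (rule AE_I2)
      fix x :: "real ^ 'd"
      have "(\<lambda>m. (1 / real (Suc m)) *\<^sub>R x) \<longlonglongrightarrow> 0 *\<^sub>R x"
        by (intro tendsto_scaleR tendsto_const LIMSEQ_Suc[OF lim_1_over_n])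
      then show "(\<lambda>m. f ((1 / real (Suc m)) *\<^sub>R x) *\<^sub>R p x) \<longlonglongrightarrow> f 0 *\<^sub>R p x"
        by (intro tendsto_scaleR tendsto_const continuous_on_tendsto_compose[OF f(1)]) auto
    qed
    show "AE x in lborel. norm (f ((1 / real (Suc m)) *\<^sub>R x) *\<^sub>R p x) \<le> B * norm (p x)" for m
      by (auto intro!: AE_I2 mult_right_mono f)
  qed (use p in auto)
  then show ?thesis by simp
qed

lemma scaled_coeff_bound:
  fixes f :: "real ^ 'd::finite \<Rightarrow> real" and p :: "real ^ 'd \<Rightarrow> 'b::{banach, second_countable_topology}"
  assumes f: "continuous_on UNIV f" "\<And>x. \<bar>f x\<bar> \<le> B" and p: "integrable lborel p"
  shows "integrable lborel (\<lambda>x. f (c *\<^sub>R x) *\<^sub>R p x)" "norm (LINT x|lborel. f (c *\<^sub>R x) *\<^sub>R p x) \<le> B * (LINT x|lborel. norm (p x))"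
proof -
  have [measurable]: "f \<in> borel_measurable borel" by (intro borel_measurable_continuous_onI f)
  have [measurable]: "p \<in> borel_measurable borel" using p by auto
  have B: "0 \<le> B" using f(2)[of 0] by linarith
  have le: "norm (f (c *\<^sub>R x) *\<^sub>R p x) \<le> B * norm (p x)" for x
    by (auto intro!: mult_right_mono f)
  show i: "integrable lborel (\<lambda>x. f (c *\<^sub>R x) *\<^sub>R p x)"
    by (rule Bochner_Integration.integrable_bound[OF integrable_mult_right[OF integrable_norm[OF p], of B]])
      (use le B in \<open>auto intro!: AE_I2\<close>)
  have "norm (LINT x|lborel. f (c *\<^sub>R x) *\<^sub>R p x) \<le> (LINT x|lborel. norm (f (c *\<^sub>R x) *\<^sub>R p x))" by (rule integral_norm_bound)
  also have "\<dots> \<le> (LINT x|lborel. B * norm (p x))" by (intro integral_mono le integrable_norm[OF i] integrable_mult_right integrable_norm[OF p])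
  finally show "norm (LINT x|lborel. f (c *\<^sub>R x) *\<^sub>R p x) \<le> B * (LINT x|lborel. norm (p x))" by simp
qed


section \<open>Comparison of the truncated virial rate with the energy\<close>

locale virial_data =
  fixes V :: "real ^ 'd::finite \<Rightarrow> real" and \<beta> :: real
  assumes dim: "CARD('d) \<in> {2, 3}" and V_smooth: "smooth V" and V_nonneg: "\<And>x. 0 \<le> V x"
    and V_virial: "\<And>x. 0 \<le> real CARD('d) * V x + (\<Sum>i\<in>UNIV. x $ i * partial i V x)"
begin

lemma weight_scaled_weight: "weight (scaled_weight (real (Suc m))) (real (Suc m)) V"
  by unfold_locales (rule smooth_scaled_weight V_smooth dim | (rule supp_in_scaled_weight, simp))+

definition virial_rate :: "nat \<Rightarrow> (real ^ 'd \<Rightarrow> complex) \<Rightarrow> (real ^ 'd \<Rightarrow> complex ^ 'd) \<Rightarrow> real" where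
  "virial_rate m u g = weight.kinetic_a (scaled_weight (real (Suc m))) u (\<lambda>j x. g x $ j) + weight.potential_a (scaled_weight (real (Suc m))) V \<beta> u"

text \<open>The energy with its three integrals separated and with an explicit representative of the
  gradient.\<close>

definition energy_of :: "(real ^ 'd \<Rightarrow> complex) \<Rightarrow> (real ^ 'd \<Rightarrow> complex ^ 'd) \<Rightarrow> real" where
  "energy_of u g = 1 / 2 * (norm_L2 g)\<^sup>2 + (LINT x|lborel. V x * (cmod (u x))\<^sup>2) + \<beta> / 2 * (LINT x|lborel. (cmod (u x))^4)"

text \<open>The radial derivative of the weight is nonnegative, so the hypothesis on \<open>d V + x \<cdot> \<nabla>V\<close> replaces the
  force term by a multiple of the potential energy.\<close>
definition rate_majorant :: "nat \<Rightarrow> (real ^ 'd \<Rightarrow> complex) \<Rightarrow> (real ^ 'd \<Rightarrow> complex ^ 'd) \<Rightarrow> real" where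
  "rate_majorant m u g =
    Re (\<Sum>k\<in>UNIV. \<Sum>j\<in>UNIV. LINT x|lborel. partial k (partial j virial_weight) ((1 / real (Suc m)) *\<^sub>R x) *\<^sub>R (cnj (g x $ k) * g x $ j))
    - 1 / 4 * ((1 / real (Suc m))\<^sup>2 * Re (LINT x|lborel. laplacian (laplacian virial_weight) ((1 / real (Suc m)) *\<^sub>R x) *\<^sub>R (cnj (u x) * u x)))
    + 2 * real CARD('d) * (LINT x|lborel. virial_slope ((1 / real (Suc m)) *\<^sub>R x) *\<^sub>R (V x * (cmod (u x))\<^sup>2))
    + \<beta> / 2 * Re (LINT x|lborel. laplacian virial_weight ((1 / real (Suc m)) *\<^sub>R x) *\<^sub>R (cnj (u x) * cub (u x)))"

end

locale virial_state = virial_data +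
  fixes u :: "real ^ 'a \<Rightarrow> complex" and g :: "real ^ 'a \<Rightarrow> complex ^ 'a"
  assumes u: "u \<in> L2" and g: "g \<in> L2" and wg: "is_weak_gradient u g"
    and Vu: "integrable lborel (\<lambda>x. V x * (cmod (u x))\<^sup>2)"
begin

lemma cub_u: "(\<lambda>x. cub (u x)) \<in> L2"
  by (rule L2_cub[OF L2D(1)[OF u] Sobolev_H1(1)[OF dim u g wg]])

lemma gk: "(\<lambda>x. g x $ k) \<in> L2" by (rule L2_component[OF g])

lemma integrable_products:
  "integrable lborel (\<lambda>x. cnj (g x $ k) * g x $ j)" "integrable lborel (\<lambda>x. cnj (u x) * u x)"
  "integrable lborel (\<lambda>x. cnj (u x) * cub (u x))"
  by (intro L2_mult_integrable L2_cnj gk u cub_u)+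

lemma u4: "cnj (u x) * cub (u x) = complex_of_real ((cmod (u x))^4)"
proof -
  have "cnj (u x) * cub (u x) = complex_of_real ((cmod (u x))\<^sup>2) * (u x * cnj (u x))" by (simp add: cub_def mult_ac)
  then show ?thesis by (simp only: complex_norm_square[symmetric] of_real_mult[symmetric] power_add[symmetric]) simp
qed

lemma integrable_u4: "integrable lborel (\<lambda>x. (cmod (u x))^4)"
  using integrable_products(3) unfolding u4 complex_of_real_integrable_eq .

lemma virial_weight_coeff:
  "continuous_on UNIV (partial k (partial j virial_weight))" "continuous_on UNIV (laplacian virial_weight)" "continuous_on UNIV (laplacian (laplacian virial_weight))"
  "\<exists>B. \<forall>x. \<bar>partial k (partial j virial_weight) (x :: real ^ 'a)\<bar> \<le> B" "\<exists>B. \<forall>x. \<bar>laplacian virial_weight (x :: real ^ 'a)\<bar> \<le> B"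
  "\<exists>B. \<forall>x. \<bar>laplacian (laplacian virial_weight) (x :: real ^ 'a)\<bar> \<le> B"
proof -
  show "continuous_on UNIV (partial k (partial j virial_weight))" "continuous_on UNIV (laplacian virial_weight)" "continuous_on UNIV (laplacian (laplacian virial_weight))"
    by (intro smooth_continuous smooth_partial smooth_laplacian virial_weight_smooth)+
  have "\<exists>B. \<forall>x. \<bar>f x\<bar> \<le> B" if "Cc_smooth f" for f :: "real ^ 'a \<Rightarrow> real"
    using Cc_smooth_bounded[OF that] by (metis real_norm_def)
  then show "\<exists>B. \<forall>x. \<bar>partial k (partial j virial_weight) (x :: real ^ 'a)\<bar> \<le> B" "\<exists>B. \<forall>x. \<bar>laplacian virial_weight (x :: real ^ 'a)\<bar> \<le> B"
    "\<exists>B. \<forall>x. \<bar>laplacian (laplacian virial_weight) (x :: real ^ 'a)\<bar> \<le> B"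
    by (auto intro!: Cc_smooth_partial Cc_smooth_laplacian Cc_smooth_virial_weight)
qed

text \<open>Three of the four terms agree after rewriting the derivatives of the scaled weight; only
  the force term is estimated.\<close>

lemma virial_rate_le: "virial_rate m u g \<le> rate_majorant m u g"
proof -
  interpret weight "scaled_weight (real (Suc m))" "real (Suc m)" V \<beta> by (rule weight_scaled_weight)
  have r: "0 < real (Suc m)" by simp
  let ?s = "1 / real (Suc m)"
  have k1: "(complex_of_real (partial k (partial j (scaled_weight (real (Suc m)))) x) * cnj (g x $ k)) * g x $ j
     = partial k (partial j virial_weight) (?s *\<^sub>R x) *\<^sub>R (cnj (g x $ k) * g x $ j)" for k j x
    by (simp only: scaled_weight_partials(2)[OF r] scaleR_conv_of_real mult.assoc)
  have k2: "(complex_of_real (laplacian (laplacian (scaled_weight (real (Suc m)))) x) * cnj (u x)) * u x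
     = complex_of_real (?s\<^sup>2) * (laplacian (laplacian virial_weight) (?s *\<^sub>R x) *\<^sub>R (cnj (u x) * u x))" for x
    by (simp only: scaled_weight_partials(4)[OF r] scaleR_conv_of_real mult.assoc of_real_mult)
  have k3: "(complex_of_real (laplacian (scaled_weight (real (Suc m))) x) * cnj (u x)) * cub (u x)
     = laplacian virial_weight (?s *\<^sub>R x) *\<^sub>R (cnj (u x) * cub (u x))" for x
    by (simp only: scaled_weight_partials(3)[OF r] scaleR_conv_of_real mult.assoc)
  let ?c = "\<lambda>x. \<Sum>j\<in>UNIV. partial j (scaled_weight (real (Suc m))) x * partial j V x"
  have cc: "(\<Sum>j\<in>UNIV. complex_of_real (partial j (scaled_weight (real (Suc m))) x) * complex_of_real (partial j V x)) = complex_of_real (?c x)" for x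
    by simp
  obtain B where B: "\<And>x. norm (complex_of_real (?c x)) \<le> B" using supp_in_bounded[OF V_virial_coeff] unfolding cc by metis
  have cm: "(\<lambda>x. complex_of_real (?c x)) \<in> borel_measurable borel"
    using borel_measurable_continuous_onI[OF V_virial_coeff(1)] unfolding cc .
  have ci: "integrable lborel (\<lambda>x. (complex_of_real (?c x) * cnj (u x)) * u x)"
    by (intro L2_mult_integrable L2_mult_bounded[OF L2_cnj[OF u] cm B] u)
  have eq: "(complex_of_real (?c x) * cnj (u x)) * u x = complex_of_real (?c x * (cmod (u x))\<^sup>2)" for x
    by (simp only: of_real_mult complex_norm_square mult_ac)
  have ci': "integrable lborel (\<lambda>x. ?c x * (cmod (u x))\<^sup>2)"
    using ci unfolding eq complex_of_real_integrable_eq .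
  have "- Re (LINT x|lborel. (complex_of_real (?c x) * cnj (u x)) * u x) = (LINT x|lborel. - (?c x * (cmod (u x))\<^sup>2))"
    unfolding eq integral_complex_of_real using ci' by simp
  also have "\<dots> \<le> (LINT x|lborel. 2 * real CARD('a) * (virial_slope (?s *\<^sub>R x) *\<^sub>R (V x * (cmod (u x))\<^sup>2)))"
  proof (rule integral_mono)
    show "integrable lborel (\<lambda>x. - (?c x * (cmod (u x))\<^sup>2))" using ci' by simp
    show "integrable lborel (\<lambda>x. 2 * real CARD('a) * (virial_slope (?s *\<^sub>R x) *\<^sub>R (V x * (cmod (u x))\<^sup>2)))"
      by (intro integrable_mult_right scaled_coeff_bound(1)[OF virial_slope_continuous virial_slope_abs Vu])
    fix x
    have "- ?c x = 2 * virial_slope (?s *\<^sub>R x) * (- (\<Sum>j\<in>UNIV. x $ j * partial j V x))"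
      by (simp add: scaled_weight_partials(1) sum_distrib_left mult_ac sum_negf)
    also have "\<dots> \<le> 2 * virial_slope (?s *\<^sub>R x) * (real CARD('a) * V x)"
      using V_virial[of x] virial_slope_nonneg[of "?s *\<^sub>R x"] by (intro mult_left_mono) auto
    finally have "- ?c x * (cmod (u x))\<^sup>2 \<le> 2 * virial_slope (?s *\<^sub>R x) * (real CARD('a) * V x) * (cmod (u x))\<^sup>2"
      by (rule mult_right_mono) simp
    then show "- (?c x * (cmod (u x))\<^sup>2) \<le> 2 * real CARD('a) * (virial_slope (?s *\<^sub>R x) *\<^sub>R (V x * (cmod (u x))\<^sup>2))"
      by (simp add: mult_ac)
  qed
  also have "\<dots> = 2 * real CARD('a) * (LINT x|lborel. virial_slope (?s *\<^sub>R x) *\<^sub>R (V x * (cmod (u x))\<^sup>2))"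
    by (rule integral_mult_right_zero)
  finally have force: "- Re (LINT x|lborel. (complex_of_real (?c x) * cnj (u x)) * u x) \<le> \<dots>" .
  have s2: "Re (LINT x|lborel. complex_of_real (?s\<^sup>2) * (laplacian (laplacian virial_weight) (?s *\<^sub>R x) *\<^sub>R (cnj (u x) * u x)))
      = ?s\<^sup>2 * Re (LINT x|lborel. laplacian (laplacian virial_weight) (?s *\<^sub>R x) *\<^sub>R (cnj (u x) * u x))"
    unfolding integral_mult_right_zero by simp
  show ?thesis
    unfolding virial_rate_def rate_majorant_def kinetic_a_def potential_a_def k1 k2 k3 cc s2 using force by linarith
qed

lemma Re_sum_diag: "Re (\<Sum>k\<in>UNIV. \<Sum>j\<in>UNIV. (if j = k then 2 else 0) *\<^sub>R (LINT x|lborel. cnj (g x $ k) * g x $ j)) = 2 * (norm_L2 g)\<^sup>2"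
proof -
  have "Re (LINT x|lborel. cnj (g x $ k) * g x $ k) = (norm_L2 (\<lambda>x. g x $ k))\<^sup>2" for k
  proof -
    have "Re (LINT x|lborel. cnj (g x $ k) * g x $ k) = (LINT x|lborel. Re (cnj (g x $ k) * g x $ k))"
      by (rule integral_Re[symmetric, OF integrable_products(1)])
    also have "\<dots> = (norm_L2 (\<lambda>x. g x $ k))\<^sup>2"
      unfolding norm_L2_sq cmod_power2 by (simp add: power2_eq_square)
    finally show ?thesis .
  qed
  then show ?thesis
    by (simp add: norm_L2_vec_sq[OF g] if_distrib[of "\<lambda>c. c *\<^sub>R _"] sum_distrib_left Re_sum cong: if_cong)
qed

text \<open>Each coefficient flattens to its value at the origin: Hessian 2 times the identity,
  Laplacian 2 d, slope 1. The bilaplacian term disappears through its prefactor.\<close>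

lemma rate_majorant_lim: "(\<lambda>m. rate_majorant m u g) \<longlonglongrightarrow>
  2 * (norm_L2 g)\<^sup>2 + 2 * real CARD('a) * (LINT x|lborel. V x * (cmod (u x))\<^sup>2) + \<beta> * real CARD('a) * (LINT x|lborel. (cmod (u x))^4)"
proof -
  obtain B2 where B2: "\<And>k j x. \<bar>partial k (partial j virial_weight) (x :: real ^ 'a)\<bar> \<le> B2 k j" using virial_weight_coeff(4) by metis
  obtain BL where BL: "\<And>x. \<bar>laplacian virial_weight (x :: real ^ 'a)\<bar> \<le> BL" using virial_weight_coeff(5) by metis
  obtain BLL where BLL: "\<And>x. \<bar>laplacian (laplacian virial_weight) (x :: real ^ 'a)\<bar> \<le> BLL" using virial_weight_coeff(6) by metis
  have s: "(\<lambda>m. 1 / real (Suc m)) \<longlonglongrightarrow> 0" by (rule LIMSEQ_Suc[OF lim_1_over_n])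
  have "(\<lambda>m. rate_majorant m u g) \<longlonglongrightarrow>
    Re (\<Sum>k\<in>UNIV. \<Sum>j\<in>UNIV. partial k (partial j virial_weight) 0 *\<^sub>R (LINT x|lborel. cnj (g x $ k) * g x $ j))
    - 1 / 4 * (0\<^sup>2 * Re (laplacian (laplacian virial_weight) (0 :: real ^ 'a) *\<^sub>R (LINT x|lborel. cnj (u x) * u x)))
    + 2 * real CARD('a) * (virial_slope (0 :: real ^ 'a) *\<^sub>R (LINT x|lborel. V x * (cmod (u x))\<^sup>2))
    + \<beta> / 2 * Re (laplacian virial_weight (0 :: real ^ 'a) *\<^sub>R (LINT x|lborel. cnj (u x) * cub (u x)))"
    unfolding rate_majorant_def
    by (intro tendsto_add tendsto_diff tendsto_mult tendsto_const tendsto_Re tendsto_sum tendsto_power s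
      scaled_coeff_tendsto[OF virial_weight_coeff(1) B2 integrable_products(1)]
      scaled_coeff_tendsto[OF virial_weight_coeff(3) BLL integrable_products(2)]
      scaled_coeff_tendsto[OF virial_slope_continuous virial_slope_abs Vu]
      scaled_coeff_tendsto[OF virial_weight_coeff(2) BL integrable_products(3)])
  moreover have "(LINT x|lborel. cnj (u x) * cub (u x)) = complex_of_real (LINT x|lborel. (cmod (u x))^4)"
    unfolding u4 by (rule integral_complex_of_real)
  ultimately show ?thesis
    unfolding virial_weight_second_partial_0 Re_sum_diag by (simp add: virial_slope_0 laplacian_virial_weight_0 mult_ac)
qed

text \<open>On the right the gradient term has the coefficient d, on the left 2, and d is at least
  2. The potential and quartic terms coincide.\<close>

lemma limit_le_energy:
  "2 * (norm_L2 g)\<^sup>2 + 2 * real CARD('a) * (LINT x|lborel. V x * (cmod (u x))\<^sup>2) + \<beta> * real CARD('a) * (LINT x|lborel. (cmod (u x))^4)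
    \<le> 2 * real CARD('a) * energy_of u g"
proof -
  have "2 * (norm_L2 g)\<^sup>2 \<le> real CARD('a) * (norm_L2 g)\<^sup>2" using dim by (intro mult_right_mono) auto
  then show ?thesis by (simp add: energy_of_def algebra_simps)
qed

end


text \<open>Uniform in the scale m and over states of bounded norms. An upper bound is enough
  because it only has to dominate a positive part.\<close>

lemma (in virial_data) rate_majorant_bound:
  assumes M: "0 \<le> M"
  shows "\<exists>C. \<forall>u g m. virial_state V u g \<longrightarrow> norm_L2 u \<le> M \<longrightarrow> norm_L2 g \<le> M \<longrightarrow>
    (LINT x|lborel. V x * (cmod (u x))\<^sup>2) \<le> M \<longrightarrow> rate_majorant m u g \<le> C"
proof -
  have cc: "\<exists>B. \<forall>x. \<bar>f x\<bar> \<le> B" if "Cc_smooth f" for f :: "real ^ 'd \<Rightarrow> real"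
    using Cc_smooth_bounded[OF that] by (metis real_norm_def)
  have "\<exists>B. \<forall>x. \<bar>partial k (partial j virial_weight) (x :: real ^ 'd)\<bar> \<le> B" for k j
    by (intro cc Cc_smooth_partial Cc_smooth_virial_weight)
  then obtain B2 where B2: "\<And>k j x. \<bar>partial k (partial j virial_weight) (x :: real ^ 'd)\<bar> \<le> B2 k j" by metis
  obtain BL where BL: "\<And>x. \<bar>laplacian virial_weight (x :: real ^ 'd)\<bar> \<le> BL"
    using cc[OF Cc_smooth_laplacian[OF Cc_smooth_virial_weight]] by metis
  obtain BLL where BLL: "\<And>x. \<bar>laplacian (laplacian virial_weight) (x :: real ^ 'd)\<bar> \<le> BLL"
    using cc[OF Cc_smooth_laplacian[OF Cc_smooth_laplacian[OF Cc_smooth_virial_weight]]] by metis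
  have nn: "0 \<le> B2 k j" "0 \<le> BL" "0 \<le> BLL" for k j
    using B2[of k j 0] BL[of 0] BLL[of 0] by linarith+
  let ?Q = "sqrt (4096 * (2 * M\<^sup>2)^3)"
  define C where "C = (\<Sum>k\<in>UNIV. \<Sum>j\<in>UNIV. B2 k j * (M * M)) + 1 / 4 * (BLL * (M * M)) + 2 * real CARD('d) * (6 * exp 1 * M) + \<bar>\<beta>\<bar> / 2 * (BL * (M * ?Q))"
  have "rate_majorant m u g \<le> C"
    if vs: "virial_state V u g" and uM: "norm_L2 u \<le> M" and gM: "norm_L2 g \<le> M" and VM: "(LINT x|lborel. V x * (cmod (u x))\<^sup>2) \<le> M" for u g m
  proof -
    interpret virial_state V \<beta> u g by fact
    let ?s = "1 / real (Suc m)"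
    have prod: "norm (LINT x|lborel. f (?s *\<^sub>R x) *\<^sub>R (cnj (p x) * q x)) \<le> B * (P * Q)"
      if f: "continuous_on UNIV f" "\<And>x. \<bar>f x\<bar> \<le> B" and p: "p \<in> L2" "norm_L2 p \<le> P" and q: "q \<in> L2" "norm_L2 q \<le> Q"
      for f :: "real ^ 'd \<Rightarrow> real" and p q :: "real ^ 'd \<Rightarrow> complex" and B P Q
    proof -
      have B: "0 \<le> B" using f(2)[of 0] by linarith
      have "norm (LINT x|lborel. f (?s *\<^sub>R x) *\<^sub>R (cnj (p x) * q x)) \<le> B * (LINT x|lborel. norm (cnj (p x) * q x))"
        by (rule scaled_coeff_bound(2)[OF f]) (intro L2_mult_integrable L2_cnj p q)
      also have "(LINT x|lborel. norm (cnj (p x) * q x)) \<le> norm_L2 p * norm_L2 q"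
        unfolding norm_mult complex_mod_cnj by (rule L2_Cauchy_Schwarz(2)[OF p(1) q(1)])
      also have "norm_L2 p * norm_L2 q \<le> P * Q"
        using p q norm_L2_nonneg[of p] norm_L2_nonneg[of q] by (intro mult_mono) auto
      finally show ?thesis using B by (simp add: mult_left_mono)
    qed
    have gk_le: "norm_L2 (\<lambda>x. g x $ k) \<le> M" for k
    proof -
      have "norm_L2 (\<lambda>x. g x $ k) \<le> norm_L2 g"
        by (rule norm_L2_mono(2)[OF g L2D(1)[OF gk]]) (rule Finite_Cartesian_Product.norm_nth_le)
      then show ?thesis using gM by linarith
    qed
    have "norm_L2 (\<lambda>x. cub (u x)) = sqrt (LINT x|lborel. cmod (u x) ^ 6)"
      by (simp add: norm_L2_def norm_cub flip: power_mult)
    also have "\<dots> \<le> sqrt (4096 * ((norm_L2 u)\<^sup>2 + (norm_L2 g)\<^sup>2)^3)"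
      by (intro real_sqrt_le_mono Sobolev_H1(2)[OF dim u g wg])
    also have "\<dots> \<le> ?Q"
      using power_mono[OF uM norm_L2_nonneg, of 2] power_mono[OF gM norm_L2_nonneg, of 2]
      by (intro real_sqrt_le_mono mult_left_mono power_mono) auto
    finally have cub_le: "norm_L2 (\<lambda>x. cub (u x)) \<le> ?Q" .
    have 1: "Re (\<Sum>k\<in>UNIV. \<Sum>j\<in>UNIV. LINT x|lborel. partial k (partial j virial_weight) (?s *\<^sub>R x) *\<^sub>R (cnj (g x $ k) * g x $ j))
      \<le> (\<Sum>k\<in>UNIV. \<Sum>j\<in>UNIV. B2 k j * (M * M))"
      by (intro order_trans[OF complex_Re_le_cmod] sum_norm_le prod virial_weight_coeff B2 gk gk_le)
    have 2: "\<bar>?s\<^sup>2 * Re (LINT x|lborel. laplacian (laplacian virial_weight) (?s *\<^sub>R x) *\<^sub>R (cnj (u x) * u x))\<bar> \<le> BLL * (M * M)"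
    proof -
      have "\<bar>Re (LINT x|lborel. laplacian (laplacian virial_weight) (?s *\<^sub>R x) *\<^sub>R (cnj (u x) * u x))\<bar> \<le> BLL * (M * M)"
        by (intro order_trans[OF abs_Re_le_cmod] prod virial_weight_coeff BLL u uM)
      moreover have "\<bar>?s\<^sup>2\<bar> \<le> 1" by (simp add: power_le_one)
      ultimately have "\<bar>?s\<^sup>2\<bar> * \<bar>Re (LINT x|lborel. laplacian (laplacian virial_weight) (?s *\<^sub>R x) *\<^sub>R (cnj (u x) * u x))\<bar> \<le> 1 * (BLL * (M * M))"
        by (intro mult_mono) auto
      then show ?thesis unfolding abs_mult by simp
    qed
    have 3: "(LINT x|lborel. virial_slope (?s *\<^sub>R x) *\<^sub>R (V x * (cmod (u x))\<^sup>2)) \<le> 6 * exp 1 * M"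
    proof -
      have "(LINT x|lborel. virial_slope (?s *\<^sub>R x) *\<^sub>R (V x * (cmod (u x))\<^sup>2)) \<le> 6 * exp 1 * (LINT x|lborel. norm (V x * (cmod (u x))\<^sup>2))"
        using scaled_coeff_bound(2)[OF virial_slope_continuous virial_slope_abs Vu, of ?s] unfolding real_norm_def by linarith
      also have "(LINT x|lborel. norm (V x * (cmod (u x))\<^sup>2)) = (LINT x|lborel. V x * (cmod (u x))\<^sup>2)"
        using V_nonneg by simp
      finally show ?thesis using VM by (simp add: mult_left_mono order_trans)
    qed
    have 4: "\<beta> / 2 * Re (LINT x|lborel. laplacian virial_weight (?s *\<^sub>R x) *\<^sub>R (cnj (u x) * cub (u x))) \<le> \<bar>\<beta>\<bar> / 2 * (BL * (M * ?Q))"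
    proof -
      have "\<bar>Re (LINT x|lborel. laplacian virial_weight (?s *\<^sub>R x) *\<^sub>R (cnj (u x) * cub (u x)))\<bar> \<le> BL * (M * ?Q)"
        by (intro order_trans[OF abs_Re_le_cmod] prod virial_weight_coeff BL u uM cub_u cub_le)
      then have "\<bar>\<beta> / 2\<bar> * \<bar>Re (LINT x|lborel. laplacian virial_weight (?s *\<^sub>R x) *\<^sub>R (cnj (u x) * cub (u x)))\<bar> \<le> \<bar>\<beta> / 2\<bar> * (BL * (M * ?Q))"
        by (intro mult_left_mono) auto
      then show ?thesis unfolding abs_mult[symmetric] by (simp add: abs_le_iff)
    qed
    have gen: "a1 - 1 / 4 * a2 + 2 * d * a3 + a4 \<le> b1 + 1 / 4 * b2 + 2 * d * b3 + b4"
      if "a1 \<le> b1" "\<bar>a2\<bar> \<le> b2" "a3 \<le> b3" "a4 \<le> b4" "0 \<le> d" for a1 a2 a3 a4 b1 b2 b3 b4 d :: real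
      using that mult_left_mono[OF that(3), of "2 * d"] by linarith
    show ?thesis unfolding rate_majorant_def C_def by (rule gen[OF 1 2 3 4]) simp
  qed
  then show ?thesis by blast
qed

section \<open>The variance inequality for a global solution\<close>

locale global_flow = virial_data +
  fixes \<psi> :: "real \<Rightarrow> real ^ 'a \<Rightarrow> complex" and g :: "real \<Rightarrow> real ^ 'a \<Rightarrow> complex ^ 'a" and E :: real
  assumes flow_H1: "\<And>t. 0 \<le> t \<Longrightarrow> \<psi> t \<in> L2" "\<And>t. 0 \<le> t \<Longrightarrow> g t \<in> L2" "\<And>t. 0 \<le> t \<Longrightarrow> is_weak_gradient (\<psi> t) (g t)"
    and flow_V: "\<And>t. 0 \<le> t \<Longrightarrow> integrable lborel (\<lambda>x. V x * (cmod (\<psi> t x))\<^sup>2)"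
    and flow_eq: "weak_NLS V \<beta> \<psi>"
    and flow_bound: "\<And>T. \<exists>M. \<forall>t\<in>{0..T}. norm_L2 (\<psi> t) \<le> M \<and> norm_L2 (g t) \<le> M \<and> (LINT x|lborel. V x * (cmod (\<psi> t x))\<^sup>2) \<le> M"
    and mass: "\<And>t. 0 \<le> t \<Longrightarrow> norm_L2 (\<psi> t) = norm_L2 (\<psi> 0)"
    and energy_const: "\<And>t. 0 \<le> t \<Longrightarrow> energy_of (\<psi> t) (g t) = E"
    and variance: "integrable lborel (\<lambda>x. (norm x)\<^sup>2 * (cmod (\<psi> 0 x))\<^sup>2)"
begin

abbreviation "r m \<equiv> real (Suc m)"

lemma nf: "nls_flow (scaled_weight (r m)) (r m) V \<beta> \<psi> g"
proof -
  have w: "weight (scaled_weight (r m)) (r m) V" by (rule weight_scaled_weight)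
  have "\<exists>M. \<forall>t\<in>{0..T}. norm_L2 (\<psi> t) \<le> M \<and> norm_L2 (g t) \<le> M" for T using flow_bound[of T] by blast
  then show ?thesis
    by (intro nls_flow.intro w nls_flow_axioms.intro flow_H1 flow_eq)
qed

lemma vs: "0 \<le> t \<Longrightarrow> virial_state V (\<psi> t) (g t)"
  by unfold_locales (auto intro: flow_H1 flow_V)

text \<open>The positive part, because the rate is controlled from above only.\<close>

abbreviation "excess m s \<equiv> max (virial_rate m (\<psi> s) (g s) - 2 * real CARD('a) * E) 0"

lemma excess_integrable: "(\<lambda>s. excess m s) integrable_on {0..T}"
proof (cases "0 \<le> T")
  case True
  interpret nls_flow "scaled_weight (r m)" "r m" V \<beta> \<psi> g by (rule nf)
  let ?f = "\<lambda>s. virial_rate m (\<psi> s) (g s)"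
  have i: "?f integrable_on {0..T}" using virial_evolution(2)[OF True] unfolding virial_rate_def by blast
  obtain C where C: "\<And>t. t \<in> {0..T} \<Longrightarrow> \<bar>?f t\<bar> \<le> C" using virial_rate_bounded[of T] unfolding virial_rate_def by blast
  have "?f absolutely_integrable_on {0..T}"
    by (rule absolutely_integrable_integrable_bound[where g="\<lambda>x. C"]) (use i C in auto)
  then have "(\<lambda>s. ?f s - 2 * real CARD('a) * E) absolutely_integrable_on {0..T}"
    by (intro set_integral_diff(1)) (auto intro!: absolutely_integrable_on_const)
  then have "(\<lambda>s. max (?f s - 2 * real CARD('a) * E) 0) absolutely_integrable_on {0..T}"
    by (intro absolutely_integrable_max_1) (auto simp: set_integrable_def)
  then show ?thesis by (rule set_lebesgue_integral_eq_integral(1))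
qed (simp add: integrable_on_empty)

text \<open>At each time the majorant tends to a value at most \<open>2 d E\<close>, by conservation
  of energy, so the excess tends to 0 there. A bound uniform in m over [0,T] allows dominated
  convergence in time.\<close>

lemma excess_tendsto: "0 \<le> T \<Longrightarrow> (\<lambda>m. integral {0..T} (\<lambda>s. excess m s)) \<longlonglongrightarrow> 0"
proof -
  assume T: "0 \<le> T"
  obtain M0 where M0: "\<And>t. t \<in> {0..T} \<Longrightarrow> norm_L2 (\<psi> t) \<le> M0 \<and> norm_L2 (g t) \<le> M0 \<and> (LINT x|lborel. V x * (cmod (\<psi> t x))\<^sup>2) \<le> M0"
    using flow_bound by blast
  have "0 \<le> max M0 0" by simp
  from rate_majorant_bound[OF this] obtain C where C: "\<forall>u g m. virial_state V u g \<longrightarrow> norm_L2 u \<le> max M0 0 \<longrightarrow> norm_L2 g \<le> max M0 0 \<longrightarrow>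
    (LINT x|lborel. V x * (cmod (u x))\<^sup>2) \<le> max M0 0 \<longrightarrow> rate_majorant m u g \<le> C" by (rule exE)
  have le: "excess m s \<le> max (rate_majorant m (\<psi> s) (g s) - 2 * real CARD('a) * E) 0" if "s \<in> {0..T}" for m s
    using virial_state.virial_rate_le[OF vs[of s], where m=m and \<beta>=\<beta>] that by auto
  have "(\<lambda>m. integral {0..T} (\<lambda>s. excess m s)) \<longlonglongrightarrow> integral {0..T} (\<lambda>s. 0)"
  proof (rule dominated_convergence(2)[where h="\<lambda>s. max (C - 2 * real CARD('a) * E) 0"])
    show "(\<lambda>s. excess m s) integrable_on {0..T}" for m by (rule excess_integrable)
    fix s assume s: "s \<in> {0..T}"
    then have s0: "0 \<le> s" by simp
    have rC: "rate_majorant m (\<psi> s) (g s) \<le> C" for m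
      using M0[OF s] by (intro C[rule_format] vs[OF s0]) (auto simp: max.coboundedI1)
    show "norm (excess m s) \<le> max (C - 2 * real CARD('a) * E) 0" for m
      using le[OF s, of m] rC[of m] by (auto simp: max_def split: if_splits)
    have lim: "(\<lambda>m. max (rate_majorant m (\<psi> s) (g s) - 2 * real CARD('a) * E) 0) \<longlonglongrightarrow>
       max (2 * (norm_L2 (g s))\<^sup>2 + 2 * real CARD('a) * (LINT x|lborel. V x * (cmod (\<psi> s x))\<^sup>2) + \<beta> * real CARD('a) * (LINT x|lborel. (cmod (\<psi> s x))^4) - 2 * real CARD('a) * E) 0"
      by (intro tendsto_max tendsto_diff virial_state.rate_majorant_lim[OF vs[OF s0]] tendsto_const)
    have "2 * (norm_L2 (g s))\<^sup>2 + 2 * real CARD('a) * (LINT x|lborel. V x * (cmod (\<psi> s x))\<^sup>2) + \<beta> * real CARD('a) * (LINT x|lborel. (cmod (\<psi> s x))^4) - 2 * real CARD('a) * E \<le> 0"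
      using virial_state.limit_le_energy[OF vs[OF s0], where \<beta>=\<beta>] energy_const[OF s0] by simp
    then have lim0: "(\<lambda>m. max (rate_majorant m (\<psi> s) (g s) - 2 * real CARD('a) * E) 0) \<longlonglongrightarrow> 0"
      using lim by (simp add: max_absorb2)
    show "(\<lambda>m. excess m s) \<longlonglongrightarrow> 0"
      by (rule tendsto_sandwich[OF _ _ tendsto_const lim0]) (use le[OF s] in \<open>auto intro!: always_eventually\<close>)
  qed auto
  then show ?thesis by simp
qed

definition weighted_variance :: "nat \<Rightarrow> real" where
  "weighted_variance m = (LINT x|lborel. (r m)\<^sup>2 * (1 + virial_weight ((1 / r m) *\<^sub>R x)) * (cmod (\<psi> 0 x))\<^sup>2)"

abbreviation "momentum m t \<equiv> weight.momentum_a (scaled_weight (r m)) (\<psi> t) (\<lambda>j x. g t x $ j)"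

lemma weighted_variance_eq:
  assumes "0 \<le> t"
  shows "(LINT x|lborel. (r m)\<^sup>2 * (1 + virial_weight ((1 / r m) *\<^sub>R x)) * (cmod (\<psi> t x))\<^sup>2) = (r m)\<^sup>2 * (norm_L2 (\<psi> t))\<^sup>2 + weight.mass_a (scaled_weight (r m)) (\<psi> t)"
proof -
  interpret nls_flow "scaled_weight (r m)" "r m" V \<beta> \<psi> g by (rule nf)
  have i1: "integrable lborel (\<lambda>x. (cmod (\<psi> t x))\<^sup>2)" using L2D(2)[OF flow_H1(1)[OF assms]] .
  have "0 < r m" by simp
  then obtain B where B: "\<And>x :: real ^ 'a. \<bar>scaled_weight (r m) x\<bar> \<le> B"
    using supp_in_bounded[OF smooth_continuous[OF smooth_scaled_weight] supp_in_scaled_weight, of "r m"] unfolding real_norm_def by blast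
  have i2: "integrable lborel (\<lambda>x. scaled_weight (r m) x * (cmod (\<psi> t x))\<^sup>2)"
    using scaled_coeff_bound(1)[OF smooth_continuous[OF smooth_scaled_weight] B i1, of 1] by simp
  have "(LINT x|lborel. (r m)\<^sup>2 * (1 + virial_weight ((1 / r m) *\<^sub>R x)) * (cmod (\<psi> t x))\<^sup>2) = (LINT x|lborel. (r m)\<^sup>2 * (cmod (\<psi> t x))\<^sup>2 + scaled_weight (r m) x * (cmod (\<psi> t x))\<^sup>2)"
    by (intro Bochner_Integration.integral_cong refl) (simp only: scaled_weight_def, simp only: algebra_simps)
  also have "\<dots> = (r m)\<^sup>2 * (norm_L2 (\<psi> t))\<^sup>2 + mass_a (\<psi> t)"
    using i1 i2 by (simp add: norm_L2_sq mass_a_def del: of_nat_Suc)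
  finally show ?thesis .
qed

text \<open>The rate is at most \<open>2 d E\<close> plus the excess; integrating twice gives
  \<open>d E T^2\<close> and the error term. The weighted variance at time T is nonnegative, and its
  mass part is the same as at time 0.\<close>

lemma truncated_inequality:
  assumes T: "0 \<le> T"
  shows "0 \<le> weighted_variance m + T * momentum m 0 + real CARD('a) * E * T\<^sup>2 + T * integral {0..T} (\<lambda>s. excess m s)"
proof -
  interpret nls_flow "scaled_weight (r m)" "r m" V \<beta> \<psi> g by (rule nf)
  let ?e = "integral {0..T} (\<lambda>s. excess m s)"
  have P: "momentum m s \<le> momentum m 0 + 2 * real CARD('a) * E * s + ?e" if s: "s \<in> {0..T}" for s
  proof -
    have s0: "0 \<le> s" using s by simp
    have h: "((\<lambda>s. virial_rate m (\<psi> s) (g s)) has_integral (momentum m s - momentum m 0)) {0..s}"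
      using virial_evolution(2)[OF s0] unfolding virial_rate_def .
    have "((\<lambda>t. 2 * real CARD('a) * E) has_integral (2 * real CARD('a) * E * s)) {0..s}"
      using has_integral_const_real[of "2 * real CARD('a) * E" 0 s] s0 by (simp add: mult.commute)
    then have k: "((\<lambda>t. 2 * real CARD('a) * E + excess m t) has_integral (2 * real CARD('a) * E * s + integral {0..s} (\<lambda>t. excess m t))) {0..s}"
      by (rule has_integral_add[OF _ integrable_integral[OF excess_integrable]])
    have "momentum m s - momentum m 0 \<le> 2 * real CARD('a) * E * s + integral {0..s} (\<lambda>t. excess m t)"
      by (rule has_integral_le[OF h k]) auto
    \<comment> \<open>As the excess is nonnegative, its integral over the whole of [0,T] serves for
      every s; the second integration then contributes the factor T.\<close>
    moreover have "integral {0..s} (\<lambda>t. excess m t) \<le> ?e"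
      by (rule integral_subset_le[OF _ excess_integrable excess_integrable]) (use s in auto)
    ultimately show ?thesis by linarith
  qed
  have "((\<lambda>s. (momentum m 0 + ?e) + 2 * real CARD('a) * E * s) has_integral ((momentum m 0 + ?e) * T + real CARD('a) * E * T\<^sup>2 - ((momentum m 0 + ?e) * 0 + real CARD('a) * E * 0\<^sup>2))) {0..T}"
    using T by (intro fundamental_theorem_of_calculus)
      (auto intro!: derivative_eq_intros simp flip: has_real_derivative_iff_has_vector_derivative)
  then have k: "((\<lambda>s. momentum m 0 + 2 * real CARD('a) * E * s + ?e) has_integral ((momentum m 0 + ?e) * T + real CARD('a) * E * T\<^sup>2)) {0..T}"
    by (simp add: add_ac)
  have "mass_a (\<psi> T) - mass_a (\<psi> 0) \<le> (momentum m 0 + ?e) * T + real CARD('a) * E * T\<^sup>2"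
    by (rule has_integral_le[OF virial_evolution(1)[OF T] k]) (use P in auto)
  moreover have "0 \<le> (r m)\<^sup>2 * (norm_L2 (\<psi> T))\<^sup>2 + mass_a (\<psi> T)"
    unfolding weighted_variance_eq[OF T, symmetric]
    by (intro integral_nonneg_AE AE_I2 mult_nonneg_nonneg virial_weight_bounds) auto
  ultimately show ?thesis
    unfolding weighted_variance_def weighted_variance_eq[OF order_refl] mass[OF T] by (simp add: algebra_simps)
qed

lemma psi0_measurable [measurable]: "\<psi> 0 \<in> borel_measurable borel"
  by (rule L2D(1)[OF flow_H1(1)]) simp

text \<open>Finite initial variance supplies the dominating function through
  \<open>virial_weight_bounds\<close>; the pointwise limit comes from the expansion of the weight at
  the origin.\<close>

lemma weighted_variance_lim: "weighted_variance \<longlonglongrightarrow> (LINT x|lborel. (norm x)\<^sup>2 * (cmod (\<psi> 0 x))\<^sup>2)"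
  unfolding weighted_variance_def
proof (rule integral_dominated_convergence[where w="\<lambda>x. 6 * exp 1 * ((norm x)\<^sup>2 * (cmod (\<psi> 0 x))\<^sup>2)"])
  have [measurable]: "virial_weight \<in> borel_measurable borel" by (intro borel_measurable_continuous_onI smooth_continuous virial_weight_smooth)
  show "(\<lambda>x. (r m)\<^sup>2 * (1 + virial_weight ((1 / r m) *\<^sub>R x)) * (cmod (\<psi> 0 x))\<^sup>2) \<in> borel_measurable lborel" for m by measurable
  show "AE x in lborel. norm ((r m)\<^sup>2 * (1 + virial_weight ((1 / r m) *\<^sub>R x)) * (cmod (\<psi> 0 x))\<^sup>2) \<le> 6 * exp 1 * ((norm x)\<^sup>2 * (cmod (\<psi> 0 x))\<^sup>2)" for m
  proof (rule AE_I2)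
    fix x :: "real ^ 'a"
    let ?y = "(1 / r m) *\<^sub>R x"
    have "(r m)\<^sup>2 * (1 + virial_weight ?y) \<le> (r m)\<^sup>2 * (6 * exp 1 * (?y \<bullet> ?y))"
      by (intro mult_left_mono virial_weight_bounds) auto
    also have "\<dots> = 6 * exp 1 * (norm x)\<^sup>2" by (simp add: dot_square_norm power2_eq_square)
    finally have "(r m)\<^sup>2 * (1 + virial_weight ?y) * (cmod (\<psi> 0 x))\<^sup>2 \<le> 6 * exp 1 * (norm x)\<^sup>2 * (cmod (\<psi> 0 x))\<^sup>2" by (rule mult_right_mono) simp
    moreover have "0 \<le> (r m)\<^sup>2 * (1 + virial_weight ?y) * (cmod (\<psi> 0 x))\<^sup>2" by (intro mult_nonneg_nonneg virial_weight_bounds) auto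
    ultimately show "norm ((r m)\<^sup>2 * (1 + virial_weight ?y) * (cmod (\<psi> 0 x))\<^sup>2) \<le> 6 * exp 1 * ((norm x)\<^sup>2 * (cmod (\<psi> 0 x))\<^sup>2)"
      by (simp only: real_norm_def abs_of_nonneg mult.assoc)
  qed
  show "AE x in lborel. (\<lambda>m. (r m)\<^sup>2 * (1 + virial_weight ((1 / r m) *\<^sub>R x)) * (cmod (\<psi> 0 x))\<^sup>2) \<longlonglongrightarrow> (norm x)\<^sup>2 * (cmod (\<psi> 0 x))\<^sup>2"
  proof (intro AE_I2 tendsto_mult tendsto_const)
    fix x :: "real ^ 'a"
    \<comment> \<open>The intermediate points are squeezed between 1 - |x / r|^2 and 1. Since
      \<open>expinv 2 1\<close> is exp (-1), it cancels the factor \<open>exp 1\<close> in the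
      limit.\<close>
    have "\<exists>\<xi>. 1 - ((1 / r m) *\<^sub>R x) \<bullet> ((1 / r m) *\<^sub>R x) \<le> \<xi> \<and> \<xi> \<le> 1 \<and> 1 + virial_weight ((1 / r m) *\<^sub>R x) = exp 1 * (((1 / r m) *\<^sub>R x) \<bullet> ((1 / r m) *\<^sub>R x)) * expinv 2 \<xi>" for m
      using virial_weight_expansion[of "(1 / r m) *\<^sub>R x"] by metis
    then obtain \<xi> where \<xi>: "\<And>m. 1 - ((1 / r m) *\<^sub>R x) \<bullet> ((1 / r m) *\<^sub>R x) \<le> \<xi> m" "\<And>m. \<xi> m \<le> 1"
      "\<And>m. 1 + virial_weight ((1 / r m) *\<^sub>R x) = exp 1 * (((1 / r m) *\<^sub>R x) \<bullet> ((1 / r m) *\<^sub>R x)) * expinv 2 (\<xi> m)" by metis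
    have "(\<lambda>m. 1 - ((1 / r m) *\<^sub>R x) \<bullet> ((1 / r m) *\<^sub>R x)) \<longlonglongrightarrow> 1 - (0 *\<^sub>R x) \<bullet> (0 *\<^sub>R x)"
      by (intro tendsto_diff tendsto_inner tendsto_scaleR tendsto_const LIMSEQ_Suc[OF lim_1_over_n])
    then have l: "(\<lambda>m. 1 - ((1 / r m) *\<^sub>R x) \<bullet> ((1 / r m) *\<^sub>R x)) \<longlonglongrightarrow> 1" by simp
    have "\<xi> \<longlonglongrightarrow> 1"
      by (rule tendsto_sandwich[OF _ _ l tendsto_const]) (use \<xi> in \<open>auto intro!: always_eventually\<close>)
    then have "(\<lambda>m. exp 1 * (norm x)\<^sup>2 * expinv 2 (\<xi> m)) \<longlonglongrightarrow> exp 1 * (norm x)\<^sup>2 * expinv 2 1"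
      by (intro tendsto_mult tendsto_const continuous_on_tendsto_compose[OF expinv_continuous[of UNIV]]) auto
    moreover have "(r m)\<^sup>2 * (1 + virial_weight ((1 / r m) *\<^sub>R x)) = exp 1 * (norm x)\<^sup>2 * expinv 2 (\<xi> m)" for m
      unfolding \<xi>(3) by (simp add: dot_square_norm power2_eq_square)
    moreover have "exp 1 * (norm x)\<^sup>2 * expinv 2 1 = (norm x)\<^sup>2"
      by (simp add: expinv_def exp_minus field_simps)
    ultimately show "(\<lambda>m. (r m)\<^sup>2 * (1 + virial_weight ((1 / r m) *\<^sub>R x))) \<longlonglongrightarrow> (norm x)\<^sup>2" by simp
  qed
qed (use variance in auto)

lemma moment_L2: "(\<lambda>x. complex_of_real (x $ j) * \<psi> 0 x) \<in> L2"
proof (rule L2I_le[OF _ variance])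
  show "(\<lambda>x. complex_of_real (x $ j) * \<psi> 0 x) \<in> borel_measurable borel"
    by (intro borel_measurable_times borel_measurable_of_real psi0_measurable borel_measurable_continuous_onI continuous_intros)
  show "(norm (complex_of_real (x $ j) * \<psi> 0 x))\<^sup>2 \<le> (norm x)\<^sup>2 * (cmod (\<psi> 0 x))\<^sup>2" for x
    using power_mono[OF component_le_norm_cart[of x j], of 2] by (simp add: norm_mult power_mult_distrib mult_right_mono)
qed

text \<open>The gradient of the scaled weight is \<open>2 x\<close> times a slope that flattens to
  1, hence the factor 2. The density is integrable because \<open>x \<psi>\<close> and the gradient
  are both in L2 at time 0.\<close>

lemma momentum_lim: "(\<lambda>m. momentum m 0) \<longlonglongrightarrow>
   2 * Im (LINT x|lborel. cnj (\<psi> 0 x) * (\<Sum>j\<in>UNIV. complex_of_real (x $ j) * (g 0 x $ j)))"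
proof -
  let ?p = "\<lambda>x. cnj (\<psi> 0 x) * (\<Sum>j\<in>UNIV. complex_of_real (x $ j) * (g 0 x $ j))"
  have eq: "?p x = (\<Sum>j\<in>UNIV. cnj (complex_of_real (x $ j) * \<psi> 0 x) * (g 0 x $ j))" for x
    by (simp add: sum_distrib_left mult_ac)
  have p: "integrable lborel ?p"
    unfolding eq by (intro Bochner_Integration.integrable_sum L2_mult_integrable L2_cnj moment_L2 L2_component flow_H1(2)) simp
  have "(\<lambda>m. Im (LINT x|lborel. virial_slope ((1 / r m) *\<^sub>R x) *\<^sub>R (2 * ?p x))) \<longlonglongrightarrow> Im (virial_slope (0 :: real ^ 'a) *\<^sub>R (LINT x|lborel. 2 * ?p x))"
    by (intro tendsto_Im scaled_coeff_tendsto[OF virial_slope_continuous virial_slope_abs integrable_mult_right[OF p]])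
  moreover have "momentum m 0 = Im (LINT x|lborel. virial_slope ((1 / r m) *\<^sub>R x) *\<^sub>R (2 * ?p x))" for m
  proof -
    interpret nls_flow "scaled_weight (r m)" "r m" V \<beta> \<psi> g by (rule nf)
    show ?thesis
      unfolding momentum_a_def
      by (intro arg_cong[of _ _ Im] Bochner_Integration.integral_cong refl)
        (simp add: scaled_weight_partials(1) sum_distrib_left scaleR_conv_of_real mult_ac del: of_nat_Suc)
  qed
  ultimately show ?thesis by (simp add: virial_slope_0)
qed

theorem variance_inequality:
  assumes T: "0 \<le> T"
  shows "0 \<le> (LINT x|lborel. (norm x)\<^sup>2 * (cmod (\<psi> 0 x))\<^sup>2)
     + T * (2 * Im (LINT x|lborel. cnj (\<psi> 0 x) * (\<Sum>j\<in>UNIV. complex_of_real (x $ j) * (g 0 x $ j)))) + real CARD('a) * E * T\<^sup>2"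
proof -
  have "(\<lambda>m. weighted_variance m + T * momentum m 0 + real CARD('a) * E * T\<^sup>2 + T * integral {0..T} (\<lambda>s. excess m s)) \<longlonglongrightarrow>
    (LINT x|lborel. (norm x)\<^sup>2 * (cmod (\<psi> 0 x))\<^sup>2)
     + T * (2 * Im (LINT x|lborel. cnj (\<psi> 0 x) * (\<Sum>j\<in>UNIV. complex_of_real (x $ j) * (g 0 x $ j)))) + real CARD('a) * E * T\<^sup>2 + T * 0"
    by (intro tendsto_add tendsto_mult tendsto_const weighted_variance_lim momentum_lim excess_tendsto T)
  from LIMSEQ_le_const[OF this] truncated_inequality[OF T] show ?thesis by simp
qed

end

section \<open>From continuity in X to bounds on compact time intervals\<close>

lemma weak_grad_H1:
  assumes "\<phi> \<in> H1"
  shows "\<phi> \<in> L2" "weak_grad \<phi> \<in> L2" "is_weak_gradient \<phi> (weak_grad \<phi>)"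
proof -
  show "\<phi> \<in> L2" using assms by (simp add: H1_def)
  have "\<exists>g. g \<in> L2 \<and> is_weak_gradient \<phi> g" using assms by (auto simp: H1_def)
  from someI_ex[OF this] show "weak_grad \<phi> \<in> L2" "is_weak_gradient \<phi> (weak_grad \<phi>)"
    by (auto simp: weak_grad_def)
qed

text \<open>The initial condition holds only almost everywhere, so the gradients of
  \<open>\<psi> 0\<close> and \<open>\<psi>0\<close> have to be compared through this.\<close>

lemma is_weak_gradient_cong_AE:
  assumes "is_weak_gradient \<phi> g" "AE x in lborel. \<psi> x = \<phi> x" "\<phi> \<in> borel_measurable borel" "\<psi> \<in> borel_measurable borel"
  shows "is_weak_gradient \<psi> g"
  unfolding is_weak_gradient_def
proof (intro allI impI)
  fix \<eta> i assume t: "test_function (\<eta> :: real ^ 'a \<Rightarrow> complex)"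
  then have [measurable]: "partial i \<eta> \<in> borel_measurable borel"
    by (intro Cc_smooth_measurable Cc_smooth_partial) (simp add: test_function_iff)
  note [measurable] = assms(3,4)
  have "(LINT x|lborel. \<psi> x * partial i \<eta> x) = (LINT x|lborel. \<phi> x * partial i \<eta> x)"
    by (rule integral_cong_AE) (use assms(2) in auto)
  then show "(LINT x|lborel. \<psi> x * partial i \<eta> x) = - (LINT x|lborel. g x $ i * \<eta> x)"
    using assms(1) t by (simp add: is_weak_gradient_def)
qed

text \<open>The norm of X refers to the weak gradient chosen for the difference. By uniqueness it
  agrees almost everywhere with the difference of the two chosen gradients, so closeness in X
  controls the gradient and the potential energy.\<close>

lemma space_X_diff:
  assumes V: "V \<in> borel_measurable borel" "\<And>x. 0 \<le> V x" and \<phi>: "\<phi> \<in> space_X V" and \<psi>: "\<psi> \<in> space_X V"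
  shows "(\<lambda>x. \<phi> x - \<psi> x) \<in> space_X V"
    and "norm_L2 (weak_grad \<phi>) \<le> norm_L2 (weak_grad \<psi>) + norm_X V (\<lambda>x. \<phi> x - \<psi> x)"
    and "(LINT x|lborel. V x * (cmod (\<phi> x))\<^sup>2) \<le> 2 * (LINT x|lborel. V x * (cmod (\<psi> x))\<^sup>2) + 2 * (norm_X V (\<lambda>x. \<phi> x - \<psi> x))\<^sup>2"
proof -
  let ?\<delta> = "\<lambda>x. \<phi> x - \<psi> x"
  have H: "\<phi> \<in> H1" "\<psi> \<in> H1" using \<phi> \<psi> by (auto simp: space_X_def)
  note p = weak_grad_H1[OF H(1)] and q = weak_grad_H1[OF H(2)]
  note [measurable] = V(1) L2D(1)[OF p(1)] L2D(1)[OF q(1)]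
  have \<delta>L: "?\<delta> \<in> L2" by (intro L2_diff p q)
  have gL: "(\<lambda>x. weak_grad \<phi> x - weak_grad \<psi> x) \<in> L2" by (intro L2_diff p q)
  have w: "is_weak_gradient ?\<delta> (\<lambda>x. weak_grad \<phi> x - weak_grad \<psi> x)"
    by (rule is_weak_gradient_diff[OF p q])
  have \<delta>H: "?\<delta> \<in> H1" using \<delta>L gL w by (auto simp: H1_def)
  note d = weak_grad_H1[OF \<delta>H]
  have AE: "AE x in lborel. weak_grad ?\<delta> x = weak_grad \<phi> x - weak_grad \<psi> x"
    by (rule weak_gradient_unique[OF d gL w])
  have iV: "integrable lborel (\<lambda>x. V x * (cmod (\<phi> x))\<^sup>2)" "integrable lborel (\<lambda>x. V x * (cmod (\<psi> x))\<^sup>2)"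
    using \<phi> \<psi> by (auto simp: space_X_def)
  have le: "V x * (cmod (a - b))\<^sup>2 \<le> 2 * (V x * (cmod a)\<^sup>2) + 2 * (V x * (cmod b)\<^sup>2)" for x a b
    using mult_left_mono[OF norm_add_sq_le[of a "- b"] V(2)[of x]] by (simp add: algebra_simps)
  have iVd: "integrable lborel (\<lambda>x. V x * (cmod (?\<delta> x))\<^sup>2)"
  proof (rule Bochner_Integration.integrable_bound[where f="\<lambda>x. 2 * (V x * (cmod (\<phi> x))\<^sup>2) + 2 * (V x * (cmod (\<psi> x))\<^sup>2)"])
    show "AE x in lborel. norm (V x * (cmod (?\<delta> x))\<^sup>2) \<le> norm (2 * (V x * (cmod (\<phi> x))\<^sup>2) + 2 * (V x * (cmod (\<psi> x))\<^sup>2))"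
      using le V(2) by (auto intro!: AE_I2 simp: abs_mult order_trans[OF _ abs_ge_self])
  qed (use iV in auto)
  show "?\<delta> \<in> space_X V" using \<delta>H iVd by (simp add: space_X_def)
  have X: "(norm_X V ?\<delta>)\<^sup>2 = (norm_L2 ?\<delta>)\<^sup>2 + (norm_L2 (weak_grad ?\<delta>))\<^sup>2 + (LINT x|lborel. V x * (cmod (?\<delta> x))\<^sup>2)"
  proof -
    have "(LINT x|lborel. (cmod (?\<delta> x))\<^sup>2 + (norm (weak_grad ?\<delta> x))\<^sup>2 + V x * (cmod (?\<delta> x))\<^sup>2)
      = (norm_L2 ?\<delta>)\<^sup>2 + (norm_L2 (weak_grad ?\<delta>))\<^sup>2 + (LINT x|lborel. V x * (cmod (?\<delta> x))\<^sup>2)"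
      using L2D(2)[OF d(1)] L2D(2)[OF d(2)] iVd by (simp add: norm_L2_sq)
    moreover have "0 \<le> (LINT x|lborel. (cmod (?\<delta> x))\<^sup>2 + (norm (weak_grad ?\<delta> x))\<^sup>2 + V x * (cmod (?\<delta> x))\<^sup>2)"
      using V(2) by (intro integral_nonneg_AE AE_I2 add_nonneg_nonneg mult_nonneg_nonneg) auto
    ultimately show ?thesis by (simp add: norm_X_def)
  qed
  have Vd0: "0 \<le> (LINT x|lborel. V x * (cmod (?\<delta> x))\<^sup>2)" using V(2) by (intro integral_nonneg_AE AE_I2 mult_nonneg_nonneg) auto
  have X0: "0 \<le> norm_X V ?\<delta>" unfolding norm_X_def using V(2)
    by (intro real_sqrt_ge_zero integral_nonneg_AE AE_I2 add_nonneg_nonneg mult_nonneg_nonneg) auto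
  have "(norm_L2 (weak_grad ?\<delta>))\<^sup>2 \<le> (norm_X V ?\<delta>)\<^sup>2"
    unfolding X using Vd0 by simp
  then have g1: "norm_L2 (weak_grad ?\<delta>) \<le> norm_X V ?\<delta>" using X0 by (rule power2_le_imp_le)
  have "(LINT x|lborel. (norm (weak_grad ?\<delta> x))\<^sup>2) = (LINT x|lborel. (norm (weak_grad \<phi> x - weak_grad \<psi> x))\<^sup>2)"
    by (rule integral_cong_AE) (use AE L2D(1)[OF d(2)] L2D(1)[OF gL] in auto)
  then have "norm_L2 (\<lambda>x. weak_grad \<phi> x - weak_grad \<psi> x) = norm_L2 (weak_grad ?\<delta>)" by (simp add: norm_L2_def)
  then show "norm_L2 (weak_grad \<phi>) \<le> norm_L2 (weak_grad \<psi>) + norm_X V ?\<delta>"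
    using norm_L2_triangle[OF p(2) q(2)] g1 by linarith
  have "(LINT x|lborel. V x * (cmod (\<phi> x))\<^sup>2) \<le> (LINT x|lborel. 2 * (V x * (cmod (\<psi> x))\<^sup>2) + 2 * (V x * (cmod (?\<delta> x))\<^sup>2))"
  proof (rule integral_mono)
    show "V x * (cmod (\<phi> x))\<^sup>2 \<le> 2 * (V x * (cmod (\<psi> x))\<^sup>2) + 2 * (V x * (cmod (?\<delta> x))\<^sup>2)" for x
      using mult_left_mono[OF norm_add_sq_le[of "\<psi> x" "?\<delta> x"] V(2)[of x]] by (simp add: algebra_simps)
  qed (use iV iVd in auto)
  also have "\<dots> = 2 * (LINT x|lborel. V x * (cmod (\<psi> x))\<^sup>2) + 2 * (LINT x|lborel. V x * (cmod (?\<delta> x))\<^sup>2)"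
    using iV iVd by simp
  also have "(LINT x|lborel. V x * (cmod (?\<delta> x))\<^sup>2) \<le> (norm_X V ?\<delta>)\<^sup>2" unfolding X by simp
  finally show "(LINT x|lborel. V x * (cmod (\<phi> x))\<^sup>2) \<le> 2 * (LINT x|lborel. V x * (cmod (\<psi> x))\<^sup>2) + 2 * (norm_X V ?\<delta>)\<^sup>2" by simp
qed

section \<open>Blow-up\<close>

text \<open>If the norms were unbounded on [0,T], a sequence of times along which they grow would
  have a subsequence converging to some t, contradicting the local bound that continuity at t
  provides.\<close>

lemma continuous_in_X_bounded:
  assumes V: "V \<in> borel_measurable borel" "\<And>x. 0 \<le> V x" and cont: "continuous_in_X V \<infinity> \<psi>"
  shows "\<exists>M. \<forall>t\<in>{0..T}. norm_L2 (weak_grad (\<psi> t)) \<le> M \<and> (LINT x|lborel. V x * (cmod (\<psi> t x))\<^sup>2) \<le> M"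
proof (rule ccontr)
  assume neg: "\<not> ?thesis"
  have I: "time_interval \<infinity> = {0..}" by (auto simp: time_interval_def)
  let ?B = "\<lambda>t. max (norm_L2 (weak_grad (\<psi> t))) (LINT x|lborel. V x * (cmod (\<psi> t x))\<^sup>2)"
  have "\<exists>t\<in>{0..T}. real n < ?B t" for n :: nat
    using neg by (auto simp: not_le less_max_iff_disj)
  then obtain s where s: "\<And>n. s n \<in> {0..T}" "\<And>n. real n < ?B (s n)" by metis
  obtain t \<sigma> where t: "t \<in> {0..T}" "strict_mono \<sigma>" "(s \<circ> \<sigma>) \<longlonglongrightarrow> t"
    using compact_Icc[of 0 T] s(1) unfolding compact_def by metis
  let ?x = "\<lambda>n. norm_X V (\<lambda>x. \<psi> (s (\<sigma> n)) x - \<psi> t x)"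
  have X: "\<psi> u \<in> space_X V" if "0 \<le> u" for u using cont that by (auto simp: continuous_in_X_def I)
  have "((\<lambda>u. norm_X V (\<lambda>x. \<psi> u x - \<psi> t x)) \<longlongrightarrow> 0) (at t within {0..})"
    using cont t(1) by (auto simp: continuous_in_X_def I)
  then have "\<forall>\<^sub>F u in at t within {0..}. norm_X V (\<lambda>x. \<psi> u x - \<psi> t x) < 1" by (rule order_tendstoD) simp
  then obtain e where e: "0 < e" "\<And>u. 0 \<le> u \<Longrightarrow> u \<noteq> t \<Longrightarrow> dist u t < e \<Longrightarrow> norm_X V (\<lambda>x. \<psi> u x - \<psi> t x) < 1"
    unfolding eventually_at by auto
  \<comment> \<open>The first entry covers u = t, which the limit \<open>at t within\<close> leaves
    out; the other two are the bounds of \<open>space_X_diff\<close> at distance below 1.\<close>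
  define M where "M = max (?B t) (max (norm_L2 (weak_grad (\<psi> t)) + 1) (2 * (LINT x|lborel. V x * (cmod (\<psi> t x))\<^sup>2) + 2))"
  have local: "?B u \<le> M" if u: "0 \<le> u" "dist u t < e" for u
  proof (cases "u = t")
    case False
    then have d: "norm_X V (\<lambda>x. \<psi> u x - \<psi> t x) < 1" using e(2) u by blast
    have d0: "0 \<le> norm_X V (\<lambda>x. \<psi> u x - \<psi> t x)" unfolding norm_X_def using V(2)
      by (intro real_sqrt_ge_zero integral_nonneg_AE AE_I2 add_nonneg_nonneg mult_nonneg_nonneg) auto
    have "(norm_X V (\<lambda>x. \<psi> u x - \<psi> t x))\<^sup>2 \<le> 1" using d d0 by (simp add: power_le_one)
    moreover have "0 \<le> t" using t(1) by simp
    ultimately have "norm_L2 (weak_grad (\<psi> u)) \<le> norm_L2 (weak_grad (\<psi> t)) + 1"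
      "(LINT x|lborel. V x * (cmod (\<psi> u x))\<^sup>2) \<le> 2 * (LINT x|lborel. V x * (cmod (\<psi> t x))\<^sup>2) + 2"
      using space_X_diff(2,3)[OF V X[OF u(1)] X[of t]] d by linarith+
    then show ?thesis unfolding M_def by (intro max.coboundedI2 max.mono)
  qed (simp add: M_def)
  obtain N where N: "\<And>n. N \<le> n \<Longrightarrow> dist (s (\<sigma> n)) t < e"
    using t(3) e(1) unfolding lim_sequentially comp_def by blast
  define n where "n = max N (nat \<lceil>M\<rceil>)"
  have "?B (s (\<sigma> n)) \<le> M" using s(1) by (intro local N) (auto simp: n_def)
  moreover have "M \<le> real n" unfolding n_def by linarith
  moreover have "real n \<le> real (\<sigma> n)" using seq_suble[OF t(2)] by simp
  ultimately show False using s(2)[of "\<sigma> n"] by linarith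
qed

theorem theorem2p9:
  fixes V :: "real ^ 'd::finite \<Rightarrow> real" and \<beta> :: real
    and \<psi>0 :: "real ^ 'd \<Rightarrow> complex" and \<psi> :: "real \<Rightarrow> real ^ 'd \<Rightarrow> complex"
    and Tmax :: ereal
  assumes dim: "CARD('d) \<in> {2, 3}"
    and beta: "\<beta> < 0"
    and V_nonneg: "\<And>x. 0 \<le> V x"
    and V_smooth: "smooth V"
    and V_bounded_derivs: "\<And>is. 2 \<le> length is \<Longrightarrow> \<exists>C. AE x in lborel. \<bar>D_multi is V x\<bar> \<le> C"
    and V_virial: "\<And>x. 0 \<le> real CARD('d) * V x + (\<Sum>i\<in>UNIV. x $ i * partial i V x)"
    and init: "\<psi>0 \<in> space_X V"
    and variance: "integrable lborel (\<lambda>x. (norm x)\<^sup>2 * (cmod (\<psi>0 x))\<^sup>2)"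
    and maximal: "NLS_maximal_solution V \<beta> \<psi>0 Tmax \<psi>"
    and mass_conserved: "\<And>t. t \<in> time_interval Tmax \<Longrightarrow> norm_L2 (\<psi> t) = norm_L2 \<psi>0"
    and energy_conserved: "\<And>t. t \<in> time_interval Tmax \<Longrightarrow> energy V \<beta> (\<psi> t) = energy V \<beta> \<psi>0"
    and cases: "energy V \<beta> \<psi>0 < 0
      \<or> (energy V \<beta> \<psi>0 = 0 \<and> virial_momentum \<psi>0 < 0)
      \<or> (energy V \<beta> \<psi>0 > 0 \<and> virial_momentum \<psi>0 <
            - sqrt (real CARD('d) * energy V \<beta> \<psi>0) * norm_L2 (\<lambda>x. norm x *\<^sub>R \<psi>0 x))"
  shows "Tmax < \<infinity>"
proof (rule ccontr)
  assume "\<not> Tmax < \<infinity>"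
  then have T: "Tmax = \<infinity>" by simp
  have I: "time_interval Tmax = {0..}" by (auto simp: time_interval_def T)
  let ?E = "energy V \<beta> \<psi>0" and ?m = "virial_momentum \<psi>0" and ?d = "real CARD('d)"
  let ?var = "LINT x|lborel. (norm x)\<^sup>2 * (cmod (\<psi>0 x))\<^sup>2"
  have sol: "continuous_in_X V Tmax \<psi>" "AE x in lborel. \<psi> 0 x = \<psi>0 x"
    using maximal by (auto simp: NLS_maximal_solution_def NLS_solution_def)
  have X: "\<psi> t \<in> space_X V" if "0 \<le> t" for t
    using sol(1) that by (auto simp: continuous_in_X_def I)
  then have H: "\<psi> t \<in> H1" if "0 \<le> t" for t using that by (auto simp: space_X_def)
  note wg = weak_grad_H1[OF H]
  have Vm: "V \<in> borel_measurable borel" by (intro borel_measurable_continuous_onI smooth_continuous V_smooth)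
  have H0: "\<psi>0 \<in> H1" using init by (simp add: space_X_def)
  note wg0 = weak_grad_H1[OF H0]
  have m0[measurable]: "\<psi>0 \<in> borel_measurable borel" "\<psi> 0 \<in> borel_measurable borel"
    using L2D(1)[OF wg0(1)] L2D(1)[OF wg(1), of 0] by auto
  interpret virial_data V \<beta>
    by unfold_locales (use dim V_smooth V_nonneg V_virial in auto)
  have vs: "virial_state V (\<psi> t) (weak_grad (\<psi> t))" if "0 \<le> t" for t
    by unfold_locales (use wg[OF that] X[OF that] in \<open>auto simp: space_X_def\<close>)
  \<comment> \<open>Splitting the energy integral requires each part to be integrable; for the
    quartic part this rests on the L6 bound.\<close>
  have en: "energy_of (\<psi> t) (weak_grad (\<psi> t)) = ?E" if "0 \<le> t" for t
  proof -
    interpret virial_state V \<beta> "\<psi> t" "weak_grad (\<psi> t)" by (rule vs[OF that])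
    have "energy V \<beta> (\<psi> t) = energy_of (\<psi> t) (weak_grad (\<psi> t))"
      unfolding energy_def energy_of_def norm_L2_sq
      using L2D(2)[OF g] Vu integrable_u4 by simp
    then show ?thesis using energy_conserved[of t] that by (simp add: I)
  qed
  have bnd: "\<exists>M. \<forall>t\<in>{0..S}. norm_L2 (\<psi> t) \<le> M \<and> norm_L2 (weak_grad (\<psi> t)) \<le> M \<and> (LINT x|lborel. V x * (cmod (\<psi> t x))\<^sup>2) \<le> M" for S
  proof -
    obtain M where M: "\<And>t. t \<in> {0..S} \<Longrightarrow> norm_L2 (weak_grad (\<psi> t)) \<le> M \<and> (LINT x|lborel. V x * (cmod (\<psi> t x))\<^sup>2) \<le> M"
      using continuous_in_X_bounded[OF Vm V_nonneg sol(1)[unfolded T], of S] by blast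
    have "norm_L2 (\<psi> t) = norm_L2 \<psi>0" if "t \<in> {0..S}" for t using mass_conserved[of t] that by (simp add: I)
    then show ?thesis using M by (intro exI[of _ "max M (norm_L2 \<psi>0)"]) (auto simp: max.coboundedI1)
  qed
  have var0: "integrable lborel (\<lambda>x. (norm x)\<^sup>2 * (cmod (\<psi> 0 x))\<^sup>2)"
  proof -
    have "AE x in lborel. (norm x)\<^sup>2 * (cmod (\<psi> 0 x))\<^sup>2 = (norm x)\<^sup>2 * (cmod (\<psi>0 x))\<^sup>2" using sol(2) by eventually_elim simp
    then show ?thesis using variance by (subst integrable_cong_AE) auto
  qed
  interpret global_flow V \<beta> \<psi> "\<lambda>t. weak_grad (\<psi> t)" ?E
  proof (unfold_locales)
    show "weak_NLS V \<beta> \<psi>"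
      using maximal unfolding NLS_maximal_solution_def NLS_solution_def I weak_NLS_def by auto
  next
    show "norm_L2 (\<psi> t) = norm_L2 (\<psi> 0)" if "0 \<le> t" for t
      using mass_conserved[of t] mass_conserved[of 0] that by (simp add: I)
  qed (use wg X en bnd var0 in \<open>auto simp: space_X_def\<close>)
  \<comment> \<open>\<open>weak_grad\<close> makes an independent choice for \<open>\<psi> 0\<close>
    and for \<open>\<psi>0\<close>, which agree only almost everywhere; uniqueness of weak gradients
    identifies the two choices.\<close>
  have wgAE: "AE x in lborel. weak_grad (\<psi> 0) x = weak_grad \<psi>0 x"
    by (rule weak_gradient_unique[OF wg(1)[OF order_refl] wg(2)[OF order_refl] wg(3)[OF order_refl] wg0(2)])
      (rule is_weak_gradient_cong_AE[OF wg0(3) sol(2) m0])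
  have mom: "?m = Im (LINT x|lborel. cnj (\<psi> 0 x) * (\<Sum>j\<in>UNIV. complex_of_real (x $ j) * (weak_grad (\<psi> 0) x $ j)))"
  proof -
    have [measurable]: "(\<lambda>x. weak_grad \<psi>0 x $ j) \<in> borel_measurable borel" "(\<lambda>x. weak_grad (\<psi> 0) x $ j) \<in> borel_measurable borel" for j
      using L2D(1)[OF L2_component[OF wg0(2)]] L2D(1)[OF L2_component[OF wg(2)]] by auto
    have [measurable]: "(\<lambda>x :: real ^ 'd. complex_of_real (x $ j)) \<in> borel_measurable borel" for j
      by (intro borel_measurable_continuous_onI continuous_intros)
    have [measurable]: "(\<lambda>x. cnj (\<psi>0 x)) \<in> borel_measurable borel" "(\<lambda>x. cnj (\<psi> 0 x)) \<in> borel_measurable borel"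
      using L2D(1)[OF L2_cnj[OF wg0(1)]] L2D(1)[OF L2_cnj[OF wg(1)]] by auto
    show ?thesis
      unfolding virial_momentum_def
    proof (intro arg_cong[of _ _ Im] integral_cong_AE)
      show "AE x in lborel. cnj (\<psi>0 x) * (\<Sum>i\<in>UNIV. complex_of_real (x $ i) * (weak_grad \<psi>0 x $ i))
        = cnj (\<psi> 0 x) * (\<Sum>j\<in>UNIV. complex_of_real (x $ j) * (weak_grad (\<psi> 0) x $ j))"
        using sol(2) wgAE by eventually_elim simp
    qed measurable
  qed
  have var: "(LINT x|lborel. (norm x)\<^sup>2 * (cmod (\<psi> 0 x))\<^sup>2) = ?var"
    by (rule integral_cong_AE) (use sol(2) in auto)
  have ineq: "0 \<le> ?var + 2 * S * ?m + ?d * ?E * S\<^sup>2" if "0 \<le> S" for S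
    using variance_inequality[OF that] unfolding var mom[symmetric] by (simp add: mult_ac)
  have var_nonneg: "0 \<le> ?var" by (intro integral_nonneg_AE AE_I2) auto
  have dpos: "0 < ?d" by simp
  from cases show False
  proof (elim disjE conjE)
    assume E: "?E < 0"
    have dE: "?d * ?E < 0" using E dpos by (rule mult_pos_neg[rotated])
    \<comment> \<open>S >= 1 allows the variance to be replaced by S times itself; the other entry
      makes \<open>S * (- (d E))\<close> at least the variance plus 2 |m| + 1. Together the
      quadratic is at most -S.\<close>
    define S where "S = max 1 ((?var + 2 * \<bar>?m\<bar> + 1) / (- (?d * ?E)))"
    have S: "1 \<le> S" "(?var + 2 * \<bar>?m\<bar> + 1) / (- (?d * ?E)) \<le> S" by (auto simp: S_def)
    have "?var + 2 * \<bar>?m\<bar> + 1 \<le> S * (- (?d * ?E))" using S(2) dE by (subst (asm) pos_divide_le_eq) auto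
    then have "S * (?var + 2 * \<bar>?m\<bar> + 1) \<le> S * (S * (- (?d * ?E)))" using S(1) by (intro mult_left_mono) auto
    moreover have "?var \<le> S * ?var" using mult_right_mono[OF S(1) var_nonneg] by simp
    moreover have "S * ?m \<le> S * \<bar>?m\<bar>" using S(1) by (intro mult_left_mono) auto
    ultimately have "?var + 2 * S * ?m + ?d * ?E * S\<^sup>2 \<le> - S"
      by (simp add: algebra_simps power2_eq_square)
    then show False using ineq[of S] S(1) by linarith
  next
    assume E: "?E = 0" and m: "?m < 0"
    \<comment> \<open>For E = 0 the right side is affine in S with negative slope; at this S it
      equals -1.\<close>
    define S where "S = (?var + 1) / (- 2 * ?m)"
    have "0 \<le> S" unfolding S_def using m var_nonneg by (intro divide_nonneg_pos) linarith+
    moreover have "2 * S * ?m = - (?var + 1)" using m by (simp add: S_def field_simps)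
    ultimately show False using ineq[of S] E by simp
  next
    assume E: "0 < ?E" and m: "?m < - sqrt (?d * ?E) * norm_L2 (\<lambda>x. norm x *\<^sub>R \<psi>0 x)"
    have dE: "0 < ?d * ?E" using E dpos by simp
    have nv: "(norm_L2 (\<lambda>x. norm x *\<^sub>R \<psi>0 x))\<^sup>2 = ?var"
      by (simp add: norm_L2_sq power_mult_distrib)
    have "(sqrt (?d * ?E) * norm_L2 (\<lambda>x. norm x *\<^sub>R \<psi>0 x))\<^sup>2 < (- ?m)\<^sup>2"
      using m dE norm_L2_nonneg[of "\<lambda>x. norm x *\<^sub>R \<psi>0 x"] by (intro power_strict_mono mult_nonneg_nonneg) auto
    then have sq: "(?d * ?E) * ?var < ?m\<^sup>2" using dE by (simp add: power_mult_distrib nv)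
    have "0 \<le> sqrt (?d * ?E) * norm_L2 (\<lambda>x. norm x *\<^sub>R \<psi>0 x)"
      by (intro mult_nonneg_nonneg real_sqrt_ge_zero norm_L2_nonneg less_imp_le[OF dE])
    then have m0: "?m < 0" using m by linarith
    \<comment> \<open>The vertex of the parabola, positive since m < 0. Its value there is the
      variance minus m^2 / (d E), and the hypothesis on the momentum makes it negative.\<close>
    define S where "S = - ?m / (?d * ?E)"
    have S: "0 \<le> S" unfolding S_def using m0 dE by (intro divide_nonneg_pos) linarith+
    have "(?d * ?E) * (?var + 2 * S * ?m + ?d * ?E * S\<^sup>2) = (?d * ?E) * ?var - ?m\<^sup>2"
    proof -
      have gen: "D * (v + 2 * (- m / D) * m + D * (- m / D)\<^sup>2) = D * v - m\<^sup>2" if "D \<noteq> 0" for D v m :: real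
        using that by (simp add: field_simps power2_eq_square)
      show ?thesis unfolding S_def by (rule gen) (use dE in linarith)
    qed
    then have "(?d * ?E) * (?var + 2 * S * ?m + ?d * ?E * S\<^sup>2) < 0" using sq by linarith
    moreover have "0 \<le> (?d * ?E) * (?var + 2 * S * ?m + ?d * ?E * S\<^sup>2)" by (rule mult_nonneg_nonneg[OF less_imp_le[OF dE] ineq[OF S]])
    ultimately show False by linarith
  qed
qed

end
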